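(* Let $n\ge3$ be an integer, $\eta<\frac{(n-2)^2}{4}$, and for $i=1,2$ let $q_i>2$, $\delta_i>-2$ and $l_i=2\frac{q_i+\delta_i}{2+\delta_i}$. Consider $$u''+\frac{n-1}{r}u'+\frac{\eta}{r^2}u+f(u,r)=0,\qquad f(u,r)=\begin{cases}K_1r^{\delta_1}u|u|^{q_1-2}& r\le1,\\ K_2r^{\delta_2}u|u|^{q_2-2}& r>1.\end{cases}$$ Assume $K_2<0<K_1$, $2<l_1<2^*$, $l_2>2_*(\eta)$, and moreover $l_2\ge l_1\ge 2_*(\eta)$. Then there is an increasing sequence of positive numbers $(L_k)_{k\ge0}$ converging to some $L_\infty<\infty$ such that: for any $k\in\mathbb N$, $v(r,L_k)$ is an $\mathcal R_k^{\sf fd}$-solution; $v(r,L)$ is a positive $\mathcal S_0^{\sf fd}$-solution for any $0<L<L_0$; and for any $k\ge1$, $v(r,L)$ is an $\mathcal S_k^{\sf fd}$-solution for any $L_{k-1}<L<L_k$. Consequently there is an increasing sequence $D_k\nearrow\infty$ such that $u(r,D_k)$ is an $\mathcal R_k^{\sf fd}$-solution for any $k\ge0$.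
   Context: Notation: $2^*=\frac{2n}{n-2}$, $\kappa(\eta)=\frac{(n-2)-\sqrt{(n-2)^2-4\eta}}{2}$, $2_*(\eta)=2\frac{n+\sqrt{(n-2)^2-4\eta}}{n-2+\sqrt{(n-2)^2-4\eta}}$. Solutions are understood as $C^1$ functions satisfying the equation for $r\ne1$. For $d\in\mathbb R$, $u(r,d)$ denotes the solution with $\lim_{r\to0}u(r,d)r^{\kappa(\eta)}=d$; such a solution is called an $\mathcal R$-solution. An $\mathcal S$-solution is a solution $u$ defined near $0^+$ with $\lim_{r\to0}u(r)r^{\kappa(\eta)}=\pm\infty$. For $L\in\mathbb R$, $v(r,L)$ denotes the solution with $\lim_{r\to\infty}v(r,L)r^{n-2-\kappa(\eta)}=L$; such a solution is called a $\sf fd$-solution. An $\mathcal R_k^{\sf fd}$-solution (respectively $\mathcal S_k^{\sf fd}$-solution) is a solution defined for all $r>0$ that is both an $\mathcal R$-solution (respectively $\mathcal S$-solution) and a $\sf fd$-solution, and has exactly $k$ zeroes in $(0,\infty)$, all nondegenerate (nonzero derivative). $\mathbb N$ contains $0$. *)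

theory Defs
  imports "HOL-Analysis.Analysis"
begin

definition kappa :: "nat \<Rightarrow> real \<Rightarrow> real" where
  "kappa n \<eta> = ((real n - 2) - sqrt ((real n - 2)\<^sup>2 - 4 * \<eta>)) / 2"

definition upper_two_star :: "nat \<Rightarrow> real" where
  "upper_two_star n = 2 * real n / (real n - 2)"

definition lower_two_star :: "nat \<Rightarrow> real \<Rightarrow> real" where
  "lower_two_star n \<eta> =
     2 * ((real n + sqrt ((real n - 2)\<^sup>2 - 4 * \<eta>)) / (real n - 2 + sqrt ((real n - 2)\<^sup>2 - 4 * \<eta>)))"

text \<open>The set \<open>I\<close> is meant to be an open subinterval of the positive half-line. The nonlinearity
  \<open>f u r\<close> may jump at \<open>r = 1\<close>, so there only \<open>C\<^sup>1\<close> regularity is required.\<close>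

definition is_solution ::
  "nat \<Rightarrow> real \<Rightarrow> (real \<Rightarrow> real \<Rightarrow> real) \<Rightarrow> real set \<Rightarrow> (real \<Rightarrow> real) \<Rightarrow> bool" where
  "is_solution n \<eta> f I u \<longleftrightarrow>
     (\<forall>r\<in>I. u differentiable (at r)) \<and>
     continuous_on I (deriv u) \<and>
     (\<forall>r\<in>I - {1}. deriv u differentiable (at r) \<and>
        deriv (deriv u) r + (real n - 1) / r * deriv u r + \<eta> / r\<^sup>2 * u r + f (u r) r = 0)"

text \<open>The solutions \<open>u(r,d)\<close> and \<open>v(r,L)\<close> need not exist for all \<open>r > 0\<close>. The functions below are
  their maximal continuations, obtained by gluing all solutions on some \<open>(0,R)\<close>, respectively
  \<open>(a,\<infinity>)\<close>, with the prescribed asymptotics; the value is unspecified at an \<open>r\<close> reached by no such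
  solution, or at which two of them disagree.\<close>

definition u_sol ::
  "nat \<Rightarrow> real \<Rightarrow> (real \<Rightarrow> real \<Rightarrow> real) \<Rightarrow> real \<Rightarrow> real \<Rightarrow> real" where
  "u_sol n \<eta> f d r = (THE y. \<exists>R u. 0 < r \<and> r < R \<and> is_solution n \<eta> f {0<..<R} u \<and>
     ((\<lambda>s. u s * s powr kappa n \<eta>) \<longlongrightarrow> d) (at_right 0) \<and> y = u r)"

definition v_sol ::
  "nat \<Rightarrow> real \<Rightarrow> (real \<Rightarrow> real \<Rightarrow> real) \<Rightarrow> real \<Rightarrow> real \<Rightarrow> real" where
  "v_sol n \<eta> f L r = (THE y. \<exists>a v. 0 \<le> a \<and> a < r \<and> is_solution n \<eta> f {a<..} v \<and>
     ((\<lambda>s. v s * s powr (real n - 2 - kappa n \<eta>)) \<longlongrightarrow> L) at_top \<and> y = v r)"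

definition R_solution ::
  "nat \<Rightarrow> real \<Rightarrow> (real \<Rightarrow> real \<Rightarrow> real) \<Rightarrow> (real \<Rightarrow> real) \<Rightarrow> bool" where
  "R_solution n \<eta> f u \<longleftrightarrow> (\<exists>R>0. is_solution n \<eta> f {0<..<R} u) \<and>
     (\<exists>d. ((\<lambda>r. u r * r powr kappa n \<eta>) \<longlongrightarrow> d) (at_right 0))"

definition S_solution ::
  "nat \<Rightarrow> real \<Rightarrow> (real \<Rightarrow> real \<Rightarrow> real) \<Rightarrow> (real \<Rightarrow> real) \<Rightarrow> bool" where
  "S_solution n \<eta> f u \<longleftrightarrow> (\<exists>R>0. is_solution n \<eta> f {0<..<R} u) \<and>
     (filterlim (\<lambda>r. u r * r powr kappa n \<eta>) at_top (at_right 0) \<or>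
      filterlim (\<lambda>r. u r * r powr kappa n \<eta>) at_bot (at_right 0))"

definition fd_solution ::
  "nat \<Rightarrow> real \<Rightarrow> (real \<Rightarrow> real \<Rightarrow> real) \<Rightarrow> (real \<Rightarrow> real) \<Rightarrow> bool" where
  "fd_solution n \<eta> f u \<longleftrightarrow> (\<exists>a\<ge>0. is_solution n \<eta> f {a<..} u) \<and>
     (\<exists>L. ((\<lambda>r. u r * r powr (real n - 2 - kappa n \<eta>)) \<longlongrightarrow> L) at_top)"

definition nondegenerate_zeros :: "nat \<Rightarrow> (real \<Rightarrow> real) \<Rightarrow> bool" where
  "nondegenerate_zeros k u \<longleftrightarrow>
     finite {r. 0 < r \<and> u r = 0} \<and> card {r. 0 < r \<and> u r = 0} = k \<and>
     (\<forall>r>0. u r = 0 \<longrightarrow> deriv u r \<noteq> 0)"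

definition R_fd ::
  "nat \<Rightarrow> real \<Rightarrow> (real \<Rightarrow> real \<Rightarrow> real) \<Rightarrow> nat \<Rightarrow> (real \<Rightarrow> real) \<Rightarrow> bool" where
  "R_fd n \<eta> f k u \<longleftrightarrow> is_solution n \<eta> f {0<..} u \<and> R_solution n \<eta> f u \<and>
     fd_solution n \<eta> f u \<and> nondegenerate_zeros k u"

definition S_fd ::
  "nat \<Rightarrow> real \<Rightarrow> (real \<Rightarrow> real \<Rightarrow> real) \<Rightarrow> nat \<Rightarrow> (real \<Rightarrow> real) \<Rightarrow> bool" where
  "S_fd n \<eta> f k u \<longleftrightarrow> is_solution n \<eta> f {0<..} u \<and> S_solution n \<eta> f u \<and>
     fd_solution n \<eta> f u \<and> nondegenerate_zeros k u"

end

theory Submission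
  imports Defs
begin

text \<open>
  Put \<open>t = ln r\<close>, \<open>w(t) = r\<^bsup>\<kappa>\<^esup> u(r)\<close> and \<open>\<mu> = ((n-2)\<^sup>2 - 4\<eta>)\<^bsup>1/2\<^esup>\<close>. The linear part of the equation becomes
  \<open>w'' + \<mu> w'\<close>; regular solutions are those for which \<open>w\<close> converges at minus infinity, and fast
  decaying ones those for which \<open>e\<^bsup>\<mu>t\<^esup> w\<close> converges at plus infinity. Write
  \<open>\<alpha>\<^sub>i = (2 + \<delta>\<^sub>i)/(q\<^sub>i - 2) = 2/(l\<^sub>i - 2)\<close>, \<open>\<gamma> = \<alpha>\<^sub>1 - \<kappa>\<close> and \<open>\<gamma>' = \<kappa> + \<mu> - \<alpha>\<^sub>2\<close>.

  Inside the unit ball, \<open>x = e\<^bsup>\<gamma>t\<^esup> w\<close> satisfies an autonomous equation. With time running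
  towards the origin it is a damped oscillator in an even double well, which degenerates to a single well when
  \<open>\<gamma> = \<mu>\<close>; the bounds on \<open>l\<^sub>1\<close> say that the friction \<open>2\<gamma> - \<mu>\<close> is positive and that \<open>\<gamma> \<le> \<mu>\<close>. By scaling, all regular solutions lie on one orbit and its mirror image (\<open>regular_orbit\<close>).
  Followed away from the origin, this orbit gains energy and winds outwards: it is a spiral with turning points
  \<open>M 0 < M 1 < \<dots>\<close>, and its arcs from a turning point to the next zero, reflected to the right half plane and read
  inwards, are nested branches in the quadrant \<open>x > 0\<close>, \<open>x' > 0\<close>.

  Outside the unit ball the equation is defocusing. The fast decaying solutions with positive coefficient
  are rescalings of a single positive function that blows up at finite time, so their phase points at \<open>r = 1\<close> form
  a curve in the same quadrant, parametrized by \<open>\<sigma> = ln L / \<gamma>'\<close>, which runs from the origin to infinity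
  as \<open>\<sigma>\<close> runs up to a finite bound. The curve crosses every branch in one direction only: where it
  meets a branch, its height above the branch changes at a rate that is a positive quantity plus a non-negative multiple
  of \<open>\<gamma> + \<gamma>' - \<mu>\<close>, and this number is non-negative because \<open>l\<^sub>2 \<ge> l\<^sub>1\<close> (\<open>G_upcrossing\<close>).
  Hence it meets the \<open>k\<close>-th branch at exactly one parameter \<open>\<sigma>\<^sub>k\<close>
  (\<open>curve_crosses_branch\<close>), and these increase to a finite limit. The values \<open>L\<^sub>k\<close> are \<open>e\<^bsup>\<gamma>'\<sigma>\<^sub>k\<^esup>\<close>.

  A solution whose phase point lies between the branches \<open>k - 1\<close> and \<open>k\<close> has exactly \<open>k\<close> zeros
  (\<open>zeros_between_branches\<close>): trajectories moving in the same direction cannot cross in the phase plane, so its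
  turning points remain caught between consecutive turning points of the spiral, one step further inwards after each
  half turn, and inside \<open>M 0\<close> no zero is left. Having finitely many zeros, the solution has one sign near the origin,
  where \<open>w\<close> is then monotone and has a finite or an infinite limit (\<open>finite_or_infinite_limit\<close>). A finite limit puts the phase
  point on a branch, so the solution is regular at the parameters \<open>\<sigma>\<^sub>k\<close> and singular everywhere else. Finally
  \<open>D\<^sub>k = e\<^bsup>\<gamma>c\<^sub>k\<^esup>\<close>, where \<open>c\<^sub>k\<close> is the time at which the spiral passes through the \<open>k\<close>-th crossing
  point; these times tend to infinity because the spiral makes only finitely many turns in bounded time.
\<close>

section \<open>Calculus on the line\<close>

lemma increasing_open_real:
  fixes f :: "real \<Rightarrow> real"
  assumes "a \<le> b" and "continuous_on {a..b} f"
    and "\<And>x. a < x \<Longrightarrow> x < b \<Longrightarrow> (f has_real_derivative f' x) (at x)"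
    and "\<And>x. a < x \<Longrightarrow> x < b \<Longrightarrow> 0 \<le> f' x"
  shows "f a \<le> f b"
  by (rule DERIV_nonneg_imp_increasing_open[OF assms(1) _ assms(2)]) (use assms(3,4) in blast)

lemma decreasing_open_real:
  fixes f :: "real \<Rightarrow> real"
  assumes "a \<le> b" and "continuous_on {a..b} f"
    and "\<And>x. a < x \<Longrightarrow> x < b \<Longrightarrow> (f has_real_derivative f' x) (at x)"
    and "\<And>x. a < x \<Longrightarrow> x < b \<Longrightarrow> f' x \<le> 0"
  shows "f b \<le> f a"
  by (rule DERIV_nonpos_imp_decreasing_open[OF assms(1) _ assms(2)]) (use assms(3,4) in blast)

lemma integral_from_0_deriv:
  fixes \<phi> :: "real \<Rightarrow> real"
  assumes "continuous_on {0..} \<phi>" and "0 \<le> s"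
  shows "((\<lambda>s. integral {0..s} \<phi>) has_real_derivative \<phi> s) (at s within {0..})"
proof -
  have "((\<lambda>s. integral {0..s} \<phi>) has_real_derivative \<phi> s) (at s within {0..s+1})"
    using assms by (intro integral_has_real_derivative) (auto intro: continuous_on_subset)
  moreover have "at s within {0..s+1} = at s within {0..}"
  proof (rule at_within_nhd[of _ "{..<s+1}"])
  qed auto
  ultimately show ?thesis by simp
qed

lemma integral_from_0_deriv_at:
  fixes \<phi> :: "real \<Rightarrow> real"
  assumes "continuous_on {0..} \<phi>" and "0 < s"
  shows "((\<lambda>s. integral {0..s} \<phi>) has_real_derivative \<phi> s) (at s)"
proof -
  have "at s within {0..} = at s"
    using assms(2) by (intro at_within_interior) simp
  then show ?thesis using integral_from_0_deriv[OF assms(1), of s] assms(2) by simp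
qed

lemma integral_from_0_continuous:
  fixes \<phi> :: "real \<Rightarrow> real"
  assumes "continuous_on {0..} \<phi>"
  shows "continuous_on {0..} (\<lambda>s. integral {0..s} \<phi>)"
  using integral_from_0_deriv[OF assms]
  by (meson DERIV_continuous_on atLeast_iff)

lemma integral_monomial:
  fixes s :: real
  assumes "0 \<le> s"
  shows "integral {0..s} (\<lambda>t. t ^ n) = s ^ Suc n / real (Suc n)"
proof -
  have "((\<lambda>t. t ^ n) has_integral (s ^ Suc n / real (Suc n) - 0 ^ Suc n / real (Suc n))) {0..s}"
  proof (rule fundamental_theorem_of_calculus)
    fix x :: real assume "x \<in> {0..s}"
    have "((\<lambda>t. t ^ Suc n / real (Suc n)) has_real_derivative x ^ n) (at x within {0..s})"
      by (rule derivative_eq_intros refl | simp del: power_Suc of_nat_Suc)+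
    then show "((\<lambda>t. t ^ Suc n / real (Suc n)) has_vector_derivative x ^ n) (at x within {0..s})"
      by (simp add: has_real_derivative_iff_has_vector_derivative)
  qed fact
  then show ?thesis by (simp add: integral_unique)
qed

lemma integral_diff_monomial_le:
  fixes \<phi> \<psi> :: "real \<Rightarrow> real"
  assumes "continuous_on {0..} \<phi>" and "continuous_on {0..} \<psi>" and "0 \<le> s"
    and "\<And>t. 0 \<le> t \<Longrightarrow> t \<le> s \<Longrightarrow> \<bar>\<phi> t - \<psi> t\<bar> \<le> A * t ^ n"
  shows "\<bar>integral {0..s} \<phi> - integral {0..s} \<psi>\<bar> \<le> A * s ^ Suc n / real (Suc n)"
proof -
  have c: "continuous_on {0..s} \<phi>" "continuous_on {0..s} \<psi>"
    using assms(1,2) by (auto intro: continuous_on_subset)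
  have "integral {0..s} \<phi> - integral {0..s} \<psi> = integral {0..s} (\<lambda>t. \<phi> t - \<psi> t)"
    using c by (subst integral_diff) (auto intro: integrable_continuous_real)
  moreover have "norm (integral {0..s} (\<lambda>t. \<phi> t - \<psi> t)) \<le> integral {0..s} (\<lambda>t. A * t ^ n)"
    using c assms(4)
    by (intro integral_norm_bound_integral integrable_continuous_real continuous_intros) auto
  moreover have "integral {0..s} (\<lambda>t. A * t ^ n) = A * s ^ Suc n / real (Suc n)"
    using integral_monomial[OF assms(3), of n] by simp
  ultimately show ?thesis by simp
qed

lemma DERIV_time_shift:
  fixes f :: "real \<Rightarrow> real"
  assumes "(f has_real_derivative D) (at (c + s))"
  shows "((\<lambda>s. f (c + s)) has_real_derivative D) (at s)"
  using assms DERIV_shift[of f D s c] by (simp add: add.commute)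

lemma filterlim_exp_at_bot_0:
  assumes "0 < (c::real)"
  shows "((\<lambda>t. exp (c * t)) \<longlongrightarrow> 0) at_bot"
  using assms by (intro filterlim_compose[OF exp_at_bot] filterlim_tendsto_pos_mult_at_bot[OF tendsto_const] filterlim_ident)

lemma first_zero_after:
  fixes f :: "real \<Rightarrow> real"
  assumes c: "continuous_on {a..b} f" and f0: "0 < f a" and ex: "a \<le> b" "f b \<le> 0"
  shows "\<exists>z>a. z \<le> b \<and> f z = 0 \<and> (\<forall>s. a \<le> s \<and> s < z \<longrightarrow> 0 < f s)"
proof -
  define S where "S = {a..b} \<inter> f -` {..0}"
  have "closed S" unfolding S_def by (intro continuous_closed_preimage c) auto
  moreover have "b \<in> S" using ex by (auto simp: S_def)
  moreover have bb: "bdd_below S" by (auto simp: S_def intro!: bdd_belowI[of _ a])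
  ultimately have zS: "Inf S \<in> S" by (intro closed_contains_Inf) auto
  define z where "z = Inf S"
  have z: "a \<le> z" "f z \<le> 0" "z \<le> b" using zS by (auto simp: S_def z_def)
  have pos: "0 < f s" if "a \<le> s" "s < z" for s
  proof (rule ccontr)
    assume "\<not> 0 < f s"
    then have "s \<in> S" using that z by (auto simp: S_def)
    then have "z \<le> s" unfolding z_def using bb by (rule cInf_lower)
    with that show False by simp
  qed
  have "\<exists>x\<ge>a. x \<le> z \<and> f x = 0"
    using z f0 continuous_on_subset[OF c, of "{a..z}"] by (intro IVT2') auto
  then have "f z = 0" using pos by force
  moreover have "a \<noteq> z" using z f0 by auto
  ultimately show ?thesis using z pos by (intro exI[of _ z]) auto
qed

text \<open>At its first zero the function would arrive from above, which a positive derivative there excludes.\<close>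

lemma positive_persists:
  fixes f f' :: "real \<Rightarrow> real"
  assumes d: "\<And>s. a \<le> s \<Longrightarrow> s \<le> b \<Longrightarrow> (f has_real_derivative f' s) (at s)"
    and up: "\<And>s. a < s \<Longrightarrow> s \<le> b \<Longrightarrow> f s = 0 \<Longrightarrow> 0 < f' s"
    and fa: "0 < f a" and ab: "a \<le> b"
  shows "0 < f b"
proof (rule ccontr)
  assume "\<not> 0 < f b"
  moreover have "continuous_on {a..b} f"
    by (rule DERIV_continuous_on, rule has_field_derivative_at_within, rule d) auto
  ultimately obtain c where c: "a < c" "c \<le> b" "f c = 0" and pos: "\<And>s. a \<le> s \<Longrightarrow> s < c \<Longrightarrow> 0 < f s"
    using first_zero_after[of a b f] fa ab by auto
  have "\<exists>e>0. \<forall>h>0. h < e \<longrightarrow> f (c - h) < f c"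
    by (rule DERIV_pos_inc_left[OF d up]) (use c in auto)
  then obtain e where e: "0 < e" "\<And>h. 0 < h \<Longrightarrow> h < e \<Longrightarrow> f (c - h) < f c" by blast
  define h where "h = min (e/2) (c - a)"
  have "0 < h" "h < e" "a \<le> c - h" using e c by (auto simp: h_def)
  with e(2)[of h] pos[of "c - h"] c(3) show False by auto
qed

text \<open>Continuous induction: the first time at which the bound is attained is excluded by the validity of the bound before it.\<close>

lemma bound_persists:
  fixes f :: "real \<Rightarrow> real"
  assumes cont: "continuous_on {a..} f" and "f a < M"
    and step: "\<And>t. a < t \<Longrightarrow> (\<And>s. a \<le> s \<Longrightarrow> s < t \<Longrightarrow> f s < M) \<Longrightarrow> f t < M"
    and "a \<le> t"
  shows "f t < M"
proof (rule ccontr)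
  assume t: "\<not> f t < M"
  have "continuous_on {a..t} (\<lambda>s. M - f s)" by (intro continuous_intros continuous_on_subset[OF cont]) auto
  then obtain z where "a < z" "M - f z = 0" "\<And>s. a \<le> s \<Longrightarrow> s < z \<Longrightarrow> 0 < M - f s"
    using first_zero_after[of a t "\<lambda>s. M - f s"] assms(2,4) t by auto
  with step[of z] show False by auto
qed

lemma filterlim_add_at_bot: "filterlim (\<lambda>t. c + t) at_bot at_bot" for c :: real
  unfolding filterlim_at_bot
proof
  fix Z
  show "\<forall>\<^sub>F t in at_bot. c + t \<le> Z" using eventually_le_at_bot[of "Z - c"] by eventually_elim simp
qed

lemma filterlim_diff_at_bot: "filterlim (\<lambda>t. c - t) at_bot at_top" for c :: real
  using filterlim_compose[OF filterlim_add_at_bot[of c] filterlim_uminus_at_bot_at_top] by simp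

lemma exp_scale_deriv: "((\<lambda>t. exp (c * t)) has_real_derivative c * exp (c * t)) (at t)" for c t :: real
  by (auto intro!: derivative_eq_intros)

lemma limit_deriv_zero:
  fixes f f' :: "real \<Rightarrow> real"
  assumes d: "\<And>s. s \<ge> s0 \<Longrightarrow> (f has_real_derivative f' s) (at s)"
    and l: "(f \<longlongrightarrow> l) at_top" and m: "(f' \<longlongrightarrow> m) at_top"
  shows "m = 0"
proof (rule ccontr)
  assume "m \<noteq> 0"
  have "\<forall>\<^sub>F s in at_top. \<bar>f' s - m\<bar> < \<bar>m\<bar> / 2"
    using tendstoD[OF m, of "\<bar>m\<bar>/2"] \<open>m \<noteq> 0\<close> by (simp add: dist_real_def)
  moreover have "\<forall>\<^sub>F s in at_top. \<bar>f s - l\<bar> < \<bar>m\<bar> / 4"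
    using tendstoD[OF l, of "\<bar>m\<bar>/4"] \<open>m \<noteq> 0\<close> by (simp add: dist_real_def)
  ultimately have "\<forall>\<^sub>F s in at_top. \<bar>f' s - m\<bar> < \<bar>m\<bar> / 2 \<and> \<bar>f s - l\<bar> < \<bar>m\<bar> / 4"
    by (rule eventually_conj)
  then obtain s1 where s1: "\<And>s. s \<ge> s1 \<Longrightarrow> \<bar>f' s - m\<bar> < \<bar>m\<bar> / 2 \<and> \<bar>f s - l\<bar> < \<bar>m\<bar> / 4"
    unfolding eventually_at_top_linorder by blast
  define a where "a = max s0 s1"
  have "\<exists>z. a < z \<and> z < a + 1 \<and> f (a+1) - f a = (a + 1 - a) * f' z"
    by (rule MVT2) (auto intro!: d simp: a_def)
  then obtain z where z: "a < z" "f (a+1) - f a = f' z" by auto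
  have "\<bar>f' z - m\<bar> < \<bar>m\<bar> / 2" "\<bar>f a - l\<bar> < \<bar>m\<bar> / 4" "\<bar>f (a+1) - l\<bar> < \<bar>m\<bar>/4"
    using s1[of z] s1[of a] s1[of "a+1"] z by (auto simp: a_def)
  then show False using z(2) by linarith
qed

lemma antimono_tendsto_at_top:
  fixes f :: "real \<Rightarrow> real"
  assumes mono: "\<And>s t. s0 \<le> s \<Longrightarrow> s \<le> t \<Longrightarrow> f t \<le> f s" and bd: "\<And>s. s0 \<le> s \<Longrightarrow> l0 \<le> f s"
  shows "\<exists>l. (f \<longlongrightarrow> l) at_top \<and> (\<forall>s\<ge>s0. l \<le> f s)"
proof -
  define l where "l = Inf (f ` {s0..})"
  have bb: "bdd_below (f ` {s0..})" using bd by (auto intro!: bdd_belowI2)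
  have l: "l \<le> f s" if "s0 \<le> s" for s unfolding l_def using that bb by (intro cInf_lower) auto
  have "(f \<longlongrightarrow> l) at_top"
  proof (rule decreasing_tendsto)
    show "\<forall>\<^sub>F n in at_top. l \<le> f n" using l by (auto simp: eventually_at_top_linorder)
    fix x assume "l < x"
    then obtain s where "s0 \<le> s" "f s < x" unfolding l_def using bb
      by (subst (asm) cInf_less_iff) auto
    then show "\<forall>\<^sub>F n in at_top. f n < x" using mono by (auto simp: eventually_at_top_linorder intro!: exI[of _ s] intro: le_less_trans)
  qed
  with l show ?thesis by blast
qed

lemma DERIV_glue:
  fixes g h :: "real \<Rightarrow> real"
  assumes g: "(g has_real_derivative D) (at c within {..c})"
    and h: "(h has_real_derivative D) (at c within {c..})" and eq: "g c = h c"
  shows "((\<lambda>t. if t \<le> c then g t else h t) has_real_derivative D) (at c)"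
proof -
  let ?f = "\<lambda>t. if t \<le> c then g t else h t"
  have "(?f has_real_derivative D) (at c within {..c})"
    by (rule has_field_derivative_transform_within[OF g zero_less_one]) auto
  moreover have "(?f has_real_derivative D) (at c within {c..})"
    by (rule has_field_derivative_transform_within[OF h zero_less_one]) (use eq in auto)
  ultimately have "(?f has_real_derivative D) (at c within ({..c} \<union> {c..}))"
    unfolding has_field_derivative_iff unfolding at_within_union by (rule filterlim_sup)
  moreover have "{..c} \<union> {c..} = (UNIV :: real set)" by auto
  ultimately show ?thesis by simp
qed

lemma isCont_glue:
  fixes g h :: "real \<Rightarrow> real"
  assumes "isCont g c" "isCont h c" "g c = h c"
  shows "isCont (\<lambda>t. if t \<le> c then g t else h t) c"
proof -
  let ?f = "\<lambda>t. if t \<le> c then g t else h t"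
  have g: "(g \<longlongrightarrow> g c) (at_left c)" and h: "(h \<longlongrightarrow> h c) (at_right c)"
    using assms(1,2) by (auto simp: isCont_def filterlim_at_split)
  have "(?f \<longlongrightarrow> g c) (at_left c)"
    by (rule Lim_transform_eventually[OF g]) (simp add: eventually_at_filter)
  moreover have "(?f \<longlongrightarrow> h c) (at_right c)"
    by (rule Lim_transform_eventually[OF h]) (simp add: eventually_at_filter)
  ultimately show ?thesis using assms(3) by (simp add: isCont_def filterlim_at_split)
qed

lemma exp_powr: "exp t powr (x::real) = exp (x * t)"
  by (simp add: powr_def)

section \<open>Volterra fixed points and uniqueness for second order equations\<close>

text \<open>Picard iteration for a causal operator: if each application of \<open>\<Phi>\<close> turns a bound \<open>A t\<^sup>n\<close> on
  a difference into \<open>C A t\<^bsup>n+1\<^esup>/(n+1)\<close>, then consecutive iterates differ by a term of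
  the exponential series, so they converge locally uniformly, whatever the size of \<open>C\<close>.\<close>

lemma volterra_fixed_point:
  fixes \<Phi> :: "(real \<Rightarrow> real) \<Rightarrow> real \<Rightarrow> real"
  assumes cont: "\<And>u. continuous_on {0..} u \<Longrightarrow> continuous_on {0..} (\<Phi> u)"
    and est: "\<And>T. 0 \<le> T \<Longrightarrow> \<exists>C\<ge>0. \<forall>u v A n. continuous_on {0..} u \<longrightarrow> continuous_on {0..} v \<longrightarrow>
        (\<forall>t\<in>{0..T}. \<bar>u t - v t\<bar> \<le> A * t ^ n) \<longrightarrow>
        (\<forall>t\<in>{0..T}. \<bar>\<Phi> u t - \<Phi> v t\<bar> \<le> C * A * t ^ Suc n / real (Suc n))"
  shows "\<exists>u. continuous_on {0..} u \<and> (\<forall>t\<ge>0. u t = \<Phi> u t)"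
proof -
  define it where "it n = (\<Phi> ^^ n) (\<lambda>_. 0)" for n
  have itS: "it (Suc n) = \<Phi> (it n)" for n by (simp add: it_def)
  have itc: "continuous_on {0..} (it n)" for n
    by (induction n) (auto simp: itS it_def[of 0] intro: cont)
  define lim where "lim x = (\<Sum>i. it (Suc i) x - it i x)" for x
  have sum_it: "(\<Sum>i<n. it (Suc i) x - it i x) = it n x" for n x
    by (subst sum_lessThan_telescope) (simp add: it_def)
  have ul: "uniform_limit {0..T} it lim sequentially" if T: "0 \<le> T" for T
  proof -
    obtain C where C: "C \<ge> 0" and CE: "\<And>u v A n t. continuous_on {0..} u \<Longrightarrow> continuous_on {0..} v \<Longrightarrow>
        (\<forall>t\<in>{0..T}. \<bar>u t - v t\<bar> \<le> A * t ^ n) \<Longrightarrow> t \<in> {0..T} \<Longrightarrow>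
        \<bar>\<Phi> u t - \<Phi> v t\<bar> \<le> C * A * t ^ Suc n / real (Suc n)"
      using est[OF T] by blast
    have "continuous_on {0..T} (it 1)" using itc by (rule continuous_on_subset) auto
    then have "bounded (it 1 ` {0..T})" by (intro compact_imp_bounded compact_continuous_image) auto
    then obtain A where "\<forall>x\<in>{0..T}. \<bar>it 1 x\<bar> \<le> A" unfolding bounded_iff by auto
    then have A: "x \<in> {0..T} \<Longrightarrow> \<bar>it 1 x\<bar> \<le> A" for x by blast
    have A0: "0 \<le> A" using A[of 0] T by auto
    have bd: "\<forall>t\<in>{0..T}. \<bar>it (Suc n) t - it n t\<bar> \<le> (A * C ^ n / fact n) * t ^ n" for n
    proof (induction n)
      case 0 then show ?case using A by (simp add: it_def)
    next
      case (Suc n)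
      show ?case
      proof
        fix t assume t: "t \<in> {0..T}"
        have "\<bar>it (Suc (Suc n)) t - it (Suc n) t\<bar> \<le> C * (A * C ^ n / fact n) * t ^ Suc n / real (Suc n)"
          unfolding itS[of "Suc n"] itS[of n] using CE[OF itc itc Suc t] by (simp add: itS)
        then show "\<bar>it (Suc (Suc n)) t - it (Suc n) t\<bar> \<le> A * C ^ Suc n / fact (Suc n) * t ^ Suc n"
          by (simp add: field_simps)
      qed
    qed
    have "norm (it (Suc n) t - it n t) \<le> A * (inverse (fact n) * (C * T) ^ n)" if "t \<in> {0..T}" for n t
    proof -
      have "\<bar>it (Suc n) t - it n t\<bar> \<le> (A * C ^ n / fact n) * t ^ n" using bd that by blast
      also have "\<dots> \<le> (A * C ^ n / fact n) * T ^ n"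
        using that A0 C by (intro mult_left_mono power_mono) auto
      finally show ?thesis by (simp add: field_simps)
    qed
    moreover have "summable (\<lambda>n. A * (inverse (fact n) * (C * T) ^ n))"
      by (intro summable_mult summable_exp)
    ultimately have "uniform_limit {0..T} (\<lambda>n x. \<Sum>i<n. it (Suc i) x - it i x) (\<lambda>x. \<Sum>i. it (Suc i) x - it i x) sequentially"
      by (rule Weierstrass_m_test)
    then show ?thesis unfolding sum_it lim_def[abs_def] .
  qed
  have limc: "continuous_on {0..} lim"
  proof -
    have "continuous_on {0..<T} lim" if "0 \<le> T" for T
    proof -
      have "continuous_on {0..T} lim"
        by (rule uniform_limit_theorem[OF _ ul[OF that]]) (auto intro!: always_eventually continuous_on_subset[OF itc])
      then show ?thesis by (rule continuous_on_subset) auto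
    qed
    note * = this
    show ?thesis
    proof (rule continuous_on_eq_continuous_within[THEN iffD2], rule ballI)
      fix x :: real assume x: "x \<in> {0..}"
      have "continuous (at x within {0..<x+1}) lim"
        using *[of "x+1"] x by (auto simp: continuous_on_eq_continuous_within)
      moreover have "at x within {0..<x+1} = at x within {0..}"
        by (rule at_within_nhd[of _ "{..<x+1}"]) auto
      ultimately show "continuous (at x within {0..}) lim" by simp
    qed
  qed
  have "lim t = \<Phi> lim t" if t: "0 \<le> t" for t
  proof -
    obtain C where C: "C \<ge> 0" and CE: "\<And>u v A n s. continuous_on {0..} u \<Longrightarrow> continuous_on {0..} v \<Longrightarrow>
        (\<forall>r\<in>{0..t}. \<bar>u r - v r\<bar> \<le> A * r ^ n) \<Longrightarrow> s \<in> {0..t} \<Longrightarrow>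
        \<bar>\<Phi> u s - \<Phi> v s\<bar> \<le> C * A * s ^ Suc n / real (Suc n)"
      using est[OF t] by blast
    have "(\<lambda>n. \<Phi> (it n) t) \<longlonglongrightarrow> \<Phi> lim t"
    proof (rule tendstoI)
      fix e :: real assume e: "e > 0"
      define d where "d = e / (C * t + 1)"
      have Ct: "C * t + 1 > 0" using C t by (simp add: add_nonneg_pos)
      have d: "d > 0" using e Ct by (simp add: d_def)
      have "\<forall>\<^sub>F n in sequentially. \<forall>x\<in>{0..t}. dist (it n x) (lim x) < d"
        using uniform_limitD[OF ul[OF t] d] .
      then show "\<forall>\<^sub>F n in sequentially. dist (\<Phi> (it n) t) (\<Phi> lim t) < e"
      proof eventually_elim
        case (elim n)
        then have "\<forall>r\<in>{0..t}. \<bar>it n r - lim r\<bar> \<le> d * r ^ 0" by (auto simp: dist_real_def less_imp_le)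
        from CE[OF itc limc this, of t] t have "\<bar>\<Phi> (it n) t - \<Phi> lim t\<bar> \<le> (C * t) * d"
          by (simp add: mult_ac)
        also have "\<dots> < (C * t + 1) * d" using d by simp
        also have "\<dots> = e" using Ct by (simp add: d_def)
        finally show ?case by (simp add: dist_real_def)
      qed
    qed
    moreover have "(\<lambda>n. it (Suc n) t) \<longlonglongrightarrow> lim t"
      using tendsto_uniform_limitI[OF ul[OF t], of t] t by (intro LIMSEQ_Suc) auto
    ultimately show ?thesis unfolding itS using LIMSEQ_unique by blast
  qed
  with limc show ?thesis by blast
qed

text \<open>Gronwall for the squared distance of two phase points; the differential inequality is used in
  both time directions.\<close>

lemma second_order_unique:
  fixes x1 y1 x2 y2 :: "real \<Rightarrow> real" and F :: "real \<Rightarrow> real \<Rightarrow> real \<Rightarrow> real"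
  assumes cont: "continuous_on {a..b} x1" "continuous_on {a..b} y1"
      "continuous_on {a..b} x2" "continuous_on {a..b} y2"
    and x1: "\<And>s. a < s \<Longrightarrow> s < b \<Longrightarrow> (x1 has_real_derivative y1 s) (at s)"
    and x2: "\<And>s. a < s \<Longrightarrow> s < b \<Longrightarrow> (x2 has_real_derivative y2 s) (at s)"
    and y1: "\<And>s. a < s \<Longrightarrow> s < b \<Longrightarrow> (y1 has_real_derivative F s (x1 s) (y1 s)) (at s)"
    and y2: "\<And>s. a < s \<Longrightarrow> s < b \<Longrightarrow> (y2 has_real_derivative F s (x2 s) (y2 s)) (at s)"
    and lip: "\<And>s. a < s \<Longrightarrow> s < b \<Longrightarrow>
        \<bar>F s (x1 s) (y1 s) - F s (x2 s) (y2 s)\<bar> \<le> C * (\<bar>x1 s - x2 s\<bar> + \<bar>y1 s - y2 s\<bar>)"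
    and c: "c \<in> {a..b}" "x1 c = x2 c" "y1 c = y2 c"
    and s: "s \<in> {a..b}"
  shows "x1 s = x2 s \<and> y1 s = y2 s"
proof -
  define d where "d s = (x1 s - x2 s)\<^sup>2 + (y1 s - y2 s)\<^sup>2" for s
  define d' where "d' s = 2 * ((x1 s - x2 s) * (y1 s - y2 s)) +
      2 * ((y1 s - y2 s) * (F s (x1 s) (y1 s) - F s (x2 s) (y2 s)))" for s
  define M where "M = 1 + 3 * \<bar>C\<bar>"
  have d0: "0 \<le> d s" for s by (simp add: d_def)
  have dd: "(d has_real_derivative d' s) (at s)" if "a < s" "s < b" for s
    unfolding d_def[abs_def] d'_def
    by (rule derivative_eq_intros x1[OF that] x2[OF that] y1[OF that] y2[OF that] refl | simp add: algebra_simps)+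
  have bd: "\<bar>d' s\<bar> \<le> M * d s" if "a < s" "s < b" for s
  proof -
    define p q where "p = \<bar>x1 s - x2 s\<bar>" and "q = \<bar>y1 s - y2 s\<bar>"
    have pq: "0 \<le> p" "0 \<le> q" by (auto simp: p_def q_def)
    have "\<bar>d' s\<bar> \<le> 2 * (p * q) + 2 * (q * \<bar>F s (x1 s) (y1 s) - F s (x2 s) (y2 s)\<bar>)"
      unfolding d'_def p_def q_def by (rule order_trans[OF abs_triangle_ineq]) (simp add: abs_mult)
    also have "\<dots> \<le> 2 * (p * q) + 2 * (q * (\<bar>C\<bar> * (p + q)))"
    proof -
      have "\<bar>F s (x1 s) (y1 s) - F s (x2 s) (y2 s)\<bar> \<le> C * (p + q)"
        using lip[OF that] by (simp add: p_def q_def)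
      also have "\<dots> \<le> \<bar>C\<bar> * (p + q)" using pq by (intro mult_right_mono) auto
      finally show ?thesis using pq by (intro add_left_mono mult_left_mono) auto
    qed
    also have "\<dots> = (1 + \<bar>C\<bar>) * (2 * (p * q)) + 2 * \<bar>C\<bar> * q\<^sup>2"
      by (simp add: algebra_simps power2_eq_square)
    also have "\<dots> \<le> (1 + \<bar>C\<bar>) * (p\<^sup>2 + q\<^sup>2) + 2 * \<bar>C\<bar> * (p\<^sup>2 + q\<^sup>2)"
      using sum_squares_bound[of p q] by (intro add_mono mult_left_mono) auto
    also have "\<dots> = M * (p\<^sup>2 + q\<^sup>2)" by (simp add: M_def algebra_simps)
    finally show ?thesis by (simp add: p_def q_def d_def)
  qed
  have dcont: "continuous_on {a..b} d"
    unfolding d_def[abs_def] by (intro continuous_intros cont)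
  have dc: "d c = 0" using c by (simp add: d_def)
  have "d s \<le> 0"
  proof (cases "c \<le> s")
    case True
    have "exp (- M * s) * d s \<le> exp (- M * c) * d c"
    proof (rule decreasing_open_real[OF True, where f' = "\<lambda>x. exp (- M * x) * (d' x - M * d x)"])
      show "continuous_on {c..s} (\<lambda>s. exp (- M * s) * d s)"
        by (intro continuous_intros continuous_on_subset[OF dcont]) (use c s in auto)
      fix x assume x: "c < x" "x < s"
      then have x': "a < x" "x < b" using c s by auto
      show "((\<lambda>s. exp (- M * s) * d s) has_real_derivative exp (- M * x) * (d' x - M * d x)) (at x)"
        by (rule derivative_eq_intros dd[OF x'] refl | simp add: algebra_simps)+
      show "exp (- M * x) * (d' x - M * d x) \<le> 0" using bd[OF x'] by (simp add: mult_le_0_iff)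
    qed
    then show ?thesis using dc by (simp add: mult_le_0_iff)
  next
    case False
    have "exp (M * s) * d s \<le> exp (M * c) * d c"
    proof (rule increasing_open_real[where a = s and b = c and f' = "\<lambda>x. exp (M * x) * (d' x + M * d x)"])
      show "continuous_on {s..c} (\<lambda>s. exp (M * s) * d s)"
        by (intro continuous_intros continuous_on_subset[OF dcont]) (use c s in auto)
      fix x assume x: "s < x" "x < c"
      then have x': "a < x" "x < b" using c s by auto
      show "((\<lambda>s. exp (M * s) * d s) has_real_derivative exp (M * x) * (d' x + M * d x)) (at x)"
        by (rule derivative_eq_intros dd[OF x'] refl | simp add: algebra_simps)+
      show "0 \<le> exp (M * x) * (d' x + M * d x)" using bd[OF x'] by (simp add: zero_le_mult_iff)
    qed (use False in auto)
    then show ?thesis using dc by (simp add: mult_le_0_iff)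
  qed
  with d0[of s] have "d s = 0" by linarith
  then show ?thesis by (simp add: d_def sum_power2_eq_zero_iff)
qed

section \<open>The signed power and truncation\<close>

definition spow :: "real \<Rightarrow> real \<Rightarrow> real" where
  "spow q x = x * \<bar>x\<bar> powr (q - 2)"

lemma spow_minus [simp]: "spow q (- x) = - spow q x"
  by (simp add: spow_def)

lemma spow_0 [simp]: "spow q 0 = 0"
  by (simp add: spow_def)

lemma spow_pos: "0 < x \<Longrightarrow> 0 < spow q x"
  by (simp add: spow_def)

lemma spow_eq_powr: "0 < x \<Longrightarrow> spow q x = x powr (q - 1)"
proof -
  assume x: "0 < x"
  have "x powr (q - 1) = x powr (1 + (q - 2))" by simp
  also have "\<dots> = x * x powr (q - 2)" using x by (subst powr_add) simp
  finally show ?thesis using x by (simp add: spow_def)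
qed

lemma spow_scale: "0 < c \<Longrightarrow> spow q (c * x) = c powr (q - 1) * spow q x"
proof -
  assume c: "0 < c"
  have "c powr (q - 1) = c powr (1 + (q - 2))" by simp
  also have "\<dots> = c * c powr (q - 2)" using c by (subst powr_add) simp
  finally show ?thesis using c by (simp add: spow_def abs_mult powr_mult)
qed

lemma spow_mult_self: "x * spow q x = \<bar>x\<bar> powr q"
proof (cases "x = 0")
  case False
  have "\<bar>x\<bar> powr q = \<bar>x\<bar> powr (2 + (q - 2))" by simp
  also have "\<dots> = x\<^sup>2 * \<bar>x\<bar> powr (q - 2)" using False by (subst powr_add) simp
  finally show ?thesis by (simp add: spow_def power2_eq_square)
qed simp

lemma DERIV_spow:
  assumes q: "2 < q"
  shows "(spow q has_real_derivative (q - 1) * \<bar>x\<bar> powr (q - 2)) (at x)"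
proof -
  have pos: "(spow q has_real_derivative (q - 1) * \<bar>x\<bar> powr (q - 2)) (at x)" if "0 < x" for x
  proof (rule has_field_derivative_transform_within_open[where S = "{0<..}" and f = "\<lambda>x. x powr (q - 1)"])
    show "((\<lambda>x. x powr (q - 1)) has_real_derivative (q - 1) * \<bar>x\<bar> powr (q - 2)) (at x)"
      using has_real_derivative_powr[OF that, of "q - 1"] that by simp
  qed (use that in \<open>auto simp: spow_eq_powr\<close>)
  consider "0 < x" | "x < 0" | "x = 0" by linarith
  then show ?thesis
  proof cases
    case 1 then show ?thesis by (rule pos)
  next
    case 2
    have "((\<lambda>x. - spow q (- x)) has_real_derivative - ((q - 1) * \<bar>-x\<bar> powr (q - 2) * -1)) (at x)"
      by (intro DERIV_minus DERIV_chain2[OF pos]) (use 2 in \<open>auto intro!: derivative_eq_intros\<close>)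
    then show ?thesis by simp
  next
    case 3
    have "((\<lambda>z. \<bar>z\<bar> powr (q - 2)) \<longlongrightarrow> 0) (at (0::real))"
      by (rule tendsto_zero_powrI) (use q in \<open>auto intro!: tendsto_eq_intros\<close>)
    then have "((\<lambda>z. (spow q z - spow q 0) / (z - 0)) \<longlongrightarrow> 0) (at 0)"
      by (rule Lim_transform_eventually) (auto simp: spow_def eventually_at_filter)
    then show ?thesis using 3 q by (simp add: has_field_derivative_iff)
  qed
qed

lemma continuous_on_spow [continuous_intros]:
  assumes "2 < q" "continuous_on S f"
  shows "continuous_on S (\<lambda>x. spow q (f x))"
proof -
  have "continuous_on UNIV (spow q)"
    by (rule DERIV_continuous_on[OF has_field_derivative_at_within, OF DERIV_spow[OF assms(1)]])
  then show ?thesis using assms(2) continuous_on_compose2 by blast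
qed

lemma DERIV_abs_powr:
  assumes q: "2 < q"
  shows "((\<lambda>x. \<bar>x\<bar> powr q / q) has_real_derivative spow q x) (at x)"
proof -
  have pos: "((\<lambda>x. \<bar>x\<bar> powr q / q) has_real_derivative spow q x) (at x)" if "0 < x" for x
  proof (rule has_field_derivative_transform_within_open[where S = "{0<..}" and f = "\<lambda>x. x powr q / q"])
    show "((\<lambda>x. x powr q / q) has_real_derivative spow q x) (at x)"
      using DERIV_cdivide[OF has_real_derivative_powr[OF that, of q], of q] that q
      by (simp add: spow_eq_powr)
  qed (use that in auto)
  consider "0 < x" | "x < 0" | "x = 0" by linarith
  then show ?thesis
  proof cases
    case 1 then show ?thesis by (rule pos)
  next
    case 2
    have "((\<lambda>x. \<bar>-x\<bar> powr q / q) has_real_derivative (spow q (-x) * -1)) (at x)"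
      by (intro DERIV_chain2[OF pos]) (use 2 in \<open>auto intro!: derivative_eq_intros\<close>)
    then show ?thesis by simp
  next
    case 3
    have "((\<lambda>z. spow q z / q) \<longlongrightarrow> spow q 0 / q) (at (0::real))"
      using q by (intro tendsto_divide[OF isContD[OF DERIV_isCont[OF DERIV_spow[OF q]]] tendsto_const]) auto
    then have "((\<lambda>z. (\<bar>z\<bar> powr q / q - \<bar>0\<bar> powr q / q) / (z - 0)) \<longlongrightarrow> 0) (at 0)"
      by (simp, elim Lim_transform_eventually) (auto simp: spow_mult_self[symmetric] eventually_at_filter)
    then show ?thesis using 3 by (simp add: has_field_derivative_iff)
  qed
qed

lemma spow_lipschitz:
  assumes q: "2 < q" and "\<bar>x\<bar> \<le> M" "\<bar>y\<bar> \<le> M"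
  shows "\<bar>spow q x - spow q y\<bar> \<le> (q - 1) * M powr (q - 2) * \<bar>x - y\<bar>"
proof -
  have "norm (spow q x - spow q y) \<le> (q - 1) * M powr (q - 2) * norm (x - y)"
  proof (rule field_differentiable_bound[where S = "{-M..M}" and f' = "\<lambda>x. (q - 1) * \<bar>x\<bar> powr (q - 2)"])
    fix z assume "z \<in> {-M..M}"
    then have "\<bar>z\<bar> powr (q - 2) \<le> M powr (q - 2)" using q by (intro powr_mono2) auto
    then show "norm ((q - 1) * \<bar>z\<bar> powr (q - 2)) \<le> (q - 1) * M powr (q - 2)"
      using q by (simp add: abs_mult mult_left_mono)
  qed (use assms in \<open>auto intro: has_field_derivative_at_within DERIV_spow\<close>)
  then show ?thesis by simp
qed

definition cutoff :: "real \<Rightarrow> real \<Rightarrow> real" where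
  "cutoff M x = max (- M) (min M x)"

lemma cutoff_id: "\<bar>x\<bar> \<le> M \<Longrightarrow> cutoff M x = x"
  by (auto simp: cutoff_def)

lemma spow_cutoff_lipschitz:
  assumes "2 < q" "0 \<le> M"
  shows "\<bar>spow q (cutoff M x) - spow q (cutoff M y)\<bar> \<le> (q - 1) * M powr (q - 2) * \<bar>x - y\<bar>"
proof -
  have "\<bar>spow q (cutoff M x) - spow q (cutoff M y)\<bar> \<le> (q - 1) * M powr (q - 2) * \<bar>cutoff M x - cutoff M y\<bar>"
    using assms by (intro spow_lipschitz) (auto simp: cutoff_def)
  also have "\<dots> \<le> (q - 1) * M powr (q - 2) * \<bar>x - y\<bar>"
    using assms by (intro mult_left_mono) (auto simp: cutoff_def)
  finally show ?thesis .
qed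

lemma scaled_spow_cutoff:
  assumes q: "2 < q" and M: "0 \<le> M" and k: "0 \<le> k"
  shows "\<bar>k * spow q (cutoff M x) - k * spow q (cutoff M y)\<bar> \<le> k * ((q - 1) * M powr (q - 2)) * \<bar>x - y\<bar>"
    and "\<bar>k * spow q (cutoff M x)\<bar> \<le> k * spow q M"
proof -
  have "\<bar>k * spow q (cutoff M x) - k * spow q (cutoff M y)\<bar> = k * \<bar>spow q (cutoff M x) - spow q (cutoff M y)\<bar>"
    using k by (simp add: abs_mult right_diff_distrib[symmetric])
  also have "\<dots> \<le> k * ((q - 1) * M powr (q - 2) * \<bar>x - y\<bar>)"
    by (intro mult_left_mono spow_cutoff_lipschitz q M k)
  finally show "\<bar>k * spow q (cutoff M x) - k * spow q (cutoff M y)\<bar> \<le> k * ((q - 1) * M powr (q - 2)) * \<bar>x - y\<bar>"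
    by simp
  have "cutoff M x \<le> M" "- M \<le> cutoff M x" using M by (auto simp: cutoff_def)
  then have "\<bar>spow q (cutoff M x)\<bar> \<le> spow q M"
    using q M by (auto simp: spow_def abs_mult intro!: mult_mono powr_mono2)
  then show "\<bar>k * spow q (cutoff M x)\<bar> \<le> k * spow q M" using k by (simp add: abs_mult mult_left_mono)
qed

lemma spow_local_lipschitz:
  fixes k :: real
  assumes "2 < q" "0 \<le> R"
  shows "\<exists>\<Lambda>\<ge>0. \<forall>x y. \<bar>x\<bar> \<le> R \<longrightarrow> \<bar>y\<bar> \<le> R \<longrightarrow> \<bar>k * spow q x - k * spow q y\<bar> \<le> \<Lambda> * \<bar>x - y\<bar>"
proof (intro exI[of _ "\<bar>k\<bar> * ((q - 1) * R powr (q - 2))"] conjI allI impI)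
  fix x y assume "\<bar>x\<bar> \<le> R" "\<bar>y\<bar> \<le> R"
  then have "\<bar>k\<bar> * \<bar>spow q x - spow q y\<bar> \<le> \<bar>k\<bar> * ((q - 1) * R powr (q - 2) * \<bar>x - y\<bar>)"
    by (intro mult_left_mono spow_lipschitz assms) auto
  then show "\<bar>k * spow q x - k * spow q y\<bar> \<le> \<bar>k\<bar> * ((q - 1) * R powr (q - 2)) * \<bar>x - y\<bar>"
    by (simp add: abs_mult right_diff_distrib[symmetric])
qed (use assms in auto)

section \<open>The singular initial value problem at minus infinity\<close>

text \<open>In the variable \<open>z = e\<^bsup>\<rho>t\<^esup>\<close> the problem becomes a Volterra equation on \<open>z \<ge> 0\<close>, with the bounded
  kernel \<open>(1 - (\<zeta>/z)\<^bsup>\<mu>/\<rho>\<^esup>)/(\<rho>\<mu>)\<close>; so the prescribed limit at minus infinity acts as an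
  ordinary initial value.\<close>

lemma singular_exists:
  fixes h :: "real \<Rightarrow> real"
  assumes mu: "0 < \<mu>" and rho: "0 < \<rho>" and lip: "\<And>x y. \<bar>h x - h y\<bar> \<le> \<Lambda> * \<bar>x - y\<bar>"
  shows "\<exists>w p. (\<forall>t. (w has_real_derivative p t) (at t)) \<and>
     (\<forall>t. (p has_real_derivative - \<mu> * p t + exp (\<rho> * t) * h (w t)) (at t)) \<and> (w \<longlongrightarrow> d) at_bot"
proof -
  define \<beta> where "\<beta> = \<mu> / \<rho>"
  have b: "0 < \<beta>" using mu rho by (simp add: \<beta>_def)
  have L0: "0 \<le> \<Lambda>" using lip[of 1 0] by simp
  have hc: "continuous_on UNIV h"
  proof (rule lipschitz_on_continuous_on[of \<Lambda>])
    show "\<Lambda>-lipschitz_on UNIV h" using lip L0 by (intro lipschitz_onI) (auto simp: dist_real_def)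
  qed
  have hcc: "continuous_on {0..} (\<lambda>z. h (u z))" if "continuous_on {0..} u" for u :: "real \<Rightarrow> real"
    using hc that continuous_on_compose2 by blast
  have jc: "continuous_on {0..} (\<lambda>z. z powr \<beta> * h (u z))" if "continuous_on {0..} u" for u :: "real \<Rightarrow> real"
    using b by (intro continuous_intros hcc[OF that] continuous_on_powr') auto
  define J where "J u z = integral {0..z} (\<lambda>z. z powr \<beta> * h (u z))" for u and z :: real
  \<comment> \<open>The variation of constants formula in \<open>z\<close>, with the kernel multiplied out.\<close>
  define \<Phi> where "\<Phi> u z = d + (integral {0..z} (\<lambda>z. h (u z)) - z powr (- \<beta>) * J u z) / (\<rho> * \<mu>)" for u z
  have \<Phi>d: "(\<Phi> u has_real_derivative z powr (- \<beta> - 1) * J u z / \<rho>\<^sup>2) (at z)"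
    if u: "continuous_on {0..} u" and z: "0 < z" for u z
  proof -
    have 1: "((\<lambda>z. integral {0..z} (\<lambda>z. h (u z))) has_real_derivative h (u z)) (at z)"
      using integral_from_0_deriv_at[OF hcc[OF u] z] .
    have 2: "(J u has_real_derivative z powr \<beta> * h (u z)) (at z)"
      unfolding J_def[abs_def] using integral_from_0_deriv_at[OF jc[OF u] z] .
    have D: "(\<Phi> u has_real_derivative 0 + (h (u z) - (- \<beta> * z powr (- \<beta> - 1) * J u z +
        z powr \<beta> * h (u z) * z powr (- \<beta>))) / (\<rho> * \<mu>)) (at z)"
      unfolding \<Phi>_def[abs_def]
      by (rule DERIV_add[OF DERIV_const DERIV_cdivide[OF DERIV_diff[OF 1
          DERIV_mult[OF has_real_derivative_powr[OF z] 2]]]])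
    have 3: "z powr \<beta> * h (u z) * z powr (-\<beta>) = h (u z)"
      using z by (simp add: powr_minus)
    have "0 + (h (u z) - (- \<beta> * z powr (- \<beta> - 1) * J u z +
        z powr \<beta> * h (u z) * z powr (- \<beta>))) / (\<rho> * \<mu>) = z powr (- \<beta> - 1) * J u z / \<rho>\<^sup>2"
    proof -
      have "0 + (h (u z) - (- \<beta> * z powr (- \<beta> - 1) * J u z +
        z powr \<beta> * h (u z) * z powr (- \<beta>))) / (\<rho> * \<mu>) = \<beta> * (z powr (- \<beta> - 1) * J u z) / (\<rho> * \<mu>)"
        unfolding 3 by simp
      also have "\<dots> = z powr (- \<beta> - 1) * J u z / \<rho>\<^sup>2"
        using mu rho unfolding \<beta>_def power2_eq_square by (simp only: times_divide_eq_left) simp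
      finally show ?thesis .
    qed
    then show ?thesis by (rule DERIV_cong[OF D])
  qed
  have cont: "continuous_on {0..} (\<Phi> u)" if u: "continuous_on {0..} u" for u
  proof (rule continuous_on_eq_continuous_within[THEN iffD2], rule ballI)
    fix z :: real assume z: "z \<in> {0..}"
    show "continuous (at z within {0..}) (\<Phi> u)"
    proof (cases "z = 0")
      case False
      with z have "isCont (\<Phi> u) z" by (intro DERIV_isCont[OF \<Phi>d[OF u]]) auto
      then show ?thesis by (rule continuous_at_imp_continuous_at_within)
    next
      case True
      have "bounded ((\<lambda>z. h (u z)) ` {0..1})"
        by (intro compact_imp_bounded compact_continuous_image continuous_on_subset[OF hcc[OF u]]) auto
      then obtain H where H: "\<And>z. z \<in> {0..1} \<Longrightarrow> \<bar>h (u z)\<bar> \<le> H" unfolding bounded_iff real_norm_def by blast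
      have H0: "0 \<le> H" using H[of 0] by auto
      have bd: "norm (\<Phi> u z - d) \<le> 2 * H * z / (\<rho> * \<mu>)" if z: "0 \<le> z" "z \<le> 1" for z
      proof -
        have 1: "\<bar>integral {0..z} (\<lambda>z. h (u z)) - integral {0..z} (\<lambda>z. 0)\<bar> \<le> H * z ^ Suc 0 / real (Suc 0)"
          by (rule integral_diff_monomial_le) (use hcc[OF u] H z in auto)
        have 2: "\<bar>J u z - integral {0..z} (\<lambda>z. 0)\<bar> \<le> (z powr \<beta> * H) * z ^ Suc 0 / real (Suc 0)"
          unfolding J_def
        proof (rule integral_diff_monomial_le)
          fix t assume t: "0 \<le> t" "t \<le> z"
          then show "\<bar>t powr \<beta> * h (u t) - 0\<bar> \<le> z powr \<beta> * H * t ^ 0"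
            using H[of t] z b by (auto simp: abs_mult intro!: mult_mono powr_mono2)
        qed (use jc[OF u] z in auto)
        have 3: "\<bar>z powr (- \<beta>) * J u z\<bar> \<le> H * z"
        proof (cases "z = 0")
          case False
          have "\<bar>z powr (- \<beta>) * J u z\<bar> \<le> z powr (- \<beta>) * (z powr \<beta> * H * z)"
            using 2 by (simp add: abs_mult mult_left_mono)
          also have "\<dots> = H * z" using False z by (simp add: powr_minus)
          finally show ?thesis .
        qed simp
        have "\<bar>integral {0..z} (\<lambda>z. h (u z)) - z powr (- \<beta>) * J u z\<bar> \<le> 2 * H * z"
          using 1 3 by simp
        then show ?thesis using mu rho by (simp add: \<Phi>_def abs_mult divide_right_mono)
      qed
      have "((\<lambda>z. \<Phi> u z - d) \<longlongrightarrow> 0) (at 0 within {0..})"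
      proof (rule Lim_null_comparison)
        show "\<forall>\<^sub>F z in at 0 within {0..}. norm (\<Phi> u z - d) \<le> 2 * H * z / (\<rho> * \<mu>)"
          unfolding eventually_at by (intro exI[of _ 1]) (auto intro!: bd[unfolded real_norm_def] simp: dist_real_def)
        show "((\<lambda>z. 2 * H * z / (\<rho> * \<mu>)) \<longlongrightarrow> 0) (at 0 within {0..})"
          using mu rho by (auto intro!: tendsto_eq_intros)
      qed
      then have "(\<Phi> u \<longlongrightarrow> d) (at 0 within {0..})" by (simp add: LIM_zero_iff)
      then show ?thesis unfolding True by (simp add: continuous_within \<Phi>_def)
    qed
  qed
  have est: "\<bar>\<Phi> u z - \<Phi> v z\<bar> \<le> (2 * \<Lambda> / (\<rho> * \<mu>)) * A * z ^ Suc n / real (Suc n)"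
    if u: "continuous_on {0..} u" and v: "continuous_on {0..} v"
      and A: "\<forall>t\<in>{0..T}. \<bar>u t - v t\<bar> \<le> A * t ^ n" and z: "z \<in> {0..T}" for u v A n z T
  proof -
    have hd: "\<bar>h (u t) - h (v t)\<bar> \<le> (\<Lambda> * A) * t ^ n" if "0 \<le> t" "t \<le> z" for t
    proof -
      have "\<bar>h (u t) - h (v t)\<bar> \<le> \<Lambda> * \<bar>u t - v t\<bar>" by (rule lip)
      also have "\<dots> \<le> \<Lambda> * (A * t ^ n)" using A that z L0 by (intro mult_left_mono) auto
      finally show ?thesis by simp
    qed
    define I where "I = \<Lambda> * A * z ^ Suc n / real (Suc n)"
    have 1: "\<bar>integral {0..z} (\<lambda>z. h (u z)) - integral {0..z} (\<lambda>z. h (v z))\<bar> \<le> I"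
      unfolding I_def by (rule integral_diff_monomial_le) (use hcc u v hd z in auto)
    have 2: "\<bar>J u z - J v z\<bar> \<le> (z powr \<beta> * (\<Lambda> * A)) * z ^ Suc n / real (Suc n)"
      unfolding J_def
    proof (rule integral_diff_monomial_le)
      fix t assume t: "0 \<le> t" "t \<le> z"
      have "\<bar>t powr \<beta> * h (u t) - t powr \<beta> * h (v t)\<bar> = t powr \<beta> * \<bar>h (u t) - h (v t)\<bar>"
        by (simp add: abs_mult right_diff_distrib[symmetric])
      also have "\<dots> \<le> z powr \<beta> * (\<Lambda> * A * t ^ n)"
        using hd[OF t] t b by (intro mult_mono powr_mono2) auto
      finally show "\<bar>t powr \<beta> * h (u t) - t powr \<beta> * h (v t)\<bar> \<le> z powr \<beta> * (\<Lambda> * A) * t ^ n"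
        by (simp add: mult_ac)
    qed (use jc u v z in auto)
    have I0: "0 \<le> I" using 1 by linarith
    have 3: "\<bar>z powr (- \<beta>) * J u z - z powr (- \<beta>) * J v z\<bar> \<le> I"
    proof (cases "z = 0")
      case False
      have "\<bar>z powr (- \<beta>) * J u z - z powr (- \<beta>) * J v z\<bar> = z powr (- \<beta>) * \<bar>J u z - J v z\<bar>"
        by (simp add: abs_mult right_diff_distrib[symmetric])
      also have "\<dots> \<le> z powr (- \<beta>) * (z powr \<beta> * I)"
        using 2 by (intro mult_left_mono) (auto simp: I_def)
      also have "\<dots> = I" using False z by (simp add: powr_minus)
      finally show ?thesis .
    qed (use I0 in simp)
    have "\<bar>(\<Phi> u z - \<Phi> v z) * (\<rho> * \<mu>)\<bar> \<le> 2 * I"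
    proof -
      have "(\<Phi> u z - \<Phi> v z) * (\<rho> * \<mu>) = (integral {0..z} (\<lambda>z. h (u z)) - integral {0..z} (\<lambda>z. h (v z)))
         - (z powr (- \<beta>) * J u z - z powr (- \<beta>) * J v z)"
        using mu rho by (simp add: \<Phi>_def field_simps)
      with 1 3 show ?thesis by linarith
    qed
    then have "\<bar>\<Phi> u z - \<Phi> v z\<bar> * (\<rho> * \<mu>) \<le> 2 * I" using mu rho unfolding abs_mult by simp
    then have "\<bar>\<Phi> u z - \<Phi> v z\<bar> \<le> 2 * I / (\<rho> * \<mu>)" using mu rho by (simp only: pos_le_divide_eq mult_pos_pos)
    then show ?thesis by (simp only: I_def times_divide_eq_left times_divide_eq_right divide_divide_eq_left mult.assoc mult.commute mult.left_commute)
  qed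
  have "\<exists>\<omega>. continuous_on {0..} \<omega> \<and> (\<forall>z\<ge>0. \<omega> z = \<Phi> \<omega> z)"
  proof (rule volterra_fixed_point[OF cont], assumption)
    fix T :: real assume "0 \<le> T"
    have "0 \<le> 2 * \<Lambda> / (\<rho> * \<mu>)" using L0 mu rho by simp
    with est[where T = T] show "\<exists>C\<ge>0. \<forall>u v A n. continuous_on {0..} u \<longrightarrow> continuous_on {0..} v \<longrightarrow>
        (\<forall>t\<in>{0..T}. \<bar>u t - v t\<bar> \<le> A * t ^ n) \<longrightarrow>
        (\<forall>t\<in>{0..T}. \<bar>\<Phi> u t - \<Phi> v t\<bar> \<le> C * A * t ^ Suc n / real (Suc n))"
      by blast
  qed
  then obtain \<omega> where oc: "continuous_on {0..} \<omega>" and om: "\<And>z. 0 \<le> z \<Longrightarrow> \<omega> z = \<Phi> \<omega> z" by blast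
  define w where "w t = \<omega> (exp (\<rho> * t))" for t
  define p where "p t = exp (- \<mu> * t) * J \<omega> (exp (\<rho> * t)) / \<rho>" for t
  have od: "(\<omega> has_real_derivative z powr (- \<beta> - 1) * J \<omega> z / \<rho>\<^sup>2) (at z)" if "0 < z" for z
    by (rule has_field_derivative_transform_within_open[OF \<Phi>d[OF oc that], of "{0<..}"])
      (use that om in auto)
  have wd: "(w has_real_derivative p t) (at t)" for t
  proof -
    have "(w has_real_derivative (exp (\<rho> * t) powr (- \<beta> - 1) * J \<omega> (exp (\<rho> * t)) / \<rho>\<^sup>2) * (\<rho> * exp (\<rho> * t))) (at t)"
      unfolding w_def[abs_def] by (rule DERIV_chain2[OF od]) (auto intro!: derivative_eq_intros)
    moreover have "exp (\<rho> * t) powr (- \<beta> - 1) * exp (\<rho> * t) = exp (- \<mu> * t)"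
      using rho by (simp add: powr_def exp_add[symmetric] \<beta>_def field_simps)
    ultimately show ?thesis using rho unfolding p_def power2_eq_square
      by (elim DERIV_cong) (simp add: field_simps)
  qed
  have pd: "(p has_real_derivative - \<mu> * p t + exp (\<rho> * t) * h (w t)) (at t)" for t
  proof -
    have "(J \<omega> has_real_derivative exp (\<rho> * t) powr \<beta> * h (\<omega> (exp (\<rho> * t)))) (at (exp (\<rho> * t)))"
      unfolding J_def[abs_def] by (rule integral_from_0_deriv_at[OF jc[OF oc]]) simp
    then have "((\<lambda>t. J \<omega> (exp (\<rho> * t))) has_real_derivative (exp (\<rho> * t) powr \<beta> * h (w t)) * (\<rho> * exp (\<rho> * t))) (at t)"
      unfolding w_def by (rule DERIV_chain2) (auto intro!: derivative_eq_intros)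
    then have "(p has_real_derivative (exp (- \<mu> * t) * ((exp (\<rho> * t) powr \<beta> * h (w t)) * (\<rho> * exp (\<rho> * t))) +
       (- \<mu> * exp (- \<mu> * t)) * J \<omega> (exp (\<rho> * t))) / \<rho>) (at t)"
      unfolding p_def[abs_def] using rho by (auto intro!: derivative_eq_intros)
    moreover have "exp (- \<mu> * t) * exp (\<rho> * t) powr \<beta> = 1"
      using rho by (simp add: powr_def exp_add[symmetric] \<beta>_def field_simps)
    then have "exp (- \<mu> * t) * ((exp (\<rho> * t) powr \<beta> * h (w t)) * (\<rho> * exp (\<rho> * t))) = h (w t) * (\<rho> * exp (\<rho> * t))"
      by (metis (no_types, lifting) mult.assoc mult_1)
    ultimately show ?thesis using rho unfolding p_def
      by (elim DERIV_cong) (simp add: field_simps)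
  qed
  have "(w \<longlongrightarrow> d) at_bot"
  proof -
    have "(\<omega> \<longlongrightarrow> \<omega> 0) (at 0 within {0..})"
      using oc by (simp add: continuous_on_def)
    moreover have "\<omega> 0 = d" using om[of 0] by (simp add: \<Phi>_def)
    moreover have "filterlim (\<lambda>t. exp (\<rho> * t)) (at 0 within {0..}) at_bot"
    proof -
      have "((\<lambda>t. exp (\<rho> * t)) \<longlongrightarrow> 0) at_bot"
        using rho by (intro filterlim_compose[OF exp_at_bot] filterlim_tendsto_pos_mult_at_bot[OF tendsto_const] filterlim_ident)
      then show ?thesis by (auto simp: filterlim_at)
    qed
    ultimately show ?thesis unfolding w_def[abs_def] by (metis filterlim_compose)
  qed
  with wd pd show ?thesis by blast
qed

text \<open>If \<open>e\<^bsup>\<mu>t\<^esup> p\<close> exceeded the bound at one time, it would exceed a positive constant at all earlier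
  times, and integrating \<open>p \<ge> const e\<^bsup>-\<mu>t\<^esup>\<close> backwards would make \<open>w\<close> diverge.\<close>

lemma singular_tail_upper:
  fixes w p b :: "real \<Rightarrow> real"
  assumes mu: "0 < \<mu>" and rho: "0 < \<rho>" and m: "0 \<le> m"
    and w: "\<And>t. t \<le> T \<Longrightarrow> (w has_real_derivative p t) (at t)"
    and p: "\<And>t. t \<le> T \<Longrightarrow> (p has_real_derivative - \<mu> * p t + exp (\<rho> * t) * b t) (at t)"
    and b: "\<And>t. t \<le> T \<Longrightarrow> b t \<le> m"
    and lim: "(w \<longlongrightarrow> d) at_bot" and t: "t \<le> T"
  shows "p t \<le> m / (\<mu> + \<rho>) * exp (\<rho> * t) \<and> w t - d \<le> m / (\<rho> * (\<mu> + \<rho>)) * exp (\<rho> * t)"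
proof -
  define k where "k = m / (\<mu> + \<rho>)"
  have km: "k * (\<mu> + \<rho>) = m" and k0: "0 \<le> k" using mu rho m by (auto simp: k_def)
  define A where "A t = exp (\<mu> * t) * p t - k * exp ((\<mu> + \<rho>) * t)" for t
  have Ad: "(A has_real_derivative exp ((\<mu> + \<rho>) * t) * (b t - m)) (at t)" if "t \<le> T" for t
    unfolding A_def[abs_def]
    by (rule derivative_eq_intros p[OF that] refl | simp add: km[symmetric] algebra_simps exp_add)+
  have pub: "p t \<le> k * exp (\<rho> * t)" if t: "t \<le> T" for t
  proof (rule ccontr)
    assume "\<not> p t \<le> k * exp (\<rho> * t)"
    define e where "e = A t"
    have e: "0 < e"
    proof -
      have "e = exp (\<mu> * t) * (p t - k * exp (\<rho> * t))" by (simp add: e_def A_def algebra_simps exp_add)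
      with \<open>\<not> p t \<le> k * exp (\<rho> * t)\<close> show ?thesis by simp
    qed
    have Age: "e \<le> A s" if "s \<le> t" for s
      unfolding e_def
    proof (rule deriv_nonpos_imp_antimono[OF _ _ that])
      fix x assume "x \<in> {s..t}"
      then have x: "x \<le> T" using t by simp
      show "(A has_real_derivative exp ((\<mu> + \<rho>) * x) * (b x - m)) (at x)" by (rule Ad[OF x])
      show "exp ((\<mu> + \<rho>) * x) * (b x - m) \<le> 0" using b[OF x] by (simp add: mult_le_0_iff)
    qed
    have pge: "e * exp (- \<mu> * s) \<le> p s" if "s \<le> t" for s
    proof -
      have "e \<le> exp (\<mu> * s) * p s"
        using Age[OF that] k0 unfolding A_def by (smt (verit) exp_gt_zero mult_nonneg_nonneg)
      then show ?thesis by (simp add: exp_minus field_simps)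
    qed
    have wub: "w s + e / \<mu> * exp (- \<mu> * s) \<le> w t + e / \<mu> * exp (- \<mu> * t)" if "s \<le> t" for s
    proof (rule deriv_nonneg_imp_mono[OF _ _ that])
      fix x assume "x \<in> {s..t}"
      then have x: "x \<le> T" "x \<le> t" using t by auto
      show "((\<lambda>s. w s + e / \<mu> * exp (- \<mu> * s)) has_real_derivative p x - e * exp (- \<mu> * x)) (at x)"
        by (rule derivative_eq_intros w[OF x(1)] refl | use mu in simp)+
      show "0 \<le> p x - e * exp (- \<mu> * x)" using pge[OF x(2)] by simp
    qed
    have "filterlim (\<lambda>s. - (\<mu> * s)) at_top at_bot"
      using mu by (simp add: filterlim_uminus_at_top filterlim_tendsto_pos_mult_at_bot[OF tendsto_const _ filterlim_ident])
    then have "filterlim (\<lambda>s. exp (- \<mu> * s)) at_top at_bot"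
      by (intro filterlim_compose[OF exp_at_top]) simp
    then have "filterlim (\<lambda>s. e / \<mu> * exp (- \<mu> * s)) at_top at_bot"
      by (intro filterlim_tendsto_pos_mult_at_top[OF tendsto_const]) (use e mu in auto)
    then have "filterlim (\<lambda>s. w s + e / \<mu> * exp (- \<mu> * s)) at_top at_bot"
      by (rule filterlim_tendsto_add_at_top[OF lim])
    then have "\<forall>\<^sub>F s in at_bot. w t + e / \<mu> * exp (- \<mu> * t) < w s + e / \<mu> * exp (- \<mu> * s)"
      unfolding filterlim_at_top_dense by blast
    moreover have "\<forall>\<^sub>F s in at_bot. s \<le> t" by (rule eventually_le_at_bot)
    ultimately have "\<forall>\<^sub>F s :: real in at_bot. False"
      by eventually_elim (use wub in force)
    then show False by simp
  qed
  define B where "B s = w s - k / \<rho> * exp (\<rho> * s)" for s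
  have "B t \<le> d"
  proof (rule tendsto_lowerbound)
    have "((\<lambda>s. w s - k / \<rho> * exp (\<rho> * s)) \<longlongrightarrow> d - k / \<rho> * 0) at_bot"
      using rho by (intro tendsto_intros lim filterlim_compose[OF exp_at_bot]
        filterlim_tendsto_pos_mult_at_bot[OF tendsto_const] filterlim_ident)
    then show "(B \<longlongrightarrow> d) at_bot" by (simp add: B_def[abs_def])
    have "B t \<le> B s" if "s \<le> t" for s
    proof (rule deriv_nonpos_imp_antimono[OF _ _ that])
      fix x assume "x \<in> {s..t}"
      then have x: "x \<le> T" using t by auto
      show "(B has_real_derivative p x - k * exp (\<rho> * x)) (at x)"
        unfolding B_def[abs_def] by (rule derivative_eq_intros w[OF x(1)] refl | use rho in simp)+
      show "p x - k * exp (\<rho> * x) \<le> 0" using pub[OF x] by simp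
    qed
    then show "\<forall>\<^sub>F s in at_bot. B t \<le> B s"
      by (intro eventually_mono[OF eventually_le_at_bot[of t]])
  qed auto
  then have "w t - d \<le> k / \<rho> * exp (\<rho> * t)" by (simp add: B_def)
  with pub[OF t] show ?thesis by (simp add: k_def mult.commute)
qed

text \<open>The only homogeneous solutions are the constants and \<open>e\<^bsup>-\<mu>t\<^esup>\<close>; convergence of \<open>w\<close> excludes
  the second, so \<open>w\<close> and its derivative are governed by the forcing term.\<close>

lemma singular_tail:
  fixes w p b :: "real \<Rightarrow> real"
  assumes mu: "0 < \<mu>" and rho: "0 < \<rho>"
    and w: "\<And>t. t \<le> T \<Longrightarrow> (w has_real_derivative p t) (at t)"
    and p: "\<And>t. t \<le> T \<Longrightarrow> (p has_real_derivative - \<mu> * p t + exp (\<rho> * t) * b t) (at t)"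
    and b: "\<And>t. t \<le> T \<Longrightarrow> \<bar>b t\<bar> \<le> m"
    and lim: "(w \<longlongrightarrow> d) at_bot" and t: "t \<le> T"
  shows "\<bar>p t\<bar> \<le> m / (\<mu> + \<rho>) * exp (\<rho> * t)" "\<bar>w t - d\<bar> \<le> m / (\<rho> * (\<mu> + \<rho>)) * exp (\<rho> * t)"
proof -
  have m: "0 \<le> m" using b[of T] by simp
  have 1: "p t \<le> m / (\<mu> + \<rho>) * exp (\<rho> * t) \<and> w t - d \<le> m / (\<rho> * (\<mu> + \<rho>)) * exp (\<rho> * t)"
    by (rule singular_tail_upper[OF mu rho m w p _ lim t]) (use b abs_le_D1 in blast)+
  have 2: "- p t \<le> m / (\<mu> + \<rho>) * exp (\<rho> * t) \<and> - w t - - d \<le> m / (\<rho> * (\<mu> + \<rho>)) * exp (\<rho> * t)"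
  proof (rule singular_tail_upper[where b = "\<lambda>t. - b t", OF mu rho m _ _ _ tendsto_minus[OF lim] t])
    fix t assume t: "t \<le> T"
    show "((\<lambda>t. - w t) has_real_derivative - p t) (at t)" by (intro DERIV_minus w t)
    show "((\<lambda>t. - p t) has_real_derivative - \<mu> * - p t + exp (\<rho> * t) * - b t) (at t)"
      using DERIV_minus[OF p[OF t]] by (simp add: algebra_simps)
    show "- b t \<le> m" using b[OF t] by simp
  qed
  show "\<bar>p t\<bar> \<le> m / (\<mu> + \<rho>) * exp (\<rho> * t)" "\<bar>w t - d\<bar> \<le> m / (\<rho> * (\<mu> + \<rho>)) * exp (\<rho> * t)"
    using 1 2 by linarith+
qed

text \<open>The difference of two solutions satisfies the tail estimate with a forcing bounded by \<open>L m\<close>, where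
  \<open>m\<close> is the supremum of the difference itself; so far back in time that the factor of \<open>m\<close> is at most \<open>1/2\<close>, this
  forces \<open>m = 0\<close>. From there the ordinary uniqueness theorem takes over.\<close>

lemma singular_unique:
  fixes h :: "real \<Rightarrow> real"
  assumes mu: "0 < \<mu>" and rho: "0 < \<rho>"
    and lip: "\<And>R. 0 \<le> R \<Longrightarrow> \<exists>\<Lambda>\<ge>0. \<forall>x y. \<bar>x\<bar> \<le> R \<longrightarrow> \<bar>y\<bar> \<le> R \<longrightarrow> \<bar>h x - h y\<bar> \<le> \<Lambda> * \<bar>x - y\<bar>"
    and w1: "\<And>t. t \<le> T \<Longrightarrow> (w1 has_real_derivative p1 t) (at t)"
    and p1: "\<And>t. t \<le> T \<Longrightarrow> (p1 has_real_derivative - \<mu> * p1 t + exp (\<rho> * t) * h (w1 t)) (at t)"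
    and l1: "(w1 \<longlongrightarrow> d) at_bot"
    and w2: "\<And>t. t \<le> T \<Longrightarrow> (w2 has_real_derivative p2 t) (at t)"
    and p2: "\<And>t. t \<le> T \<Longrightarrow> (p2 has_real_derivative - \<mu> * p2 t + exp (\<rho> * t) * h (w2 t)) (at t)"
    and l2: "(w2 \<longlongrightarrow> d) at_bot"
    and t: "t \<le> T"
  shows "w1 t = w2 t \<and> p1 t = p2 t"
proof -
  have c: "continuous_on {a..T} w1" "continuous_on {a..T} w2" "continuous_on {a..T} p1" "continuous_on {a..T} p2" for a
    by (rule DERIV_continuous_on, rule has_field_derivative_at_within, (rule w1 w2 p1 p2), simp)+
  have "\<forall>\<^sub>F t in at_bot. \<bar>w1 t - d\<bar> < 1 \<and> \<bar>w2 t - d\<bar> < 1 \<and> t \<le> T"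
    using tendstoD[OF l1, of 1] tendstoD[OF l2, of 1] eventually_le_at_bot[of T]
    by (simp add: dist_real_def eventually_conj)
  then obtain t0 where t0: "\<And>t. t \<le> t0 \<Longrightarrow> \<bar>w1 t - d\<bar> < 1 \<and> \<bar>w2 t - d\<bar> < 1 \<and> t \<le> T"
    unfolding eventually_at_bot_linorder by blast
  obtain L where L0: "0 \<le> L" and L: "\<And>x y. \<bar>x\<bar> \<le> \<bar>d\<bar> + 1 \<Longrightarrow> \<bar>y\<bar> \<le> \<bar>d\<bar> + 1 \<Longrightarrow> \<bar>h x - h y\<bar> \<le> L * \<bar>x - y\<bar>"
    using lip[of "\<bar>d\<bar> + 1"] by auto
  have "((\<lambda>t. L / (\<rho> * (\<mu> + \<rho>)) * exp (\<rho> * t)) \<longlongrightarrow> L / (\<rho> * (\<mu> + \<rho>)) * 0) at_bot"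
    using rho by (intro tendsto_intros filterlim_compose[OF exp_at_bot]
        filterlim_tendsto_pos_mult_at_bot[OF tendsto_const] filterlim_ident)
  then have "\<forall>\<^sub>F t in at_bot. L / (\<rho> * (\<mu> + \<rho>)) * exp (\<rho> * t) < 1/2 \<and> t \<le> t0"
    using eventually_le_at_bot[of t0] by (intro eventually_conj order_tendstoD(2)[of _ 0]) auto
  then obtain t1 where t1: "\<And>t. t \<le> t1 \<Longrightarrow> L / (\<rho> * (\<mu> + \<rho>)) * exp (\<rho> * t) < 1/2 \<and> t \<le> t0"
    unfolding eventually_at_bot_linorder by blast
  define D P where "D t = w1 t - w2 t" and "P t = p1 t - p2 t" for t
  define m where "m = (SUP t\<in>{..t1}. \<bar>D t\<bar>)"
  have bb: "bdd_above ((\<lambda>t. \<bar>D t\<bar>) ` {..t1})"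
    by (rule bdd_aboveI2[of _ _ 2]) (use t0 t1 D_def in force)
  have Dm: "\<bar>D t\<bar> \<le> m" if "t \<le> t1" for t
    unfolding m_def by (rule cSUP_upper) (use that bb in auto)
  have DP: "(D has_real_derivative P t) (at t)"
    "(P has_real_derivative - \<mu> * P t + exp (\<rho> * t) * (h (w1 t) - h (w2 t))) (at t)" if "t \<le> t1" for t
  proof -
    have tT: "t \<le> T" using t0 t1[OF that] by blast
    show "(D has_real_derivative P t) (at t)"
      unfolding D_def[abs_def] P_def by (intro DERIV_diff w1 w2 tT)
    show "(P has_real_derivative - \<mu> * P t + exp (\<rho> * t) * (h (w1 t) - h (w2 t))) (at t)"
      unfolding P_def[abs_def]
      by (rule DERIV_cong[OF DERIV_diff[OF p1[OF tT] p2[OF tT]]]) (simp add: algebra_simps)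
  qed
  have bb': "\<bar>h (w1 t) - h (w2 t)\<bar> \<le> L * m" if "t \<le> t1" for t
  proof -
    have "\<bar>h (w1 t) - h (w2 t)\<bar> \<le> L * \<bar>D t\<bar>"
      unfolding D_def using t0[of t] t1[OF that] by (intro L) auto
    also have "\<dots> \<le> L * m" using Dm[OF that] L0 by (rule mult_left_mono)
    finally show ?thesis .
  qed
  have Dl: "(D \<longlongrightarrow> 0) at_bot" unfolding D_def[abs_def] using tendsto_diff[OF l1 l2] by simp
  have m0: "0 \<le> m" using Dm[of t1] by linarith
  have Dh: "\<bar>D t\<bar> \<le> m / 2" if "t \<le> t1" for t
  proof -
    have "\<bar>D t - 0\<bar> \<le> L * m / (\<rho> * (\<mu> + \<rho>)) * exp (\<rho> * t)"
      by (rule singular_tail(2)[OF mu rho DP bb' Dl that])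
    also have "\<dots> = (L / (\<rho> * (\<mu> + \<rho>)) * exp (\<rho> * t)) * m" by simp
    also have "\<dots> \<le> 1/2 * m" using t1[OF that] m0 by (intro mult_right_mono) auto
    finally show ?thesis by simp
  qed
  have "m \<le> m / 2" unfolding m_def
    by (rule cSUP_least) (use Dh in \<open>auto simp: m_def\<close>)
  with m0 have m: "m = 0" by simp
  have eq: "w1 t = w2 t \<and> p1 t = p2 t" if "t \<le> t1" for t
    using Dm[OF that] singular_tail(1)[OF mu rho DP bb' Dl that] m by (simp add: D_def P_def)
  show ?thesis
  proof (cases "t \<le> t1")
    case False
    have b1: "bounded (w1 ` {t1..T})" and b2: "bounded (w2 ` {t1..T})"
      using c by (auto intro!: compact_imp_bounded compact_continuous_image)
    obtain R1 where R1: "\<And>s. s \<in> {t1..T} \<Longrightarrow> \<bar>w1 s\<bar> \<le> R1" using b1 unfolding bounded_iff real_norm_def by blast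
    obtain R2 where R2: "\<And>s. s \<in> {t1..T} \<Longrightarrow> \<bar>w2 s\<bar> \<le> R2" using b2 unfolding bounded_iff real_norm_def by blast
    note R = R1 R2
    define R where "R = max 0 (max R1 R2)"
    obtain K where K0: "0 \<le> K" and K: "\<And>x y. \<bar>x\<bar> \<le> R \<Longrightarrow> \<bar>y\<bar> \<le> R \<Longrightarrow> \<bar>h x - h y\<bar> \<le> K * \<bar>x - y\<bar>"
      using lip[of R] by (auto simp: R_def)
    show ?thesis
    proof (rule second_order_unique[where ?x1.0 = w1 and ?x2.0 = w2 and ?y1.0 = p1 and ?y2.0 = p2 and s = t and a = t1 and b = T and c = t1 and C = "exp (\<rho> * T) * K + \<mu>"
          and F = "\<lambda>s x y. - \<mu> * y + exp (\<rho> * s) * h x"])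
      fix s assume s: "t1 < s" "s < T"
      have "\<bar>h (w1 s) - h (w2 s)\<bar> \<le> K * \<bar>w1 s - w2 s\<bar>"
        using R[of s] s by (intro K) (auto simp: R_def)
      moreover have "exp (\<rho> * s) \<le> exp (\<rho> * T)" using s rho by simp
      ultimately have 1: "exp (\<rho> * s) * \<bar>h (w1 s) - h (w2 s)\<bar> \<le> exp (\<rho> * T) * (K * \<bar>w1 s - w2 s\<bar>)"
        by (intro mult_mono) auto
      have "\<bar>- \<mu> * p1 s + exp (\<rho> * s) * h (w1 s) - (- \<mu> * p2 s + exp (\<rho> * s) * h (w2 s))\<bar>
         = \<bar>- (\<mu> * (p1 s - p2 s)) + exp (\<rho> * s) * (h (w1 s) - h (w2 s))\<bar>"
        by (simp add: algebra_simps)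
      also have "\<dots> \<le> \<mu> * \<bar>p1 s - p2 s\<bar> + exp (\<rho> * s) * \<bar>h (w1 s) - h (w2 s)\<bar>"
        using mu by (intro order_trans[OF abs_triangle_ineq]) (simp add: abs_mult)
      also have "\<dots> \<le> \<mu> * \<bar>p1 s - p2 s\<bar> + exp (\<rho> * T) * K * \<bar>w1 s - w2 s\<bar>" using 1 by simp
      also have "\<dots> \<le> (exp (\<rho> * T) * K + \<mu>) * (\<bar>w1 s - w2 s\<bar> + \<bar>p1 s - p2 s\<bar>)"
        using mu K0 by (simp add: algebra_simps)
      finally show "\<bar>- \<mu> * p1 s + exp (\<rho> * s) * h (w1 s) - (- \<mu> * p2 s + exp (\<rho> * s) * h (w2 s))\<bar>
         \<le> (exp (\<rho> * T) * K + \<mu>) * (\<bar>w1 s - w2 s\<bar> + \<bar>p1 s - p2 s\<bar>)" .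
    qed (use c eq[of t1] False t t0[of t1] t1[of t1] in \<open>auto intro!: w1 w2 DERIV_cong[OF p1] DERIV_cong[OF p2]\<close>)
  qed (rule eq)
qed

section \<open>The regular initial value problem\<close>

lemma damped_ivp_exists:
  fixes h :: "real \<Rightarrow> real"
  assumes lip: "\<And>x y. \<bar>h x - h y\<bar> \<le> \<Lambda> * \<bar>x - y\<bar>"
  shows "\<exists>x y. x 0 = x0 \<and> y 0 = y0 \<and> (\<forall>s\<ge>0. (x has_real_derivative y s) (at s)) \<and>
     (\<forall>s\<ge>0. (y has_real_derivative - a * y s + h (x s)) (at s))"
proof -
  have L0: "0 \<le> \<Lambda>" using lip[of 1 0] by simp
  have hc: "continuous_on UNIV h"
  proof (rule lipschitz_on_continuous_on[of \<Lambda>])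
    show "\<Lambda>-lipschitz_on UNIV h" using lip L0 by (intro lipschitz_onI) (auto simp: dist_real_def)
  qed
  have hcc: "continuous_on {0..} (\<lambda>z. h (u z))" if "continuous_on {0..} u" for u :: "real \<Rightarrow> real"
    using hc that continuous_on_compose2 by blast
  define Y where "Y u s = y0 + a * x0 - a * u s + integral {0..s} (\<lambda>s. h (u s))" for u and s :: real
  \<comment> \<open>Integrating the equation once leaves no derivative of \<open>u\<close>, so a fixed point of \<open>\<Phi>\<close> need only be continuous.\<close>
  define \<Phi> where "\<Phi> u s = x0 + integral {0..s} (Y u)" for u and s :: real
  have Yc: "continuous_on {0..} (Y u)" if "continuous_on {0..} u" for u
    unfolding Y_def[abs_def] by (intro continuous_intros that integral_from_0_continuous hcc)
  have cont: "continuous_on {0..} (\<Phi> u)" if "continuous_on {0..} u" for u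
    unfolding \<Phi>_def[abs_def] by (intro continuous_intros integral_from_0_continuous Yc that)
  have est: "\<bar>\<Phi> u s - \<Phi> v s\<bar> \<le> (\<bar>a\<bar> + \<Lambda> * T) * A * s ^ Suc n / real (Suc n)"
    if u: "continuous_on {0..} u" and v: "continuous_on {0..} v"
      and A: "\<forall>t\<in>{0..T}. \<bar>u t - v t\<bar> \<le> A * t ^ n" and s: "s \<in> {0..T}" for u v A n s T
  proof -
    have "\<bar>integral {0..s} (Y u) - integral {0..s} (Y v)\<bar> \<le> ((\<bar>a\<bar> + \<Lambda> * T) * A) * s ^ Suc n / real (Suc n)"
    proof (rule integral_diff_monomial_le)
      fix t assume t: "0 \<le> t" "t \<le> s"
      have At: "\<bar>u t - v t\<bar> \<le> A * t ^ n" using A t s by auto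
      then have An: "0 \<le> A * t ^ n" by linarith
      have 1: "\<bar>integral {0..t} (\<lambda>s. h (u s)) - integral {0..t} (\<lambda>s. h (v s))\<bar> \<le> (\<Lambda> * A) * t ^ Suc n / real (Suc n)"
      proof (rule integral_diff_monomial_le)
        fix r assume r: "0 \<le> r" "r \<le> t"
        have "\<bar>h (u r) - h (v r)\<bar> \<le> \<Lambda> * \<bar>u r - v r\<bar>" by (rule lip)
        also have "\<dots> \<le> \<Lambda> * (A * r ^ n)" using A r t s L0 by (intro mult_left_mono) auto
        finally show "\<bar>h (u r) - h (v r)\<bar> \<le> (\<Lambda> * A) * r ^ n" by simp
      qed (use hcc u v t in auto)
      have 2: "(\<Lambda> * A) * t ^ Suc n / real (Suc n) \<le> \<Lambda> * T * (A * t ^ n)"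
      proof -
        have "(\<Lambda> * A) * t ^ Suc n / real (Suc n) \<le> (\<Lambda> * A) * t ^ Suc n"
        proof -
          have "0 \<le> (\<Lambda> * A) * t ^ Suc n" using L0 An t
            by (metis (no_types, opaque_lifting) mult.assoc mult.left_commute mult_nonneg_nonneg power_Suc)
          then show ?thesis by (simp add: divide_le_eq mult_le_cancel_left1 del: of_nat_Suc power_Suc)
        qed
        also have "\<dots> = \<Lambda> * t * (A * t ^ n)" by simp
        also have "\<dots> \<le> \<Lambda> * T * (A * t ^ n)" using An t s L0 by (intro mult_right_mono mult_left_mono) auto
        finally show ?thesis .
      qed
      have "\<bar>Y u t - Y v t\<bar> = \<bar>- (a * (u t - v t)) + (integral {0..t} (\<lambda>s. h (u s)) - integral {0..t} (\<lambda>s. h (v s)))\<bar>"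
        by (simp add: Y_def algebra_simps)
      also have "\<dots> \<le> \<bar>a\<bar> * \<bar>u t - v t\<bar> + \<bar>integral {0..t} (\<lambda>s. h (u s)) - integral {0..t} (\<lambda>s. h (v s))\<bar>"
        by (intro order_trans[OF abs_triangle_ineq]) (simp add: abs_mult)
      also have "\<dots> \<le> \<bar>a\<bar> * (A * t ^ n) + \<Lambda> * T * (A * t ^ n)"
        using 1 2 At by (intro add_mono mult_left_mono) auto
      finally show "\<bar>Y u t - Y v t\<bar> \<le> ((\<bar>a\<bar> + \<Lambda> * T) * A) * t ^ n" by (simp add: algebra_simps)
    qed (use Yc u v s in auto)
    then show ?thesis by (simp add: \<Phi>_def)
  qed
  have "\<exists>u. continuous_on {0..} u \<and> (\<forall>z\<ge>0. u z = \<Phi> u z)"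
  proof (rule volterra_fixed_point[OF cont], assumption)
    fix T :: real assume "0 \<le> T"
    then have "0 \<le> \<bar>a\<bar> + \<Lambda> * T" using L0 by simp
    with est[where T = T] show "\<exists>C\<ge>0. \<forall>u v A n. continuous_on {0..} u \<longrightarrow> continuous_on {0..} v \<longrightarrow>
        (\<forall>t\<in>{0..T}. \<bar>u t - v t\<bar> \<le> A * t ^ n) \<longrightarrow>
        (\<forall>t\<in>{0..T}. \<bar>\<Phi> u t - \<Phi> v t\<bar> \<le> C * A * t ^ Suc n / real (Suc n))"
      by blast
  qed
  then obtain u where uc: "continuous_on {0..} u" and u: "\<And>z. 0 \<le> z \<Longrightarrow> u z = \<Phi> u z" by blast
  have u0: "u 0 = x0" using u[of 0] by (simp add: \<Phi>_def)
  have Y0: "Y u 0 = y0" by (simp add: Y_def u0)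
  have ud: "(u has_real_derivative Y u s) (at s within {0..})" if "0 \<le> s" for s
  proof (rule has_field_derivative_transform_within[OF _ zero_less_one])
    show "(\<Phi> u has_real_derivative Y u s) (at s within {0..})"
      unfolding \<Phi>_def[abs_def] using integral_from_0_deriv[OF Yc[OF uc] that]
      by (auto intro!: derivative_eq_intros)
  qed (use that u in auto)
  have Yd: "(Y u has_real_derivative - a * Y u s + h (u s)) (at s within {0..})" if "0 \<le> s" for s
    unfolding Y_def[of u, abs_def]
    using ud[OF that] integral_from_0_deriv[OF hcc[OF uc] that]
    by (auto intro!: derivative_eq_intros simp: Y_def)
  \<comment> \<open>The tangent lines continue the solution to negative times, so that the derivatives at \<open>0\<close> are two-sided.\<close>
  define x y where "x s = (if s \<le> 0 then x0 + y0 * s else u s)"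
    and "y s = (if s \<le> 0 then y0 + (- a * y0 + h x0) * s else Y u s)" for s
  have ev: "\<forall>\<^sub>F t in nhds s. t > 0" if "0 < s" for s :: real
    using that by (rule order_tendstoD[OF filterlim_ident])
  have xd: "(x has_real_derivative y s) (at s)" if "0 \<le> s" for s
  proof (cases "s = 0")
    case True
    show ?thesis unfolding x_def[abs_def] True
      by (rule DERIV_glue) (use ud[of 0] Y0 u0 in \<open>auto simp: y_def intro!: derivative_eq_intros\<close>)
  next
    case False
    then have s: "0 < s" using that by simp
    have "at s within {0..} = at s" using s by (intro at_within_interior) simp
    then have "(u has_real_derivative y s) (at s)" using ud[OF that] s by (simp add: y_def)
    then show ?thesis
      by (rule has_field_derivative_transform_within_open[of _ _ _ "{0<..}"]) (use s in \<open>auto simp: x_def\<close>)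
  qed
  have yd: "(y has_real_derivative - a * y s + h (x s)) (at s)" if "0 \<le> s" for s
  proof (cases "s = 0")
    case True
    show ?thesis unfolding y_def[abs_def] True
      by (rule DERIV_glue) (use Yd[of 0] Y0 u0 in \<open>auto simp: x_def intro!: derivative_eq_intros\<close>)
  next
    case False
    then have s: "0 < s" using that by simp
    have "at s within {0..} = at s" using s by (intro at_within_interior) simp
    then have "(Y u has_real_derivative - a * y s + h (x s)) (at s)" using Yd[OF that] s by (simp add: y_def x_def)
    then show ?thesis
      by (rule has_field_derivative_transform_within_open[of _ _ _ "{0<..}"]) (use s in \<open>auto simp: y_def\<close>)
  qed
  have "x 0 = x0" "y 0 = y0" by (auto simp: x_def y_def)
  with xd yd show ?thesis by blast
qed

section \<open>A damped oscillator in a double well\<close>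

text \<open>The autonomous form of \<open>w'' + \<mu> w' + K e\<^bsup>\<rho>t\<^esup> w|w|\<^bsup>q-2\<^esup> = 0\<close> for \<open>x(s) = e\<^bsup>-\<gamma>s\<^esup> w(-s)\<close>. The linearization at
  zero has the exponents \<open>-\<gamma>\<close>, which belongs to the solutions with \<open>w\<close> bounded, and \<open>\<mu> - \<gamma>\<close>; hence
  the friction \<open>a = 2\<gamma> - \<mu>\<close> and the curvature \<open>B = \<gamma>(\<mu> - \<gamma>)\<close> of the potential hill.\<close>

locale damped_well =
  fixes \<mu> \<gamma> K q :: real
  assumes mu: "0 < \<mu>" and gam: "\<mu> / 2 < \<gamma>" "\<gamma> \<le> \<mu>" and K: "0 < K" and q: "2 < q"
begin

definition "a = 2 * \<gamma> - \<mu>"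
definition "B = \<gamma> * (\<mu> - \<gamma>)"
definition "\<rho> = (q - 2) * \<gamma>"

definition V :: "real \<Rightarrow> real" where "V x = K * (\<bar>x\<bar> powr q / q) - B * x\<^sup>2 / 2"
definition dV :: "real \<Rightarrow> real" where "dV x = K * spow q x - B * x"

definition traj :: "(real \<Rightarrow> real) \<Rightarrow> (real \<Rightarrow> real) \<Rightarrow> bool" where
  "traj x y \<longleftrightarrow> (\<forall>s\<ge>0. (x has_real_derivative y s) (at s) \<and>
     (y has_real_derivative - a * y s - dV (x s)) (at s))"

lemma a_pos: "0 < a" using gam by (simp add: a_def)
lemma gam_pos: "0 < \<gamma>" using gam mu by linarith
lemma B_nonneg: "0 \<le> B" using gam gam_pos by (simp add: B_def)
lemma rho_pos: "0 < \<rho>" using q gam_pos by (simp add: \<rho>_def)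

lemma V_minus [simp]: "V (- x) = V x" by (simp add: V_def)
lemma dV_minus [simp]: "dV (- x) = - dV x" by (simp add: dV_def)
lemma dV_0 [simp]: "dV 0 = 0" by (simp add: dV_def)
lemma V_0 [simp]: "V 0 = 0" by (simp add: V_def)

lemma V_deriv: "(V has_real_derivative dV x) (at x)"
  unfolding V_def[abs_def] dV_def
  by (rule DERIV_cong[OF DERIV_diff[OF DERIV_cmult[OF DERIV_abs_powr[OF q]]
        DERIV_cdivide[OF DERIV_cmult[OF DERIV_pow]]]]) simp

lemma V_cont: "continuous_on S V"
  by (rule DERIV_continuous_on[OF has_field_derivative_at_within, OF V_deriv])

lemma dV_cont: "continuous_on S dV"
  unfolding dV_def[abs_def] by (intro continuous_intros q)

lemma dV_lipschitz:
  assumes "\<bar>x\<bar> \<le> M" "\<bar>y\<bar> \<le> M"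
  shows "\<bar>dV x - dV y\<bar> \<le> (K * ((q - 1) * M powr (q - 2)) + B) * \<bar>x - y\<bar>"
proof -
  have "\<bar>dV x - dV y\<bar> = \<bar>K * (spow q x - spow q y) - B * (x - y)\<bar>"
    by (simp add: dV_def algebra_simps)
  also have "\<dots> \<le> K * \<bar>spow q x - spow q y\<bar> + B * \<bar>x - y\<bar>"
    using K B_nonneg by (intro order_trans[OF abs_triangle_ineq4]) (simp add: abs_mult)
  also have "\<dots> \<le> K * ((q - 1) * M powr (q - 2) * \<bar>x - y\<bar>) + B * \<bar>x - y\<bar>"
    using spow_lipschitz[OF q assms] K by (intro add_right_mono mult_left_mono) auto
  finally show ?thesis by (simp add: algebra_simps)
qed

lemma V_factor: "0 < x \<Longrightarrow> V x = x\<^sup>2 * (K * x powr (q - 2) / q - B / 2)"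
proof -
  assume x: "0 < x"
  have "x powr q = x powr (2 + (q - 2))" by simp
  also have "\<dots> = x\<^sup>2 * x powr (q - 2)" using x by (subst powr_add) simp
  finally show ?thesis using x by (simp add: V_def algebra_simps)
qed

text \<open>Where the potential is non-negative it increases away from zero. Stating this through \<open>0 \<le> V x\<close> covers the double
  well and the single well \<open>B = 0\<close> at once.\<close>

lemma V_less:
  assumes x: "0 < x" "x < x'" and V: "0 \<le> V x"
  shows "V x < V x'"
proof -
  have f: "0 \<le> K * x powr (q - 2) / q - B / 2"
    using V x unfolding V_factor[OF x(1)] by (simp add: zero_le_mult_iff)
  have "x powr (q - 2) < x' powr (q - 2)" using x q by (intro powr_less_mono2) auto
  then have "K * x powr (q - 2) / q < K * x' powr (q - 2) / q"
    using K q by (intro divide_strict_right_mono mult_strict_left_mono) auto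
  moreover have "x\<^sup>2 < x'\<^sup>2" using x by (simp add: power2_eq_square mult_strict_mono')
  ultimately show ?thesis using f x unfolding V_factor[OF x(1)] V_factor[of x', OF less_trans[OF x]]
    by (intro mult_strict_mono) auto
qed

lemma dV_pos:
  assumes x: "0 < x" and V: "0 \<le> V x"
  shows "0 < dV x"
proof -
  have f: "B / 2 \<le> K * x powr (q - 2) / q"
    using V x unfolding V_factor[OF x(1)] by (simp add: zero_le_mult_iff)
  have p: "0 < K * x powr (q - 2)" using x K by simp
  have "K * x powr (q - 2) / q < K * x powr (q - 2) / 2"
    using p q by (intro divide_strict_left_mono) auto
  with f have "B < K * x powr (q - 2)" by simp
  then have "0 < x * (K * x powr (q - 2) - B)" using x by simp
  then show ?thesis using x by (simp add: dV_def spow_def algebra_simps)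
qed

lemma dV_nonzero:
  assumes V: "0 < V x"
  shows "dV x \<noteq> 0"
proof -
  consider "0 < x" | "0 < - x" | "x = 0" by linarith
  then show ?thesis
  proof cases
    case 1 then show ?thesis using dV_pos[of x] V by simp
  next
    case 2 then show ?thesis using dV_pos[of "- x"] V by simp
  next
    case 3 then show ?thesis using V by simp
  qed
qed

lemma V_coercive: "\<exists>M>0. \<forall>x. M \<le> \<bar>x\<bar> \<longrightarrow> e < V x"
proof -
  define M where "M = max ((q / K * (B / 2 + 1)) powr (1 / (q - 2))) (\<bar>e\<bar> + 1)"
  have M1: "1 \<le> M" "\<bar>e\<bar> + 1 \<le> M" by (auto simp: M_def)
  have "e < V x" if "M \<le> \<bar>x\<bar>" for x
  proof -
    have x: "0 < \<bar>x\<bar>" using that M1 by linarith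
    have c: "0 < q / K * (B / 2 + 1)" using q K B_nonneg by (intro mult_pos_pos divide_pos_pos) auto
    have c': "(c powr (1 / (q - 2))) powr (q - 2) = c" if "0 < c" for c
      using q that by (simp add: powr_powr)
    have "((q / K * (B / 2 + 1)) powr (1 / (q - 2))) powr (q - 2) \<le> \<bar>x\<bar> powr (q - 2)"
      using q that by (intro powr_mono2) (auto simp: M_def)
    then have "q / K * (B / 2 + 1) \<le> \<bar>x\<bar> powr (q - 2)" unfolding c'[OF c] .
    then have "K / q * (q / K * (B / 2 + 1)) \<le> K / q * \<bar>x\<bar> powr (q - 2)"
      using K q by (intro mult_left_mono) auto
    then have "B / 2 + 1 \<le> K * \<bar>x\<bar> powr (q - 2) / q" using K q by simp
    then have "\<bar>x\<bar>\<^sup>2 * 1 \<le> \<bar>x\<bar>\<^sup>2 * (K * \<bar>x\<bar> powr (q - 2) / q - B / 2)"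
      by (intro mult_left_mono) auto
    also have "\<dots> = V x" using V_factor[OF x] V_minus[of x] by (cases "0 \<le> x") auto
    finally have "\<bar>x\<bar>\<^sup>2 \<le> V x" by simp
    moreover have "e < \<bar>x\<bar> * 1" using M1 that by linarith
    moreover have "\<bar>x\<bar> * 1 \<le> \<bar>x\<bar> * \<bar>x\<bar>" using M1 that by (intro mult_left_mono) auto
    ultimately show ?thesis by (simp add: power2_eq_square)
  qed
  then show ?thesis using M1 by (intro exI[of _ M]) auto
qed

lemma traj_x: "traj x y \<Longrightarrow> 0 \<le> s \<Longrightarrow> (x has_real_derivative y s) (at s)"
  and traj_y: "traj x y \<Longrightarrow> 0 \<le> s \<Longrightarrow> (y has_real_derivative - a * y s - dV (x s)) (at s)"
  by (auto simp: traj_def)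

lemma traj_cont:
  assumes "traj x y" "S \<subseteq> {0..}"
  shows "continuous_on S x" "continuous_on S y"
  using assms unfolding traj_def
  by (auto intro!: continuous_at_imp_continuous_on dest!: DERIV_isCont)

lemma traj_decreasing:
  assumes T: "traj x y" and "0 \<le> u" "u < v" and neg: "\<And>s. u < s \<Longrightarrow> s < v \<Longrightarrow> y s < 0"
  shows "x v < x u"
proof (rule DERIV_neg_imp_decreasing_open[OF assms(3)])
  fix s assume s: "u < s" "s < v"
  then have "(x has_real_derivative y s) (at s)" using assms(2) by (intro traj_x[OF T]) simp
  with neg[OF s] show "\<exists>d. (x has_real_derivative d) (at s) \<and> d < 0" by blast
qed (rule traj_cont[OF T], use assms(2) in auto)

lemma traj_shift:
  assumes "traj x y" "0 \<le> c"
  shows "traj (\<lambda>s. x (c + s)) (\<lambda>s. y (c + s))"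
  using assms unfolding traj_def by (auto intro!: DERIV_time_shift)

lemma traj_minus:
  assumes "traj x y"
  shows "traj (\<lambda>s. - x s) (\<lambda>s. - y s)"
  unfolding traj_def
proof (intro allI impI conjI)
  fix s :: real assume s: "0 \<le> s"
  show "((\<lambda>s. - x s) has_real_derivative - y s) (at s)"
    by (intro DERIV_minus traj_x[OF assms s])
  show "((\<lambda>s. - y s) has_real_derivative - a * - y s - dV (- x s)) (at s)"
    by (rule DERIV_cong[OF DERIV_minus[OF traj_y[OF assms s]]]) simp
qed

text \<open>Between the common phase point and the time in question both trajectories are bounded, and there the force is
  Lipschitz continuous.\<close>

lemma traj_unique:
  assumes 1: "traj x1 y1" and 2: "traj x2 y2"
    and eq: "x1 s = x2 \<sigma>" "y1 s = y2 \<sigma>" and s: "0 \<le> s" "0 \<le> \<sigma>" and r: "0 \<le> s + r" "0 \<le> \<sigma> + r"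
  shows "x1 (s + r) = x2 (\<sigma> + r) \<and> y1 (s + r) = y2 (\<sigma> + r)"
proof -
  define l h where "l = max (- s) (- \<sigma>)" and "h = max 0 r"
  have sub: "(\<lambda>t. s + t) ` {l..h} \<subseteq> {0..}" "(\<lambda>t. \<sigma> + t) ` {l..h} \<subseteq> {0..}" by (auto simp: l_def)
  have c: "continuous_on {l..h} (\<lambda>t. x1 (s + t))" "continuous_on {l..h} (\<lambda>t. y1 (s + t))"
    "continuous_on {l..h} (\<lambda>t. x2 (\<sigma> + t))" "continuous_on {l..h} (\<lambda>t. y2 (\<sigma> + t))"
    by (intro continuous_on_compose2[OF traj_cont(1)[OF 1 order.refl] _ sub(1)]
        continuous_on_compose2[OF traj_cont(2)[OF 1 order.refl] _ sub(1)]
        continuous_on_compose2[OF traj_cont(1)[OF 2 order.refl] _ sub(2)]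
        continuous_on_compose2[OF traj_cont(2)[OF 2 order.refl] _ sub(2)] continuous_intros)+
  have "bounded ((\<lambda>t. x1 (s + t)) ` {l..h})" "bounded ((\<lambda>t. x2 (\<sigma> + t)) ` {l..h})"
    by (intro compact_imp_bounded compact_continuous_image c; simp)+
  then obtain R1 R2 where R1: "\<And>t. t \<in> {l..h} \<Longrightarrow> \<bar>x1 (s + t)\<bar> \<le> R1" and R2: "\<And>t. t \<in> {l..h} \<Longrightarrow> \<bar>x2 (\<sigma> + t)\<bar> \<le> R2"
    unfolding bounded_iff real_norm_def by blast
  define L where "L = K * ((q - 1) * (max R1 R2) powr (q - 2)) + B"
  show ?thesis
  proof (rule second_order_unique[where ?x1.0 = "\<lambda>t. x1 (s + t)" and ?x2.0 = "\<lambda>t. x2 (\<sigma> + t)"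
        and ?y1.0 = "\<lambda>t. y1 (s + t)" and ?y2.0 = "\<lambda>t. y2 (\<sigma> + t)" and s = r and a = l and b = h and c = 0
        and F = "\<lambda>_ x y. - a * y - dV x" and C = "a + L"])
    fix t assume t: "l < t" "t < h"
    have st: "0 \<le> s + t" "0 \<le> \<sigma> + t" using t by (auto simp: l_def)
    show "((\<lambda>t. x1 (s + t)) has_real_derivative y1 (s + t)) (at t)"
      "((\<lambda>t. y1 (s + t)) has_real_derivative - a * y1 (s + t) - dV (x1 (s + t))) (at t)"
      using traj_x[OF 1 st(1)] traj_y[OF 1 st(1)] by (auto intro!: DERIV_time_shift)
    show "((\<lambda>t. x2 (\<sigma> + t)) has_real_derivative y2 (\<sigma> + t)) (at t)"
      "((\<lambda>t. y2 (\<sigma> + t)) has_real_derivative - a * y2 (\<sigma> + t) - dV (x2 (\<sigma> + t))) (at t)"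
      using traj_x[OF 2 st(2)] traj_y[OF 2 st(2)] by (auto intro!: DERIV_time_shift)
    define X1 X2 Y1 Y2 where "X1 = x1 (s + t)" and "X2 = x2 (\<sigma> + t)" and "Y1 = y1 (s + t)" and "Y2 = y2 (\<sigma> + t)"
    have "\<bar>X1\<bar> \<le> max R1 R2" "\<bar>X2\<bar> \<le> max R1 R2"
      using R1[of t] R2[of t] t unfolding X1_def X2_def by force+
    then have "\<bar>dV X1 - dV X2\<bar> \<le> L * \<bar>X1 - X2\<bar>" unfolding L_def by (rule dV_lipschitz)
    moreover have "\<bar>- a * Y1 - dV X1 - (- a * Y2 - dV X2)\<bar> \<le> a * \<bar>Y1 - Y2\<bar> + \<bar>dV X1 - dV X2\<bar>"
    proof -
      have "- a * Y1 - dV X1 - (- a * Y2 - dV X2) = - (a * (Y1 - Y2)) - (dV X1 - dV X2)" by (simp add: algebra_simps)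
      then show ?thesis using abs_triangle_ineq4[of "- (a * (Y1 - Y2))" "dV X1 - dV X2"] a_pos by (simp add: abs_mult)
    qed
    moreover have "0 \<le> L" using K q B_nonneg by (simp add: L_def)
    then have "a * \<bar>Y1 - Y2\<bar> + L * \<bar>X1 - X2\<bar> \<le> (a + L) * (\<bar>X1 - X2\<bar> + \<bar>Y1 - Y2\<bar>)"
      using a_pos by (simp add: algebra_simps)
    ultimately show "\<bar>- a * Y1 - dV X1 - (- a * Y2 - dV X2)\<bar> \<le> (a + L) * (\<bar>X1 - X2\<bar> + \<bar>Y1 - Y2\<bar>)"
      by linarith
  qed (use c eq s r in \<open>auto simp: l_def h_def\<close>)
qed

lemma traj_zero:
  assumes "traj x y" "x s = 0" "y s = 0" "0 \<le> s" "0 \<le> t"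
  shows "x t = 0 \<and> y t = 0"
proof -
  have z: "traj (\<lambda>_. 0) (\<lambda>_. 0)" by (auto simp: traj_def)
  show ?thesis using traj_unique[OF assms(1) z, of s "max s t" "t - s"] assms by auto
qed

lemma traj_equilibrium:
  assumes "traj x y" "dV (x s) = 0" "y s = 0" "0 \<le> s" "0 \<le> t"
  shows "y t = 0"
proof -
  have z: "traj (\<lambda>_. x s) (\<lambda>_. 0)" using assms(2) by (auto simp: traj_def)
  show ?thesis using traj_unique[OF assms(1) z, of s "max s t" "t - s"] assms by auto
qed

subsection \<open>Energy\<close>

definition En :: "real \<Rightarrow> real \<Rightarrow> real" where "En x y = y\<^sup>2 / 2 + V x"

lemma En_deriv:
  assumes "traj x y" "0 \<le> s"
  shows "((\<lambda>s. En (x s) (y s)) has_real_derivative - a * (y s)\<^sup>2) (at s)"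
  unfolding En_def
  by (rule DERIV_cong[OF DERIV_add[OF DERIV_cdivide[OF DERIV_power[OF traj_y[OF assms], of 2]]
        DERIV_chain2[OF V_deriv traj_x[OF assms]]]])
     (simp add: field_simps power2_eq_square)

lemma En_antimono:
  assumes "traj x y" "0 \<le> s" "s \<le> t"
  shows "En (x t) (y t) \<le> En (x s) (y s)"
proof (rule deriv_nonpos_imp_antimono[OF _ _ assms(3)])
  fix r assume "r \<in> {s..t}"
  then show "((\<lambda>s. En (x s) (y s)) has_real_derivative - a * (y r)\<^sup>2) (at r)"
    using assms by (intro En_deriv) auto
  show "- a * (y r)\<^sup>2 \<le> 0" using a_pos by simp
qed

lemma En_strict:
  assumes "traj x y" "0 \<le> s" "s < t" "\<And>r. s < r \<Longrightarrow> r < t \<Longrightarrow> y r \<noteq> 0"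
  shows "En (x t) (y t) < En (x s) (y s)"
proof (rule DERIV_neg_imp_decreasing_open[OF assms(3)])
  fix r assume "s < r" "r < t"
  then show "\<exists>d. ((\<lambda>s. En (x s) (y s)) has_real_derivative d) (at r) \<and> d < 0"
    using assms a_pos by (intro exI[of _ "- a * (y r)\<^sup>2"] conjI En_deriv) auto
next
  show "continuous_on {s..t} (\<lambda>s. En (x s) (y s))"
    unfolding En_def using assms
    by (intro continuous_intros continuous_on_compose2[OF V_cont[of UNIV]] traj_cont[OF assms(1)]) auto
qed

lemma no_zero_of_negative_energy:
  assumes "traj x y" "0 \<le> s" "s \<le> t" "En (x s) (y s) < 0"
  shows "x t \<noteq> 0"
proof
  assume "x t = 0"
  then have "0 \<le> En (x t) (y t)" by (simp add: En_def)
  with En_antimono[OF assms(1-3)] assms(4) show False by simp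
qed

text \<open>The energy confines the solution of a truncated equation to the region where the truncation does not act.\<close>

lemma traj_exists: "\<exists>x y. traj x y \<and> x 0 = x0 \<and> y 0 = y0"
proof -
  obtain M0 where M0: "\<And>x. M0 \<le> \<bar>x\<bar> \<Longrightarrow> En x0 y0 < V x" using V_coercive by blast
  define M where "M = max M0 (\<bar>x0\<bar> + 1)"
  have M: "0 \<le> M" "\<bar>x0\<bar> < M" by (auto simp: M_def)
  define h where "h x = B * x - K * spow q (cutoff M x)" for x
  have "\<bar>h x - h y\<bar> \<le> (B + K * ((q - 1) * M powr (q - 2))) * \<bar>x - y\<bar>" for x y
  proof -
    have "\<bar>h x - h y\<bar> = \<bar>B * (x - y) - (K * spow q (cutoff M x) - K * spow q (cutoff M y))\<bar>"
      by (simp add: h_def algebra_simps)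
    also have "\<dots> \<le> B * \<bar>x - y\<bar> + K * ((q - 1) * M powr (q - 2)) * \<bar>x - y\<bar>"
      using scaled_spow_cutoff(1)[OF q M(1), of K x y] K B_nonneg abs_mult[of B "x - y"]
        abs_triangle_ineq4[of "B * (x - y)" "K * spow q (cutoff M x) - K * spow q (cutoff M y)"] by simp
    finally show ?thesis by (simp add: algebra_simps)
  qed
  from damped_ivp_exists[of h, OF this, of x0 y0 a]
  obtain x y where i: "x 0 = x0" "y 0 = y0"
    and xd: "\<And>s. 0 \<le> s \<Longrightarrow> (x has_real_derivative y s) (at s)"
    and yd: "\<And>s. 0 \<le> s \<Longrightarrow> (y has_real_derivative - a * y s + h (x s)) (at s)" by blast
  have hM: "h z = - dV z" if "\<bar>z\<bar> \<le> M" for z using that by (simp add: h_def dV_def cutoff_id)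
  have cont: "continuous_on {0..} x" "continuous_on {0..} y"
    using xd yd by (auto intro!: continuous_at_imp_continuous_on dest!: DERIV_isCont)
  have bd: "\<bar>x t\<bar> < M" if "0 \<le> t" for t
  proof (rule bound_persists[where f = "\<lambda>t. \<bar>x t\<bar>" and a = 0])
    fix t assume t: "0 < t" and b: "\<And>s. 0 \<le> s \<Longrightarrow> s < t \<Longrightarrow> \<bar>x s\<bar> < M"
    have "En (x t) (y t) \<le> En (x 0) (y 0)"
    proof (rule decreasing_open_real[where a = 0 and b = t and f = "\<lambda>t. En (x t) (y t)" and f' = "\<lambda>s. - a * (y s)\<^sup>2"])
      show "continuous_on {0..t} (\<lambda>s. En (x s) (y s))"
        unfolding En_def
        by (intro continuous_intros continuous_on_compose2[OF V_cont[of UNIV]] continuous_on_subset[OF cont(1)]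
            continuous_on_subset[OF cont(2)]) auto
      fix s assume s: "0 < s" "s < t"
      have "(y has_real_derivative - a * y s - dV (x s)) (at s)"
        using hM[of "x s"] b[of s] s by (intro DERIV_cong[OF yd]) auto
      then show "((\<lambda>t. En (x t) (y t)) has_real_derivative - a * (y s)\<^sup>2) (at s)"
        unfolding En_def using xd[of s] s
        by (intro DERIV_cong[OF DERIV_add[OF DERIV_cdivide[OF DERIV_power[where n = 2]]
            DERIV_chain2[OF V_deriv]]]) (auto simp: field_simps power2_eq_square)
      show "- a * (y s)\<^sup>2 \<le> 0" using a_pos by simp
    qed (use t in auto)
    then have "V (x t) \<le> En x0 y0" using i by (simp add: En_def) (smt (verit) divide_nonneg_nonneg zero_le_power2)
    then have "\<bar>x t\<bar> < M0" using M0[of "x t"] by force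
    then show "\<bar>x t\<bar> < M" by (simp add: M_def)
  qed (use cont M i that in \<open>auto intro!: continuous_intros\<close>)
  have "traj x y" unfolding traj_def
    using xd yd hM bd by (auto simp: less_imp_le)
  with i show ?thesis by blast
qed

text \<open>The energy confines the trajectory, so position and energy converge by monotonicity; hence so do velocity and
  acceleration, and the limit of a derivative of a convergent function is zero.\<close>

lemma settles:
  assumes T: "traj x y" and s0: "0 \<le> s0" and neg: "\<And>s. s0 \<le> s \<Longrightarrow> y s < 0"
  shows "\<exists>l. (x \<longlongrightarrow> l) at_top \<and> (y \<longlongrightarrow> 0) at_top \<and> dV l = 0 \<and> (\<forall>s\<ge>s0. l < x s) \<and> ((\<lambda>s. En (x s) (y s)) \<longlongrightarrow> V l) at_top"
proof -
  have dec: "x t < x s" if "s0 \<le> s" "s < t" for s t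
    by (rule traj_decreasing[OF T _ that(2)]) (use neg that s0 in auto)
  obtain M where M: "\<And>x'. M \<le> \<bar>x'\<bar> \<Longrightarrow> En (x s0) (y s0) < V x'" using V_coercive by blast
  have xb: "- \<bar>M\<bar> \<le> x s" if "s0 \<le> s" for s
  proof -
    have "V (x s) \<le> En (x s) (y s)" by (simp add: En_def)
    then have "\<not> M \<le> \<bar>x s\<bar>" using En_antimono[OF T s0 that] M[of "x s"] by force
    then show ?thesis by linarith
  qed
  obtain l where l: "(x \<longlongrightarrow> l) at_top" and ll: "\<And>s. s0 \<le> s \<Longrightarrow> l \<le> x s"
    using antimono_tendsto_at_top[of s0 x "- \<bar>M\<bar>"] dec xb by (metis less_le order.refl)
  have lt: "l < x s" if "s0 \<le> s" for s using ll[of "s + 1"] dec[of s "s+1"] that by simp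
  have "bounded (V ` {- \<bar>M\<bar>..x s0})" by (intro compact_imp_bounded compact_continuous_image V_cont) auto
  then obtain C where C: "\<And>z. z \<in> {- \<bar>M\<bar>..x s0} \<Longrightarrow> \<bar>V z\<bar> \<le> C" unfolding bounded_iff real_norm_def by blast
  have "- C \<le> En (x s) (y s)" if "s0 \<le> s" for s
  proof -
    have "\<bar>V (x s)\<bar> \<le> C" using xb[OF that] dec[of s0 s] that by (intro C) (cases "s = s0", auto)
    moreover have "0 \<le> (y s)\<^sup>2 / 2" by simp
    ultimately show ?thesis unfolding En_def by linarith
  qed
  then obtain e where e: "((\<lambda>s. En (x s) (y s)) \<longlongrightarrow> e) at_top"
    using antimono_tendsto_at_top[of s0 "\<lambda>s. En (x s) (y s)" "- C"] En_antimono[OF T] s0 by force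
  have Vl: "((\<lambda>s. V (x s)) \<longlongrightarrow> V l) at_top"
    using DERIV_isCont[OF V_deriv] l by (rule isCont_tendsto_compose)
  have "((\<lambda>s. - sqrt (2 * (En (x s) (y s) - V (x s)))) \<longlongrightarrow> - sqrt (2 * (e - V l))) at_top"
    by (intro tendsto_intros e Vl)
  moreover have "\<forall>\<^sub>F s in at_top. - sqrt (2 * (En (x s) (y s) - V (x s))) = y s"
    using eventually_ge_at_top[of s0]
    by eventually_elim (use neg in \<open>simp add: En_def less_imp_le\<close>)
  ultimately have yl: "(y \<longlongrightarrow> - sqrt (2 * (e - V l))) at_top"
    by (rule Lim_transform_eventually)
  have y0: "- sqrt (2 * (e - V l)) = 0"
    by (rule limit_deriv_zero[OF _ l yl, of s0]) (use traj_x[OF T] s0 in auto)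
  have "((\<lambda>s. - a * y s - dV (x s)) \<longlongrightarrow> - a * (- sqrt (2 * (e - V l))) - dV l) at_top"
    by (intro tendsto_intros yl isCont_tendsto_compose[OF _ l] continuous_on_interior[OF dV_cont[of UNIV]]) simp
  then have "- a * (- sqrt (2 * (e - V l))) - dV l = 0"
    by (intro limit_deriv_zero[OF _ yl, of s0]) (use traj_y[OF T] s0 in auto)
  then have "dV l = 0" using y0 by simp
  moreover have "e = V l" using y0 by simp
  ultimately show ?thesis using l yl y0 lt e by auto
qed

subsection \<open>Trajectories do not cross\<close>

text \<open>While they move to the left, two trajectories are graphs of the velocity over the position.
  The one that starts further out stays the faster one: at a place of equal velocity they would
  be the same trajectory.\<close>

lemma no_crossing:
  assumes 1: "traj x1 y1" and 2: "traj x2 y2"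
    and n1: "\<And>s. 0 < s \<Longrightarrow> s < s1 \<Longrightarrow> y1 s < 0" and n2: "\<And>s. 0 < s \<Longrightarrow> s < s2 \<Longrightarrow> y2 s < 0"
    and start: "x1 0 \<le> x2 0" "\<And>s. 0 \<le> s \<Longrightarrow> s \<le> s2 \<Longrightarrow> x2 s = x1 0 \<Longrightarrow> y2 s < y1 0"
    and s: "0 \<le> s" "s \<le> s1" and \<sigma>: "0 \<le> \<sigma>" "\<sigma> \<le> s2" and eq: "x1 s = x2 \<sigma>"
  shows "y2 \<sigma> < y1 s"
proof (rule ccontr)
  assume not: "\<not> y2 \<sigma> < y1 s"
  have dec1: "x1 v < x1 u" if "0 \<le> u" "u < v" "v \<le> s1" for u v
    by (rule traj_decreasing[OF 1 that(1,2)]) (use n1 that in auto)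
  have dec2: "x2 v < x2 u" if "0 \<le> u" "u < v" "v \<le> s2" for u v
    by (rule traj_decreasing[OF 2 that(1,2)]) (use n2 that in auto)
  have inj: "inj_on x2 {0..\<sigma>}" using dec2 \<sigma> by (intro linorder_inj_onI) force+
  define g where "g = inv_into {0..\<sigma>} x2"
  have gx: "\<forall>u\<in>{0..\<sigma>}. g (x2 u) = u" unfolding g_def using inj by (simp add: inv_into_f_f)
  have cx2: "continuous_on {0..\<sigma>} x2" by (rule traj_cont[OF 2]) auto
  have gc: "continuous_on (x2 ` {0..\<sigma>}) g" by (rule continuous_on_inv[OF cx2 _ gx]) auto
  have img: "x1 u \<in> x2 ` {0..\<sigma>}" if "0 \<le> u" "u \<le> s" for u
  proof -
    have "x2 \<sigma> \<le> x1 u" using dec1[of u s] eq that s by (cases "u = s") auto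
    moreover have "x1 u \<le> x2 0" using dec1[of 0 u] start(1) that s by (cases "u = 0") auto
    ultimately obtain v where "0 \<le> v" "v \<le> \<sigma>" "x2 v = x1 u"
      using IVT2'[of x2 \<sigma> "x1 u" 0] cx2 \<sigma> by auto
    then show ?thesis by (metis atLeastAtMost_iff image_eqI)
  qed
  define D where "D u = y1 u - y2 (g (x1 u))" for u
  have gr: "g (x1 u) \<in> {0..\<sigma>} \<and> x2 (g (x1 u)) = x1 u" if "0 \<le> u" "u \<le> s" for u
    using img[OF that] gx by auto
  have "continuous_on {0..s} D"
  proof -
    have cx1: "continuous_on {0..s} x1" "continuous_on {0..s} y1" by (auto intro!: traj_cont[OF 1])
    have cg: "continuous_on {0..s} (\<lambda>u. g (x1 u))"
      by (rule continuous_on_compose2[OF gc cx1(1)]) (use img in auto)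
    have cy2: "continuous_on {0..\<sigma>} y2" by (rule traj_cont[OF 2]) auto
    have "continuous_on {0..s} (\<lambda>u. y2 (g (x1 u)))"
      by (rule continuous_on_compose2[OF cy2 cg]) (use gr in auto)
    then show ?thesis unfolding D_def[abs_def] by (intro continuous_intros cx1)
  qed
  moreover have "0 < D 0" using start(2)[of "g (x1 0)"] gr[of 0] s \<sigma> by (auto simp: D_def)
  moreover have "D s \<le> 0" using not gx eq \<sigma> by (auto simp: D_def)
  ultimately obtain u where u: "0 \<le> u" "u \<le> s" "D u = 0"
    using IVT2'[of D s 0 0] s by auto
  define v where "v = g (x1 u)"
  have v: "0 \<le> v" "v \<le> \<sigma>" "x2 v = x1 u" "y2 v = y1 u" using gr[OF u(1,2)] u(3) by (auto simp: v_def D_def)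
  show False
  proof (cases "u \<le> v")
    case True
    have "x1 (u + - u) = x2 (v + - u) \<and> y1 (u + - u) = y2 (v + - u)"
      by (rule traj_unique[OF 1 2]) (use u v True in auto)
    then show False using start(2)[of "v - u"] True u v \<sigma> by auto
  next
    case False
    have "x1 (u + - v) = x2 (v + - v) \<and> y1 (u + - v) = y2 (v + - v)"
      by (rule traj_unique[OF 1 2]) (use u v False in auto)
    then have "x1 (u - v) = x2 0" by simp
    then show False using dec1[of 0 "u - v"] start(1) False u v s by auto
  qed
qed

section \<open>The regular solution and its spiral\<close>

text \<open>Solutions of \<open>w'' + \<mu> w' + K e\<^bsup>\<rho>t\<^esup> w|w|\<^bsup>q-2\<^esup> = 0\<close> and trajectories are the same
  thing seen through \<open>x(s) = e\<^bsup>-\<gamma>s\<^esup> w(-s)\<close>.\<close>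

lemma spow_exp: "spow q (exp (\<gamma> * t) * w) = exp (\<gamma> * t) * exp (\<rho> * t) * spow q w"
  using spow_scale[of "exp (\<gamma> * t)" q w]
  by (simp add: powr_def \<rho>_def exp_add[symmetric] algebra_simps)

lemma fowler_deriv:
  assumes w: "(w has_real_derivative p t) (at t)"
    and p: "(p has_real_derivative - \<mu> * p t + exp (\<rho> * t) * (- K * spow q (w t))) (at t)"
  shows "((\<lambda>t. exp (\<gamma> * t) * w t) has_real_derivative exp (\<gamma> * t) * (\<gamma> * w t + p t)) (at t)" (is ?A)
    and "((\<lambda>t. exp (\<gamma> * t) * (\<gamma> * w t + p t)) has_real_derivative
       a * (exp (\<gamma> * t) * (\<gamma> * w t + p t)) - dV (exp (\<gamma> * t) * w t)) (at t)" (is ?B)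
proof -
  note e = exp_scale_deriv[of \<gamma> t]
  show ?A by (rule DERIV_cong[OF DERIV_mult[OF e w]]) (simp add: algebra_simps)
  show ?B
    by (rule DERIV_cong[OF DERIV_mult[OF e DERIV_add[OF DERIV_cmult[OF w] p]]])
       (simp only: dV_def spow_exp, simp add: a_def B_def algebra_simps)
qed

lemma w_of_traj_deriv:
  assumes T: "traj x y" and t: "t \<le> 0"
  shows "((\<lambda>t. exp (- \<gamma> * t) * x (- t)) has_real_derivative exp (- \<gamma> * t) * (- \<gamma> * x (- t) - y (- t))) (at t)" (is ?A)
    and "((\<lambda>t. exp (- \<gamma> * t) * (- \<gamma> * x (- t) - y (- t))) has_real_derivative
       - \<mu> * (exp (- \<gamma> * t) * (- \<gamma> * x (- t) - y (- t))) +
        exp (\<rho> * t) * (- K * spow q (exp (- \<gamma> * t) * x (- t)))) (at t)" (is ?B)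
proof -
  note e = exp_scale_deriv[of "- \<gamma>" t]
  have m: "((\<lambda>t. - t) has_real_derivative -1) (at t)" by (auto intro!: derivative_eq_intros)
  have x: "((\<lambda>t. x (- t)) has_real_derivative y (- t) * -1) (at t)"
    by (rule DERIV_chain2[OF traj_x[OF T] m]) (use t in simp)
  have y: "((\<lambda>t. y (- t)) has_real_derivative (- a * y (- t) - dV (x (- t))) * -1) (at t)"
    by (rule DERIV_chain2[OF traj_y[OF T] m]) (use t in simp)
  show ?A by (rule DERIV_cong[OF DERIV_mult[OF e x]]) (simp add: algebra_simps)
  have "x (- t) = exp (\<gamma> * t) * (exp (- \<gamma> * t) * x (- t))" by (simp add: exp_minus)
  then have s: "spow q (x (- t)) = exp (\<gamma> * t) * exp (\<rho> * t) * spow q (exp (- \<gamma> * t) * x (- t))"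
    by (metis spow_exp)
  have "exp (- \<gamma> * t) * spow q (x (- t)) = exp (\<rho> * t) * spow q (exp (- \<gamma> * t) * x (- t))"
    unfolding s by (simp add: exp_minus)
  then show ?B
    by (intro DERIV_cong[OF DERIV_mult[OF e DERIV_diff[OF DERIV_cmult[OF x] y]]])
       (simp add: dV_def a_def B_def algebra_simps)
qed

text \<open>The regular solutions normalized by their limit at minus infinity, together with the bound that comes with their construction.\<close>

definition core :: "(real \<Rightarrow> real) \<Rightarrow> (real \<Rightarrow> real) \<Rightarrow> bool" where
  "core w p \<longleftrightarrow> (\<forall>t. (w has_real_derivative p t) (at t) \<and>
      (p has_real_derivative - \<mu> * p t + exp (\<rho> * t) * (- K * spow q (w t))) (at t)) \<and>
      (w \<longlongrightarrow> 1) at_bot \<and> (\<forall>t. \<bar>w t\<bar> \<le> 1)"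

text \<open>The quantity \<open>e\<^bsup>-\<rho>t\<^esup> p\<^sup>2/2 + K|w|\<^sup>q/q\<close> decreases, so a solution starting from \<open>w = 1\<close> at minus
  infinity never leaves \<open>|w| \<le> 1\<close>; truncating the nonlinearity at \<open>|w| = 2\<close> is therefore harmless.\<close>

lemma core_exists: "\<exists>w p. core w p"
proof -
  define h where "h x = - K * spow q (cutoff 2 x)" for x
  have hl: "\<bar>h x - h y\<bar> \<le> K * ((q - 1) * 2 powr (q - 2)) * \<bar>x - y\<bar>" for x y
    using scaled_spow_cutoff(1)[OF q, of 2 K x y] K by (simp add: h_def)
  from singular_exists[OF mu rho_pos, of h, OF hl, of 1] obtain w p
    where w: "\<And>t. (w has_real_derivative p t) (at t)"
      and p: "\<And>t. (p has_real_derivative - \<mu> * p t + exp (\<rho> * t) * h (w t)) (at t)"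
      and l: "(w \<longlongrightarrow> 1) at_bot" by blast
  define H where "H = K * spow q 2"
  have H: "\<bar>h x\<bar> \<le> H" for x
    using scaled_spow_cutoff(2)[OF q, of 2 K x] K by (simp add: h_def H_def)
  have ptail: "\<bar>p t\<bar> \<le> H / (\<mu> + \<rho>) * exp (\<rho> * t)" for t
    by (rule singular_tail(1)[OF mu rho_pos w p _ l order.refl]) (rule H)
  define N where "N t = exp (- \<rho> * t) * (p t)\<^sup>2 / 2 + K * (\<bar>w t\<bar> powr q / q)" for t
  have wN: "((\<lambda>t. \<bar>w t\<bar> powr q) \<longlongrightarrow> 1) at_bot"
    using tendsto_powr[OF tendsto_rabs[OF l] tendsto_const, of q] by simp
  have Nl: "(N \<longlongrightarrow> K / q) at_bot"
  proof -
    have "((\<lambda>t. exp (- \<rho> * t) * (p t)\<^sup>2 / 2) \<longlongrightarrow> 0) at_bot"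
    proof (rule Lim_null_comparison)
      show "\<forall>\<^sub>F t in at_bot. norm (exp (- \<rho> * t) * (p t)\<^sup>2 / 2) \<le> (H / (\<mu> + \<rho>))\<^sup>2 / 2 * exp (\<rho> * t)"
      proof (intro always_eventually allI)
        fix t
        have "(p t)\<^sup>2 \<le> (H / (\<mu> + \<rho>) * exp (\<rho> * t))\<^sup>2" using power_mono[OF ptail[of t], of 2] by simp
        then have "exp (- \<rho> * t) * (p t)\<^sup>2 \<le> exp (- \<rho> * t) * ((H / (\<mu> + \<rho>))\<^sup>2 * (exp (\<rho> * t) * exp (\<rho> * t)))"
          by (intro mult_left_mono) (auto simp: power2_eq_square mult_ac)
        also have "\<dots> = (H / (\<mu> + \<rho>))\<^sup>2 * exp (\<rho> * t)" by (simp add: exp_minus)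
        finally show "norm (exp (- \<rho> * t) * (p t)\<^sup>2 / 2) \<le> (H / (\<mu> + \<rho>))\<^sup>2 / 2 * exp (\<rho> * t)" by simp
      qed
      show "((\<lambda>t. (H / (\<mu> + \<rho>))\<^sup>2 / 2 * exp (\<rho> * t)) \<longlongrightarrow> 0) at_bot"
        by (rule tendsto_mult_right_zero[OF filterlim_exp_at_bot_0[OF rho_pos]])
    qed
    then have "(N \<longlongrightarrow> 0 + K * (1 / q)) at_bot" unfolding N_def[abs_def]
      using q by (intro tendsto_intros wN) auto
    then show ?thesis by simp
  qed
  have bd: "\<bar>w t\<bar> \<le> 1" if small: "\<And>s. s < t \<Longrightarrow> \<bar>w s\<bar> < 2" for t
  proof -
    have wc: "isCont w s" and pc: "isCont p s" for s using w p by (blast intro: DERIV_isCont)+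
    have Ncont: "continuous_on S N" for S
    proof -
      have "continuous_on S w" "continuous_on S p" using wc pc by (auto intro: continuous_at_imp_continuous_on)
      then show ?thesis unfolding N_def[abs_def] using q by (intro continuous_intros continuous_on_powr') auto
    qed
    have anti: "N t \<le> N s" if "s \<le> t" for s
    proof (rule decreasing_open_real[where f' = "\<lambda>r. - (exp (- \<rho> * r) * (p r)\<^sup>2 * (\<rho> / 2 + \<mu>))", OF that Ncont])
      fix r assume r: "s < r" "r < t"
      have hr: "h (w r) = - K * spow q (w r)" using small[OF r(2)] by (simp add: h_def cutoff_id)
      have 1: "((\<lambda>t. exp (- \<rho> * t)) has_real_derivative - \<rho> * exp (- \<rho> * r)) (at r)"
        by (auto intro!: derivative_eq_intros)
      have ee: "exp (- \<rho> * r) * (p r * (exp (\<rho> * r) * Z)) = p r * Z" for Z by (simp add: exp_minus)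
      show "(N has_real_derivative - (exp (- \<rho> * r) * (p r)\<^sup>2 * (\<rho> / 2 + \<mu>))) (at r)"
        unfolding N_def[abs_def]
        by (rule DERIV_cong[OF DERIV_add[OF DERIV_cdivide[OF DERIV_mult[OF 1 DERIV_power[OF p, of 2]]]
              DERIV_cmult[OF DERIV_chain2[OF DERIV_abs_powr[OF q] w]]]])
           (use ee[of "K * spow q (w r)"] in \<open>simp add: hr field_simps power2_eq_square\<close>)
      show "- (exp (- \<rho> * r) * (p r)\<^sup>2 * (\<rho> / 2 + \<mu>)) \<le> 0" using mu rho_pos by simp
    qed
    have "N t \<le> K / q"
    proof (rule tendsto_lowerbound[OF Nl])
      show "\<forall>\<^sub>F s in at_bot. N t \<le> N s"
        by (rule eventually_mono[OF eventually_le_at_bot[of t]]) (rule anti)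
    qed simp
    then have "K * (\<bar>w t\<bar> powr q / q) \<le> K / q" unfolding N_def
      by (smt (verit) divide_nonneg_nonneg exp_ge_zero mult_nonneg_nonneg zero_le_power2)
    then have le1: "\<bar>w t\<bar> powr q \<le> 1" using K q by (simp add: divide_le_cancel)
    show ?thesis
    proof (rule ccontr)
      assume "\<not> \<bar>w t\<bar> \<le> 1"
      then have "1 powr q < \<bar>w t\<bar> powr q" using q by (intro powr_less_mono2) auto
      with le1 show False by simp
    qed
  qed
  have "\<forall>\<^sub>F t in at_bot. \<bar>w t\<bar> < 2" using tendsto_rabs[OF l] by (rule order_tendstoD) simp
  then obtain t0 where t0: "\<And>t. t \<le> t0 \<Longrightarrow> \<bar>w t\<bar> < 2" unfolding eventually_at_bot_linorder by blast
  have lt2: "\<bar>w t\<bar> < 2" for t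
  proof (cases "t \<le> t0")
    case False
    show ?thesis
    proof (rule bound_persists[where a = t0 and f = "\<lambda>t. \<bar>w t\<bar>"])
      show "continuous_on {t0..} (\<lambda>t. \<bar>w t\<bar>)"
        using w by (auto intro!: continuous_intros continuous_at_imp_continuous_on dest: DERIV_isCont)
      fix t assume t: "t0 < t" "\<And>s. t0 \<le> s \<Longrightarrow> s < t \<Longrightarrow> \<bar>w s\<bar> < 2"
      have "\<bar>w t\<bar> \<le> 1"
      proof (rule bd)
        fix s assume "s < t" then show "\<bar>w s\<bar> < 2" using t0[of s] t(2)[of s] by linarith
      qed
      then show "\<bar>w t\<bar> < 2" by simp
    qed (use t0 False in auto)
  qed (rule t0)
  have "h (w t) = - K * spow q (w t)" for t using lt2[of t] by (simp add: h_def cutoff_id)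
  with w p l bd lt2 have "core w p" unfolding core_def by metis
  then show ?thesis by blast
qed

definition "w0 = (SOME w. \<exists>p. core w p)"
definition "p0 = (SOME p. core w0 p)"

lemma core0: "core w0 p0"
proof -
  have "\<exists>p. core w0 p" unfolding w0_def using core_exists by (rule someI_ex)
  then show ?thesis unfolding p0_def by (rule someI_ex)
qed

lemma w0_deriv: "(w0 has_real_derivative p0 t) (at t)"
  and p0_deriv: "(p0 has_real_derivative - \<mu> * p0 t + exp (\<rho> * t) * (- K * spow q (w0 t))) (at t)"
  and w0_lim: "(w0 \<longlongrightarrow> 1) at_bot" and w0_le: "\<bar>w0 t\<bar> \<le> 1"
  using core0 by (auto simp: core_def)

lemma p0_bound: "\<bar>p0 t\<bar> \<le> K / (\<mu> + \<rho>) * exp (\<rho> * t)"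
proof (rule singular_tail(1)[OF mu rho_pos w0_deriv p0_deriv _ w0_lim order.refl])
  fix t
  have "\<bar>spow q (w0 t)\<bar> \<le> 1"
    using w0_le[of t] q by (auto simp: spow_def abs_mult intro!: mult_le_one powr_le1)
  then show "\<bar>- K * spow q (w0 t)\<bar> \<le> K" using K by (simp add: abs_mult)
qed

lemma p0_lim: "(p0 \<longlongrightarrow> 0) at_bot"
proof (rule Lim_null_comparison)
  show "\<forall>\<^sub>F t in at_bot. norm (p0 t) \<le> K / (\<mu> + \<rho>) * exp (\<rho> * t)"
    unfolding real_norm_def by (intro always_eventually allI p0_bound)
qed (rule tendsto_mult_right_zero[OF filterlim_exp_at_bot_0[OF rho_pos]])

definition X :: "real \<Rightarrow> real" where "X t = exp (\<gamma> * t) * w0 t"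
definition Y :: "real \<Rightarrow> real" where "Y t = exp (\<gamma> * t) * (\<gamma> * w0 t + p0 t)"

lemma X_deriv: "(X has_real_derivative Y t) (at t)"
  and Y_deriv: "(Y has_real_derivative a * Y t - dV (X t)) (at t)"
  unfolding X_def[abs_def] Y_def[abs_def] by (rule fowler_deriv[OF w0_deriv p0_deriv])+

lemma X_cont: "continuous_on S X" and Y_cont: "continuous_on S Y"
  using X_deriv Y_deriv by (blast intro: continuous_at_imp_continuous_on DERIV_isCont)+

lemma traj_X: "traj (\<lambda>s. X (t0 - s)) (\<lambda>s. - Y (t0 - s))"
  unfolding traj_def
proof (intro allI impI conjI)
  fix s :: real
  have m: "((\<lambda>s. t0 - s) has_real_derivative -1) (at s)" by (auto intro!: derivative_eq_intros)
  show "((\<lambda>s. X (t0 - s)) has_real_derivative - Y (t0 - s)) (at s)"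
    by (rule DERIV_cong[OF DERIV_chain2[OF X_deriv m]]) simp
  show "((\<lambda>s. - Y (t0 - s)) has_real_derivative - a * - Y (t0 - s) - dV (X (t0 - s))) (at s)"
    by (rule DERIV_cong[OF DERIV_minus[OF DERIV_chain2[OF Y_deriv m]]]) simp
qed

lemma traj_X': "traj (\<lambda>s. - X (t0 - s)) (\<lambda>s. Y (t0 - s))"
  using traj_minus[OF traj_X[of t0]] by simp

lemma En_minus_y [simp]: "En x (- y) = En x y" by (simp add: En_def)
lemma En_minus_x [simp]: "En (- x) y = En x y" by (simp add: En_def)

lemma En_X_mono: "t \<le> t' \<Longrightarrow> En (X t) (Y t) \<le> En (X t') (Y t')"
  using En_antimono[OF traj_X[of t'], of 0 "t' - t"] by simp

lemma X_Y_initial: "\<exists>t0. \<forall>t\<le>t0. 0 < X t \<and> 0 < Y t \<and> 1/2 \<le> w0 t"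
proof -
  have "((\<lambda>t. \<gamma> * w0 t + p0 t) \<longlongrightarrow> \<gamma> * 1 + 0) at_bot" by (intro tendsto_intros w0_lim p0_lim)
  then have "\<forall>\<^sub>F t in at_bot. 0 < \<gamma> * w0 t + p0 t" by (rule order_tendstoD) (use gam_pos in simp)
  moreover have "\<forall>\<^sub>F t in at_bot. 1/2 < w0 t" using w0_lim by (rule order_tendstoD) simp
  ultimately have "\<forall>\<^sub>F t in at_bot. 0 < X t \<and> 0 < Y t \<and> 1/2 \<le> w0 t"
    by eventually_elim (auto simp: X_def Y_def)
  then show ?thesis by (auto simp: eventually_at_bot_linorder)
qed

text \<open>The energy vanishes in the limit at minus infinity and increases along the spiral.\<close>

lemma En_X_pos: "0 < En (X t) (Y t)"
proof -
  obtain t0 where t0: "\<And>t. t \<le> t0 \<Longrightarrow> 0 < X t \<and> 0 < Y t" using X_Y_initial by blast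
  have w: "isCont w0 t" "isCont p0 t" for t using w0_deriv p0_deriv by (blast intro: DERIV_isCont)+
  have "(X \<longlongrightarrow> 0 * 1) at_bot" "(Y \<longlongrightarrow> 0 * (\<gamma> * 1 + 0)) at_bot"
    unfolding X_def[abs_def] Y_def[abs_def]
    by (intro tendsto_intros w0_lim p0_lim filterlim_exp_at_bot_0 gam_pos)+
  then have "((\<lambda>t. En (X t) (Y t)) \<longlongrightarrow> 0\<^sup>2 / 2 + V 0) at_bot"
    unfolding En_def by (intro tendsto_intros isCont_tendsto_compose[OF DERIV_isCont[OF V_deriv]]) auto
  then have lim: "((\<lambda>t. En (X t) (Y t)) \<longlongrightarrow> 0) at_bot" by simp
  have nn: "0 \<le> En (X t) (Y t)" for t
    by (rule tendsto_upperbound[OF lim])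
       (auto intro!: eventually_mono[OF eventually_le_at_bot[of t]] En_X_mono)
  have pos: "0 < En (X s) (Y s)" if "s \<le> t0" for s
  proof -
    have "En (X (s - 1)) (Y (s - 1)) < En (X s) (Y s)"
    proof -
      have "- Y (s - r) \<noteq> 0" if "0 < r" for r using t0[of "s - r"] that \<open>s \<le> t0\<close> by simp
      then show ?thesis using En_strict[OF traj_X[of s], of 0 1] by simp
    qed
    with nn[of "s - 1"] show ?thesis by linarith
  qed
  have "0 < En (X (min t t0)) (Y (min t t0))" by (rule pos) simp
  also have "\<dots> \<le> En (X t) (Y t)" by (rule En_X_mono) simp
  finally show ?thesis .
qed

subsection \<open>Oscillation\<close>

text \<open>Read in the direction of increasing energy, a trajectory of positive energy cannot approach an equilibrium,
  since these have non-positive energy.\<close>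

definition fwd :: "(real \<Rightarrow> real) \<Rightarrow> (real \<Rightarrow> real) \<Rightarrow> bool" where
  "fwd x y \<longleftrightarrow> (\<forall>t. (x has_real_derivative y t) (at t) \<and> (y has_real_derivative a * y t - dV (x t)) (at t) \<and>
     0 < En (x t) (y t))"

lemma fwd_X: "fwd X Y"
  by (simp add: fwd_def X_deriv Y_deriv En_X_pos)

lemma fwd_minus:
  assumes "fwd x y"
  shows "fwd (\<lambda>t. - x t) (\<lambda>t. - y t)"
  unfolding fwd_def
proof (intro allI conjI)
  fix t
  have x: "(x has_real_derivative y t) (at t)" and y: "(y has_real_derivative a * y t - dV (x t)) (at t)"
    and e: "0 < En (x t) (y t)" using assms by (auto simp: fwd_def)
  show "((\<lambda>t. - x t) has_real_derivative - y t) (at t)" by (rule DERIV_minus[OF x])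
  show "((\<lambda>t. - y t) has_real_derivative a * - y t - dV (- x t)) (at t)"
    by (rule DERIV_cong[OF DERIV_minus[OF y]]) simp
  show "0 < En (- x t) (- y t)" using e by simp
qed

text \<open>A trajectory that moves left for ever and stays bounded converges. If its energy is bounded, the limit is an
  equilibrium of positive energy, which does not exist; if not, the velocity stays away from zero and
  the position cannot remain bounded.\<close>

lemma fwd_not_bounded_monotone:
  assumes F: "fwd x y" and neg: "\<And>t. t0 \<le> t \<Longrightarrow> y t < 0" and bd: "\<And>t. t0 \<le> t \<Longrightarrow> m \<le> x t"
  shows False
proof -
  have x: "(x has_real_derivative y t) (at t)" and y: "(y has_real_derivative a * y t - dV (x t)) (at t)"
    and e: "0 < En (x t) (y t)" for t using F by (auto simp: fwd_def)
  have dec: "x t \<le> x s" if "t0 \<le> s" "s \<le> t" for s t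
    by (rule deriv_nonpos_imp_antimono[OF x _ that(2)]) (use that in \<open>auto intro!: neg[THEN less_imp_le]\<close>)
  obtain l where l: "(x \<longlongrightarrow> l) at_top"
    using antimono_tendsto_at_top[of t0 x m, OF dec bd] by blast
  have Ed: "((\<lambda>t. En (x t) (y t)) has_real_derivative a * (y t)\<^sup>2) (at t)" for t
    unfolding En_def
    by (rule DERIV_cong[OF DERIV_add[OF DERIV_cdivide[OF DERIV_power[OF y, of 2]]
        DERIV_chain2[OF V_deriv x]]])
     (simp add: field_simps power2_eq_square)
  have inc: "En (x s) (y s) \<le> En (x t) (y t)" if "s \<le> t" for s t
    by (rule deriv_nonneg_imp_mono[OF Ed _ that]) (use a_pos in simp)
  have Vl: "((\<lambda>s. V (x s)) \<longlongrightarrow> V l) at_top"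
    using DERIV_isCont[OF V_deriv] l by (rule isCont_tendsto_compose)
  show False
  proof (cases "\<exists>C. \<forall>t\<ge>t0. En (x t) (y t) \<le> C")
    case True
    then obtain C where C: "\<And>t. t0 \<le> t \<Longrightarrow> En (x t) (y t) \<le> C" by blast
    obtain n where n: "((\<lambda>t. - En (x t) (y t)) \<longlongrightarrow> n) at_top"
      using antimono_tendsto_at_top[of t0 "\<lambda>t. - En (x t) (y t)" "- C"] inc C by force
    define E where "E = - n"
    have E: "((\<lambda>t. En (x t) (y t)) \<longlongrightarrow> E) at_top" using tendsto_minus[OF n] by (simp add: E_def)
    have "En (x t0) (y t0) \<le> E"
      by (rule tendsto_lowerbound[OF E]) (auto intro!: eventually_mono[OF eventually_ge_at_top[of t0]] inc)
    then have Epos: "0 < E" using e[of t0] by linarith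
    have "((\<lambda>s. - sqrt (2 * (En (x s) (y s) - V (x s)))) \<longlongrightarrow> - sqrt (2 * (E - V l))) at_top"
      by (intro tendsto_intros E Vl)
    moreover have "\<forall>\<^sub>F s in at_top. - sqrt (2 * (En (x s) (y s) - V (x s))) = y s"
      using eventually_ge_at_top[of t0]
      by eventually_elim (use neg in \<open>simp add: En_def less_imp_le\<close>)
    ultimately have yl: "(y \<longlongrightarrow> - sqrt (2 * (E - V l))) at_top"
      by (rule Lim_transform_eventually)
    have y0: "- sqrt (2 * (E - V l)) = 0"
      by (rule limit_deriv_zero[OF x l yl])
    have "((\<lambda>s. a * y s - dV (x s)) \<longlongrightarrow> a * (- sqrt (2 * (E - V l))) - dV l) at_top"
      by (intro tendsto_intros yl isCont_tendsto_compose[OF _ l] continuous_on_interior[OF dV_cont[of UNIV]]) simp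
    then have "a * (- sqrt (2 * (E - V l))) - dV l = 0"
      by (intro limit_deriv_zero[OF y yl])
    then have "dV l = 0" using y0 by simp
    moreover have "E = V l" using y0 by simp
    ultimately show False using dV_nonzero[of l] Epos by simp
  next
    case False
    have "\<forall>\<^sub>F t in at_top. V (x t) < V l + 1" using Vl by (rule order_tendstoD) simp
    then obtain t1 where t1: "\<And>t. t1 \<le> t \<Longrightarrow> V (x t) < V l + 1" unfolding eventually_at_top_linorder by blast
    obtain t2 where t2: "t0 \<le> t2" "V l + 2 < En (x t2) (y t2)" using False by (meson not_le)
    define t3 where "t3 = max t1 t2"
    have ym: "y t \<le> -1" if "t3 \<le> t" for t
    proof -
      have "V l + 2 < En (x t) (y t)" using inc[of t2 t] t2 that by (simp add: t3_def)
      moreover have "V (x t) < V l + 1" using t1 that by (simp add: t3_def)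
      ultimately have "1 < (y t)\<^sup>2" by (simp add: En_def)
      moreover have "y t < 0" using neg t2 that by (simp add: t3_def)
      ultimately show ?thesis
        by (metis abs_square_le_1 linorder_not_less abs_of_neg neg_le_iff_le minus_minus nle_le)
    qed
    define t4 where "t4 = t3 + \<bar>x t3 - m\<bar> + 1"
    have "x t4 + t4 \<le> x t3 + t3"
      by (rule deriv_nonpos_imp_antimono[where g = "\<lambda>t. x t + t" and g' = "\<lambda>t. y t + 1"])
         (use x in \<open>auto intro!: derivative_eq_intros simp: t4_def dest: ym\<close>)
    moreover have "t0 \<le> t4" using t2 unfolding t4_def t3_def by linarith
    then have "m \<le> x t4" by (rule bd)
    ultimately show False unfolding t4_def by linarith
  qed
qed

text \<open>Moving to the right, the slope \<open>y/x\<close> satisfies a Riccati equation that sends it to \<open>- \<infinity>\<close> once \<open>x\<close> is large.\<close>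

lemma fwd_turns:
  assumes F: "fwd x y" and pos: "\<And>t. t0 \<le> t \<Longrightarrow> 0 < y t"
  shows False
proof -
  have x: "(x has_real_derivative y t) (at t)" and y: "(y has_real_derivative a * y t - dV (x t)) (at t)" for t
    using F by (auto simp: fwd_def)
  have inc: "x s \<le> x t" if "t0 \<le> s" "s \<le> t" for s t
    by (rule deriv_nonneg_imp_mono[OF x _ that(2)]) (use that in \<open>auto intro!: pos[THEN less_imp_le]\<close>)
  have unb: "\<exists>t\<ge>t0. C < x t" for C
  proof (rule ccontr)
    assume "\<not> (\<exists>t\<ge>t0. C < x t)"
    then show False
      using fwd_not_bounded_monotone[OF fwd_minus[OF F], of t0 "- C"] pos by force
  qed
  define R where "R = ((a\<^sup>2 / 4 + B + 1) / K) powr (1 / (q - 2)) + 1"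
  obtain t1 where t1: "t0 \<le> t1" "R < x t1" using unb by blast
  have xR: "R < x t" if "t1 \<le> t" for t using inc[OF t1(1) that] t1(2) by simp
  have R1: "1 \<le> R" by (simp add: R_def)
  define m where "m t = y t / x t" for t
  have md: "(m has_real_derivative (a * m t - (m t)\<^sup>2 + B - K * (x t) powr (q - 2))) (at t)" if "t1 \<le> t" for t
  proof -
    have x0: "0 < x t" using xR[OF that] R1 by linarith
    have eq: "dV (x t) = x t * (K * (x t) powr (q - 2) - B)" using x0 by (simp add: dV_def spow_def algebra_simps)
    show ?thesis unfolding m_def[abs_def]
      by (rule DERIV_cong[OF DERIV_divide[OF y x]]) (use x0 in \<open>auto simp: eq field_simps power2_eq_square\<close>)
  qed
  have mle: "a * m t - (m t)\<^sup>2 + B - K * (x t) powr (q - 2) \<le> -1" if "t1 \<le> t" for t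
  proof -
    define c where "c = (a\<^sup>2 / 4 + B + 1) / K"
    have c: "0 < c" using K B_nonneg by (simp add: c_def add_nonneg_pos)
    have "(c powr (1 / (q - 2))) powr (q - 2) \<le> (x t) powr (q - 2)"
      using xR[OF that] q by (intro powr_mono2) (auto simp: R_def c_def)
    then have "c \<le> (x t) powr (q - 2)" using q c by (simp add: powr_powr)
    then have "K * c \<le> K * (x t) powr (q - 2)" using K by simp
    then have "a\<^sup>2 / 4 + B + 1 \<le> K * (x t) powr (q - 2)" using K by (simp add: c_def)
    moreover have "a * m t - (m t)\<^sup>2 = a\<^sup>2 / 4 - (m t - a / 2)\<^sup>2" by (simp add: power2_eq_square field_simps)
    moreover have "0 \<le> (m t - a / 2)\<^sup>2" by simp
    ultimately show ?thesis by linarith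
  qed
  define t2 where "t2 = t1 + \<bar>m t1\<bar> + 1"
  have "m t2 + t2 \<le> m t1 + t1"
  proof (rule deriv_nonpos_imp_antimono[where g = "\<lambda>t. m t + t" and g' = "\<lambda>t. (a * m t - (m t)\<^sup>2 + B - K * (x t) powr (q - 2)) + 1"])
    fix t assume "t \<in> {t1..t2}"
    then have t: "t1 \<le> t" by simp
    show "((\<lambda>t. m t + t) has_real_derivative (a * m t - (m t)\<^sup>2 + B - K * (x t) powr (q - 2)) + 1) (at t)"
      by (intro DERIV_add md[OF t] DERIV_ident)
    show "(a * m t - (m t)\<^sup>2 + B - K * (x t) powr (q - 2)) + 1 \<le> 0" using mle[OF t] by linarith
  qed (simp add: t2_def)
  then have "m t2 < 0" by (simp add: t2_def)
  moreover have "0 < x t2" using xR[of t2] R1 by (simp add: t2_def)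
  moreover have "0 < y t2" using pos[of t2] t1(1) by (simp add: t2_def)
  ultimately show False by (simp add: m_def divide_less_0_iff)
qed

lemma fwd_next_turn:
  assumes F: "fwd x y" and "0 < y t0"
  shows "\<exists>\<tau>>t0. y \<tau> = 0 \<and> (\<forall>t. t0 \<le> t \<and> t < \<tau> \<longrightarrow> 0 < y t)"
proof -
  obtain t where "t0 \<le> t" "y t \<le> 0" using fwd_turns[OF F, of t0] by force
  moreover have "continuous_on {t0..t} y" using F unfolding fwd_def
    by (auto intro!: continuous_at_imp_continuous_on dest: DERIV_isCont)
  ultimately show ?thesis using first_zero_after[of t0 t y] assms(2) by blast
qed

text \<open>At positive energy the force at a turning point on the right points to the left, so the trajectory
  keeps moving left until it reaches zero, and reaches it with non-zero speed.\<close>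

lemma fwd_next_zero:
  assumes F: "fwd x y" and y0: "y \<tau> = 0" and x0: "0 < x \<tau>"
  shows "\<exists>\<zeta>>\<tau>. x \<zeta> = 0 \<and> (\<forall>t. \<tau> \<le> t \<and> t < \<zeta> \<longrightarrow> 0 < x t) \<and> (\<forall>t. \<tau> < t \<and> t \<le> \<zeta> \<longrightarrow> y t < 0)"
proof -
  have x: "(x has_real_derivative y t) (at t)" and y: "(y has_real_derivative a * y t - dV (x t)) (at t)"
    and e: "0 < En (x t) (y t)" for t
    using F by (auto simp: fwd_def)
  have xc: "continuous_on S x" and yc: "continuous_on S y" for S
    using x y by (blast intro: continuous_at_imp_continuous_on DERIV_isCont)+
  have turn: "a * y t - dV (x t) < 0" if "0 < x t" "y t = 0" for t
    using dV_pos[of "x t"] e[of t] that by (simp add: En_def)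
  \<comment> \<open>While the position is positive, the velocity can only vanish by decreasing.\<close>
  have neg: "y t < 0" if t: "\<tau> < t" and px: "\<And>s. \<tau> \<le> s \<Longrightarrow> s \<le> t \<Longrightarrow> 0 < x s" for t
  proof -
    obtain d where d: "0 < d" "\<And>h. 0 < h \<Longrightarrow> h < d \<Longrightarrow> y (\<tau> + h) < y \<tau>"
      using DERIV_neg_dec_right[OF y turn[OF x0 y0]] by blast
    define s where "s = \<tau> + min (d/2) (t - \<tau>)"
    have s: "\<tau> < s" "s \<le> t" "y s < 0" using d(2)[of "min (d/2) (t - \<tau>)"] d(1) t y0 by (auto simp: s_def)
    have "0 < - y t"
    proof (rule positive_persists[where f = "\<lambda>t. - y t" and f' = "\<lambda>t. - (a * y t - dV (x t))" and a = s])
      fix r assume r: "s < r" "r \<le> t" "- y r = 0"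
      then have "0 < x r" using px[of r] s by simp
      then show "0 < - (a * y r - dV (x r))" using turn[of r] r by simp
    next
      fix r
      show "((\<lambda>t. - y t) has_real_derivative - (a * y r - dV (x r))) (at r)" by (rule DERIV_minus[OF y])
    qed (use s in auto)
    then show ?thesis by simp
  qed
  have "\<exists>t\<ge>\<tau>. x t \<le> 0"
  proof (rule ccontr)
    assume "\<not> (\<exists>t\<ge>\<tau>. x t \<le> 0)"
    then have px: "0 < x t" if "\<tau> \<le> t" for t using that by force
    show False
      by (rule fwd_not_bounded_monotone[OF F, of "\<tau> + 1" 0]) (use px[THEN less_imp_le] neg[OF _ px] in auto)
  qed
  then obtain \<zeta> where z: "\<tau> < \<zeta>" "x \<zeta> = 0" "\<And>s. \<tau> \<le> s \<Longrightarrow> s < \<zeta> \<Longrightarrow> 0 < x s"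
    using first_zero_after[OF xc x0] by blast
  have n: "y t < 0" if "\<tau> < t" "t < \<zeta>" for t using neg[of t] z that by force
  have "y \<zeta> \<le> 0"
  proof (rule tendsto_upperbound)
    show "(y \<longlongrightarrow> y \<zeta>) (at_left \<zeta>)"
      using DERIV_isCont[OF y] by (simp add: continuous_at_imp_continuous_at_within isCont_def filterlim_at_split)
    show "\<forall>\<^sub>F t in at_left \<zeta>. y t \<le> 0"
      using eventually_at_left_real[OF z(1)] by eventually_elim (use n in force)
  qed simp
  moreover have "y \<zeta> \<noteq> 0" using e[of \<zeta>] z(2) by (auto simp: En_def)
  ultimately show ?thesis using z n by (intro exI[of _ \<zeta>]) (auto simp: less_le)
qed

subsection \<open>Turning points and zeros of the spiral\<close>

text \<open>The \<open>n\<close>-th turning point of the spiral lies on the right for even \<open>n\<close> and on the left for odd \<open>n\<close>;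
  multiplication with this sign reflects it to the right.\<close>

definition sg :: "nat \<Rightarrow> real" where "sg n = (- 1) ^ n"

lemma sg_Suc [simp]: "sg (Suc n) = - sg n" and sg_0 [simp]: "sg 0 = 1"
  by (auto simp: sg_def)

lemma sg_cases: "sg n = 1 \<or> sg n = -1"
  by (induction n) (auto simp: sg_def)

lemma sg_sq [simp]: "sg n * sg n = 1" and sg_abs [simp]: "\<bar>sg n\<bar> = 1"
  using sg_cases[of n] by auto

text \<open>Half a turn of the spiral consists of an arc, from a turning point to the next zero, and of the following rise from
  that zero to the next turning point, on the other side.\<close>

definition arc :: "nat \<Rightarrow> real \<times> real \<Rightarrow> bool" where
  "arc n z \<longleftrightarrow> fst z < snd z \<and> Y (fst z) = 0 \<and> X (snd z) = 0 \<and>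
     (\<forall>t. fst z \<le> t \<and> t < snd z \<longrightarrow> 0 < sg n * X t) \<and> (\<forall>t. fst z < t \<and> t \<le> snd z \<longrightarrow> sg n * Y t < 0)"

definition rise :: "nat \<Rightarrow> real \<Rightarrow> real \<Rightarrow> bool" where
  "rise n \<zeta> \<tau> \<longleftrightarrow> \<zeta> < \<tau> \<and> (\<forall>t. \<zeta> \<le> t \<and> t < \<tau> \<longrightarrow> 0 < sg n * Y t) \<and> (\<forall>t. \<zeta> < t \<and> t \<le> \<tau> \<longrightarrow> 0 < sg n * X t)"

lemma fwd_sg: "fwd (\<lambda>t. sg n * X t) (\<lambda>t. sg n * Y t)"
  using sg_cases[of n] fwd_X fwd_minus[OF fwd_X] by auto

lemma arc_from_turn:
  assumes "Y \<tau> = 0" "0 < sg n * X \<tau>"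
  shows "\<exists>\<zeta>. arc n (\<tau>, \<zeta>)"
  using fwd_next_zero[OF fwd_sg[of n], of \<tau>] assms sg_cases[of n] by (auto simp: arc_def)

lemma first_arc: "\<exists>z. arc 0 z \<and> (\<forall>t<fst z. 0 < X t \<and> 0 < Y t)"
proof -
  obtain t0 where t0: "\<And>t. t \<le> t0 \<Longrightarrow> 0 < X t \<and> 0 < Y t" using X_Y_initial by blast
  obtain \<tau> where \<tau>: "t0 < \<tau>" "Y \<tau> = 0" "\<And>t. t0 \<le> t \<Longrightarrow> t < \<tau> \<Longrightarrow> 0 < Y t"
    using fwd_next_turn[OF fwd_X, of t0] t0[of t0] by auto
  have X: "0 < X t" if "t0 \<le> t" "t \<le> \<tau>" for t
  proof -
    have "X t0 \<le> X t"
    proof (rule increasing_open_real[OF that(1) X_cont X_deriv])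
      fix s assume "t0 < s" "s < t" then show "0 \<le> Y s" using \<tau>(3)[of s] that by simp
    qed
    then show ?thesis using t0[of t0] by simp
  qed
  obtain \<zeta> where "arc 0 (\<tau>, \<zeta>)" using arc_from_turn[of \<tau> 0] \<tau> X[of \<tau>] by auto
  moreover have "0 < X t \<and> 0 < Y t" if "t < \<tau>" for t
    using t0[of t] X[of t] \<tau>(3)[of t] that by (cases "t \<le> t0") auto
  ultimately show ?thesis by (intro exI[of _ "(\<tau>, \<zeta>)"]) auto
qed

lemma next_arc:
  assumes A: "arc n z"
  shows "\<exists>z'. arc (Suc n) z' \<and> rise (Suc n) (snd z) (fst z')"
proof -
  define \<zeta> where "\<zeta> = snd z"
  have z: "X \<zeta> = 0" "0 < sg (Suc n) * Y \<zeta>" using A by (auto simp: arc_def \<zeta>_def)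
  obtain \<tau> where \<tau>: "\<zeta> < \<tau>" "sg (Suc n) * Y \<tau> = 0" "\<And>t. \<zeta> \<le> t \<Longrightarrow> t < \<tau> \<Longrightarrow> 0 < sg (Suc n) * Y t"
    using fwd_next_turn[OF fwd_sg[of "Suc n"], of \<zeta>] z by blast
  have X: "0 < sg (Suc n) * X t" if "\<zeta> < t" "t \<le> \<tau>" for t
  proof -
    have "sg (Suc n) * X \<zeta> < sg (Suc n) * X t"
    proof (rule DERIV_pos_imp_increasing_open[OF that(1)])
      fix s assume "\<zeta> < s" "s < t"
      then show "\<exists>d. ((\<lambda>t. sg (Suc n) * X t) has_real_derivative d) (at s) \<and> 0 < d"
        using \<tau>(3)[of s] that by (intro exI[of _ "sg (Suc n) * Y s"] conjI DERIV_cmult X_deriv) auto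
    qed (intro continuous_intros X_cont)
    then show ?thesis using z by simp
  qed
  have Y0: "Y \<tau> = 0" using \<tau>(2) sg_cases[of "Suc n"] by auto
  obtain \<zeta>' where "arc (Suc n) (\<tau>, \<zeta>')" using arc_from_turn[OF Y0 X[of \<tau>]] \<tau> by auto
  moreover have "rise (Suc n) \<zeta> \<tau>" using \<tau> X by (auto simp: rise_def)
  ultimately show ?thesis by (intro exI[of _ "(\<tau>, \<zeta>')"]) (auto simp: \<zeta>_def)
qed

definition arcs :: "(nat \<Rightarrow> real \<times> real) \<Rightarrow> bool" where
  "arcs f \<longleftrightarrow> (\<forall>n. arc n (f n) \<and> rise (Suc n) (snd (f n)) (fst (f (Suc n)))) \<and>
     (\<forall>t<fst (f 0). 0 < X t \<and> 0 < Y t)"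

lemma arcs_exist: "\<exists>f. arcs f"
proof -
  have "\<exists>f. \<forall>n. (arc n (f n) \<and> (n = 0 \<longrightarrow> (\<forall>t<fst (f n). 0 < X t \<and> 0 < Y t))) \<and>
      rise (Suc n) (snd (f n)) (fst (f (Suc n)))"
    by (rule dependent_nat_choice) (use first_arc next_arc in auto)
  then show ?thesis unfolding arcs_def by blast
qed

definition "turns = (SOME f. arcs f)"
definition "\<tau> n = fst (turns n)"
definition "\<zeta> n = snd (turns n)"

lemma arcs_turns: "arcs turns"
  unfolding turns_def using arcs_exist by (rule someI_ex)

lemma tau_less_zeta: "\<tau> n < \<zeta> n" and Y_tau: "Y (\<tau> n) = 0" and X_zeta: "X (\<zeta> n) = 0"
  and X_arc: "\<tau> n \<le> t \<Longrightarrow> t < \<zeta> n \<Longrightarrow> 0 < sg n * X t"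
  and Y_arc: "\<tau> n < t \<Longrightarrow> t \<le> \<zeta> n \<Longrightarrow> sg n * Y t < 0"
  and zeta_less_tau: "\<zeta> n < \<tau> (Suc n)"
  and Y_rise: "\<zeta> n \<le> t \<Longrightarrow> t < \<tau> (Suc n) \<Longrightarrow> sg n * Y t < 0"
  and X_rise: "\<zeta> n < t \<Longrightarrow> t \<le> \<tau> (Suc n) \<Longrightarrow> sg n * X t < 0"
  and X_Y_before: "t < \<tau> 0 \<Longrightarrow> 0 < X t \<and> 0 < Y t"
  using arcs_turns unfolding arcs_def arc_def rise_def \<tau>_def \<zeta>_def by auto

lemma Y_half_turn: "\<tau> n < t \<Longrightarrow> t < \<tau> (Suc n) \<Longrightarrow> sg n * Y t < 0"
  using Y_arc[of n t] Y_rise[of n t] by linarith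

lemma tau_mono: "strict_mono \<tau>"
  using tau_less_zeta zeta_less_tau by (intro strict_mono_Suc_iff[THEN iffD2]) (meson less_trans)

text \<open>Zeros and turning points cannot accumulate, because the phase point never reaches the origin.\<close>

lemma tau_unbounded: "\<exists>n. C < \<tau> n"
proof (rule ccontr)
  assume "\<not> (\<exists>n. C < \<tau> n)"
  then have C: "\<tau> n \<le> C" for n by (simp add: not_less)
  have inc: "incseq \<tau>" using tau_mono by (simp add: incseq_def strict_mono_less_eq)
  then obtain T where T: "\<tau> \<longlonglongrightarrow> T" using incseq_convergent[OF inc] C by blast
  have "(\<lambda>n. \<tau> (Suc n)) \<longlonglongrightarrow> T" using T by (rule LIMSEQ_Suc)
  then have Z: "\<zeta> \<longlonglongrightarrow> T"
    by (rule tendsto_sandwich[OF _ _ T, rotated 2])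
       (auto intro!: always_eventually less_imp_le tau_less_zeta zeta_less_tau)
  have "(\<lambda>n. X (\<zeta> n)) \<longlonglongrightarrow> X T" "(\<lambda>n. Y (\<tau> n)) \<longlonglongrightarrow> Y T"
    using isCont_tendsto_compose[OF DERIV_isCont[OF X_deriv] Z] isCont_tendsto_compose[OF DERIV_isCont[OF Y_deriv] T] by auto
  then have "X T = 0" "Y T = 0" by (simp_all add: X_zeta Y_tau LIMSEQ_const_iff)
  then show False using En_X_pos[of T] by (simp add: En_def)
qed

text \<open>Outside the arcs, position and velocity have the same sign or one of them vanishes.\<close>

lemma arc_cover:
  assumes "X t * Y t < 0"
  shows "\<exists>n. \<tau> n < t \<and> t < \<zeta> n"
proof -
  define m where "m = (LEAST n. t < \<tau> n)"
  have m: "t < \<tau> m" unfolding m_def using tau_unbounded by (rule LeastI_ex)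
  have "m \<noteq> 0" using X_Y_before[of t] m assms by (cases "m = 0") (auto simp: mult_less_0_iff)
  then obtain n where n: "m = Suc n" by (cases m) auto
  have "\<tau> n \<le> t" using not_less_Least[of n "\<lambda>n. t < \<tau> n"] n by (simp add: m_def)
  moreover have "\<tau> n \<noteq> t" using assms Y_tau[of n] by auto
  moreover have "t < \<zeta> n"
  proof (rule ccontr)
    assume "\<not> t < \<zeta> n"
    then have "t = \<zeta> n \<or> \<zeta> n < t" by linarith
    then have "sg n * Y t < 0" "t = \<zeta> n \<or> sg n * X t < 0"
      using Y_rise[of n t] X_rise[of n t] m n by auto
    then have "X t * Y t \<ge> 0" using X_zeta[of n] sg_cases[of n] by (auto simp: mult_nonpos_nonpos)
    with assms show False by simp
  qed
  ultimately show ?thesis by (intro exI[of _ n]) auto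
qed

definition M :: "nat \<Rightarrow> real" where "M n = sg n * X (\<tau> n)"

lemma M_pos: "0 < M n"
  unfolding M_def using X_arc[of n "\<tau> n"] tau_less_zeta by simp

lemma En_sg: "En (sg n * x) y = En x y" "En x (sg n * y) = En x y" "V (sg n * x) = V x"
  using sg_cases[of n] by auto

lemma V_M: "V (M n) = En (X (\<tau> n)) (Y (\<tau> n))"
  by (simp add: M_def En_sg Y_tau) (simp add: En_def)

lemma V_M_pos: "0 < V (M n)"
  unfolding V_M by (rule En_X_pos)

lemma V_pos_beyond_M: "M n \<le> v \<Longrightarrow> 0 < V v"
  using V_less[of "M n" v] V_M_pos[of n] M_pos[of n] by (cases "v = M n") auto

lemma En_X_strict:
  assumes "s < t" "\<And>r. s < r \<Longrightarrow> r < t \<Longrightarrow> Y r \<noteq> 0"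
  shows "En (X s) (Y s) < En (X t) (Y t)"
  using En_strict[OF traj_X[of t], of 0 "t - s"] assms by auto

text \<open>The spiral, started at its turning points, or at any other time \<open>t\<close>, and run inwards.
  The sign makes the start lie on the right.\<close>

definition Rx :: "nat \<Rightarrow> real \<Rightarrow> real \<Rightarrow> real" where "Rx n t s = sg n * X (t - s)"
definition Ry :: "nat \<Rightarrow> real \<Rightarrow> real \<Rightarrow> real" where "Ry n t s = - sg n * Y (t - s)"

lemma traj_R: "traj (Rx n t) (Ry n t)"
  unfolding Rx_def[abs_def] Ry_def[abs_def]
  using sg_cases[of n] traj_X[of t] traj_X'[of t] by auto

lemma R_start: "Rx n (\<tau> n) 0 = M n" "Ry n (\<tau> n) 0 = 0"
  by (simp_all add: Rx_def Ry_def M_def Y_tau)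

lemma R_Suc_neg: "0 < s \<Longrightarrow> s < \<tau> (Suc n) - \<tau> n \<Longrightarrow> Ry (Suc n) (\<tau> (Suc n)) s < 0"
  using Y_half_turn[of n "\<tau> (Suc n) - s"] by (simp add: Ry_def)

lemma R_Suc_end: "Rx (Suc n) (\<tau> (Suc n)) (\<tau> (Suc n) - \<tau> n) = - M n" "Ry (Suc n) (\<tau> (Suc n)) (\<tau> (Suc n) - \<tau> n) = 0"
  by (simp_all add: Rx_def Ry_def M_def Y_tau)

lemma R_0_neg: "0 < s \<Longrightarrow> Ry 0 (\<tau> 0) s < 0" and R_0_pos: "0 \<le> s \<Longrightarrow> 0 < Rx 0 (\<tau> 0) s"
  using X_Y_before[of "\<tau> 0 - s"] M_pos[of 0] by (auto simp: Ry_def Rx_def M_def le_less)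

lemma En_R: "En (Rx n t s) (Ry n t s) = En (X (t - s)) (Y (t - s))"
  unfolding Rx_def Ry_def using sg_cases[of n] by auto

lemma R_0_lim: "(Rx 0 (\<tau> 0) \<longlongrightarrow> 0) at_top" "((\<lambda>s. En (Rx 0 (\<tau> 0) s) (Ry 0 (\<tau> 0) s)) \<longlongrightarrow> 0) at_top"
proof -
  obtain l where l: "(Rx 0 (\<tau> 0) \<longlongrightarrow> l) at_top" "dV l = 0"
    "((\<lambda>s. En (Rx 0 (\<tau> 0) s) (Ry 0 (\<tau> 0) s)) \<longlongrightarrow> V l) at_top"
    using settles[OF traj_R[of 0 "\<tau> 0"], of 1] R_0_neg by auto
  have "((\<lambda>s. exp (\<gamma> * (\<tau> 0 - s))) \<longlongrightarrow> 0) at_top"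
    by (rule filterlim_compose[OF filterlim_exp_at_bot_0[OF gam_pos] filterlim_diff_at_bot])
  then have e: "((\<lambda>s. exp (\<gamma> * (\<tau> 0 - s)) * 1) \<longlongrightarrow> 0) at_top" by simp
  have "\<bar>X (\<tau> 0 - s)\<bar> \<le> exp (\<gamma> * (\<tau> 0 - s)) * 1" for s
    unfolding X_def abs_mult using w0_le by (intro mult_mono) auto
  then have "\<forall>\<^sub>F s in at_top. norm (Rx 0 (\<tau> 0) s) \<le> exp (\<gamma> * (\<tau> 0 - s)) * 1"
    by (intro always_eventually allI) (simp add: Rx_def)
  then have R: "(Rx 0 (\<tau> 0) \<longlongrightarrow> 0) at_top" using e by (rule Lim_null_comparison)
  then have "l = 0" using tendsto_unique[OF _ l(1) R] by simp
  with R show "(Rx 0 (\<tau> 0) \<longlongrightarrow> 0) at_top" "((\<lambda>s. En (Rx 0 (\<tau> 0) s) (Ry 0 (\<tau> 0) s)) \<longlongrightarrow> 0) at_top"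
    using l(3) by auto
qed

text \<open>On its way into the origin the spiral follows the direction \<open>y = -\<gamma> x\<close> of the regular linear solutions, with a
  defect controlled by the nonlinearity.\<close>

lemma slope_near_origin:
  "\<exists>C\<ge>0. \<exists>\<xi>>0. \<xi> < M 0 \<and> (\<forall>s\<ge>0. Rx 0 (\<tau> 0) s \<le> \<xi> \<longrightarrow>
      Ry 0 (\<tau> 0) s \<le> - (\<gamma> - C * Rx 0 (\<tau> 0) s powr (q - 2)) * Rx 0 (\<tau> 0) s)"
proof -
  obtain t0 where t0: "\<And>t. t \<le> t0 \<Longrightarrow> 0 < X t \<and> 0 < Y t \<and> 1/2 \<le> w0 t" using X_Y_initial by blast
  define t1 where "t1 = min t0 (\<tau> 0 - 1)"
  have inc: "X s < X t" if "s < t" "t \<le> \<tau> 0" for s t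
  proof (rule DERIV_pos_imp_increasing_open[OF that(1)])
    fix r assume "s < r" "r < t"
    then show "\<exists>d. (X has_real_derivative d) (at r) \<and> 0 < d"
      using X_deriv X_Y_before[of r] that by (intro exI[of _ "Y r"]) auto
  qed (rule X_cont)
  define C where "C = 2 * (K / (\<mu> + \<rho>)) * 2 powr (q - 2)"
  have C0: "0 \<le> C" using K mu rho_pos by (simp add: C_def)
  have "- Y t \<le> - (\<gamma> - C * X t powr (q - 2)) * X t" if t: "t \<le> \<tau> 0" "X t \<le> X t1" for t
  proof -
    have "t \<le> t1" using inc[of t1 t] t by (force simp: t1_def)
    then have w: "1/2 \<le> w0 t" "0 < X t" using t0 by (auto simp: t1_def)
    have "exp (\<rho> * t) \<le> 2 powr (q - 2) * X t powr (q - 2)"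
    proof -
      have "exp (\<rho> * t) = exp (\<gamma> * t) powr (q - 2)" by (simp add: powr_def \<rho>_def mult_ac)
      also have "\<dots> \<le> (2 * X t) powr (q - 2)"
        using w q by (intro powr_mono2) (auto simp: X_def)
      also have "\<dots> = 2 powr (q - 2) * X t powr (q - 2)" using w by (simp add: powr_mult)
      finally show ?thesis .
    qed
    then have "K / (\<mu> + \<rho>) * exp (\<rho> * t) \<le> K / (\<mu> + \<rho>) * (2 powr (q - 2) * X t powr (q - 2))"
      using K mu rho_pos by (intro mult_left_mono) auto
    then have p: "- p0 t \<le> K / (\<mu> + \<rho>) * (2 powr (q - 2) * X t powr (q - 2))"
      using p0_bound[of t] by linarith
    also have "\<dots> \<le> C * X t powr (q - 2) * w0 t"
    proof -
      have "K / (\<mu> + \<rho>) * (2 powr (q - 2) * X t powr (q - 2)) * 1 \<le> K / (\<mu> + \<rho>) * (2 powr (q - 2) * X t powr (q - 2)) * (2 * w0 t)"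
        using w K mu rho_pos by (intro mult_left_mono) auto
      then show ?thesis by (simp add: C_def mult_ac)
    qed
    finally have "exp (\<gamma> * t) * - p0 t \<le> exp (\<gamma> * t) * (C * X t powr (q - 2) * w0 t)"
      by (intro mult_left_mono) auto
    then show ?thesis by (simp add: Y_def X_def algebra_simps)
  qed
  then have "Ry 0 (\<tau> 0) s \<le> - (\<gamma> - C * Rx 0 (\<tau> 0) s powr (q - 2)) * Rx 0 (\<tau> 0) s" if "0 \<le> s" "Rx 0 (\<tau> 0) s \<le> X t1" for s
    using that by (auto simp: Rx_def Ry_def)
  moreover have "0 < X t1" using t0[of t1] by (simp add: t1_def)
  moreover have "X t1 < M 0" using inc[of t1 "\<tau> 0"] by (simp add: M_def t1_def)
  ultimately show ?thesis using C0 by blast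
qed

section \<open>Regular orbits\<close>

text \<open>Scaling: the equation is invariant under \<open>w(t) \<mapsto> e\<^bsup>\<gamma>c\<^esup> w(t + c)\<close> and under reflection.\<close>

lemma scaled_core:
  assumes "\<bar>\<sigma>\<bar> = 1"
  shows "((\<lambda>t. \<sigma> * exp (\<gamma> * c) * w0 (t + c)) has_real_derivative \<sigma> * exp (\<gamma> * c) * p0 (t + c)) (at t)" (is ?A)
    and "((\<lambda>t. \<sigma> * exp (\<gamma> * c) * p0 (t + c)) has_real_derivative - \<mu> * (\<sigma> * exp (\<gamma> * c) * p0 (t + c)) +
       exp (\<rho> * t) * (- K * spow q (\<sigma> * exp (\<gamma> * c) * w0 (t + c)))) (at t)" (is ?B)
    and "((\<lambda>t. \<sigma> * exp (\<gamma> * c) * w0 (t + c)) \<longlongrightarrow> \<sigma> * exp (\<gamma> * c)) at_bot" (is ?C)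
proof -
  have sh: "((\<lambda>t. f (t + c)) has_real_derivative D) (at t)" if "(f has_real_derivative D) (at (t + c))" for f D
    using that by (simp add: DERIV_shift)
  show ?A by (intro DERIV_cmult sh w0_deriv)
  have s: "spow q (\<sigma> * exp (\<gamma> * c) * w) = \<sigma> * (exp (\<gamma> * c) * exp (\<rho> * c) * spow q w)" for w
  proof -
    have "\<sigma> = 1 \<or> \<sigma> = -1" using assms by linarith
    then show ?thesis using spow_exp[of c w] spow_minus[of q "exp (\<gamma> * c) * w"] by auto
  qed
  show ?B
    by (rule DERIV_cong[OF DERIV_cmult[OF sh[OF p0_deriv]]])
       (simp only: s, simp add: algebra_simps exp_add)
  have "((\<lambda>t. w0 (t + c)) \<longlongrightarrow> 1) at_bot"
    using filterlim_compose[OF w0_lim filterlim_add_at_bot[of c]] by (simp add: add.commute)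
  then have "((\<lambda>t. \<sigma> * exp (\<gamma> * c) * w0 (t + c)) \<longlongrightarrow> \<sigma> * exp (\<gamma> * c) * 1) at_bot" by (intro tendsto_intros)
  then show ?C by simp
qed

text \<open>By uniqueness at minus infinity, the member of the scaling family with limit \<open>d\<close> is the given solution; the limit
  zero would make it vanish identically.\<close>

lemma regular_orbit:
  assumes T: "traj x y" and l: "((\<lambda>t. exp (- \<gamma> * t) * x (- t)) \<longlongrightarrow> d) at_bot" and nz: "x s1 \<noteq> 0" "0 \<le> s1"
  shows "\<exists>\<sigma> c. \<bar>\<sigma>\<bar> = 1 \<and> d = \<sigma> * exp (\<gamma> * c) \<and> (\<forall>s\<ge>0. x s = \<sigma> * X (c - s) \<and> y s = - \<sigma> * Y (c - s))"
proof -
  have un: "exp (- \<gamma> * t) * x (- t) = w2 t \<and> exp (- \<gamma> * t) * (- \<gamma> * x (- t) - y (- t)) = p2 t"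
    if w2: "\<And>t. (w2 has_real_derivative p2 t) (at t)"
      and p2: "\<And>t. (p2 has_real_derivative - \<mu> * p2 t + exp (\<rho> * t) * (- K * spow q (w2 t))) (at t)"
      and l2: "(w2 \<longlongrightarrow> d) at_bot" and t: "t \<le> 0" for w2 p2 t
    by (rule singular_unique[where h = "\<lambda>x. - K * spow q x" and T = 0 and d = d
          and ?w1.0 = "\<lambda>t. exp (- \<gamma> * t) * x (- t)" and ?p1.0 = "\<lambda>t. exp (- \<gamma> * t) * (- \<gamma> * x (- t) - y (- t))",
          OF mu rho_pos])
       (rule spow_local_lipschitz[OF q] w_of_traj_deriv[OF T] l w2 p2 l2 t | assumption)+
  have d0: "d \<noteq> 0"
  proof
    assume "d = 0"
    have "exp (- \<gamma> * - s1) * x (- (- s1)) = 0 \<and> exp (- \<gamma> * - s1) * (- \<gamma> * x (- (- s1)) - y (- (- s1))) = 0"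
      by (rule un[where ?w2.0 = "\<lambda>_. 0" and ?p2.0 = "\<lambda>_. 0"]) (use nz \<open>d = 0\<close> in auto)
    then show False using nz by simp
  qed
  define \<sigma> c where "\<sigma> = sgn d" and "c = ln \<bar>d\<bar> / \<gamma>"
  have \<sigma>: "\<bar>\<sigma>\<bar> = 1" using d0 by (simp add: \<sigma>_def abs_sgn_eq)
  have d: "\<sigma> * exp (\<gamma> * c) = d" using d0 gam_pos by (simp add: \<sigma>_def c_def sgn_mult_abs)
  have "x s = \<sigma> * X (c - s) \<and> y s = - \<sigma> * Y (c - s)" if s: "0 \<le> s" for s
  proof -
    have "exp (- \<gamma> * - s) * x (- (- s)) = \<sigma> * exp (\<gamma> * c) * w0 (- s + c) \<and>
       exp (- \<gamma> * - s) * (- \<gamma> * x (- (- s)) - y (- (- s))) = \<sigma> * exp (\<gamma> * c) * p0 (- s + c)"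
      by (rule un[where ?w2.0 = "\<lambda>t. \<sigma> * exp (\<gamma> * c) * w0 (t + c)" and ?p2.0 = "\<lambda>t. \<sigma> * exp (\<gamma> * c) * p0 (t + c)",
            OF scaled_core(1,2)[OF \<sigma>]])
         (use scaled_core(3)[OF \<sigma>, of c] d s in simp_all)
    then have e: "exp (\<gamma> * s) * x s = \<sigma> * exp (\<gamma> * c) * w0 (c - s)"
      "exp (\<gamma> * s) * (- \<gamma> * x s - y s) = \<sigma> * exp (\<gamma> * c) * p0 (c - s)" by simp_all
    have xs: "x s = \<sigma> * exp (\<gamma> * (c - s)) * w0 (c - s)"
      using e(1) by (simp add: exp_diff right_diff_distrib field_simps)
    have "- \<gamma> * x s - y s = \<sigma> * exp (\<gamma> * (c - s)) * p0 (c - s)"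
      using e(2) by (simp add: exp_diff right_diff_distrib field_simps)
    then show ?thesis using xs by (simp add: X_def Y_def algebra_simps)
  qed
  with \<sigma> d show ?thesis by blast
qed

text \<open>For a solution of one sign near minus infinity \<open>e\<^bsup>\<mu>t\<^esup> w'\<close> is monotone, so \<open>w\<close> itself is
  eventually monotone and has a finite or infinite limit: there is no third kind of behaviour at the origin.\<close>

lemma finite_or_infinite_limit:
  assumes T: "traj x y" and pos: "\<And>s. s0 \<le> s \<Longrightarrow> 0 < x s"
  shows "(\<exists>d. ((\<lambda>t. exp (- \<gamma> * t) * x (- t)) \<longlongrightarrow> d) at_bot) \<or>
     filterlim (\<lambda>t. exp (- \<gamma> * t) * x (- t)) at_top at_bot"
proof -
  define s1 where "s1 = max 0 s0"
  define W where "W s = exp (\<gamma> * s) * x s" for s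
  define P where "P s = exp (\<gamma> * s) * (\<gamma> * x s + y s)" for s
  note e = exp_scale_deriv
  have Wd: "(W has_real_derivative P s) (at s)" if "s1 \<le> s" for s
    unfolding W_def[abs_def] P_def
    by (rule DERIV_cong[OF DERIV_mult[OF e traj_x[OF T]]]) (use that in \<open>auto simp: s1_def algebra_simps\<close>)
  define A where "A s = exp (- \<mu> * s) * P s" for s
  have Ad: "(A has_real_derivative - K * exp ((\<gamma> - \<mu>) * s) * spow q (x s)) (at s)" if "s1 \<le> s" for s
  proof -
    have AA: "A = (\<lambda>s. exp ((\<gamma> - \<mu>) * s) * (\<gamma> * x s + y s))"
      by (auto simp: A_def P_def algebra_simps exp_add[symmetric])
    show ?thesis unfolding AA
      by (rule DERIV_cong[OF DERIV_mult[OF e DERIV_add[OF DERIV_cmult[OF traj_x[OF T]] traj_y[OF T]]]])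
         (use that in \<open>auto simp: s1_def dV_def a_def B_def algebra_simps\<close>)
  qed
  have Aanti: "A t \<le> A s" if "s1 \<le> s" "s \<le> t" for s t
  proof (rule deriv_nonpos_imp_antimono[OF Ad _ that(2)])
    fix r assume "r \<in> {s..t}"
    then have "s1 \<le> r" using that by auto
    then have "0 < spow q (x r)" by (intro spow_pos pos) (auto simp: s1_def)
    then show "- K * exp ((\<gamma> - \<mu>) * r) * spow q (x r) \<le> 0" using K by (simp add: mult_nonneg_nonneg)
  qed (use that in auto)
  have Wpos: "0 < W s" if "s1 \<le> s" for s using pos[of s] that by (simp add: W_def s1_def)
  have key: "(\<exists>d. (W \<longlongrightarrow> d) at_top) \<or> filterlim W at_top at_top"
  proof (cases "\<exists>s2\<ge>s1. A s2 \<le> 0")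
    case True
    then obtain s2 where s2: "s1 \<le> s2" "A s2 \<le> 0" by blast
    have "W t \<le> W s" if "s2 \<le> s" "s \<le> t" for s t
    proof (rule deriv_nonpos_imp_antimono[OF Wd _ that(2)])
      fix r assume "r \<in> {s..t}"
      then have "A r \<le> 0" using Aanti[of s2 r] s2 that by auto
      then show "P r \<le> 0" by (simp add: A_def mult_le_0_iff)
    qed (use that s2 in auto)
    then show ?thesis using antimono_tendsto_at_top[of s2 W 0] Wpos s2 by (force simp: less_imp_le)
  next
    case False
    have inc: "W s \<le> W t" if "s1 \<le> s" "s \<le> t" for s t
    proof (rule deriv_nonneg_imp_mono[OF Wd _ that(2)])
      fix r assume "r \<in> {s..t}"
      then have "s1 \<le> r" using that by auto
      then have "0 < A r" using False by force
      then show "0 \<le> P r" by (simp add: A_def zero_less_mult_iff)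
    qed (use that in auto)
    show ?thesis
    proof (cases "\<exists>C. \<forall>s\<ge>s1. W s \<le> C")
      case True
      then obtain C where C: "\<And>s. s1 \<le> s \<Longrightarrow> W s \<le> C" by blast
      obtain l where "((\<lambda>s. - W s) \<longlongrightarrow> l) at_top"
        using antimono_tendsto_at_top[of s1 "\<lambda>s. - W s" "- C"] inc C by force
      then have "((\<lambda>s. - (- W s)) \<longlongrightarrow> - l) at_top" by (rule tendsto_minus)
      then show ?thesis by auto
    next
      case unb: False
      have "filterlim W at_top at_top"
        unfolding filterlim_at_top
      proof
        fix Z
        obtain s where s: "s1 \<le> s" "Z < W s" using unb by (meson not_le)
        then show "\<forall>\<^sub>F t in at_top. Z \<le> W t"
          using inc[of s] by (intro eventually_mono[OF eventually_ge_at_top[of s]]) force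
      qed
      then show ?thesis by simp
    qed
  qed
  have eq: "(\<lambda>t. exp (- \<gamma> * t) * x (- t)) = (\<lambda>t. W (- t))" by (auto simp: W_def)
  have *: "filterlim (\<lambda>t. W (- t)) F at_bot" if "filterlim W F at_top" for F
    using filterlim_compose[OF that filterlim_uminus_at_top_at_bot] by simp
  show ?thesis unfolding eq using key * by blast
qed

section \<open>Counting zeros\<close>

lemma first_return:
  assumes T: "traj x y" and e: "0 < e" "\<And>s. 0 < s \<Longrightarrow> s < e \<Longrightarrow> y s < 0"
  shows "(\<forall>s>0. y s < 0) \<or> (\<exists>s1>0. y s1 = 0 \<and> (\<forall>s. 0 < s \<and> s < s1 \<longrightarrow> y s < 0))"
proof (cases "\<forall>s>0. y s < 0")
  case False
  then obtain s where s: "0 < s" "0 \<le> y s" by (auto simp: not_less)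
  have es: "e \<le> s" using e(2)[of s] s by force
  have "continuous_on {e/2..s} (\<lambda>s. - y s)"
    using e(1) by (intro continuous_intros traj_cont[OF T]) auto
  from first_zero_after[OF this] e(2)[of "e/2"] e(1) es s obtain z where
    z: "e/2 < z" "y z = 0" "\<And>s. e/2 \<le> s \<Longrightarrow> s < z \<Longrightarrow> y s < 0" by auto
  have "y s < 0" if "0 < s" "s < z" for s
    using z(3)[of s] e(2)[of s] that e(1) by (cases "e/2 \<le> s") auto
  with z e(1) show ?thesis by (intro disjI2 exI[of _ z]) auto
qed simp

lemma starts_left:
  assumes T: "traj x y" and "y 0 < 0 \<or> y 0 = 0 \<and> 0 < dV (x 0)"
  shows "\<exists>e>0. \<forall>s. 0 < s \<and> s < e \<longrightarrow> y s < 0"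
  using assms(2)
proof
  assume neg: "y 0 < 0"
  have "isCont y 0" using DERIV_isCont[OF traj_y[OF T, of 0]] by simp
  then have "\<forall>\<^sub>F s in at 0. y s < 0" using neg unfolding isCont_def by (rule order_tendstoD)
  then obtain e where "0 < e" "\<And>s. s \<noteq> 0 \<Longrightarrow> dist s 0 < e \<Longrightarrow> y s < 0"
    unfolding eventually_at by auto
  then show ?thesis by (intro exI[of _ e]) (auto simp: dist_real_def)
next
  assume z: "y 0 = 0 \<and> 0 < dV (x 0)"
  have "\<exists>d>0. \<forall>h>0. h < d \<longrightarrow> y (0 + h) < y 0"
    by (rule DERIV_neg_dec_right[OF traj_y[OF T order.refl]]) (use z in simp)
  then show ?thesis using z by auto
qed

lemma return_dV:
  assumes T: "traj x y" and s1: "0 < s1" "y s1 = 0" and neg: "\<And>s. 0 < s \<Longrightarrow> s < s1 \<Longrightarrow> y s < 0"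
  shows "dV (x s1) < 0"
proof (rule ccontr)
  assume "\<not> dV (x s1) < 0"
  then consider "dV (x s1) = 0" | "0 < dV (x s1)" by linarith
  then show False
  proof cases
    case 1
    then have "y (s1/2) = 0" using traj_equilibrium[OF T 1 s1(2)] s1 by simp
    with neg[of "s1/2"] s1 show False by simp
  next
    case 2
    have "\<exists>d>0. \<forall>h>0. h < d \<longrightarrow> y s1 < y (s1 - h)"
      by (rule DERIV_neg_dec_left[OF traj_y[OF T]]) (use 2 s1 in auto)
    then obtain d where d: "0 < d" "\<And>h. 0 < h \<Longrightarrow> h < d \<Longrightarrow> 0 < y (s1 - h)" using s1 by auto
    define h where "h = min (d/2) (s1/2)"
    have "0 < h" "h < d" "0 < s1 - h" "s1 - h < s1" using d s1 by (auto simp: h_def)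
    with d(2)[of h] neg[of "s1 - h"] show False by simp
  qed
qed

text \<open>At a turning point reached from the right the force points to the right. On the right half line this only happens
  where the potential is negative: the trajectory then stays in the right well for ever.\<close>

lemma return_left_or_trapped:
  assumes T: "traj x y" and s1: "0 < s1" "y s1 = 0" and neg: "\<And>s. 0 < s \<Longrightarrow> s < s1 \<Longrightarrow> y s < 0"
  shows "x s1 < 0 \<and> 0 < dV (- x s1) \<or> 0 < x s1 \<and> En (x s1) (y s1) < 0"
proof -
  have d: "dV (x s1) < 0" by (rule return_dV[OF assms])
  consider "x s1 < 0" | "x s1 = 0" | "0 < x s1" by linarith
  then show ?thesis
  proof cases
    case 3
    then have "V (x s1) < 0" using dV_pos[of "x s1"] d by force
    then show ?thesis using 3 s1 by (simp add: En_def)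
  qed (use d in auto)
qed

lemma moving_left_decreasing:
  assumes T: "traj x y" and neg: "\<And>s. 0 < s \<Longrightarrow> s < s1 \<Longrightarrow> y s < 0" and "0 \<le> u" "u < v" "v \<le> s1"
  shows "x v < x u"
  by (rule traj_decreasing[OF T assms(3,4)]) (use neg assms in auto)

text \<open>A trajectory that outruns another one all the way and never turns must come to rest at a place
  whose potential is at least the energy of the slower trajectory there.\<close>

lemma energy_of_limit:
  assumes 1: "traj x1 y1" and 2: "traj x2 y2"
    and n1: "\<And>s. 0 < s \<Longrightarrow> s < r1 \<Longrightarrow> y1 s < 0" and "y1 0 \<le> 0" and n2: "\<And>s. 0 < s \<Longrightarrow> y2 s < 0"
    and start: "x1 0 \<le> x2 0" "\<And>s. 0 \<le> s \<Longrightarrow> x2 s = x1 0 \<Longrightarrow> y2 s < y1 0"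
    and lim: "(x2 \<longlongrightarrow> l) at_top" "((\<lambda>s. En (x2 s) (y2 s)) \<longlongrightarrow> V l) at_top" "\<And>s. 1 \<le> s \<Longrightarrow> l < x2 s"
    and r: "0 \<le> r" "r < r1" "x1 r = l" "l < x1 0"
  shows "En (x1 r) (y1 r) \<le> V l"
proof (rule tendsto_lowerbound[OF lim(2)])
  have "\<forall>\<^sub>F \<sigma> in at_top. x2 \<sigma> < x1 0" using lim(1) r(4) by (rule order_tendstoD)
  then show "\<forall>\<^sub>F \<sigma> in at_top. En (x1 r) (y1 r) \<le> En (x2 \<sigma>) (y2 \<sigma>)"
    using eventually_ge_at_top[of 1]
  proof eventually_elim
    case (elim \<sigma>)
    then have "l < x2 \<sigma>" by (intro lim) simp
    then obtain s where s: "0 \<le> s" "s \<le> r" "x1 s = x2 \<sigma>"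
      using IVT2'[of x1 r "x2 \<sigma>" 0] elim r traj_cont[OF 1] by auto
    have "y2 \<sigma> < y1 s"
      by (rule no_crossing[OF 1 2, where ?s1.0 = r1 and ?s2.0 = \<sigma>]) (use n1 n2 start s r elim in auto)
    moreover have "y1 s \<le> 0" using n1[of s] s r \<open>y1 0 \<le> 0\<close> by (cases "s = 0") auto
    ultimately have "(y1 s)\<^sup>2 \<le> (y2 \<sigma>)\<^sup>2" by (simp add: abs_le_square_iff[symmetric])
    then have "En (x1 s) (y1 s) \<le> En (x2 \<sigma>) (y2 \<sigma>)" using s by (simp add: En_def)
    moreover have "En (x1 r) (y1 r) \<le> En (x1 s) (y1 s)" by (rule En_antimono[OF 1 s(1,2)])
    ultimately show ?case by linarith
  qed
qed simp

text \<open>If the faster trajectory never turned, it would come to rest at an equilibrium \<open>l\<close>. Whether \<open>l\<close> lies beyond the end of the slower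
  trajectory, before its start, or on its way, the potential at \<open>l\<close> is positive, and no equilibrium has positive
  potential.\<close>

lemma must_turn:
  assumes 1: "traj x1 y1" and 2: "traj x2 y2"
    and n1: "\<And>s. 0 < s \<Longrightarrow> s < r1 \<Longrightarrow> y1 s < 0" and "y1 0 \<le> 0" and n2: "\<And>s. 0 < s \<Longrightarrow> y2 s < 0"
    and start: "x1 0 \<le> x2 0" "\<And>s. 0 \<le> s \<Longrightarrow> x2 s = x1 0 \<Longrightarrow> y2 s < y1 0"
    and "x1 0 = x2 0 \<or> 0 < x1 0 \<and> 0 < V (x1 0)"
    and r1: "0 < r1" "x1 r1 < 0" "0 < V (x1 r1)"
  shows False
proof -
  obtain l where l: "(x2 \<longlongrightarrow> l) at_top" "dV l = 0" "\<And>s. 1 \<le> s \<Longrightarrow> l < x2 s"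
    "((\<lambda>s. En (x2 s) (y2 s)) \<longlongrightarrow> V l) at_top"
    using settles[OF 2, of 1] n2 by auto
  have "l < x2 0" using l(3)[of 1] moving_left_decreasing[OF 2, of 1 0 1] n2 by auto
  have "0 < V l"
  proof (cases "l \<le> x1 r1")
    case True
    then show ?thesis using V_less[of "- x1 r1" "- l"] r1 by (cases "l = x1 r1") auto
  next
    case False
    show ?thesis
    proof (cases "x1 0 \<le> l")
      case True
      then have "0 < x1 0" "0 < V (x1 0)" using assms(8) \<open>l < x2 0\<close> by auto
      then show ?thesis using V_less[of "x1 0" l] True by (cases "l = x1 0") auto
    next
      case False': False
      obtain r where r: "0 \<le> r" "r \<le> r1" "x1 r = l"
        using IVT2'[of x1 r1 l 0] traj_cont[OF 1] r1 False False' by auto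
      have "r < r1" using r False by (cases "r = r1") auto
      have "En (x1 r1) (y1 r1) \<le> En (x1 r) (y1 r)" by (rule En_antimono[OF 1 r(1,2)])
      moreover have "En (x1 r) (y1 r) \<le> V l"
        by (rule energy_of_limit[OF 1 2 n1 \<open>y1 0 \<le> 0\<close> n2 start l(1,4,3) r(1) \<open>r < r1\<close> r(3)]) (use False' in auto)
      moreover have "V (x1 r1) \<le> En (x1 r1) (y1 r1)" by (simp add: En_def)
      ultimately show ?thesis using r1 by linarith
    qed
  qed
  with l(2) dV_nonzero show False by blast
qed

text \<open>Started below the innermost turning point of the spiral, a trajectory stays behind the last,
  non-returning branch of the spiral and cannot reach zero.\<close>

lemma no_zero_inside:
  assumes T: "traj x y" and i: "y 0 = 0" "0 < x 0" "x 0 < M 0" "0 < dV (x 0)" and "0 \<le> s"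
  shows "x s \<noteq> 0"
proof -
  have pos: "0 < x s'" if s': "0 < s'" and neg: "\<And>s. 0 < s \<Longrightarrow> s < s' \<Longrightarrow> y s < 0" for s'
  proof (rule ccontr)
    assume "\<not> 0 < x s'"
    then obtain z where z: "0 \<le> z" "z \<le> s'" "x z = 0"
      using IVT2'[of x s' 0 0] traj_cont[OF T] i s' by auto
    have z0: "0 < z" using z i by (cases "z = 0") auto
    have "y z \<noteq> 0" using traj_zero[OF T z(3) _ z(1), of 0] i by auto
    then have ez: "0 < En (x z) (y z)" using z by (simp add: En_def)
    have "\<forall>\<^sub>F \<sigma> in at_top. Rx 0 (\<tau> 0) \<sigma> < x 0" "\<forall>\<^sub>F \<sigma> in at_top. En (Rx 0 (\<tau> 0) \<sigma>) (Ry 0 (\<tau> 0) \<sigma>) < En (x z) (y z)"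
      using order_tendstoD(2)[OF R_0_lim(1) i(2)] order_tendstoD(2)[OF R_0_lim(2) ez] by auto
    then have "\<forall>\<^sub>F \<sigma> in at_top. Rx 0 (\<tau> 0) \<sigma> < x 0 \<and> En (Rx 0 (\<tau> 0) \<sigma>) (Ry 0 (\<tau> 0) \<sigma>) < En (x z) (y z) \<and> 0 < \<sigma>"
      using eventually_gt_at_top[of 0] by (intro eventually_conj)
    then obtain \<sigma> where \<sigma>: "Rx 0 (\<tau> 0) \<sigma> < x 0" "En (Rx 0 (\<tau> 0) \<sigma>) (Ry 0 (\<tau> 0) \<sigma>) < En (x z) (y z)" "0 < \<sigma>"
      using eventually_happens'[OF trivial_limit_at_top_linorder] by blast
    obtain u where u: "0 \<le> u" "u \<le> z" "x u = Rx 0 (\<tau> 0) \<sigma>"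
      using IVT2'[of x z "Rx 0 (\<tau> 0) \<sigma>" 0] traj_cont[OF T] z \<sigma> R_0_pos[of \<sigma>] by auto
    have "Ry 0 (\<tau> 0) \<sigma> < y u"
    proof (rule no_crossing[OF T traj_R, where ?s1.0 = s' and ?s2.0 = \<sigma>])
      fix v assume "0 \<le> v" "Rx 0 (\<tau> 0) v = x 0"
      then show "Ry 0 (\<tau> 0) v < y 0" using R_0_neg[of v] R_start[of 0] i by (cases "v = 0") auto
    qed (use neg R_0_neg R_start[of 0] i u z \<sigma> in auto)
    moreover have "u \<noteq> z" using u z R_0_pos[of \<sigma>] \<sigma> by auto
    then have "y u \<le> 0" using neg[of u] u z i by (cases "u = 0") auto
    ultimately have "(y u)\<^sup>2 \<le> (Ry 0 (\<tau> 0) \<sigma>)\<^sup>2" by (simp add: abs_le_square_iff[symmetric])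
    then have "En (x u) (y u) \<le> En (Rx 0 (\<tau> 0) \<sigma>) (Ry 0 (\<tau> 0) \<sigma>)" using u by (simp add: En_def)
    moreover have "En (x z) (y z) \<le> En (x u) (y u)" by (rule En_antimono[OF T u(1,2)])
    ultimately show False using \<sigma> by linarith
  qed
  obtain e where e: "0 < e" "\<And>s. 0 < s \<Longrightarrow> s < e \<Longrightarrow> y s < 0" using starts_left[OF T] i by auto
  from first_return[OF T e] show ?thesis
  proof
    assume "\<forall>s>0. y s < 0"
    then show ?thesis using pos[of s] i \<open>0 \<le> s\<close> by (cases "s = 0") auto
  next
    assume "\<exists>s1>0. y s1 = 0 \<and> (\<forall>s. 0 < s \<and> s < s1 \<longrightarrow> y s < 0)"
    then obtain s1 where s1: "0 < s1" "y s1 = 0" "\<And>s. 0 < s \<Longrightarrow> s < s1 \<Longrightarrow> y s < 0" by blast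
    have E: "En (x s1) (y s1) < 0" using return_left_or_trapped[OF T s1] pos[OF s1(1,3)] by auto
    show ?thesis
    proof (cases "s1 \<le> s")
      case True
      then show ?thesis using no_zero_of_negative_energy[OF T _ True E] s1 by auto
    next
      case False
      then show ?thesis using pos[of s] s1 i \<open>0 \<le> s\<close> by (cases "s = 0") auto
    qed
  qed
qed

text \<open>Started beyond the innermost turning point, a trajectory approaches zero at least as fast as the
  spiral does. If it did not cross zero it would decay at the rate \<open>e\<^bsup>-\<gamma>s\<^esup>\<close> and so be a regular orbit,
  that is, the spiral itself.\<close>

lemma crosses_zero_outside:
  assumes T: "traj x y" and i: "y 0 = 0" "M 0 < x 0"
  shows "\<exists>z>0. x z = 0 \<and> (\<forall>s. 0 < s \<and> s \<le> z \<longrightarrow> y s < 0)"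
proof (rule ccontr)
  assume no: "\<not> ?thesis"
  have x0: "0 < x 0" using i M_pos[of 0] by simp
  note Vout = V_pos_beyond_M[of 0]
  obtain e where e: "0 < e" "\<And>s. 0 < s \<Longrightarrow> s < e \<Longrightarrow> y s < 0"
    using starts_left[OF T] dV_pos[OF x0] Vout[of "x 0"] i by force
  have nozero: "x z \<noteq> 0" if "0 < z" "\<And>s. 0 < s \<Longrightarrow> s < z \<Longrightarrow> y s < 0" "y z \<noteq> 0" for z
  proof
    assume z: "x z = 0"
    have "y z \<le> 0"
    proof (rule tendsto_upperbound)
      show "(y \<longlongrightarrow> y z) (at_left z)"
        using DERIV_isCont[OF traj_y[OF T]] that(1) by (simp add: isCont_def filterlim_at_split)
      show "\<forall>\<^sub>F t in at_left z. y t \<le> 0"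
        using eventually_at_left_real[OF that(1)] by eventually_elim (use that(2) in force)
    qed simp
    with that(3) have "y z < 0" by simp
    with no z that show False by (metis le_less)
  qed
  let ?X = "Rx 0 (\<tau> 0)" and ?Y = "Ry 0 (\<tau> 0)"
  have start: "?X 0 \<le> x 0" "\<And>s. 0 \<le> s \<Longrightarrow> (\<And>r. 0 < r \<Longrightarrow> r \<le> s \<Longrightarrow> y r < 0) \<Longrightarrow> x s = ?X 0 \<Longrightarrow> y s < ?Y 0"
  proof -
    fix s assume s: "0 \<le> s" "x s = ?X 0" "\<And>r. 0 < r \<Longrightarrow> r \<le> s \<Longrightarrow> y r < 0"
    then show "y s < ?Y 0" using i R_start[of 0] s(3)[of s] by (cases "s = 0") auto
  qed (use i R_start[of 0] in simp)
  have Xto: "\<exists>r>0. ?X r = v" if v: "0 < v" "v < M 0" for v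
  proof -
    have "\<forall>\<^sub>F s in at_top. ?X s < v \<and> 0 < s"
      using order_tendstoD(2)[OF R_0_lim(1) v(1)] eventually_gt_at_top[of 0] by (rule eventually_conj)
    then obtain s where s: "?X s < v" "0 < s" using eventually_happens'[OF trivial_limit_at_top_linorder] by blast
    then obtain r where r: "0 \<le> r" "r \<le> s" "?X r = v"
      using IVT2'[of ?X s v 0] traj_cont[OF traj_R] R_start[of 0] v by auto
    then show ?thesis using v R_start[of 0] by (intro exI[of _ r]) (auto simp: less_le)
  qed
  from first_return[OF T e] have neg: "\<forall>s>0. y s < 0"
  proof
    assume "\<exists>s1>0. y s1 = 0 \<and> (\<forall>s. 0 < s \<and> s < s1 \<longrightarrow> y s < 0)"
    then obtain s1 where s1: "0 < s1" "y s1 = 0" "\<And>s. 0 < s \<Longrightarrow> s < s1 \<Longrightarrow> y s < 0" by blast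
    have "x s1 < 0 \<and> 0 < dV (- x s1) \<or> 0 < x s1 \<and> En (x s1) (y s1) < 0"
      by (rule return_left_or_trapped[OF T s1])
    then have False
    proof (elim disjE conjE)
      assume "x s1 < 0"
      then obtain z where z: "0 \<le> z" "z \<le> s1" "x z = 0"
        using IVT2'[of x s1 0 0] traj_cont[OF T] x0 s1 by auto
      have "z < s1" using z \<open>x s1 < 0\<close> by (cases "z = s1") auto
      moreover have "0 < z" using z x0 by (cases "z = 0") auto
      ultimately show False using nozero[of z] s1(3) z by force
    next
      assume p: "0 < x s1" "En (x s1) (y s1) < 0"
      then have "V (x s1) < 0" using s1(2) by (simp add: En_def)
      then have "x s1 < M 0" using Vout[of "x s1"] by force
      then obtain r where r: "0 < r" "?X r = x s1" using Xto p by blast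
      have "y s1 < ?Y r"
      proof (rule no_crossing[OF traj_R T, where ?s1.0 = r and ?s2.0 = s1])
        fix s assume s: "0 \<le> s" "s \<le> s1" "x s = ?X 0"
        then have "s \<noteq> s1" using \<open>x s1 < M 0\<close> R_start[of 0] by auto
        then show "y s < ?Y 0" using start(2)[of s] s s1(3) by auto
      qed (use start(1) R_0_neg s1 r in auto)
      then show False using R_0_neg[OF r(1)] s1(2) by simp
    qed
    then show ?thesis ..
  qed simp
  then have neg': "0 < s \<Longrightarrow> y s < 0" for s by blast
  have xpos: "0 < x s" if s: "0 \<le> s" for s
  proof (rule ccontr)
    assume "\<not> 0 < x s"
    then obtain z where z: "0 \<le> z" "z \<le> s" "x z = 0"
      using IVT2'[of x s 0 0] traj_cont[OF T] x0 s by auto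
    have "0 < z" using z x0 by (cases "z = 0") auto
    then show False using nozero[of z] neg'[of z] neg' z by force
  qed
  have st2: "x s = ?X 0 \<Longrightarrow> y s < ?Y 0" if "0 \<le> s" for s using start(2)[OF that] neg' by blast
  obtain l where l: "(x \<longlongrightarrow> l) at_top" "dV l = 0" "\<And>s. 1 \<le> s \<Longrightarrow> l < x s"
    "((\<lambda>s. En (x s) (y s)) \<longlongrightarrow> V l) at_top"
    using settles[OF T, of 1] neg' by auto
  have ev: "\<forall>\<^sub>F s in at_top. 0 \<le> x s"
    using eventually_ge_at_top[of 0] by eventually_elim (rule less_imp_le[OF xpos])
  have "0 \<le> l" by (rule tendsto_lowerbound[OF l(1) ev]) simp
  have l0: "l = 0"
  proof (rule ccontr)
    assume "l \<noteq> 0"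
    then have lp: "0 < l" using \<open>0 \<le> l\<close> by simp
    have "0 < V l"
    proof (cases "M 0 \<le> l")
      case True then show ?thesis by (rule Vout)
    next
      case False
      obtain r where r: "0 < r" "?X r = l" using Xto[OF lp] False by auto
      have "En (?X r) (?Y r) \<le> V l"
        by (rule energy_of_limit[OF traj_R T, where ?r1.0 = "r + 1"])
           (use R_0_neg R_start[of 0] neg' start(1) st2 l r False in auto)
      then show ?thesis using En_X_pos[of "\<tau> 0 - r"] by (simp add: En_R)
    qed
    with l(2) dV_nonzero show False by blast
  qed
  obtain C \<xi> where C: "0 \<le> C" and \<xi>: "0 < \<xi>" "\<xi> < M 0"
    and slope: "\<And>s. 0 \<le> s \<Longrightarrow> ?X s \<le> \<xi> \<Longrightarrow> ?Y s \<le> - (\<gamma> - C * ?X s powr (q - 2)) * ?X s"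
    using slope_near_origin by blast
  have slopeT: "y s \<le> - (\<gamma> - C * x s powr (q - 2)) * x s" if s: "0 < s" "x s \<le> \<xi>" for s
  proof -
    obtain r where r: "0 < r" "?X r = x s" using Xto[of "x s"] xpos[of s] s \<xi> by auto
    have "y s < ?Y r"
      by (rule no_crossing[OF traj_R T, where ?s1.0 = r and ?s2.0 = s])
         (use start(1) st2 R_0_neg neg' s r in auto)
    with slope[of r] r s show ?thesis by auto
  qed
  have small: "((\<lambda>s. C * x s powr (q - 2)) \<longlongrightarrow> C * 0) at_top"
    using l(1) l0 q ev by (intro tendsto_intros tendsto_zero_powrI[where b = "q - 2"]) auto
  have "\<forall>\<^sub>F s in at_top. x s < \<xi> \<and> C * x s powr (q - 2) < \<gamma> / 2 \<and> 0 < s"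
    using order_tendstoD(2)[OF l(1)[unfolded l0] \<xi>(1)] order_tendstoD(2)[OF small, of "\<gamma>/2"] gam_pos
      eventually_gt_at_top[of 0] by (intro eventually_conj) auto
  then obtain s2 where s2: "\<And>s. s2 \<le> s \<Longrightarrow> x s < \<xi> \<and> C * x s powr (q - 2) < \<gamma> / 2 \<and> 0 < s"
    unfolding eventually_at_top_linorder by blast
  \<comment> \<open>The correction term turns the differential inequality for \<open>ln w\<close> into monotonicity.\<close>
  define C' where "C' = 2 * C / ((q - 2) * \<gamma>)"
  have C': "C' * (q - 2) * (\<gamma> / 2) = C" "0 \<le> C'" using q gam_pos C by (auto simp: C'_def)
  define G where "G s = ln (x s) + \<gamma> * s + C' * x s powr (q - 2)" for s
  have Gle: "G s \<le> G s2" if "s2 \<le> s" for s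
  proof (rule deriv_nonpos_imp_antimono[OF _ _ that])
    fix r assume "r \<in> {s2..s}"
    then have r: "x r < \<xi>" "C * x r powr (q - 2) < \<gamma> / 2" "0 < r" using s2[of r] by auto
    have xr: "0 < x r" using xpos r by simp
    have xd: "(x has_real_derivative y r) (at r)" using traj_x[OF T] r by simp
    define m where "m = y r / x r"
    have m: "m \<le> - (\<gamma> - C * x r powr (q - 2))" using slopeT[of r] r xr by (simp add: m_def divide_le_eq)
    have pd: "((\<lambda>s. x s powr (q - 2)) has_real_derivative (q - 2) * x r powr (q - 2) * m) (at r)"
    proof (rule DERIV_cong[OF DERIV_fun_powr[OF xd xr]])
      have "x r powr (q - 2 - of_nat 1) = x r powr (q - 2) / x r" using xr by (subst powr_diff) simp
      then show "(q - 2) * x r powr (q - 2 - of_nat 1) * y r = (q - 2) * x r powr (q - 2) * m"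
        by (simp only: m_def) simp
    qed
    have g: "((\<lambda>s. \<gamma> * s) has_real_derivative \<gamma>) (at r)" by (auto intro!: derivative_eq_intros)
    have ld: "((\<lambda>s. ln (x s)) has_real_derivative m) (at r)"
      using xd xr by (auto intro!: derivative_eq_intros simp: m_def)
    show "(G has_real_derivative m + \<gamma> + C' * ((q - 2) * x r powr (q - 2) * m)) (at r)"
      unfolding G_def[abs_def] by (intro DERIV_add DERIV_cmult ld g pd)
    have "m \<le> - (\<gamma> / 2)" using m r by linarith
    then have "C' * ((q - 2) * x r powr (q - 2) * m) \<le> C' * ((q - 2) * x r powr (q - 2) * - (\<gamma> / 2))"
      using C' q by (intro mult_left_mono) auto
    also have "\<dots> = - (C' * (q - 2) * (\<gamma> / 2)) * x r powr (q - 2)" by simp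
    also have "\<dots> = - C * x r powr (q - 2)" unfolding C' ..
    finally show "m + \<gamma> + C' * ((q - 2) * x r powr (q - 2) * m) \<le> 0" using m by linarith
  qed
  have wb: "exp (\<gamma> * s) * x s \<le> exp (G s2)" if "s2 \<le> s" for s
  proof -
    have xs: "0 < x s" using xpos s2[OF that] by simp
    have "ln (x s) + \<gamma> * s \<le> G s2"
      using Gle[OF that] mult_nonneg_nonneg[OF C'(2), of "x s powr (q - 2)"] by (simp add: G_def)
    then have "exp (ln (x s) + \<gamma> * s) \<le> exp (G s2)" by simp
    then show ?thesis using xs by (simp add: exp_add mult.commute)
  qed
  have "\<not> filterlim (\<lambda>t. exp (- \<gamma> * t) * x (- t)) at_top at_bot"
  proof
    assume "filterlim (\<lambda>t. exp (- \<gamma> * t) * x (- t)) at_top at_bot"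
    then have "\<forall>\<^sub>F t in at_bot. exp (G s2) < exp (- \<gamma> * t) * x (- t)" unfolding filterlim_at_top_dense by blast
    moreover have "\<forall>\<^sub>F t in at_bot. t \<le> - s2" by (rule eventually_le_at_bot)
    ultimately have "\<forall>\<^sub>F t :: real in at_bot. False"
    proof eventually_elim
      case (elim t)
      then show ?case using wb[of "- t"] by simp
    qed
    then show False by simp
  qed
  then obtain d where d: "((\<lambda>t. exp (- \<gamma> * t) * x (- t)) \<longlongrightarrow> d) at_bot"
    using finite_or_infinite_limit[OF T, of 0] xpos by blast
  obtain \<sigma> c where \<sigma>: "\<bar>\<sigma>\<bar> = 1" and xc: "\<And>s. 0 \<le> s \<Longrightarrow> x s = \<sigma> * X (c - s) \<and> y s = - \<sigma> * Y (c - s)"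
    using regular_orbit[OF T d, of 0] x0 by auto
  have "\<sigma> \<noteq> -1"
  proof
    assume "\<sigma> = -1"
    obtain t where "t \<le> c" "t < \<tau> 0" by (metis linorder_not_le lt_ex min.strict_boundedE order.strict_implies_order)
    then show False using xc[of "c - t"] xpos[of "c - t"] X_Y_before[of t] \<open>\<sigma> = -1\<close> by simp
  qed
  then have \<sigma>1: "\<sigma> = 1" using \<sigma> by linarith
  have Xc: "0 < X t" if "t \<le> c" for t using xc[of "c - t"] xpos[of "c - t"] that \<sigma>1 by simp
  have Yc: "Y c = 0" using xc[of 0] i \<sigma>1 by simp
  have "c = \<tau> 0"
  proof (rule ccontr)
    assume "c \<noteq> \<tau> 0"
    moreover have "\<not> c < \<tau> 0" using X_Y_before[of c] Yc by auto
    moreover have "\<not> (\<tau> 0 < c \<and> c \<le> \<zeta> 0)" using Y_arc[of 0 c] Yc by auto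
    moreover have "\<not> \<zeta> 0 \<le> c" using Xc[of "\<zeta> 0"] X_zeta[of 0] by auto
    ultimately show False by linarith
  qed
  then have "x 0 = M 0" using xc[of 0] \<sigma>1 by (simp add: M_def)
  with i show False by simp
qed

definition zeros :: "(real \<Rightarrow> real) \<Rightarrow> real set" where "zeros x = {s. 0 < s \<and> x s = 0}"

lemma zeros_single:
  assumes T: "traj x y" and neg: "\<And>s. 0 < s \<Longrightarrow> y s < 0" and z: "0 < z" "x z = 0"
  shows "zeros x = {z}"
proof -
  have "x u \<noteq> 0" if "0 < u" "u \<noteq> z" for u
    using moving_left_decreasing[OF T neg, where u = u and v = z and ?s1.0 = z]
      moving_left_decreasing[OF T neg, where u = z and v = u and ?s1.0 = u] that z
    by (cases u z rule: linorder_cases) auto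
  with z show ?thesis by (auto simp: zeros_def)
qed

lemma zeros_half_turn:
  assumes T: "traj x y" and x0: "0 < x 0" and s1: "0 < s1" "x s1 < 0"
    and neg: "\<And>s. 0 < s \<Longrightarrow> s < s1 \<Longrightarrow> y s < 0"
    and fin: "finite (zeros (\<lambda>s. - x (s1 + s)))" and card: "card (zeros (\<lambda>s. - x (s1 + s))) = k"
  shows "finite (zeros x) \<and> card (zeros x) = Suc k"
proof -
  obtain z where z: "0 \<le> z" "z \<le> s1" "x z = 0"
    using IVT2'[of x s1 0 0] traj_cont[OF T] x0 s1 by auto
  have z': "0 < z" "z < s1" using z x0 s1 by (auto simp: less_le)
  have eq: "zeros x = insert z ((\<lambda>s. s1 + s) ` zeros (\<lambda>s. - x (s1 + s)))"
  proof (intro set_eqI iffI)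
    fix u assume u: "u \<in> zeros x"
    show "u \<in> insert z ((\<lambda>s. s1 + s) ` zeros (\<lambda>s. - x (s1 + s)))"
    proof (cases "u \<le> s1")
      case True
      have "u = z"
        using moving_left_decreasing[OF T neg, where u = u and v = z and ?s1.0 = s1]
          moving_left_decreasing[OF T neg, where u = z and v = u and ?s1.0 = s1] u True z z'
        by (cases u z rule: linorder_cases) (auto simp: zeros_def)
      then show ?thesis by simp
    next
      case False
      then have "u = s1 + (u - s1)" "u - s1 \<in> zeros (\<lambda>s. - x (s1 + s))" using u by (auto simp: zeros_def)
      then show ?thesis by blast
    qed
  next
    fix u assume "u \<in> insert z ((\<lambda>s. s1 + s) ` zeros (\<lambda>s. - x (s1 + s)))"
    then show "u \<in> zeros x" using z z' s1 by (auto simp: zeros_def)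
  qed
  have "z \<notin> (\<lambda>s. s1 + s) ` zeros (\<lambda>s. - x (s1 + s))" using z' by (auto simp: zeros_def)
  moreover have "card ((\<lambda>s. s1 + s) ` zeros (\<lambda>s. - x (s1 + s))) = k"
    using card by (subst card_image) (auto simp: inj_on_def)
  ultimately show ?thesis unfolding eq using fin by simp
qed

text \<open>The turning points of a trajectory strictly between two consecutive turning points of the spiral
  move inwards together with these, one index per half turn.\<close>

definition gap :: "nat \<Rightarrow> real \<Rightarrow> bool" where
  "gap k m \<longleftrightarrow> m < M k \<and> (if k = 0 then 0 < m \<and> 0 < dV m else M (k - 1) < m)"

lemma gap_pos: "gap k m \<Longrightarrow> 0 < m \<and> 0 < dV m"
proof (cases k)
  case (Suc n)
  assume "gap k m"
  then have "M n < m" using Suc by (simp add: gap_def)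
  then show ?thesis using M_pos[of n] V_pos_beyond_M[of n m] dV_pos[of m] by auto
qed (simp add: gap_def)

text \<open>The outer neighbour of the trajectory bounds its next turning point.\<close>

lemma next_turn_less:
  assumes T: "traj x y" and i: "y 0 = 0" "0 < x 0" "x 0 < M (Suc k)"
    and s1: "0 < s1" "y s1 = 0" "\<And>s. 0 < s \<Longrightarrow> s < s1 \<Longrightarrow> y s < 0"
  shows "- x s1 < M k"
proof (rule ccontr)
  let ?X = "Rx (Suc k) (\<tau> (Suc k))" and ?Y = "Ry (Suc k) (\<tau> (Suc k))" and ?r = "\<tau> (Suc k) - \<tau> k"
  assume "\<not> - x s1 < M k"
  then obtain s where s: "0 \<le> s" "s \<le> s1" "x s = - M k"
    using IVT2'[of x s1 "- M k" 0] traj_cont[OF T] s1 i M_pos[of k] by auto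
  have r: "0 < ?r" using tau_mono by (simp add: strict_monoD)
  have "?Y ?r < y s"
  proof (rule no_crossing[OF T traj_R, where ?s1.0 = s1 and ?s2.0 = ?r])
    fix v assume v: "0 \<le> v" "v \<le> ?r" "?X v = x 0"
    have "v \<noteq> 0" using v i R_start[of "Suc k"] by auto
    moreover have "v \<noteq> ?r" using v i R_Suc_end[of k] M_pos[of k] by auto
    ultimately show "?Y v < y 0" using R_Suc_neg[of v k] v i by simp
  qed (use s1(3) R_Suc_neg i R_start[of "Suc k"] s r R_Suc_end[of k] in auto)
  moreover have "y s \<le> 0" using s1 s i by (cases "s = 0"; cases "s = s1") (auto intro: less_imp_le)
  ultimately show False using R_Suc_end[of k] by simp
qed

text \<open>Conversely its inner neighbour forces it to turn, and to turn further out.\<close>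

lemma turns_beyond:
  assumes T: "traj x y" and i: "y 0 = 0" "M (Suc k) < x 0"
  shows "\<exists>s1>0. y s1 = 0 \<and> (\<forall>s. 0 < s \<and> s < s1 \<longrightarrow> y s < 0) \<and> x s1 < - M k"
proof -
  let ?X = "Rx (Suc k) (\<tau> (Suc k))" and ?Y = "Ry (Suc k) (\<tau> (Suc k))" and ?r = "\<tau> (Suc k) - \<tau> k"
  have r: "0 < ?r" using tau_mono by (simp add: strict_monoD)
  have x0: "0 < x 0" "0 < V (x 0)" using i M_pos[of "Suc k"] V_pos_beyond_M[of "Suc k"] by auto
  obtain e where e: "0 < e" "\<And>s. 0 < s \<Longrightarrow> s < e \<Longrightarrow> y s < 0"
    using starts_left[OF T] dV_pos[of "x 0"] x0 i by force
  have start: "y s < ?Y 0" if "0 \<le> s" "x s = ?X 0" "\<And>r. 0 < r \<Longrightarrow> r \<le> s \<Longrightarrow> y r < 0" for s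
    using that(3)[of s] that(1,2) i R_start[of "Suc k"] by (cases "s = 0") auto
  from first_return[OF T e] show ?thesis
  proof
    assume n: "\<forall>s>0. y s < 0"
    have False
      by (rule must_turn[OF traj_R T, where ?r1.0 = ?r, OF R_Suc_neg])
         (use n start i R_start[of "Suc k"] R_Suc_end[of k] r V_M_pos M_pos[of "Suc k"] M_pos[of k] in auto)
    then show ?thesis ..
  next
    assume "\<exists>s1>0. y s1 = 0 \<and> (\<forall>s. 0 < s \<and> s < s1 \<longrightarrow> y s < 0)"
    then obtain s1 where s1: "0 < s1" "y s1 = 0" "\<And>s. 0 < s \<Longrightarrow> s < s1 \<Longrightarrow> y s < 0" by blast
    have "x s1 < - M k"
    proof (rule ccontr)
      assume "\<not> x s1 < - M k"
      have "x s1 \<le> M (Suc k)"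
      proof (rule ccontr)
        assume "\<not> x s1 \<le> M (Suc k)"
        then have "0 < V (x s1)" "0 < x s1" using V_pos_beyond_M[of "Suc k" "x s1"] M_pos[of "Suc k"] by auto
        then show False using return_left_or_trapped[OF T s1] s1(2) by (auto simp: En_def)
      qed
      then obtain u where u: "0 \<le> u" "u \<le> ?r" "?X u = x s1"
        using IVT2'[of ?X ?r "x s1" 0] traj_cont[OF traj_R] R_start[of "Suc k"] R_Suc_end[of k] r \<open>\<not> x s1 < - M k\<close> by auto
      have "y s1 < ?Y u"
      proof (rule no_crossing[OF traj_R T, where ?s1.0 = ?r and ?s2.0 = s1])
        fix s assume s: "0 \<le> s" "s \<le> s1" "x s = ?X 0"
        have "s \<noteq> s1"
        proof
          assume "s = s1"
          then have "0 < V (x s1)" "0 < x s1" using s V_M_pos M_pos[of "Suc k"] R_start[of "Suc k"] by auto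
          then show False using return_left_or_trapped[OF T s1] s1(2) by (auto simp: En_def)
        qed
        then show "y s < ?Y 0" using s s1 start[of s] by auto
      qed (use s1(3) R_Suc_neg i R_start[of "Suc k"] u r R_Suc_end[of k] s1(1) in auto)
      moreover have "?Y u \<le> 0"
        using R_Suc_neg[of u k] u R_start[of "Suc k"] R_Suc_end[of k] by (cases "u = 0"; cases "u = ?r") (auto intro: less_imp_le)
      ultimately show False using s1 by simp
    qed
    with s1 show ?thesis by blast
  qed
qed

text \<open>Every half turn passes one zero and lowers the index by one. The step from one to zero is special because the
  trajectory need not turn again after its last zero; it may also creep into an equilibrium on the left.\<close>

theorem zeros_in_gap:
  "traj x y \<Longrightarrow> y 0 = 0 \<Longrightarrow> gap k (x 0) \<Longrightarrow> finite (zeros x) \<and> card (zeros x) = k"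
proof (induction k arbitrary: x y)
  case 0
  then have "zeros x = {}" using no_zero_inside[OF 0(1,2)] by (auto simp: zeros_def gap_def)
  then show ?case by simp
next
  case (Suc k)
  note T = Suc.prems(1) and y0 = Suc.prems(2)
  have g: "x 0 < M (Suc k)" "M k < x 0" using Suc.prems(3) by (auto simp: gap_def)
  have x0: "0 < x 0" "0 < dV (x 0)" using gap_pos[OF Suc.prems(3)] by auto
  have step: ?case if s1: "0 < s1" "y s1 = 0" "\<And>s. 0 < s \<Longrightarrow> s < s1 \<Longrightarrow> y s < 0" "x s1 < 0"
    and far: "k \<noteq> 0 \<longrightarrow> M (k - 1) < - x s1" for s1
  proof -
    have T': "traj (\<lambda>s. - x (s1 + s)) (\<lambda>s. - y (s1 + s))"
      by (rule traj_minus[OF traj_shift[OF T]]) (use s1 in simp)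
    have "gap k (- x (s1 + 0))"
      using next_turn_less[OF T y0 x0(1) g(1) s1(1-3)] far s1 return_left_or_trapped[OF T s1(1-3)]
      by (auto simp: gap_def)
    from Suc.IH[OF T' _ this] s1 have "finite (zeros (\<lambda>s. - x (s1 + s)))" "card (zeros (\<lambda>s. - x (s1 + s))) = k" by auto
    then show ?case by (intro zeros_half_turn[OF T x0(1) s1(1,4,3)])
  qed
  show ?case
  proof (cases k)
    case 0
    obtain z where z: "0 < z" "x z = 0" "\<And>s. 0 < s \<Longrightarrow> s \<le> z \<Longrightarrow> y s < 0"
      using crosses_zero_outside[OF T y0] g 0 by auto
    have "0 < z" "\<And>s. 0 < s \<Longrightarrow> s < z \<Longrightarrow> y s < 0" using z by auto
    from first_return[OF T this] show ?thesis
    proof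
      assume n: "\<forall>s>0. y s < 0"
      have "zeros x = {z}" by (rule zeros_single[OF T _ z(1,2)]) (use n in blast)
      then show ?thesis using 0 by simp
    next
      assume "\<exists>s1>0. y s1 = 0 \<and> (\<forall>s. 0 < s \<and> s < s1 \<longrightarrow> y s < 0)"
      then obtain s1 where s1: "0 < s1" "y s1 = 0" "\<And>s. 0 < s \<Longrightarrow> s < s1 \<Longrightarrow> y s < 0" by blast
      have "z < s1" using z(3)[of s1] s1 by force
      then have "x s1 < 0" using moving_left_decreasing[OF T s1(3), where u = z and v = s1 and ?s1.0 = s1] z by auto
      then show ?thesis using step[OF s1] 0 by simp
    qed
  next
    case (Suc j)
    then obtain s1 where s1: "0 < s1" "y s1 = 0" "\<And>s. 0 < s \<Longrightarrow> s < s1 \<Longrightarrow> y s < 0" "x s1 < - M j"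
      using turns_beyond[OF T y0, of j] g by auto
    then show ?thesis using step[OF s1(1-3)] M_pos[of j] Suc by auto
  qed
qed

lemma zeros_of_spiral: "finite (zeros (Rx n (\<tau> n))) \<and> card (zeros (Rx n (\<tau> n))) = n"
proof (induction n)
  case 0
  have "Rx 0 (\<tau> 0) s \<noteq> 0" if "0 < s" for s using R_0_pos[of s] that by simp
  then have "zeros (Rx 0 (\<tau> 0)) = {}" by (auto simp: zeros_def)
  then show ?case by simp
next
  case (Suc n)
  let ?r = "\<tau> (Suc n) - \<tau> n"
  have r: "0 < ?r" using tau_mono by (simp add: strict_monoD)
  have eq: "(\<lambda>s. - Rx (Suc n) (\<tau> (Suc n)) (?r + s)) = Rx n (\<tau> n)"
    by (auto simp: Rx_def algebra_simps)
  show ?case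
  proof (rule zeros_half_turn[OF traj_R _ r])
    show "0 < Rx (Suc n) (\<tau> (Suc n)) 0" using R_start[of "Suc n"] M_pos[of "Suc n"] by simp
    show "Rx (Suc n) (\<tau> (Suc n)) ?r < 0" using R_Suc_end[of n] M_pos[of n] by simp
  qed (use R_Suc_neg Suc in \<open>auto simp: eq\<close>)
qed

text \<open>Positions relative to the \<open>k\<close>-th outgoing branch of the spiral, which runs from the turning point \<open>M k\<close>
  to the next zero. On it, seen inwards, position and velocity are positive.\<close>

definition below :: "nat \<Rightarrow> real \<Rightarrow> real \<Rightarrow> bool" where
  "below k x0 y0 \<longleftrightarrow> (\<exists>t. \<tau> k < t \<and> t < \<zeta> k \<and> sg k * X t = x0 \<and> y0 < - sg k * Y t)"

definition above :: "nat \<Rightarrow> real \<Rightarrow> real \<Rightarrow> bool" where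
  "above k x0 y0 \<longleftrightarrow> M k \<le> x0 \<or> (\<exists>t. \<tau> k < t \<and> t < \<zeta> k \<and> sg k * X t = x0 \<and> - sg k * Y t < y0)"

lemma traj_negR: "traj (\<lambda>s. - Rx k t s) (\<lambda>s. - Ry k t s)"
  by (rule traj_minus[OF traj_R])

lemma negR_neg: "t \<le> \<zeta> k \<Longrightarrow> 0 \<le> s \<Longrightarrow> s < t - \<tau> k \<Longrightarrow> - Ry k t s < 0"
  using Y_arc[of k "t - s"] by (simp add: Ry_def)

lemma negR_end: "- Rx k t (t - \<tau> k) = - M k" "- Ry k t (t - \<tau> k) = 0"
  by (simp_all add: Rx_def Ry_def M_def Y_tau)

text \<open>A trajectory starting to the right and outwards either escapes turning, or turns first between
  the turning points of the two neighbouring branches; from then on the previous count applies.\<close>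

theorem zeros_between_branches:
  assumes T: "traj x y" and i: "0 < x 0" "0 < y 0" and b: "below k (x 0) (y 0)"
    and ab: "k \<noteq> 0 \<Longrightarrow> above (k - 1) (x 0) (y 0)"
  shows "finite (zeros x) \<and> card (zeros x) = k"
proof -
  have T': "traj (\<lambda>s. - x s) (\<lambda>s. - y s)" by (rule traj_minus[OF T])
  obtain e where e: "0 < e" "\<And>s. 0 < s \<Longrightarrow> s < e \<Longrightarrow> - y s < 0"
    using starts_left[OF T'] i by auto
  from first_return[OF T' e] show ?thesis
  proof
    assume n: "\<forall>s>0. - y s < 0"
    have inc: "x 0 < x s" if "0 < s" for s
      using moving_left_decreasing[OF T', where u = 0 and v = s and ?s1.0 = s] n that by auto
    show ?thesis
    proof (cases "k = 0")
      case True
      have "zeros x = {}" using inc i by (force simp: zeros_def)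
      then show ?thesis using True by simp
    next
      case False
      define j where "j = k - 1"
      have False using ab[OF False] unfolding above_def j_def[symmetric]
      proof (elim disjE exE conjE)
        assume M: "M j \<le> x 0"
        obtain l where l: "dV l = 0" "\<And>s. 1 \<le> s \<Longrightarrow> l < - x s"
          using settles[OF T', of 1] n by auto
        have "M j \<le> - l" using l(2)[of 1] inc[of 1] M by simp
        then have "0 < V (- l)" by (rule V_pos_beyond_M)
        then show False using dV_nonzero[of l] l by simp
      next
        fix t assume t: "\<tau> j < t" "t < \<zeta> j" "sg j * X t = x 0" "- sg j * Y t < y 0"
        show False
        proof (rule must_turn[OF traj_negR[of j t] T', where ?r1.0 = "t - \<tau> j"])
          fix s assume s: "0 \<le> s" "- x s = - Rx j t 0"
          then have "s = 0" using inc[of s] t by (cases "s = 0") (auto simp: Rx_def)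
          then show "- y s < - Ry j t 0" using t by (simp add: Ry_def)
        qed (use negR_neg[of t j] negR_neg[of t j 0] t n negR_end[of j t] M_pos[of j] V_M_pos[of j] in \<open>auto simp: Rx_def less_imp_le\<close>)
      qed
      then show ?thesis ..
    qed
  next
    assume "\<exists>s1>0. - y s1 = 0 \<and> (\<forall>s. 0 < s \<and> s < s1 \<longrightarrow> - y s < 0)"
    then obtain s1 where s1: "0 < s1" "- y s1 = 0" "\<And>s. 0 < s \<Longrightarrow> s < s1 \<Longrightarrow> - y s < 0" by blast
    have inc: "x u < x v" if "0 \<le> u" "u < v" "v \<le> s1" for u v
      using moving_left_decreasing[OF T' s1(3), where u = u and v = v and ?s1.0 = s1] that by simp
    have dV1: "0 < dV (x s1)"
      using return_left_or_trapped[OF T' s1] inc[of 0 s1] i s1 by auto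
    have yneg: "- y s \<le> 0" if "0 \<le> s" "s \<le> s1" for s
      using s1(2) s1(3)[of s] i that by (cases "s = 0"; cases "s = s1") (auto intro: less_imp_le)
    have lt: "x s1 < M k"
    proof (rule ccontr)
      assume nl: "\<not> x s1 < M k"
      obtain t where t: "\<tau> k < t" "t < \<zeta> k" "sg k * X t = x 0" "y 0 < - sg k * Y t"
        using b by (auto simp: below_def)
      have R0: "- Rx k t 0 = - x 0" "- Ry k t 0 = sg k * Y t" using t by (auto simp: Rx_def Ry_def)
      have dec: "- Rx k t v < - Rx k t u" if "0 \<le> u" "u < v" "v \<le> t - \<tau> k" for u v
        by (rule moving_left_decreasing[OF traj_negR _ that]) (rule negR_neg, use t in auto)
      have "x 0 < M k" using dec[of 0 "t - \<tau> k"] R0 negR_end[of k t] t by simp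
      then obtain s where s: "0 \<le> s" "s \<le> s1" "x s = M k"
        using IVT'[of x 0 "M k" s1] nl traj_cont[OF T] s1 by auto
      have "- Ry k t (t - \<tau> k) < - y s"
      proof (rule no_crossing[OF T' traj_negR[of k t], where ?s1.0 = s1 and ?s2.0 = "t - \<tau> k"])
        fix v assume v: "0 \<le> v" "v \<le> t - \<tau> k" "- Rx k t v = - x 0"
        then have "v = 0" using dec[of 0 v] R0 by (cases "v = 0") auto
        then show "- Ry k t v < - y 0" using t R0 by simp
      qed (use s1(3) negR_neg[of t k] t R0 s negR_end[of k t] in auto)
      then show False using yneg[OF s(1,2)] negR_end[of k t] by simp
    qed
    have gt: "M (k - 1) < x s1" if "k \<noteq> 0"
    proof -
      define j where "j = k - 1"
      show ?thesis using ab[OF that] unfolding above_def j_def[symmetric]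
      proof (elim disjE exE conjE)
        assume "M j \<le> x 0" then show "M j < x s1" using inc[of 0 s1] s1 by simp
      next
        fix t assume t: "\<tau> j < t" "t < \<zeta> j" "sg j * X t = x 0" "- sg j * Y t < y 0"
        show "M j < x s1"
        proof (rule ccontr)
          assume nl: "\<not> M j < x s1"
          have R0: "- Rx j t 0 = - x 0" "- Ry j t 0 = sg j * Y t" using t by (auto simp: Rx_def Ry_def)
          have cR: "continuous_on {0..t - \<tau> j} (\<lambda>s. - Rx j t s)" by (rule traj_cont[OF traj_negR]) auto
          obtain s where s: "0 \<le> s" "s \<le> t - \<tau> j" "- Rx j t s = - x s1"
            using IVT2'[of "\<lambda>s. - Rx j t s" "t - \<tau> j" "- x s1" 0] nl cR negR_end[of j t] R0 inc[of 0 s1] s1 t by auto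
          have "- y s1 < - Ry j t s"
          proof (rule no_crossing[OF traj_negR[of j t] T', where ?s1.0 = "t - \<tau> j" and ?s2.0 = s1])
            fix v assume v: "0 \<le> v" "v \<le> s1" "- x v = - Rx j t 0"
            then have "v = 0" using inc[of 0 v] R0 by (cases "v = 0") auto
            then show "- y v < - Ry j t 0" using t R0 by simp
          qed (use s1 negR_neg[of t j] t R0 s in auto)
          moreover have "- Ry j t s \<le> 0" using negR_neg[of t j s] negR_end[of j t] s t
            by (cases "s = t - \<tau> j") (auto intro: less_imp_le)
          ultimately show False using s1(2) by simp
        qed
      qed
    qed
    have "gap k (x (s1 + 0))" using lt gt dV1 inc[of 0 s1] s1 i by (auto simp: gap_def)
    from zeros_in_gap[OF traj_shift[OF T] _ this] s1
    have Z: "finite (zeros (\<lambda>s. x (s1 + s)))" "card (zeros (\<lambda>s. x (s1 + s))) = k" by auto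
    have "zeros x = (\<lambda>s. s1 + s) ` zeros (\<lambda>s. x (s1 + s))"
    proof (intro set_eqI iffI)
      fix u assume u: "u \<in> zeros x"
      have "\<not> u \<le> s1" using inc[of 0 u] u i by (auto simp: zeros_def)
      then have "u = s1 + (u - s1)" "u - s1 \<in> zeros (\<lambda>s. x (s1 + s))" using u by (auto simp: zeros_def)
      then show "u \<in> (\<lambda>s. s1 + s) ` zeros (\<lambda>s. x (s1 + s))" by blast
    qed (use s1 in \<open>auto simp: zeros_def\<close>)
    then show ?thesis using Z by (simp add: card_image)
  qed
qed

text \<open>On a branch the trajectory first moves out to the turning point, without passing a zero.\<close>

theorem zeros_on_branch:
  assumes t: "\<tau> k < t" "t < \<zeta> k"
  shows "finite (zeros (Rx k t)) \<and> card (zeros (Rx k t)) = k"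
proof -
  have "zeros (Rx k t) = (\<lambda>s. (t - \<tau> k) + s) ` zeros (Rx k (\<tau> k))"
  proof (intro set_eqI iffI)
    fix u assume u: "u \<in> zeros (Rx k t)"
    have "\<not> u \<le> t - \<tau> k" using X_arc[of k "t - u"] t u by (auto simp: zeros_def Rx_def)
    then have "u = (t - \<tau> k) + (u - (t - \<tau> k))" "u - (t - \<tau> k) \<in> zeros (Rx k (\<tau> k))"
      using u by (auto simp: zeros_def Rx_def)
    then show "u \<in> (\<lambda>s. (t - \<tau> k) + s) ` zeros (Rx k (\<tau> k))" by blast
  qed (use t in \<open>auto simp: zeros_def Rx_def algebra_simps\<close>)
  then show ?thesis using zeros_of_spiral[of k] by (simp add: card_image)
qed

text \<open>The branches are nested, because the energy on each exceeds that on the previous ones.\<close>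

lemma on_branch_below_next:
  assumes t: "\<tau> k < t" "t < \<zeta> k" and x0: "x0 = sg k * X t" and y0: "y0 = - sg k * Y t"
  shows "below (Suc k) x0 y0"
proof -
  have "\<zeta> k \<le> \<zeta> (Suc k)" using tau_less_zeta[of "Suc k"] zeta_less_tau[of k] by linarith
  have En0: "En x0 y0 < En (X (\<tau> (Suc k))) (Y (\<tau> (Suc k)))"
  proof -
    have "En x0 y0 = En (X t) (Y t)" using sg_cases[of k] x0 y0 by auto
    also have "\<dots> < En (X (\<tau> (Suc k))) (Y (\<tau> (Suc k)))"
    proof (rule En_X_strict)
      show "t < \<tau> (Suc k)" using t zeta_less_tau[of k] by simp
      fix r assume "t < r" "r < \<tau> (Suc k)"
      then show "Y r \<noteq> 0" using Y_half_turn[of k r] t by auto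
    qed
    finally show ?thesis .
  qed
  have x0p: "0 < x0" using X_arc[of k t] t x0 by simp
  have "V x0 \<le> En x0 y0" by (simp add: En_def)
  then have "V x0 < V (M (Suc k))" using En0 by (simp add: V_M)
  then have xM: "x0 < M (Suc k)"
    using V_pos_beyond_M[of "Suc k" x0] V_less[of "M (Suc k)" x0] V_M_pos[of "Suc k"] M_pos[of "Suc k"]
    by (metis less_imp_le linorder_not_less nle_le not_less_iff_gr_or_eq)
  have c: "continuous_on {\<tau> (Suc k)..\<zeta> (Suc k)} (\<lambda>t. sg (Suc k) * X t)" by (intro continuous_intros X_cont)
  obtain t' where t': "\<tau> (Suc k) \<le> t'" "t' \<le> \<zeta> (Suc k)" "sg (Suc k) * X t' = x0"
    using IVT2'[of "\<lambda>t. sg (Suc k) * X t" "\<zeta> (Suc k)" x0 "\<tau> (Suc k)"] c x0p xM X_zeta[of "Suc k"] tau_less_zeta[of "Suc k"]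
    by (auto simp: M_def)
  have "t' \<noteq> \<tau> (Suc k)" using t' xM by (auto simp: M_def)
  moreover have "t' \<noteq> \<zeta> (Suc k)" using t' x0p X_zeta[of "Suc k"] by auto
  ultimately have st: "\<tau> (Suc k) < t'" "t' < \<zeta> (Suc k)" using t' by auto
  have "En x0 y0 < En (X t') (Y t')"
    using En0 En_X_mono[of "\<tau> (Suc k)" t'] t' by linarith
  also have "\<dots> = En x0 (- sg (Suc k) * Y t')" using t'(3) sg_cases[of "Suc k"] by auto
  finally have "y0\<^sup>2 < (- sg (Suc k) * Y t')\<^sup>2" by (simp add: En_def)
  moreover have "0 < - sg (Suc k) * Y t'" using Y_arc[OF st(1)] st by simp
  ultimately have "y0 < - sg (Suc k) * Y t'" by (rule power_less_imp_less_base[OF _ less_imp_le])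
  then show ?thesis using st t'(3) unfolding below_def by blast
qed

end

section \<open>The fast decaying solution in the defocusing region\<close>

text \<open>Outside the unit ball, time is reversed and the fast decaying solution is multiplied by \<open>e\<^bsup>-\<mu>s\<^esup>\<close>, \<open>s = -t\<close>.
  This brings the equation to \<open>W'' + \<mu> W' = k e\<^bsup>\<rho>s\<^esup> W|W|\<^bsup>q-2\<^esup>\<close> and fast decay to convergence at minus infinity.\<close>

locale defocusing =
  fixes \<mu> \<gamma> k q :: real
  assumes mu: "0 < \<mu>" and gam: "0 < \<gamma>" and k: "0 < k" and q: "2 < q"
begin

definition "\<rho> = (q - 2) * \<gamma>"

lemma rho_pos: "0 < \<rho>" using q gam by (simp add: \<rho>_def)

text \<open>Truncation at the level \<open>n + 2\<close> makes the force globally Lipschitz continuous, so that solutions exist for all times.\<close>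

definition h :: "nat \<Rightarrow> real \<Rightarrow> real" where "h n x = k * spow q (cutoff (real n + 2) x)"

definition trunc :: "nat \<Rightarrow> (real \<Rightarrow> real) \<Rightarrow> (real \<Rightarrow> real) \<Rightarrow> bool" where
  "trunc n w p \<longleftrightarrow> (\<forall>t. (w has_real_derivative p t) (at t) \<and>
     (p has_real_derivative - \<mu> * p t + exp (\<rho> * t) * h n (w t)) (at t)) \<and> (w \<longlongrightarrow> 1) at_bot"

lemma h_lipschitz: "\<bar>h n x - h n y\<bar> \<le> k * ((q - 1) * (real n + 2) powr (q - 2)) * \<bar>x - y\<bar>"
  unfolding h_def by (rule scaled_spow_cutoff(1)[OF q]) (use k in auto)

lemma h_pos: "0 < x \<Longrightarrow> 0 < h n x"
  using k by (auto simp: h_def cutoff_def intro!: mult_pos_pos spow_pos)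

lemma h_eq: "0 < x \<Longrightarrow> x \<le> real n + 2 \<Longrightarrow> h n x = k * spow q x"
  by (simp add: h_def cutoff_id)

definition "wn n = (SOME w. \<exists>p. trunc n w p)"
definition "pn n = (SOME p. trunc n (wn n) p)"

lemma trunc_wn: "trunc n (wn n) (pn n)"
proof -
  have "\<exists>w p. trunc n w p"
    unfolding trunc_def using singular_exists[OF mu rho_pos h_lipschitz[of n], of 1] by blast
  then have "\<exists>p. trunc n (wn n) p" unfolding wn_def by (rule someI_ex)
  then show ?thesis unfolding pn_def by (rule someI_ex)
qed

lemma wn_deriv: "(wn n has_real_derivative pn n t) (at t)"
  and pn_deriv: "(pn n has_real_derivative - \<mu> * pn n t + exp (\<rho> * t) * h n (wn n t)) (at t)"
  and wn_lim: "(wn n \<longlongrightarrow> 1) at_bot"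
  using trunc_wn by (auto simp: trunc_def)

text \<open>As long as \<open>w\<close> is positive, \<open>e\<^bsup>\<mu>t\<^esup> p\<close> increases from its limit zero; and as long as \<open>p\<close> is positive, \<open>w\<close> increases
  from its limit one.\<close>

lemma pn_pos: "0 < pn n t"
proof -
  define A where "A t = exp (\<mu> * t) * pn n t" for t
  have Ad: "(A has_real_derivative exp ((\<mu> + \<rho>) * t) * h n (wn n t)) (at t)" for t
  proof -
    have e: "((\<lambda>t. exp (\<mu> * t)) has_real_derivative \<mu> * exp (\<mu> * t)) (at t)"
      by (auto intro!: derivative_eq_intros)
    show ?thesis unfolding A_def[abs_def]
      by (rule DERIV_cong[OF DERIV_mult[OF e pn_deriv]]) (simp add: algebra_simps exp_add)
  qed
  define H where "H = k * spow q (real n + 2)"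
  have H: "\<bar>h n x\<bar> \<le> H" for x
    unfolding h_def H_def by (rule scaled_spow_cutoff(2)[OF q]) (use k in auto)
  have ptail: "\<bar>pn n t\<bar> \<le> H / (\<mu> + \<rho>) * exp (\<rho> * t)" for t
    by (rule singular_tail(1)[OF mu rho_pos wn_deriv pn_deriv _ wn_lim order.refl]) (rule H)
  have "\<forall>\<^sub>F t in at_bot. norm (A t) \<le> H / (\<mu> + \<rho>) * exp ((\<mu> + \<rho>) * t)"
  proof (intro always_eventually allI)
    fix t
    have "norm (A t) = exp (\<mu> * t) * \<bar>pn n t\<bar>" by (simp add: A_def abs_mult)
    also have "\<dots> \<le> exp (\<mu> * t) * (H / (\<mu> + \<rho>) * exp (\<rho> * t))" using ptail by (intro mult_left_mono) auto
    finally show "norm (A t) \<le> H / (\<mu> + \<rho>) * exp ((\<mu> + \<rho>) * t)" by (simp add: algebra_simps exp_add)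
  qed
  then have Al: "(A \<longlongrightarrow> 0) at_bot"
    by (rule Lim_null_comparison[OF _ tendsto_mult_right_zero[OF filterlim_exp_at_bot_0]]) (use mu rho_pos in simp)
  have "\<forall>\<^sub>F t in at_bot. 0 < wn n t" using wn_lim by (rule order_tendstoD) simp
  then obtain t0 where t0: "\<And>t. t \<le> t0 \<Longrightarrow> 0 < wn n t" unfolding eventually_at_bot_linorder by blast
  have Apos: "0 < A t" if "t \<le> t0" for t
  proof (rule DERIV_pos_imp_increasing_at_bot[OF _ Al])
    fix s assume "s \<le> t"
    then have "0 < h n (wn n s)" using t0 that by (intro h_pos) simp
    then show "\<exists>d. (A has_real_derivative d) (at s) \<and> 0 < d" using Ad by force
  qed
  then have ppos: "0 < pn n t" if "t \<le> t0" for t using that by (simp add: A_def zero_less_mult_iff)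
  show ?thesis
  proof (cases "t \<le> t0")
    case False
    have "- pn n t < 0"
    proof (rule bound_persists[where a = t0 and f = "\<lambda>t. - pn n t" and t = t and M = 0])
      show "continuous_on {t0..} (\<lambda>t. - pn n t)"
        using pn_deriv by (auto intro!: continuous_intros continuous_at_imp_continuous_on dest: DERIV_isCont)
      fix t assume t: "t0 < t" "\<And>s. t0 \<le> s \<Longrightarrow> s < t \<Longrightarrow> - pn n s < 0"
      have wc: "continuous_on S (wn n)" and Ac: "continuous_on S A" for S
        using wn_deriv Ad by (blast intro: continuous_at_imp_continuous_on DERIV_isCont)+
      have wp: "0 < wn n s" if "t0 \<le> s" "s \<le> t" for s
      proof -
        have "wn n t0 \<le> wn n s"
        proof (rule increasing_open_real[OF that(1) wc wn_deriv])
          fix r assume "t0 < r" "r < s"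
          then show "0 \<le> pn n r" using t(2)[of r] that by simp
        qed
        then show ?thesis using t0[of t0] by simp
      qed
      have "A t0 \<le> A t"
      proof (rule increasing_open_real[OF less_imp_le[OF t(1)] Ac Ad])
        fix s assume "t0 < s" "s < t"
        then show "0 \<le> exp ((\<mu> + \<rho>) * s) * h n (wn n s)" using h_pos[OF wp[of s], of n] by (simp add: less_imp_le)
      qed
      then have "0 < A t" using Apos[of t0] by simp
      then show "- pn n t < 0" by (simp add: A_def zero_less_mult_iff)
    qed (use ppos False in auto)
    then show ?thesis by simp
  qed (rule ppos)
qed

lemma wn_strict_mono: "s < t \<Longrightarrow> wn n s < wn n t"
  by (rule DERIV_pos_imp_increasing) (use wn_deriv pn_pos in blast)+

lemma wn_mono: "s \<le> t \<Longrightarrow> wn n s \<le> wn n t"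
  using wn_strict_mono[of s t n] by (cases "s = t") auto

lemma wn_gt_1: "1 < wn n t"
  by (rule DERIV_pos_imp_increasing_at_bot[OF _ wn_lim]) (use wn_deriv pn_pos in blast)

lemma h_local_lipschitz:
  "\<exists>\<Lambda>\<ge>0. \<forall>x y. \<bar>x\<bar> \<le> R \<longrightarrow> \<bar>y\<bar> \<le> R \<longrightarrow> \<bar>h n x - h n y\<bar> \<le> \<Lambda> * \<bar>x - y\<bar>"
  using h_lipschitz[of n] q k by (intro exI[of _ "k * ((q - 1) * (real n + 2) powr (q - 2))"]) auto

lemma wn_agree:
  assumes "n \<le> m" "wn n t \<le> real n + 2" "s \<le> t"
  shows "wn n s = wn m s \<and> pn n s = pn m s"
proof (rule singular_unique[where h = "h m" and T = t and d = 1 and ?w1.0 = "wn n" and ?p1.0 = "pn n"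
      and ?w2.0 = "wn m" and ?p2.0 = "pn m", OF mu rho_pos h_local_lipschitz])
  fix s assume s: "s \<le> t"
  have "0 < wn n s" "wn n s \<le> real n + 2" using wn_gt_1[of n s] wn_mono[OF s, of n] assms by auto
  then have "h n (wn n s) = h m (wn n s)" using assms(1) by (simp add: h_eq)
  then show "(pn n has_real_derivative - \<mu> * pn n s + exp (\<rho> * s) * h m (wn n s)) (at s)"
    using pn_deriv[of n s] by simp
qed (rule wn_deriv pn_deriv wn_lim assms)+

text \<open>The truncations agree where they do not act; together they define the maximal solution.\<close>

definition D :: "real set" where "D = {t. \<exists>n. wn n t < real n + 2}"
definition W :: "real \<Rightarrow> real" where "W t = wn (SOME n. wn n t < real n + 2) t"
definition P :: "real \<Rightarrow> real" where "P t = pn (SOME n. wn n t < real n + 2) t"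

lemma W_eq: "wn n t < real n + 2 \<Longrightarrow> W t = wn n t \<and> P t = pn n t"
proof -
  assume n: "wn n t < real n + 2"
  define m where "m = (SOME n. wn n t < real n + 2)"
  have m: "wn m t < real m + 2" unfolding m_def using n by (rule someI)
  have "wn n t = wn m t \<and> pn n t = pn m t"
  proof (cases "n \<le> m")
    case True
    then show ?thesis by (rule wn_agree[OF _ less_imp_le[OF n] order.refl])
  next
    case False
    then have "m \<le> n" by simp
    from wn_agree[OF this less_imp_le[OF m] order.refl] show ?thesis by metis
  qed
  then show ?thesis by (simp add: W_def P_def m_def)
qed

lemma D_down: "t \<in> D \<Longrightarrow> s \<le> t \<Longrightarrow> s \<in> D"
  unfolding D_def using wn_mono le_less_trans by blast

lemma W_deriv: "t \<in> D \<Longrightarrow> (W has_real_derivative P t) (at t)"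
  and P_deriv: "t \<in> D \<Longrightarrow> (P has_real_derivative - \<mu> * P t + exp (\<rho> * t) * (k * spow q (W t))) (at t)"
proof -
  assume t: "t \<in> D"
  obtain m where m: "wn m t < real m + 2" using t by (auto simp: D_def)
  have mt: "W t = wn m t" "P t = pn m t" using W_eq[OF m] by auto
  define S where "S = wn m -` {..<real m + 2}"
  have "continuous_on UNIV (wn m)" using wn_deriv by (blast intro: continuous_at_imp_continuous_on DERIV_isCont)
  then have S: "open S" "t \<in> S" unfolding S_def using m by (auto simp: open_vimage)
  have eq': "W s = wn m s" "P s = pn m s" if "s \<in> S" for s using W_eq that by (auto simp: S_def)
  show "(W has_real_derivative P t) (at t)"
    by (rule has_field_derivative_transform_within_open[OF _ S(1,2), of "wn m"]) (use wn_deriv mt eq' in auto)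
  have "h m (wn m t) = k * spow q (W t)" using h_eq[of "wn m t" m] wn_gt_1[of m t] m mt by simp
  then have "(pn m has_real_derivative - \<mu> * P t + exp (\<rho> * t) * (k * spow q (W t))) (at t)"
    using pn_deriv[of m t] mt by simp
  then show "(P has_real_derivative - \<mu> * P t + exp (\<rho> * t) * (k * spow q (W t))) (at t)"
    by (rule has_field_derivative_transform_within_open[OF _ S(1,2)]) (use eq' in auto)
qed

lemma W_gt_1: "t \<in> D \<Longrightarrow> 1 < W t" and P_pos: "t \<in> D \<Longrightarrow> 0 < P t"
  using W_eq wn_gt_1 pn_pos by (auto simp: D_def)

lemma D_nonempty: "\<exists>t0. \<forall>t\<le>t0. wn 0 t < 2"
proof -
  have "\<forall>\<^sub>F t in at_bot. wn 0 t < 2" using wn_lim by (rule order_tendstoD) simp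
  then show ?thesis by (simp add: eventually_at_bot_linorder)
qed

lemma W_lim: "(W \<longlongrightarrow> 1) at_bot"
proof -
  obtain t0 where t0: "\<And>t. t \<le> t0 \<Longrightarrow> wn 0 t < 2" using D_nonempty by blast
  have "\<forall>\<^sub>F t in at_bot. wn 0 t = W t"
    using eventually_le_at_bot[of t0] by eventually_elim (use W_eq[of 0] t0 in force)
  with wn_lim[of 0] show ?thesis by (rule Lim_transform_eventually)
qed

text \<open>Blow-up in finite time: the superlinear growth \<open>P > \<epsilon> W\<^bsup>1+\<beta>\<^esup>\<close>, \<open>\<beta> = (q-2)/2\<close>, once true
  persists, because \<open>W\<^bsup>1+2\<beta>\<^esup> = W\<^bsup>q-1\<^esup>\<close> is the order of the forcing.\<close>

lemma D_bounded: "\<exists>C. \<forall>t\<in>D. t \<le> C"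
proof -
  obtain t0 where "\<And>t. t \<le> t0 \<Longrightarrow> wn 0 t < 2" using D_nonempty by blast
  then have t0: "t0 \<in> D" by (auto simp: D_def intro!: exI[of _ 0])
  define \<beta> where "\<beta> = (q - 2) / 2"
  have b: "0 < \<beta>" using q by (simp add: \<beta>_def)
  define \<epsilon> where "\<epsilon> = min 1 (min (P t0 / (2 * W t0 powr (1 + \<beta>))) (k * exp (\<rho> * t0) / (2 * (1 + \<beta> + \<mu>))))"
  have W0: "0 < W t0 powr (1 + \<beta>)" using W_gt_1[OF t0] by simp
  have eps: "0 < \<epsilon>" "\<epsilon> \<le> 1" using P_pos[OF t0] W0 k b mu by (auto simp: \<epsilon>_def)
  have eps1: "\<epsilon> * W t0 powr (1 + \<beta>) < P t0"
  proof -
    have "\<epsilon> \<le> P t0 / (2 * W t0 powr (1 + \<beta>))" by (simp add: \<epsilon>_def)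
    then have "\<epsilon> * W t0 powr (1 + \<beta>) \<le> P t0 / (2 * W t0 powr (1 + \<beta>)) * W t0 powr (1 + \<beta>)"
      using W0 by (intro mult_right_mono) auto
    also have "\<dots> = P t0 / 2" using W0 by simp
    finally show ?thesis using P_pos[OF t0] by simp
  qed
  have eps2: "\<epsilon>\<^sup>2 * (1 + \<beta>) + \<mu> * \<epsilon> < k * exp (\<rho> * t)" if "t0 \<le> t" for t
  proof -
    have "\<epsilon>\<^sup>2 \<le> \<epsilon> * 1" unfolding power2_eq_square using eps by (intro mult_left_mono) auto
    then have "\<epsilon>\<^sup>2 * (1 + \<beta>) + \<mu> * \<epsilon> \<le> \<epsilon> * (1 + \<beta>) + \<mu> * \<epsilon>" using b by (intro add_right_mono mult_right_mono) auto
    also have "\<dots> = \<epsilon> * (1 + \<beta> + \<mu>)" by (simp add: algebra_simps)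
    also have "\<dots> \<le> k * exp (\<rho> * t0) / (2 * (1 + \<beta> + \<mu>)) * (1 + \<beta> + \<mu>)"
      using b mu by (intro mult_right_mono) (auto simp: \<epsilon>_def)
    also have "\<dots> = k * exp (\<rho> * t0) / 2" using b mu by (simp add: field_simps)
    also have "\<dots> < k * exp (\<rho> * t0)" using k by simp
    also have "\<dots> \<le> k * exp (\<rho> * t)" using k rho_pos that by simp
    finally show ?thesis .
  qed
  have bound: "t \<le> t0 + 1 / (\<beta> * \<epsilon>)" if t: "t \<in> D" for t
  proof (cases "t0 \<le> t")
    case True
    have DD: "s \<in> D" if "s \<le> t" for s using D_down[OF t that] .
    have barrier: "0 < P s - \<epsilon> * W s powr (1 + \<beta>)" if s: "t0 \<le> s" "s \<le> t" for s
    proof (rule positive_persists[where a = t0 and b = s and f = "\<lambda>s. P s - \<epsilon> * W s powr (1 + \<beta>)" and f' = "\<lambda>s. (- \<mu> * P s + exp (\<rho> * s) * (k * spow q (W s))) -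
          \<epsilon> * ((1 + \<beta>) * W s powr (1 + \<beta> - of_nat 1) * P s)"])
      fix r assume r: "t0 \<le> r" "r \<le> s"
      then have rD: "r \<in> D" using s DD by simp
      show "((\<lambda>s. P s - \<epsilon> * W s powr (1 + \<beta>)) has_real_derivative (- \<mu> * P r + exp (\<rho> * r) * (k * spow q (W r))) -
          \<epsilon> * ((1 + \<beta>) * W r powr (1 + \<beta> - of_nat 1) * P r)) (at r)"
        by (intro DERIV_diff DERIV_cmult P_deriv[OF rD] DERIV_fun_powr[OF W_deriv[OF rD]]) (use W_gt_1[OF rD] in simp)
    next
      fix r assume r: "t0 < r" "r \<le> s" "P r - \<epsilon> * W r powr (1 + \<beta>) = 0"
      then have rD: "r \<in> D" using s DD by simp
      have W1: "1 < W r" by (rule W_gt_1[OF rD])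
      have Pr: "P r = \<epsilon> * W r powr (1 + \<beta>)" using r by simp
      have pw: "W r powr (1 + \<beta> - of_nat 1) * W r powr (1 + \<beta>) = W r powr (q - 1)"
        using W1 by (simp add: powr_add[symmetric] \<beta>_def)
      have le: "W r powr (1 + \<beta>) \<le> W r powr (q - 1)" using W1 q by (intro powr_mono) (auto simp: \<beta>_def field_simps)
      have "\<mu> * P r + \<epsilon> * ((1 + \<beta>) * W r powr (1 + \<beta> - of_nat 1) * P r)
        = \<mu> * \<epsilon> * W r powr (1 + \<beta>) + \<epsilon>\<^sup>2 * (1 + \<beta>) * (W r powr (1 + \<beta> - of_nat 1) * W r powr (1 + \<beta>))"
        unfolding Pr by (simp only: power2_eq_square mult.assoc mult.commute mult.left_commute)
      also have "\<dots> = \<mu> * \<epsilon> * W r powr (1 + \<beta>) + \<epsilon>\<^sup>2 * (1 + \<beta>) * W r powr (q - 1)" unfolding pw ..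
      also have "\<dots> \<le> \<mu> * \<epsilon> * W r powr (q - 1) + \<epsilon>\<^sup>2 * (1 + \<beta>) * W r powr (q - 1)"
        using le mu eps by (intro add_right_mono mult_left_mono) auto
      also have "\<dots> = (\<epsilon>\<^sup>2 * (1 + \<beta>) + \<mu> * \<epsilon>) * W r powr (q - 1)" by (simp add: algebra_simps)
      also have "\<dots> < k * exp (\<rho> * r) * W r powr (q - 1)"
        using eps2[of r] r W1 by (intro mult_strict_right_mono) auto
      also have "\<dots> = exp (\<rho> * r) * (k * spow q (W r))" using W1 by (simp add: spow_eq_powr)
      finally show "0 < (- \<mu> * P r + exp (\<rho> * r) * (k * spow q (W r))) -
          \<epsilon> * ((1 + \<beta>) * W r powr (1 + \<beta> - of_nat 1) * P r)" by simp
    qed (use eps1 s in auto)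
    have "W t powr (- \<beta>) + \<beta> * \<epsilon> * t \<le> W t0 powr (- \<beta>) + \<beta> * \<epsilon> * t0"
    proof (rule deriv_nonpos_imp_antimono[where g = "\<lambda>t. W t powr (- \<beta>) + \<beta> * \<epsilon> * t"
          and g' = "\<lambda>s. - \<beta> * W s powr (- \<beta> - of_nat 1) * P s + \<beta> * \<epsilon>"])
      fix r assume "r \<in> {t0..t}"
      then have r: "t0 \<le> r" "r \<le> t" and rD: "r \<in> D" using DD by auto
      have m: "((\<lambda>t. \<beta> * \<epsilon> * t) has_real_derivative \<beta> * \<epsilon>) (at r)" by (auto intro!: derivative_eq_intros)
      show "((\<lambda>t. W t powr (- \<beta>) + \<beta> * \<epsilon> * t) has_real_derivative - \<beta> * W r powr (- \<beta> - of_nat 1) * P r + \<beta> * \<epsilon>) (at r)"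
        by (intro DERIV_add m DERIV_fun_powr[OF W_deriv[OF rD]]) (use W_gt_1[OF rD] in simp)
      have le: "W r powr (- \<beta> - of_nat 1) * (\<epsilon> * W r powr (1 + \<beta>)) \<le> W r powr (- \<beta> - of_nat 1) * P r"
        using barrier[OF r] by (intro mult_left_mono) auto
      have "W r powr (- \<beta> - of_nat 1) * (\<epsilon> * W r powr (1 + \<beta>)) = \<epsilon> * W r powr ((- \<beta> - of_nat 1) + (1 + \<beta>))"
        unfolding powr_add by simp
      also have "\<dots> = \<epsilon>" using W_gt_1[OF rD] by simp
      finally have eq: "W r powr (- \<beta> - of_nat 1) * (\<epsilon> * W r powr (1 + \<beta>)) = \<epsilon>" .
      have "\<epsilon> \<le> W r powr (- \<beta> - of_nat 1) * P r" using le unfolding eq .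
      then have "\<beta> * \<epsilon> \<le> \<beta> * (W r powr (- \<beta> - of_nat 1) * P r)" using b by (intro mult_left_mono) auto
      then show "- \<beta> * W r powr (- \<beta> - of_nat 1) * P r + \<beta> * \<epsilon> \<le> 0" by (simp add: mult.assoc)
    qed (rule True)
    moreover have "0 \<le> W t powr (- \<beta>)" by simp
    moreover have "W t0 powr (- \<beta>) \<le> W t0 powr 0" using W_gt_1[OF t0] b by (intro powr_mono) auto
    moreover have "W t0 powr 0 = 1" using W_gt_1[OF t0] by simp
    ultimately have "\<beta> * \<epsilon> * t \<le> 1 + \<beta> * \<epsilon> * t0" by linarith
    then have "\<beta> * \<epsilon> * (t - t0) \<le> 1" unfolding right_diff_distrib by linarith
    then have "t - t0 \<le> 1 / (\<beta> * \<epsilon>)" using b eps by (simp add: pos_le_divide_eq mult.commute)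
    then show ?thesis by simp
  next
    case False
    moreover have "0 < 1 / (\<beta> * \<epsilon>)" using b eps by simp
    ultimately show ?thesis by linarith
  qed
  then show ?thesis by blast
qed

text \<open>The truncated solutions exist for all times, so the maximal one can only end by exceeding every truncation level.\<close>

lemma W_unbounded: "\<exists>t\<in>D. C < W t"
proof -
  obtain n :: nat where n: "C < real n" using reals_Archimedean2 by blast
  obtain B where B: "\<And>t. t \<in> D \<Longrightarrow> t \<le> B" using D_bounded by blast
  have "B + 1 \<notin> D" using B[of "B + 1"] by auto
  then have big: "real n + 2 \<le> wn n (B + 1)" by (auto simp: D_def not_less)
  have "\<forall>\<^sub>F t in at_bot. wn n t < real n + 3/2 \<and> t \<le> B + 1"
    by (rule eventually_conj[OF order_tendstoD(2)[OF wn_lim] eventually_le_at_bot]) simp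
  then obtain t1 where t1: "wn n t1 < real n + 3/2" "t1 \<le> B + 1"
    using eventually_happens'[OF trivial_limit_at_bot_linorder] by blast
  have "continuous_on {t1..B+1} (wn n)" using wn_deriv by (blast intro: continuous_at_imp_continuous_on DERIV_isCont)
  then obtain t where t: "t1 \<le> t" "t \<le> B + 1" "wn n t = real n + 3/2"
    using IVT'[of "wn n" t1 "real n + 3/2" "B + 1"] t1 big by auto
  then have "wn n t < real n + 2" by simp
  then have tD: "t \<in> D" unfolding D_def by blast
  have "W t = real n + 3/2" using W_eq[of n t] t by simp
  then have "C < W t" using n by simp
  with tD show ?thesis by (rule bexI[rotated])
qed

end

section \<open>The curve of fast decaying data crosses every branch of the spiral once\<close>

locale matched = damped_well \<mu> \<gamma> K q + outer: defocusing \<mu> \<gamma>' k q'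
  for \<mu> \<gamma> K q \<gamma>' k q' :: real +
  assumes balance: "\<mu> \<le> \<gamma> + \<gamma>'"
begin

text \<open>By scaling, the outer solution with coefficient \<open>e\<^bsup>\<gamma>'\<sigma>\<^esup>\<close> is the normalized one shifted by \<open>\<sigma>\<close>;
  \<open>(data_x \<sigma>, data_y \<sigma>)\<close> is its phase point at the interface, in the inner coordinates.\<close>

definition data_x :: "real \<Rightarrow> real" where "data_x \<sigma> = exp (\<gamma>' * \<sigma>) * outer.W \<sigma>"
definition data_y :: "real \<Rightarrow> real" where "data_y \<sigma> = exp (\<gamma>' * \<sigma>) * ((\<mu> - \<gamma>) * outer.W \<sigma> + outer.P \<sigma>)"

abbreviation (input) b where "b \<equiv> \<gamma> + \<gamma>' - \<mu>"

lemma data_x_pos: "\<sigma> \<in> outer.D \<Longrightarrow> 0 < data_x \<sigma>"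
  using outer.W_gt_1[of \<sigma>] by (simp add: data_x_def)

lemma data_y_gt: "\<sigma> \<in> outer.D \<Longrightarrow> (\<mu> - \<gamma>) * data_x \<sigma> < data_y \<sigma>"
  using outer.P_pos[of \<sigma>] by (simp add: data_x_def data_y_def algebra_simps)

lemma data_y_pos: "\<sigma> \<in> outer.D \<Longrightarrow> 0 < data_y \<sigma>"
  using data_y_gt[of \<sigma>] data_x_pos[of \<sigma>] gam by (smt (verit) mult_nonneg_nonneg)

lemma data_x_deriv: "\<sigma> \<in> outer.D \<Longrightarrow> (data_x has_real_derivative data_y \<sigma> + b * data_x \<sigma>) (at \<sigma>)"
  unfolding data_x_def[abs_def]
  by (rule DERIV_cong[OF DERIV_mult[OF exp_scale_deriv outer.W_deriv]]) (auto simp: data_y_def data_x_def algebra_simps)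

lemma data_y_deriv:
  assumes "\<sigma> \<in> outer.D"
  shows "(data_y has_real_derivative (\<gamma>' - \<gamma>) * data_y \<sigma> + B * data_x \<sigma> + k * spow q' (data_x \<sigma>)) (at \<sigma>)"
proof -
  have s: "spow q' (data_x \<sigma>) = exp (\<gamma>' * \<sigma>) * exp (outer.\<rho> * \<sigma>) * spow q' (outer.W \<sigma>)"
    using spow_scale[of "exp (\<gamma>' * \<sigma>)" q' "outer.W \<sigma>"]
    by (simp add: data_x_def powr_def outer.\<rho>_def exp_add[symmetric] algebra_simps)
  show ?thesis unfolding data_y_def[abs_def]
    by (rule DERIV_cong[OF DERIV_mult[OF exp_scale_deriv DERIV_add[OF DERIV_cmult[OF outer.W_deriv] outer.P_deriv]]])
       (use assms in \<open>auto simp: s, simp add: data_x_def data_y_def B_def algebra_simps\<close>)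
qed

lemma data_x_strict_mono:
  assumes D: "\<sigma>' \<in> outer.D" and less: "\<sigma> < \<sigma>'"
  shows "data_x \<sigma> < data_x \<sigma>'"
proof (rule DERIV_pos_imp_increasing[OF less])
  fix t assume "t \<le> \<sigma>'"
  then have t: "t \<in> outer.D" by (rule outer.D_down[OF D])
  have "0 < data_y t + b * data_x t" using data_y_pos[OF t] data_x_pos[OF t] balance by (simp add: add_pos_nonneg)
  then show "\<exists>d. (data_x has_real_derivative d) (at t) \<and> 0 < d" using data_x_deriv[OF t] by blast
qed

lemma data_x_data_y_lim: "(data_x \<longlongrightarrow> 0) at_bot" "(data_y \<longlongrightarrow> 0) at_bot"
proof -
  have e: "((\<lambda>t. exp (\<gamma>' * t)) \<longlongrightarrow> 0) at_bot" by (rule filterlim_exp_at_bot_0[OF outer.gam])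
  have "((\<lambda>t. exp (\<gamma>' * t) * outer.W t) \<longlongrightarrow> 0 * 1) at_bot" by (intro tendsto_intros e outer.W_lim)
  then show "(data_x \<longlongrightarrow> 0) at_bot" by (simp add: data_x_def[abs_def])
  obtain t0 where t0: "\<And>t. t \<le> t0 \<Longrightarrow> outer.wn 0 t < 2" using outer.D_nonempty by blast
  then have D: "t \<in> outer.D" if "t \<le> t0" for t using that by (auto simp: outer.D_def intro!: exI[of _ 0])
  have Wb: "\<bar>k * spow q' (outer.W t)\<bar> \<le> k * spow q' 2" if "t \<le> t0" for t
  proof -
    have "outer.W t = outer.wn 0 t" using outer.W_eq[of 0 t] t0[OF that] by simp
    then have "0 < outer.W t" "outer.W t \<le> 2" using t0[OF that] outer.W_gt_1[OF D[OF that]] by auto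
    then have "\<bar>spow q' (outer.W t)\<bar> \<le> spow q' 2"
      using outer.q by (auto simp: spow_def abs_mult intro!: mult_mono powr_mono2)
    then show ?thesis using outer.k by (simp add: abs_mult)
  qed
  have Pb: "\<bar>outer.P t\<bar> \<le> k * spow q' 2 / (\<mu> + outer.\<rho>) * exp (outer.\<rho> * t)" if "t \<le> t0" for t
    by (rule singular_tail(1)[OF mu outer.rho_pos outer.W_deriv[OF D] outer.P_deriv[OF D] Wb outer.W_lim that])
  have "\<forall>\<^sub>F t in at_bot. norm (outer.P t) \<le> k * spow q' 2 / (\<mu> + outer.\<rho>) * exp (outer.\<rho> * t)"
    using eventually_le_at_bot[of t0] by eventually_elim (use Pb in simp)
  then have P: "(outer.P \<longlongrightarrow> 0) at_bot"
    by (rule Lim_null_comparison[OF _ tendsto_mult_right_zero[OF filterlim_exp_at_bot_0[OF outer.rho_pos]]])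
  have "((\<lambda>t. exp (\<gamma>' * t) * ((\<mu> - \<gamma>) * outer.W t + outer.P t)) \<longlongrightarrow> 0 * ((\<mu> - \<gamma>) * 1 + 0)) at_bot"
    by (intro tendsto_intros e outer.W_lim P)
  then show "(data_y \<longlongrightarrow> 0) at_bot" by (simp add: data_y_def[abs_def])
qed

subsection \<open>The branches as graphs\<close>

text \<open>The \<open>j\<close>-th branch as a graph: \<open>F j\<close> is the velocity as a function of the position, through the time
  at which the spiral passes that position.\<close>

definition branch_time :: "nat \<Rightarrow> real \<Rightarrow> real" where "branch_time j = inv_into {\<tau> j..\<zeta> j} (\<lambda>t. sg j * X t)"
definition F :: "nat \<Rightarrow> real \<Rightarrow> real" where "F j v = - sg j * Y (branch_time j v)"

lemma branch_X_dec:
  assumes "\<tau> j \<le> s" "s < t" "t \<le> \<zeta> j"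
  shows "sg j * X t < sg j * X s"
proof (rule DERIV_neg_imp_decreasing_open[OF assms(2)])
  fix r assume "s < r" "r < t"
  then have "sg j * Y r < 0" using assms by (intro Y_arc) auto
  then show "\<exists>d. ((\<lambda>t. sg j * X t) has_real_derivative d) (at r) \<and> d < 0"
    using DERIV_cmult[OF X_deriv] by blast
qed (auto intro!: continuous_intros X_cont)

lemma branch_X_inj: "inj_on (\<lambda>t. sg j * X t) {\<tau> j..\<zeta> j}"
proof (rule inj_onI)
  fix s t assume "s \<in> {\<tau> j..\<zeta> j}" "t \<in> {\<tau> j..\<zeta> j}" "sg j * X s = sg j * X t"
  then show "s = t" using branch_X_dec[of j s t] branch_X_dec[of j t s] by (cases s t rule: linorder_cases) auto
qed

lemma branch_time_X: "t \<in> {\<tau> j..\<zeta> j} \<Longrightarrow> branch_time j (sg j * X t) = t"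
  unfolding branch_time_def by (rule inv_into_f_f[OF branch_X_inj])

lemma branch_X_image: "(\<lambda>t. sg j * X t) ` {\<tau> j..\<zeta> j} = {0..M j}"
proof (intro set_eqI iffI)
  fix v assume "v \<in> (\<lambda>t. sg j * X t) ` {\<tau> j..\<zeta> j}"
  then obtain t where t: "\<tau> j \<le> t" "t \<le> \<zeta> j" "v = sg j * X t" by auto
  have "0 \<le> v" using t X_arc[of j t] X_zeta[of j] by (cases "t = \<zeta> j") auto
  moreover have "v \<le> M j" using t branch_X_dec[of j "\<tau> j" t] by (cases "t = \<tau> j") (auto simp: M_def)
  ultimately show "v \<in> {0..M j}" by simp
next
  fix v assume v: "v \<in> {0..M j}"
  have "continuous_on {\<tau> j..\<zeta> j} (\<lambda>t. sg j * X t)" by (intro continuous_intros X_cont)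
  then obtain t where "\<tau> j \<le> t" "t \<le> \<zeta> j" "sg j * X t = v"
    using IVT2'[of "\<lambda>t. sg j * X t" "\<zeta> j" v "\<tau> j"] v X_zeta[of j] tau_less_zeta[of j] by (auto simp: M_def)
  then show "v \<in> (\<lambda>t. sg j * X t) ` {\<tau> j..\<zeta> j}" by force
qed

lemma branch_time_in:
  assumes "v \<in> {0..M j}"
  shows "branch_time j v \<in> {\<tau> j..\<zeta> j} \<and> sg j * X (branch_time j v) = v"
proof -
  obtain t where t: "t \<in> {\<tau> j..\<zeta> j}" "v = sg j * X t" using assms unfolding branch_X_image[symmetric] by blast
  have "branch_time j v = t" unfolding t(2) by (rule branch_time_X[OF t(1)])
  with t show ?thesis by simp
qed

lemma branch_time_in_open: "0 < v \<Longrightarrow> v < M j \<Longrightarrow> \<tau> j < branch_time j v \<and> branch_time j v < \<zeta> j \<and> sg j * X (branch_time j v) = v"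
  using branch_time_in[of v j] X_zeta[of j] by (auto simp: M_def less_le)

lemma branch_time_cont: "continuous_on {0..M j} (branch_time j)"
  unfolding branch_X_image[symmetric]
  by (rule continuous_on_inv) (use branch_time_X in \<open>auto intro!: continuous_intros X_cont\<close>)

lemma F_cont: "continuous_on {0..M j} (F j)"
  unfolding F_def[abs_def]
  by (intro continuous_intros continuous_on_compose2[OF Y_cont[of UNIV] branch_time_cont]) auto

lemma F_ends: "F j (M j) = 0" "0 < F j 0"
proof -
  have "branch_time j (sg j * X (\<tau> j)) = \<tau> j" "branch_time j (sg j * X (\<zeta> j)) = \<zeta> j"
    by (rule branch_time_X, use tau_less_zeta[of j] in simp)+
  then have "branch_time j (M j) = \<tau> j" "branch_time j 0 = \<zeta> j" by (auto simp: M_def X_zeta)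
  then show "F j (M j) = 0" "0 < F j 0" using Y_arc[of j "\<zeta> j"] tau_less_zeta[of j] by (auto simp: F_def Y_tau)
qed

text \<open>The trajectory equation divided by the velocity; inwards the branch is traversed with position and velocity positive.\<close>

lemma F_deriv:
  assumes v: "0 < v" "v < M j"
  shows "(F j has_real_derivative - (a * F j v + dV v) / F j v) (at v)"
proof -
  note br = branch_time_in_open[OF v]
  have Yneg: "sg j * Y (branch_time j v) < 0" using br by (intro Y_arc) auto
  have "(branch_time j has_real_derivative inverse (sg j * Y (branch_time j v))) (at v)"
  proof (rule DERIV_inverse_function[where f = "\<lambda>t. sg j * X t" and a = 0 and b = "M j"])
    show "((\<lambda>t. sg j * X t) has_real_derivative sg j * Y (branch_time j v)) (at (branch_time j v))"
      by (rule DERIV_cmult[OF X_deriv])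
    show "isCont (branch_time j) v" using continuous_on_interior[OF branch_time_cont] v by simp
    show "sg j * X (branch_time j y) = y" if "0 < y" "y < M j" for y using branch_time_in_open[OF that] by simp
  qed (use v Yneg in auto)
  then have "((\<lambda>v. - sg j * Y (branch_time j v)) has_real_derivative
      - sg j * ((a * Y (branch_time j v) - dV (X (branch_time j v))) * inverse (sg j * Y (branch_time j v)))) (at v)"
    by (intro DERIV_cmult DERIV_chain2[OF Y_deriv])
  moreover have Xv: "X (branch_time j v) = sg j * v" using br sg_cases[of j] by auto
  moreover have "dV (X (branch_time j v)) = sg j * dV v" unfolding Xv using sg_cases[of j] by auto
  ultimately show ?thesis using Yneg sg_cases[of j] unfolding F_def[abs_def]
    by (elim DERIV_cong) (auto simp: field_simps)
qed

lemma below_iff: "below j v u \<longleftrightarrow> 0 < v \<and> v < M j \<and> u < F j v"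
proof
  assume "below j v u"
  then obtain t where t: "\<tau> j < t" "t < \<zeta> j" "sg j * X t = v" "u < - sg j * Y t" by (auto simp: below_def)
  have "branch_time j v = t" using branch_time_X[of t j] t by auto
  moreover have "v < M j" using branch_X_dec[of j "\<tau> j" t] t by (simp add: M_def)
  ultimately show "0 < v \<and> v < M j \<and> u < F j v" using t X_arc[of j t] by (auto simp: F_def)
next
  assume "0 < v \<and> v < M j \<and> u < F j v"
  then show "below j v u" using branch_time_in_open[of v j] unfolding below_def F_def by blast
qed

lemma above_if: "0 < v \<Longrightarrow> v < M j \<Longrightarrow> F j v < u \<Longrightarrow> above j v u"
  using branch_time_in_open[of v j] unfolding above_def F_def by blast

subsection \<open>Crossing in one direction\<close>

text \<open>The height of the curve of fast decaying data above the \<open>j\<close>-th branch, at equal position.\<close>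

definition G :: "nat \<Rightarrow> real \<Rightarrow> real" where "G j \<sigma> = data_y \<sigma> - F j (data_x \<sigma>)"

definition G' :: "nat \<Rightarrow> real \<Rightarrow> real" where
  "G' j \<sigma> = (\<gamma>' - \<gamma>) * data_y \<sigma> + B * data_x \<sigma> + k * spow q' (data_x \<sigma>) +
     (a * F j (data_x \<sigma>) + dV (data_x \<sigma>)) / F j (data_x \<sigma>) * (data_y \<sigma> + b * data_x \<sigma>)"

lemma G_deriv:
  assumes D: "\<sigma> \<in> outer.D" and M: "data_x \<sigma> < M j"
  shows "(G j has_real_derivative G' j \<sigma>) (at \<sigma>)"
proof -
  have eq: "u - - w / f * z = u + w / f * z" for u w f z :: real by simp
  show ?thesis unfolding G_def[abs_def] G'_def
    by (rule DERIV_cong[OF DERIV_diff[OF data_y_deriv[OF D] DERIV_chain2[OF F_deriv[OF data_x_pos[OF D] M] data_x_deriv[OF D]]]])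
       (rule eq)
qed

text \<open>At an intersection the slopes are ordered: the difference is, up to positive terms, \<open>b\<close> times
  the quadratic form \<open>y\<^sup>2 + a x y - B x\<^sup>2\<close>, which vanishes along the direction \<open>y = (\<mu> - \<gamma>) x\<close> of the
  fast decaying linear solutions and is positive above it, where the curve lies.\<close>

lemma G_upcrossing:
  assumes D: "\<sigma> \<in> outer.D" and M: "data_x \<sigma> < M j" and z: "G j \<sigma> = 0"
  shows "0 < G' j \<sigma>"
proof -
  define x y where "x = data_x \<sigma>" and "y = data_y \<sigma>"
  have x: "0 < x" and y: "0 < y" and gt: "(\<mu> - \<gamma>) * x < y"
    using data_x_pos[OF D] data_y_pos[OF D] data_y_gt[OF D] by (auto simp: x_def y_def)
  have F: "F j x = y" using z by (simp add: G_def x_def y_def)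
  have s: "0 < spow q' x" "0 < spow q x" using x by (auto intro: spow_pos)
  have "G' j \<sigma> = (\<gamma>' - \<gamma>) * y + B * x + k * spow q' x + (a * y + (K * spow q x - B * x)) / y * (y + b * x)"
    unfolding G'_def x_def[symmetric] y_def[symmetric] F by (simp add: dV_def)
  then have "G' j \<sigma> * y = b * ((y - (\<mu> - \<gamma>) * x) * (y + \<gamma> * x)) + k * spow q' x * y + K * spow q x * (y + b * x)"
    using y by (simp add: field_simps a_def B_def)
  moreover have "0 \<le> b * ((y - (\<mu> - \<gamma>) * x) * (y + \<gamma> * x))"
    using balance gt y x gam_pos by (intro mult_nonneg_nonneg) auto
  moreover have "0 < k * spow q' x * y" using outer.k s y by simp
  moreover have "0 \<le> K * spow q x * (y + b * x)" using K s y x balance by simp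
  ultimately have "0 < G' j \<sigma> * y" by linarith
  then show ?thesis using y by (simp add: zero_less_mult_iff)
qed

text \<open>Just after an intersection the height is positive, and it cannot return to zero from above.\<close>

lemma G_persists:
  assumes D: "\<sigma>' \<in> outer.D" and M: "data_x \<sigma>' < M j" and lt: "\<sigma> < \<sigma>'" and G: "0 \<le> G j \<sigma>"
  shows "0 < G j \<sigma>'"
proof -
  have DD: "s \<in> outer.D" "data_x s < M j" if "s \<le> \<sigma>'" for s
    using outer.D_down[OF D that] data_x_strict_mono[OF D, of s] M that by (cases "s = \<sigma>'"; force)+
  obtain s where s: "\<sigma> \<le> s" "s \<le> \<sigma>'" "0 < G j s"
  proof (cases "G j \<sigma> = 0")
    case True
    have "\<exists>d>0. \<forall>h>0. h < d \<longrightarrow> G j \<sigma> < G j (\<sigma> + h)"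
      by (rule DERIV_pos_inc_right[OF G_deriv G_upcrossing]) (use DD[of \<sigma>] lt True in auto)
    then obtain d where d: "0 < d" "\<And>h. 0 < h \<Longrightarrow> h < d \<Longrightarrow> 0 < G j (\<sigma> + h)" using True by auto
    show ?thesis
      by (rule that[of "\<sigma> + min (d/2) (\<sigma>' - \<sigma>)"]) (use d lt in auto)
  next
    case False
    then show ?thesis using that[of \<sigma>] G lt by simp
  qed
  show ?thesis
    by (rule positive_persists[where a = s and b = \<sigma>' and f' = "G' j"])
       (use s DD G_deriv G_upcrossing in auto)
qed

text \<open>Near the origin the curve lies below the branch, whose velocity at position zero is positive; at the position of the
  turning point \<open>M j\<close> it lies above, since its own velocity is positive. So there is a crossing, and by
  \<open>G_persists\<close> only one.\<close>

lemma curve_crosses_branch: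
  "\<exists>\<sigma>\<in>outer.D. data_x \<sigma> < M j \<and> G j \<sigma> = 0 \<and>
     (\<forall>s<\<sigma>. below j (data_x s) (data_y s)) \<and> (\<forall>s\<in>outer.D. \<sigma> < s \<longrightarrow> above j (data_x s) (data_y s))"
proof -
  obtain t0 where t0: "\<And>t. t \<le> t0 \<Longrightarrow> outer.wn 0 t < 2" using outer.D_nonempty by blast
  have xT: "\<exists>T\<in>outer.D. M j < data_x T"
  proof -
    have t0D: "t0 \<in> outer.D" using t0[of t0] by (auto simp: outer.D_def intro!: exI[of _ 0])
    obtain T where T: "T \<in> outer.D" "max (outer.W t0) (M j / exp (\<gamma>' * t0)) < outer.W T"
      using outer.W_unbounded[of "max (outer.W t0) (M j / exp (\<gamma>' * t0))"] by blast
    have "t0 \<le> T"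
    proof (rule ccontr)
      assume "\<not> t0 \<le> T"
      then have "T < t0" by simp
      have "outer.W T < outer.W t0"
        by (rule DERIV_pos_imp_increasing[OF \<open>T < t0\<close>])
           (use outer.W_deriv outer.P_pos outer.D_down[OF t0D] in blast)
      with T show False by simp
    qed
    then have "exp (\<gamma>' * t0) \<le> exp (\<gamma>' * T)" using outer.gam by simp
    then have "exp (\<gamma>' * t0) * outer.W T \<le> data_x T"
      unfolding data_x_def using outer.W_gt_1[OF T(1)] by (intro mult_right_mono) auto
    moreover have "M j < exp (\<gamma>' * t0) * outer.W T" using T(2) by (simp add: divide_less_eq mult.commute)
    ultimately show ?thesis using T(1) by (intro bexI[of _ T]) auto
  qed
  then obtain T where T: "T \<in> outer.D" "M j < data_x T" by blast
  have D: "s \<in> outer.D" if "s \<le> T" for s using outer.D_down[OF T(1) that] .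
  have cxc: "continuous_on {..T} data_x" and cyc: "continuous_on {..T} data_y"
    using data_x_deriv[OF D] data_y_deriv[OF D] by (auto intro!: continuous_at_imp_continuous_on dest: DERIV_isCont)
  have "((\<lambda>s. data_y s - F j (data_x s)) \<longlongrightarrow> 0 - F j 0) at_bot"
  proof (intro tendsto_intros data_x_data_y_lim)
    have "(F j \<longlongrightarrow> F j 0) (at 0 within {0..M j})"
      using F_cont[of j] M_pos[of j] by (auto simp: continuous_on_def)
    moreover have "filterlim data_x (at 0 within {0..M j}) at_bot"
    proof -
      have "\<forall>\<^sub>F s in at_bot. data_x s < M j \<and> s \<le> T"
        using order_tendstoD(2)[OF data_x_data_y_lim(1) M_pos[of j]] eventually_le_at_bot[of T] by (rule eventually_conj)
      then have "\<forall>\<^sub>F s in at_bot. data_x s \<in> {0..M j} \<and> data_x s \<noteq> 0"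
        by eventually_elim (use data_x_pos[OF D] in force)
      with data_x_data_y_lim(1) show ?thesis by (simp add: filterlim_at)
    qed
    ultimately show "((\<lambda>s. F j (data_x s)) \<longlongrightarrow> F j 0) at_bot" by (rule filterlim_compose)
  qed
  then have "\<forall>\<^sub>F s in at_bot. G j s < 0"
    unfolding G_def by (rule order_tendstoD) (use F_ends in simp)
  then have "\<forall>\<^sub>F s in at_bot. G j s < 0 \<and> s \<le> T \<and> data_x s < M j"
    using eventually_le_at_bot[of T] order_tendstoD(2)[OF data_x_data_y_lim(1) M_pos[of j]] by (intro eventually_conj)
  then obtain s0 where s0: "G j s0 < 0" "s0 \<le> T" "data_x s0 < M j"
    using eventually_happens'[OF trivial_limit_at_bot_linorder] by blast
  obtain S where S: "s0 \<le> S" "S \<le> T" "data_x S = M j"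
    using IVT'[of data_x s0 "M j" T] s0 T continuous_on_subset[OF cxc, of "{s0..T}"] by auto
  have cM: "data_x s \<in> {0..M j}" if "s \<le> S" for s
    using data_x_pos[OF D, of s] data_x_strict_mono[OF D[OF S(2)], of s] S that by (cases "s = S") auto
  have "continuous_on {s0..S} (\<lambda>s. F j (data_x s))"
    by (rule continuous_on_compose2[OF F_cont continuous_on_subset[OF cxc]]) (use cM S in auto)
  then have "continuous_on {s0..S} (G j)" unfolding G_def[abs_def]
    using S by (intro continuous_intros continuous_on_subset[OF cyc]) auto
  moreover have GS: "0 < G j S" using data_y_pos[OF D[OF S(2)]] F_ends S by (simp add: G_def)
  ultimately obtain \<sigma> where \<sigma>: "s0 \<le> \<sigma>" "\<sigma> \<le> S" "G j \<sigma> = 0"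
    using IVT'[of "G j" s0 0 S] s0 S by auto
  have "\<sigma> \<noteq> S" using \<sigma> GS by auto
  then have \<sigma>S: "\<sigma> < S" using \<sigma> by simp
  have \<sigma>D: "\<sigma> \<in> outer.D" "data_x \<sigma> < M j"
    using D[of \<sigma>] data_x_strict_mono[OF D[OF S(2)] \<sigma>S] \<sigma>S S by auto
  have bel: "below j (data_x s) (data_y s)" if "s < \<sigma>" for s
  proof -
    have sD: "s \<in> outer.D" using D that \<sigma>S S by auto
    have "data_x s < M j" using data_x_strict_mono[OF \<sigma>D(1) that] \<sigma>D by simp
    moreover have "G j s < 0" using G_persists[OF \<sigma>D that] \<sigma>(3) by force
    ultimately show ?thesis using data_x_pos[OF sD] by (simp add: below_iff G_def)
  qed
  have abv: "above j (data_x s) (data_y s)" if "s \<in> outer.D" "\<sigma> < s" for s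
  proof (cases "data_x s < M j")
    case True
    have "0 < G j s" using G_persists[OF that(1) True that(2)] \<sigma>(3) by simp
    then show ?thesis using data_x_pos[OF that(1)] True by (intro above_if) (auto simp: G_def)
  next
    case False
    then show ?thesis by (simp add: above_def)
  qed
  show ?thesis using \<sigma>D \<sigma>(3) bel abv by blast
qed

text \<open>\<open>cross j\<close> is the parameter on the curve and \<open>cross_time j\<close> the time on the spiral of their intersection on
  the \<open>j\<close>-th branch.\<close>

definition cross :: "nat \<Rightarrow> real" where
  "cross j = (SOME \<sigma>. \<sigma> \<in> outer.D \<and> data_x \<sigma> < M j \<and> G j \<sigma> = 0 \<and>
     (\<forall>s<\<sigma>. below j (data_x s) (data_y s)) \<and> (\<forall>s\<in>outer.D. \<sigma> < s \<longrightarrow> above j (data_x s) (data_y s)))"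

definition cross_time :: "nat \<Rightarrow> real" where "cross_time j = branch_time j (data_x (cross j))"

lemma cross_D: "cross j \<in> outer.D"
  and cross_M: "data_x (cross j) < M j" and cross_G: "G j (cross j) = 0"
  and before_cross: "s < cross j \<Longrightarrow> below j (data_x s) (data_y s)"
  and after_cross: "s \<in> outer.D \<Longrightarrow> cross j < s \<Longrightarrow> above j (data_x s) (data_y s)"
proof -
  have "cross j \<in> outer.D \<and> data_x (cross j) < M j \<and> G j (cross j) = 0 \<and>
     (\<forall>s<cross j. below j (data_x s) (data_y s)) \<and> (\<forall>s\<in>outer.D. cross j < s \<longrightarrow> above j (data_x s) (data_y s))"
    unfolding cross_def by (rule someI_ex) (use curve_crosses_branch[of j] in blast)
  then show "cross j \<in> outer.D" "data_x (cross j) < M j" "G j (cross j) = 0"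
    "s < cross j \<Longrightarrow> below j (data_x s) (data_y s)" "s \<in> outer.D \<Longrightarrow> cross j < s \<Longrightarrow> above j (data_x s) (data_y s)" by auto
qed

lemma cross_time_in: "\<tau> j < cross_time j" "cross_time j < \<zeta> j" and cross_time_X: "data_x (cross j) = sg j * X (cross_time j)" and cross_time_Y: "data_y (cross j) = - sg j * Y (cross_time j)"
  using branch_time_in_open[OF data_x_pos[OF cross_D] cross_M[of j]] cross_G[of j] by (auto simp: cross_time_def G_def F_def)

lemma on_branch_unique:
  assumes D: "\<sigma> \<in> outer.D" and t: "\<tau> j < t" "t < \<zeta> j" and on: "data_x \<sigma> = sg j * X t" "data_y \<sigma> = - sg j * Y t"
  shows "\<sigma> = cross j"
proof -
  have "branch_time j (data_x \<sigma>) = t" unfolding on by (rule branch_time_X) (use t in simp)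
  then have G: "G j \<sigma> = 0" using on by (simp add: G_def F_def)
  have "data_x \<sigma> < M j" using branch_X_dec[of j "\<tau> j" t] t on by (simp add: M_def)
  then have "\<not> cross j < \<sigma>" using G_persists[OF D, of j "cross j"] G cross_G[of j] by auto
  moreover have "\<not> \<sigma> < cross j" using before_cross[of \<sigma> j] G by (auto simp: below_iff G_def)
  ultimately show ?thesis by simp
qed

lemma cross_less: "cross j < cross (Suc j)"
proof (rule ccontr)
  assume n: "\<not> cross j < cross (Suc j)"
  have b: "below (Suc j) (data_x (cross j)) (data_y (cross j))"
    by (rule on_branch_below_next[OF cross_time_in cross_time_X cross_time_Y])
  then have neg: "G (Suc j) (cross j) < 0" "data_x (cross j) < M (Suc j)" by (auto simp: below_iff G_def)
  then have "cross j \<noteq> cross (Suc j)" using cross_G[of "Suc j"] by auto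
  then have "cross (Suc j) < cross j" using n by simp
  from G_persists[OF cross_D neg(2) this] cross_G[of "Suc j"] neg show False by simp
qed

lemma cross_strict_mono: "strict_mono cross"
  using cross_less by (simp add: strict_mono_Suc_iff)

lemma cross_time_strict_mono: "strict_mono cross_time"
proof (subst strict_mono_Suc_iff, rule allI)
  fix j show "cross_time j < cross_time (Suc j)"
    using cross_time_in[of j] cross_time_in[of "Suc j"] zeta_less_tau[of j] by linarith
qed

lemma cross_time_unbounded: "\<exists>j. C < cross_time j"
  using tau_unbounded[of C] cross_time_in(1) less_trans by blast

end

section \<open>Logarithmic time\<close>

lemma deriv_eq_positive:
  fixes u v :: "real \<Rightarrow> real"
  assumes eq: "\<And>r. 0 < r \<Longrightarrow> u r = v r" and r: "0 < r"
  shows "deriv u r = deriv v r" "u differentiable at r \<longleftrightarrow> v differentiable at r"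
proof -
  have ev: "\<forall>\<^sub>F s in nhds r. u s = v s"
    using eventually_nhds_in_open[of "{0<..}" r] r by (auto elim!: eventually_mono intro: eq)
  then show "deriv u r = deriv v r" by (rule deriv_cong_ev) simp
  show "u differentiable at r \<longleftrightarrow> v differentiable at r"
    unfolding real_differentiable_def using DERIV_cong_ev[OF refl ev refl] by blast
qed

lemma is_solution_cong:
  assumes S: "is_solution n \<eta> f {0<..} u" and eq: "\<And>r. 0 < r \<Longrightarrow> u r = v r"
  shows "is_solution n \<eta> f {0<..} v"
proof -
  note d = deriv_eq_positive[of u v, OF eq]
  note dd = deriv_eq_positive[of "deriv u" "deriv v", OF d(1)]
  have "continuous_on {0<..} (deriv v)"
    using S continuous_on_cong[OF refl, of "{0<..}" "deriv u" "deriv v"] d(1) by (auto simp: is_solution_def)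
  then show ?thesis using S d dd eq by (auto simp: is_solution_def)
qed

lemma is_solution_subset: "is_solution n \<eta> f I u \<Longrightarrow> J \<subseteq> I \<Longrightarrow> is_solution n \<eta> f J u"
  by (auto simp: is_solution_def intro: continuous_on_subset)

lemma nondegenerate_zeros_cong:
  assumes N: "nondegenerate_zeros k u" and eq: "\<And>r. 0 < r \<Longrightarrow> u r = v r"
  shows "nondegenerate_zeros k v"
proof -
  have "{r. 0 < r \<and> v r = 0} = {r. 0 < r \<and> u r = 0}" using eq by auto
  then show ?thesis using N eq deriv_eq_positive(1)[of u v, OF eq] by (auto simp: nondegenerate_zeros_def)
qed

text \<open>The assumptions on \<open>\<delta>1\<close> and \<open>\<delta>2\<close> make \<open>\<kappa> + \<gamma>\<close> and \<open>\<kappa> + \<mu> - \<gamma>'\<close> the scaling exponents of the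
  inner and of the outer nonlinearity.\<close>

locale radial = matched \<mu> \<gamma> K q \<gamma>' k q' for \<mu> \<gamma> K q \<gamma>' k q' :: real +
  fixes n :: nat and \<eta> \<kappa> \<delta>1 \<delta>2 :: real and f :: "real \<Rightarrow> real \<Rightarrow> real"
  assumes kappa: "\<kappa> = kappa n \<eta>" and dim: "real n - 2 = 2 * \<kappa> + \<mu>" and eta: "\<eta> = \<kappa> * (\<kappa> + \<mu>)"
    and delta1: "2 + \<delta>1 = (q - 2) * (\<kappa> + \<gamma>)" and delta2: "2 + \<delta>2 = (q' - 2) * (\<kappa> + \<mu> - \<gamma>')"
    and f: "\<And>u r. f u r = (if r \<le> 1 then K * r powr \<delta>1 * u * \<bar>u\<bar> powr (q - 2)
                                    else - k * r powr \<delta>2 * u * \<bar>u\<bar> powr (q' - 2))"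
begin

text \<open>The nonlinearity in logarithmic time.\<close>

definition R :: "real \<Rightarrow> real \<Rightarrow> real" where
  "R t w = (if t \<le> 0 then exp (\<rho> * t) * (K * spow q w) else - (exp ((q' - 2) * (\<mu> - \<gamma>') * t) * (k * spow q' w)))"

lemma R_sign: "\<bar>\<sigma>\<bar> = 1 \<Longrightarrow> R t (\<sigma> * w) = \<sigma> * R t w"
proof -
  assume "\<bar>\<sigma>\<bar> = 1"
  then have "\<sigma> = 1 \<or> \<sigma> = -1" by linarith
  then show ?thesis by (auto simp: R_def)
qed

lemma f_R: "exp ((\<kappa> + 2) * t) * f (exp (- \<kappa> * t) * w) (exp t) = R t w"
proof -
  have s: "spow p (exp (- \<kappa> * t) * w) = exp (- \<kappa> * (p - 1) * t) * spow p w" for p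
    using spow_scale[of "exp (- \<kappa> * t)" p w] by (simp add: powr_def algebra_simps)
  have le: "exp t \<le> 1 \<longleftrightarrow> t \<le> 0" by simp
  have f': "f v r = (if r \<le> 1 then K * (r powr \<delta>1 * spow q v) else - k * (r powr \<delta>2 * spow q' v))" for v r
    by (simp add: f spow_def)
  have d1: "\<delta>1 = (q - 2) * (\<kappa> + \<gamma>) - 2" and d2: "\<delta>2 = (q' - 2) * (\<kappa> + \<mu> - \<gamma>') - 2"
    using delta1 delta2 by auto
  have e1: "exp ((\<kappa> + 2) * t) * (exp (\<delta>1 * t) * exp (- \<kappa> * (q - 1) * t)) = exp (\<rho> * t)"
    by (simp add: exp_add[symmetric] d1 \<rho>_def algebra_simps)
  have e2: "exp ((\<kappa> + 2) * t) * (exp (\<delta>2 * t) * exp (- \<kappa> * (q' - 1) * t)) = exp ((q' - 2) * (\<mu> - \<gamma>') * t)"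
    by (simp add: exp_add[symmetric] d2 algebra_simps)
  show ?thesis
  proof (cases "t \<le> 0")
    case True
    have "exp ((\<kappa> + 2) * t) * f (exp (- \<kappa> * t) * w) (exp t)
      = (exp ((\<kappa> + 2) * t) * (exp (\<delta>1 * t) * exp (- \<kappa> * (q - 1) * t))) * (K * spow q w)"
      using True by (simp only: f' le if_True s exp_powr) (simp only: mult_ac)
    then show ?thesis using True unfolding e1 by (simp add: R_def)
  next
    case False
    have "exp ((\<kappa> + 2) * t) * f (exp (- \<kappa> * t) * w) (exp t)
      = - ((exp ((\<kappa> + 2) * t) * (exp (\<delta>2 * t) * exp (- \<kappa> * (q' - 1) * t))) * (k * spow q' w))"
      using False by (simp only: f' le if_False s exp_powr) (simp only: mult_ac mult_minus_left mult_minus_right)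
    then show ?thesis using False unfolding e2 by (simp add: R_def)
  qed
qed

text \<open>Solutions in logarithmic time; as for the radial equation, only continuity of the derivative is required at the
  interface.\<close>

definition logsol :: "real set \<Rightarrow> (real \<Rightarrow> real) \<Rightarrow> (real \<Rightarrow> real) \<Rightarrow> bool" where
  "logsol J U P \<longleftrightarrow> (\<forall>t\<in>J. (U has_real_derivative P t) (at t) \<and> isCont P t \<and>
     (t \<noteq> 0 \<longrightarrow> (P has_real_derivative - \<mu> * P t - R t (U t)) (at t)))"

lemma logsol_subset: "logsol J U P \<Longrightarrow> J' \<subseteq> J \<Longrightarrow> logsol J' U P"
  unfolding logsol_def by blast

lemma logsol_sign:
  assumes L: "logsol J U P" and s: "\<bar>\<sigma>\<bar> = 1"
  shows "logsol J (\<lambda>t. \<sigma> * U t) (\<lambda>t. \<sigma> * P t)"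
  unfolding logsol_def
proof (intro ballI conjI impI)
  fix t assume t: "t \<in> J"
  show "((\<lambda>t. \<sigma> * U t) has_real_derivative \<sigma> * P t) (at t)"
    by (intro DERIV_cmult) (use L t in \<open>simp add: logsol_def\<close>)
  show "isCont (\<lambda>t. \<sigma> * P t) t" using L t by (intro continuous_intros) (auto simp: logsol_def)
  assume "t \<noteq> 0"
  then have "(P has_real_derivative - \<mu> * P t - R t (U t)) (at t)" using L t by (simp add: logsol_def)
  then show "((\<lambda>t. \<sigma> * P t) has_real_derivative - \<mu> * (\<sigma> * P t) - R t (\<sigma> * U t)) (at t)"
    by (rule DERIV_cong[OF DERIV_cmult]) (simp add: R_sign[OF s] algebra_simps)
qed

definition logU :: "(real \<Rightarrow> real) \<Rightarrow> real \<Rightarrow> real" where "logU u t = exp (\<kappa> * t) * u (exp t)"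
definition logP :: "(real \<Rightarrow> real) \<Rightarrow> real \<Rightarrow> real" where
  "logP u t = exp (\<kappa> * t) * (\<kappa> * u (exp t) + exp t * deriv u (exp t))"

lemma is_solution_logsol:
  assumes S: "is_solution n \<eta> f I u" and I: "open I"
  shows "logsol {t. exp t \<in> I} (logU u) (logP u)"
  unfolding logsol_def
proof (intro ballI conjI impI)
  fix t assume "t \<in> {t. exp t \<in> I}"
  then have t: "exp t \<in> I" by simp
  have e: "((\<lambda>t. exp (\<kappa> * t)) has_real_derivative \<kappa> * exp (\<kappa> * t)) (at t)" by (rule exp_scale_deriv)
  have du: "(u has_real_derivative deriv u (exp t)) (at (exp t))"
    using S t by (simp add: is_solution_def DERIV_deriv_iff_real_differentiable)
  have ue: "((\<lambda>t. u (exp t)) has_real_derivative deriv u (exp t) * exp t) (at t)"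
    by (rule DERIV_chain2[OF du DERIV_exp])
  show "(logU u has_real_derivative logP u t) (at t)"
    unfolding logU_def[abs_def] logP_def
    by (rule DERIV_cong[OF DERIV_mult[OF e ue]]) (simp add: algebra_simps)
  have "isCont (deriv u) (exp t)"
    using S t I by (simp add: is_solution_def continuous_on_eq_continuous_at)
  then have "isCont (\<lambda>t. deriv u (exp t)) t" by (rule isCont_o2[OF isCont_exp])
  moreover have "isCont (\<lambda>t. u (exp t)) t" using DERIV_isCont[OF ue] .
  ultimately show "isCont (logP u) t" unfolding logP_def[abs_def] by (intro continuous_intros)
  assume t0: "t \<noteq> 0"
  then have t1: "exp t \<in> I - {1}" using t by simp
  define D1 D2 z where "D1 = deriv u (exp t)" and "D2 = deriv (deriv u) (exp t)" and "z = exp t"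
  have z: "0 < z" by (simp add: z_def)
  have d2: "(deriv u has_real_derivative D2) (at (exp t))"
    using S t1 by (simp add: is_solution_def DERIV_deriv_iff_real_differentiable D2_def)
  have de: "((\<lambda>t. deriv u (exp t)) has_real_derivative D2 * exp t) (at t)"
    by (rule DERIV_chain2[OF d2 DERIV_exp])
  have ode: "D2 + (real n - 1) / z * D1 + \<eta> / z\<^sup>2 * u z + f (u z) z = 0"
    using S t1 by (simp add: is_solution_def D1_def D2_def z_def)
  have eq0: "z\<^sup>2 * (D2 + (real n - 1) / z * D1 + \<eta> / z\<^sup>2 * u z + f (u z) z)
     = z\<^sup>2 * D2 + (real n - 1) * (z * D1) + \<eta> * u z + z\<^sup>2 * f (u z) z"
    using z by (simp add: field_simps power2_eq_square)
  have n1: "real n - 1 = 2 * \<kappa> + \<mu> + 1" using dim by simp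
  have zz: "z\<^sup>2 * D2 = - (2 * \<kappa> + \<mu> + 1) * (z * D1) - \<kappa> * (\<kappa> + \<mu>) * u z - z\<^sup>2 * f (u z) z"
  proof -
    have "z\<^sup>2 * D2 + (real n - 1) * (z * D1) + \<eta> * u z + z\<^sup>2 * f (u z) z = 0"
      using eq0[unfolded ode] by simp
    moreover have "(real n - 1) * (z * D1) = (2 * \<kappa> + \<mu> + 1) * (z * D1)" using n1 by simp
    moreover have "\<eta> * u z = \<kappa> * (\<kappa> + \<mu>) * u z" using eta by simp
    moreover have "- (2 * \<kappa> + \<mu> + 1) * (z * D1) = - ((2 * \<kappa> + \<mu> + 1) * (z * D1))" by (rule mult_minus_left)
    ultimately show ?thesis by linarith
  qed
  have "exp (- \<kappa> * t) * logU u t = u z" by (simp add: logU_def z_def exp_minus)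
  then have fR: "exp (\<kappa> * t) * (z\<^sup>2 * f (u z) z) = R t (logU u t)"
  proof -
    have "exp ((\<kappa> + 2) * t) = exp (\<kappa> * t) * z\<^sup>2"
      by (simp add: z_def power2_eq_square exp_add[symmetric] algebra_simps)
    then show ?thesis using f_R[of t "logU u t"] \<open>exp (- \<kappa> * t) * logU u t = u z\<close>
      by (simp only: z_def mult.assoc)
  qed
  have "(logP u has_real_derivative (exp (\<kappa> * t) * (\<kappa> * (D1 * z) + (D2 * z * z + z * D1)) +
      \<kappa> * exp (\<kappa> * t) * (\<kappa> * u z + z * D1))) (at t)"
    unfolding logP_def[abs_def]
    by (rule DERIV_cong[OF DERIV_mult[OF e DERIV_add[OF DERIV_cmult[OF ue] DERIV_mult[OF DERIV_exp de]]]])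
       (simp add: D1_def z_def algebra_simps)
  moreover have "exp (\<kappa> * t) * (\<kappa> * (D1 * z) + (D2 * z * z + z * D1)) +
      \<kappa> * exp (\<kappa> * t) * (\<kappa> * u z + z * D1) = - \<mu> * logP u t - exp (\<kappa> * t) * (z\<^sup>2 * f (u z) z)"
  proof -
    have eq: "D2 * z * z = z\<^sup>2 * D2" by (simp add: power2_eq_square)
    have "deriv u z = D1" by (simp add: D1_def z_def)
    then show ?thesis unfolding logP_def z_def[symmetric] eq zz by (simp add: algebra_simps)
  qed
  ultimately show "(logP u has_real_derivative - \<mu> * logP u t - R t (logU u t)) (at t)"
    unfolding fR by simp
qed

definition unlog :: "(real \<Rightarrow> real) \<Rightarrow> real \<Rightarrow> real" where "unlog U r = r powr (- \<kappa>) * U (ln r)"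

lemma unlog_deriv:
  assumes L: "logsol UNIV U P" and r: "0 < r"
  shows "(unlog U has_real_derivative r powr (- \<kappa> - 1) * (P (ln r) - \<kappa> * U (ln r))) (at r)"
proof -
  have U: "(U has_real_derivative P (ln r)) (at (ln r))" using L by (simp add: logsol_def)
  have "r powr (- \<kappa> - 1) = r powr (- \<kappa>) / r" using r by (simp add: powr_diff)
  then show ?thesis unfolding unlog_def[abs_def]
    by (intro DERIV_cong[OF DERIV_mult[OF has_real_derivative_powr[OF r] DERIV_chain2[OF U DERIV_ln[OF r]]]])
       (use r in \<open>simp add: field_simps\<close>)
qed

lemma is_solution_unlog:
  assumes L: "logsol UNIV U P"
  shows "is_solution n \<eta> f {0<..} (unlog U)"
  unfolding is_solution_def
proof (intro conjI ballI)
  let ?d = "\<lambda>r. r powr (- \<kappa> - 1) * (P (ln r) - \<kappa> * U (ln r))"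
  have dv: "deriv (unlog U) r = ?d r" if "0 < r" for r
    by (rule DERIV_imp_deriv[OF unlog_deriv[OF L that]])
  have Ud: "(U has_real_derivative P t) (at t)" and Pc: "isCont P t" for t using L by (auto simp: logsol_def)
  fix r :: real
  show "unlog U differentiable at r" if "r \<in> {0<..}"
    using unlog_deriv[OF L, of r] that unfolding real_differentiable_def by blast
  show "continuous_on {0<..} (deriv (unlog U))"
  proof (rule continuous_on_cong[THEN iffD2, OF refl dv])
    have "isCont (\<lambda>r. P (ln r)) r" "isCont (\<lambda>r. U (ln r)) r" if "0 < r" for r
      using that by (intro isCont_o2[OF isCont_ln] Pc DERIV_isCont[OF Ud]; simp)+
    then show "continuous_on {0<..} ?d"
      by (intro continuous_at_imp_continuous_on ballI continuous_intros) auto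
  qed simp
  assume "r \<in> {0<..} - {1}"
  then have r: "0 < r" "r \<noteq> 1" by auto
  define t where "t = ln r"
  have t: "t \<noteq> 0" "exp t = r" using r by (auto simp: t_def)
  have Pd: "(P has_real_derivative - \<mu> * P t - R t (U t)) (at (ln r))" using L t by (simp add: logsol_def t_def)
  have p1: "r powr (- \<kappa> - 1) = r powr (- \<kappa>) / r" using powr_diff[of r "- \<kappa>" 1] r by simp
  have p2: "r powr (- \<kappa> - 1 - 1) = r powr (- \<kappa>) / r\<^sup>2"
    unfolding powr_diff[of r "- \<kappa> - 1" 1] p1 using r by (simp add: power2_eq_square)
  define d2 where "d2 = r powr (- \<kappa>) / r\<^sup>2 * ((- \<kappa> - 1) * (P t - \<kappa> * U t) + (- \<mu> * P t - R t (U t)) - \<kappa> * P t)"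
  have "(?d has_real_derivative d2) (at r)"
    by (rule DERIV_cong[OF DERIV_mult[OF has_real_derivative_powr[OF r(1)]
         DERIV_diff[OF DERIV_chain2[OF Pd DERIV_ln[OF r(1)]] DERIV_cmult[OF DERIV_chain2[OF Ud DERIV_ln[OF r(1)]]]]]])
       (unfold d2_def t_def[symmetric] p1 p2, use r in \<open>simp add: power2_eq_square field_simps\<close>)
  then have dd: "(deriv (unlog U) has_real_derivative d2) (at r)"
    by (rule has_field_derivative_transform_within_open[of _ _ _ "{0<..}"]) (use r dv in auto)
  show "deriv (unlog U) differentiable at r" using dd unfolding real_differentiable_def by blast
  have fr: "f (unlog U r) r = r powr (- \<kappa>) / r\<^sup>2 * R t (U t)"
  proof -
    have "exp (- \<kappa> * t) = r powr (- \<kappa>)" using r by (simp add: powr_def t_def)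
    then have "exp ((\<kappa> + 2) * t) * f (unlog U r) r = R t (U t)"
      using f_R[of t "U t"] t by (simp add: unlog_def t_def)
    moreover have "exp ((\<kappa> + 2) * t) = r\<^sup>2 / r powr (- \<kappa>)"
    proof -
      have "exp ((\<kappa> + 2) * t) = exp t * exp t * exp (\<kappa> * t)" by (simp add: exp_add[symmetric] algebra_simps)
      also have "\<dots> = r\<^sup>2 * r powr \<kappa>" using t r by (simp add: power2_eq_square powr_def t_def)
      finally show ?thesis using r by (simp add: powr_minus field_simps)
    qed
    ultimately have eq: "r\<^sup>2 / r powr (- \<kappa>) * f (unlog U r) r = R t (U t)" by simp
    have "g = A / r\<^sup>2 * Rt" if "0 < A" "r\<^sup>2 / A * g = Rt" for A g Rt :: real
      unfolding that(2)[symmetric] using that(1) r by simp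
    from this[OF _ eq] show ?thesis using r by simp
  qed
  have n1: "real n - 1 = 2 * \<kappa> + \<mu> + 1" using dim by simp
  have e1: "deriv (deriv (unlog U)) r = d2" by (rule DERIV_imp_deriv[OF dd])
  have e2: "deriv (unlog U) r = r powr (- \<kappa>) / r * (P t - \<kappa> * U t)" using dv[OF r(1)] p1 by (simp add: t_def)
  have e3: "unlog U r = r powr (- \<kappa>) * U t" by (simp add: unlog_def t_def)
  have e4: "d2 + (real n - 1) / r * (r powr (- \<kappa>) / r * (P t - \<kappa> * U t)) + \<eta> / r\<^sup>2 * (r powr (- \<kappa>) * U t) +
      r powr (- \<kappa>) / r\<^sup>2 * R t (U t)
      = r powr (- \<kappa>) / r\<^sup>2 * ((- \<kappa> - 1) * (P t - \<kappa> * U t) + (- \<mu> * P t - R t (U t)) - \<kappa> * P t +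
        (real n - 1) * (P t - \<kappa> * U t) + \<eta> * U t + R t (U t))"
  proof -
    have "A / r\<^sup>2 * Z + m / r * (A / r * Q) + e / r\<^sup>2 * (A * v) + A / r\<^sup>2 * S = A / r\<^sup>2 * (Z + m * Q + e * v + S)"
      for A Z m Q e v S :: real
      by (simp add: power2_eq_square distrib_left add_divide_distrib mult_ac)
    then show ?thesis unfolding d2_def .
  qed
  have e5: "(- \<kappa> - 1) * (P t - \<kappa> * U t) + (- \<mu> * P t - R t (U t)) - \<kappa> * P t +
        (real n - 1) * (P t - \<kappa> * U t) + \<eta> * U t + R t (U t) = 0"
    unfolding n1 eta by (simp add: algebra_simps)
  show "deriv (deriv (unlog U)) r + (real n - 1) / r * deriv (unlog U) r +
      \<eta> / r\<^sup>2 * unlog U r + f (unlog U r) r = 0"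
    unfolding fr unfolding e1 e2 e3 e4 e5 by simp
qed

subsection \<open>Uniqueness\<close>

lemma R_lipschitz:
  assumes "lo \<le> hi" "hi \<le> 0 \<or> 0 \<le> lo" "0 \<le> N"
  shows "\<exists>C\<ge>0. \<forall>t w1 w2. lo < t \<longrightarrow> t < hi \<longrightarrow> \<bar>w1\<bar> \<le> N \<longrightarrow> \<bar>w2\<bar> \<le> N \<longrightarrow> \<bar>R t w1 - R t w2\<bar> \<le> C * \<bar>w1 - w2\<bar>"
proof -
  have eb: "exp (c * t) \<le> exp (\<bar>c\<bar> * (\<bar>lo\<bar> + \<bar>hi\<bar>))" if "lo < t" "t < hi" for c t :: real
  proof -
    have "c * t \<le> \<bar>c\<bar> * \<bar>t\<bar>" by (metis abs_ge_self abs_mult)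
    also have "\<dots> \<le> \<bar>c\<bar> * (\<bar>lo\<bar> + \<bar>hi\<bar>)" using that by (intro mult_left_mono) auto
    finally show ?thesis by simp
  qed
  have key: "\<exists>C\<ge>0. \<forall>t w1 w2. lo < t \<longrightarrow> t < hi \<longrightarrow> \<bar>w1\<bar> \<le> N \<longrightarrow> \<bar>w2\<bar> \<le> N \<longrightarrow>
      \<bar>exp (c * t) * (m * spow p w1) - exp (c * t) * (m * spow p w2)\<bar> \<le> C * \<bar>w1 - w2\<bar>" if p: "2 < p" for c m p :: real
  proof -
    obtain \<Lambda> where L: "0 \<le> \<Lambda>" "\<And>x y. \<bar>x\<bar> \<le> N \<Longrightarrow> \<bar>y\<bar> \<le> N \<Longrightarrow> \<bar>m * spow p x - m * spow p y\<bar> \<le> \<Lambda> * \<bar>x - y\<bar>"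
      using spow_local_lipschitz[OF p assms(3), of m] by blast
    show ?thesis
    proof (intro exI[of _ "exp (\<bar>c\<bar> * (\<bar>lo\<bar> + \<bar>hi\<bar>)) * \<Lambda>"] conjI allI impI)
      fix t w1 w2 assume *: "lo < t" "t < hi" "\<bar>w1\<bar> \<le> N" "\<bar>w2\<bar> \<le> N"
      have "\<bar>exp (c * t) * (m * spow p w1) - exp (c * t) * (m * spow p w2)\<bar> = exp (c * t) * \<bar>m * spow p w1 - m * spow p w2\<bar>"
        by (simp add: abs_mult flip: right_diff_distrib)
      also have "\<dots> \<le> exp (\<bar>c\<bar> * (\<bar>lo\<bar> + \<bar>hi\<bar>)) * (\<Lambda> * \<bar>w1 - w2\<bar>)"
        using eb[OF *(1,2), of c] L(2)[OF *(3,4)] by (intro mult_mono) auto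
      finally show "\<bar>exp (c * t) * (m * spow p w1) - exp (c * t) * (m * spow p w2)\<bar> \<le> exp (\<bar>c\<bar> * (\<bar>lo\<bar> + \<bar>hi\<bar>)) * \<Lambda> * \<bar>w1 - w2\<bar>"
        by (simp add: mult.assoc)
    qed (use L in auto)
  qed
  from assms(2) show ?thesis
  proof
    assume "hi \<le> 0"
    then show ?thesis using key[OF q, of \<rho> K] by (auto simp: R_def)
  next
    assume "0 \<le> lo"
    obtain C where C: "0 \<le> C" "\<And>t w1 w2. lo < t \<Longrightarrow> t < hi \<Longrightarrow> \<bar>w1\<bar> \<le> N \<Longrightarrow> \<bar>w2\<bar> \<le> N \<Longrightarrow>
        \<bar>exp ((q' - 2) * (\<mu> - \<gamma>') * t) * (k * spow q' w1) - exp ((q' - 2) * (\<mu> - \<gamma>') * t) * (k * spow q' w2)\<bar> \<le> C * \<bar>w1 - w2\<bar>"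
      using key[OF outer.q, of "(q' - 2) * (\<mu> - \<gamma>')" k] by blast
    show ?thesis
    proof (intro exI[of _ C] conjI allI impI C(1))
      fix t w1 w2 assume *: "lo < t" "t < hi" "\<bar>w1\<bar> \<le> N" "\<bar>w2\<bar> \<le> N"
      have "R t w1 - R t w2 = - (exp ((q' - 2) * (\<mu> - \<gamma>') * t) * (k * spow q' w1) - exp ((q' - 2) * (\<mu> - \<gamma>') * t) * (k * spow q' w2))"
        using * \<open>0 \<le> lo\<close> by (simp add: R_def)
      then show "\<bar>R t w1 - R t w2\<bar> \<le> C * \<bar>w1 - w2\<bar>" using C(2)[OF *] by (simp only: abs_minus_cancel)
    qed
  qed
qed

lemma logsol_unique_half:
  assumes 1: "logsol J U1 P1" and 2: "logsol J U2 P2" and J: "{lo..hi} \<subseteq> J" and side: "hi \<le> 0 \<or> 0 \<le> lo"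
    and c: "c \<in> {lo..hi}" "U1 c = U2 c" "P1 c = P2 c" and t: "t \<in> {lo..hi}"
  shows "U1 t = U2 t \<and> P1 t = P2 t"
proof -
  have c1: "continuous_on {lo..hi} U1" "continuous_on {lo..hi} P1" "continuous_on {lo..hi} U2" "continuous_on {lo..hi} P2"
    using 1 2 J unfolding logsol_def by (auto intro!: continuous_at_imp_continuous_on dest: DERIV_isCont)
  obtain B1 where B1: "\<And>s. s \<in> {lo..hi} \<Longrightarrow> \<bar>U1 s\<bar> \<le> B1"
    using compact_imp_bounded[OF compact_continuous_image[OF c1(1)]] unfolding bounded_iff real_norm_def by blast
  obtain B2 where B2: "\<And>s. s \<in> {lo..hi} \<Longrightarrow> \<bar>U2 s\<bar> \<le> B2"
    using compact_imp_bounded[OF compact_continuous_image[OF c1(3)]] unfolding bounded_iff real_norm_def by blast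
  define N where "N = max 0 (max B1 B2)"
  obtain C where C: "0 \<le> C" "\<And>t w1 w2. lo < t \<Longrightarrow> t < hi \<Longrightarrow> \<bar>w1\<bar> \<le> N \<Longrightarrow> \<bar>w2\<bar> \<le> N \<Longrightarrow> \<bar>R t w1 - R t w2\<bar> \<le> C * \<bar>w1 - w2\<bar>"
  proof -
    have lh: "lo \<le> hi" and N0: "0 \<le> N" using t by (auto simp: N_def)
    from R_lipschitz[OF lh side N0] show ?thesis using that by blast
  qed
  show ?thesis
  proof (rule second_order_unique[where ?x1.0 = U1 and ?x2.0 = U2 and ?y1.0 = P1 and ?y2.0 = P2 and s = t
        and F = "\<lambda>t x y. - \<mu> * y - R t x" and C = "\<mu> + C", OF c1])
    fix s assume s: "lo < s" "s < hi"
    then have sJ: "s \<in> J" and s0: "s \<noteq> 0" using J side by auto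
    show "(U1 has_real_derivative P1 s) (at s)" "(U2 has_real_derivative P2 s) (at s)"
      "(P1 has_real_derivative - \<mu> * P1 s - R s (U1 s)) (at s)" "(P2 has_real_derivative - \<mu> * P2 s - R s (U2 s)) (at s)"
      using 1 2 sJ s0 by (auto simp: logsol_def)
    have "\<bar>R s (U1 s) - R s (U2 s)\<bar> \<le> C * \<bar>U1 s - U2 s\<bar>"
      using B1[of s] B2[of s] s by (intro C(2)) (auto simp: N_def)
    moreover have "\<bar>- \<mu> * P1 s - R s (U1 s) - (- \<mu> * P2 s - R s (U2 s))\<bar> \<le> \<mu> * \<bar>P1 s - P2 s\<bar> + \<bar>R s (U1 s) - R s (U2 s)\<bar>"
    proof -
      have "- \<mu> * P1 s - R s (U1 s) - (- \<mu> * P2 s - R s (U2 s)) = - (\<mu> * (P1 s - P2 s)) - (R s (U1 s) - R s (U2 s))"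
        by (simp add: algebra_simps)
      then show ?thesis using abs_triangle_ineq4[of "- (\<mu> * (P1 s - P2 s))" "R s (U1 s) - R s (U2 s)"] mu
        by (simp add: abs_mult)
    qed
    moreover have "\<mu> * \<bar>P1 s - P2 s\<bar> + C * \<bar>U1 s - U2 s\<bar> \<le> (\<mu> + C) * (\<bar>U1 s - U2 s\<bar> + \<bar>P1 s - P2 s\<bar>)"
      using mu C(1) by (simp add: algebra_simps)
    ultimately show "\<bar>- \<mu> * P1 s - R s (U1 s) - (- \<mu> * P2 s - R s (U2 s))\<bar> \<le> (\<mu> + C) * (\<bar>U1 s - U2 s\<bar> + \<bar>P1 s - P2 s\<bar>)"
      by linarith
  qed (use c t in auto)
qed

text \<open>The equation changes at time zero, but position and velocity are continuous there.\<close>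

lemma logsol_unique:
  assumes 1: "logsol J U1 P1" and 2: "logsol J U2 P2" and J: "{lo..hi} \<subseteq> J"
    and c: "c \<in> {lo..hi}" "U1 c = U2 c" "P1 c = P2 c" and t: "t \<in> {lo..hi}"
  shows "U1 t = U2 t \<and> P1 t = P2 t"
proof (cases "hi \<le> 0 \<or> 0 \<le> lo")
  case True
  then show ?thesis by (rule logsol_unique_half[OF 1 2 J _ c t])
next
  case False
  have J1: "{lo..0} \<subseteq> J" and J2: "{0..hi} \<subseteq> J" using J False by auto
  have 0: "U1 0 = U2 0 \<and> P1 0 = P2 0"
  proof (cases "c \<le> 0")
    case True
    show ?thesis by (rule logsol_unique_half[OF 1 2 J1 _ _ c(2,3)]) (use c True False in auto)
  next
    case F: False
    show ?thesis by (rule logsol_unique_half[OF 1 2 J2 _ _ c(2,3)]) (use c F False in auto)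
  qed
  show ?thesis
  proof (cases "t \<le> 0")
    case True
    show ?thesis by (rule logsol_unique_half[OF 1 2 J1, of 0]) (use 0 t True False in auto)
  next
    case F: False
    show ?thesis by (rule logsol_unique_half[OF 1 2 J2, of 0]) (use 0 t F False in auto)
  qed
qed

lemma regular_unique:
  assumes 1: "logsol J U1 P1" and 2: "logsol J U2 P2" and J: "\<And>s t. t \<in> J \<Longrightarrow> s \<le> t \<Longrightarrow> s \<in> J"
    and l: "(U1 \<longlongrightarrow> d) at_bot" "(U2 \<longlongrightarrow> d) at_bot" and t: "t \<in> J"
  shows "U1 t = U2 t"
proof -
  define T where "T = min t (- 1)"
  have TJ: "s \<in> J" "s \<noteq> 0" "s \<le> 0" if "s \<le> T" for s using J[OF t, of s] that by (auto simp: T_def)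
  have eq: "U1 T = U2 T \<and> P1 T = P2 T"
  proof (rule singular_unique[where h = "\<lambda>x. - K * spow q x" and T = T and d = d
        and ?w1.0 = U1 and ?p1.0 = P1 and ?w2.0 = U2 and ?p2.0 = P2, OF mu rho_pos spow_local_lipschitz[OF q]])
    fix s assume "s \<le> T"
    note s = TJ[OF this]
    show "(U1 has_real_derivative P1 s) (at s)" "(U2 has_real_derivative P2 s) (at s)"
      "(P1 has_real_derivative - \<mu> * P1 s + exp (\<rho> * s) * (- K * spow q (U1 s))) (at s)"
      "(P2 has_real_derivative - \<mu> * P2 s + exp (\<rho> * s) * (- K * spow q (U2 s))) (at s)"
      using 1 2 s by (auto simp: logsol_def R_def)
  qed (use l in auto)
  have "{T..t} \<subseteq> J" using J[OF t] by auto
  then show ?thesis using logsol_unique[OF 1 2, of T t T t] eq by (auto simp: T_def)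
qed

text \<open>The substitution \<open>W(s) = e\<^bsup>-\<mu>s\<^esup> U(-s)\<close> turns fast decay into a limit at minus infinity, so that uniqueness
  follows from the singular initial value problem again.\<close>

lemma outer_time_reversal:
  assumes L: "logsol J U P" and s: "- s \<in> J" "s < 0"
  shows "((\<lambda>s. exp (- \<mu> * s) * U (- s)) has_real_derivative - exp (- \<mu> * s) * (\<mu> * U (- s) + P (- s))) (at s)" (is ?A)
    and "((\<lambda>s. - exp (- \<mu> * s) * (\<mu> * U (- s) + P (- s))) has_real_derivative
       - \<mu> * (- exp (- \<mu> * s) * (\<mu> * U (- s) + P (- s))) + exp (outer.\<rho> * s) * (k * spow q' (exp (- \<mu> * s) * U (- s)))) (at s)" (is ?B)
proof -
  have e: "((\<lambda>s. exp (- \<mu> * s)) has_real_derivative - \<mu> * exp (- \<mu> * s)) (at s)" by (rule exp_scale_deriv)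
  have m: "((\<lambda>t. - t) has_real_derivative -1) (at s)" by (auto intro!: derivative_eq_intros)
  have Ud: "(U has_real_derivative P (- s)) (at (- s))"
    and Pd: "(P has_real_derivative - \<mu> * P (- s) - R (- s) (U (- s))) (at (- s))"
    using L s by (auto simp: logsol_def)
  show ?A by (rule DERIV_cong[OF DERIV_mult[OF e DERIV_chain2[OF Ud m]]]) (simp add: algebra_simps)
  have "spow q' (exp (- \<mu> * s) * U (- s)) = exp (- \<mu> * (q' - 1) * s) * spow q' (U (- s))"
    using spow_scale[of "exp (- \<mu> * s)" q' "U (- s)"] by (simp add: powr_def algebra_simps)
  then have "exp (outer.\<rho> * s) * (k * spow q' (exp (- \<mu> * s) * U (- s)))
     = (exp (outer.\<rho> * s) * exp (- \<mu> * (q' - 1) * s)) * (k * spow q' (U (- s)))" by simp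
  also have "exp (outer.\<rho> * s) * exp (- \<mu> * (q' - 1) * s) = exp (- \<mu> * s) * exp ((q' - 2) * (\<mu> - \<gamma>') * (- s))"
    by (simp add: exp_add[symmetric] outer.\<rho>_def algebra_simps)
  finally have RR: "exp (outer.\<rho> * s) * (k * spow q' (exp (- \<mu> * s) * U (- s))) = - (exp (- \<mu> * s) * R (- s) (U (- s)))"
    using s by (simp add: R_def)
  have e': "((\<lambda>s. - exp (- \<mu> * s)) has_real_derivative \<mu> * exp (- \<mu> * s)) (at s)"
    using DERIV_minus[OF e] by simp
  show ?B unfolding RR
    by (rule DERIV_cong[OF DERIV_mult[OF e' DERIV_add[OF DERIV_cmult[OF DERIV_chain2[OF Ud m]] DERIV_chain2[OF Pd m]]]])
       (simp add: algebra_simps)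
qed

lemma fast_decay_unique:
  assumes 1: "logsol J U1 P1" and 2: "logsol J U2 P2" and J: "\<And>s t. t \<in> J \<Longrightarrow> t \<le> s \<Longrightarrow> s \<in> J"
    and l: "((\<lambda>t. exp (\<mu> * t) * U1 t) \<longlongrightarrow> d) at_top" "((\<lambda>t. exp (\<mu> * t) * U2 t) \<longlongrightarrow> d) at_top" and t: "t \<in> J"
  shows "U1 t = U2 t"
proof -
  define T where "T = max t 1"
  have TJ: "- s \<in> J" "s < 0" if "s \<le> - T" for s using J[OF t, of "- s"] that by (auto simp: T_def)
  have lim: "((\<lambda>s. exp (- \<mu> * s) * U (- s)) \<longlongrightarrow> d) at_bot" if "((\<lambda>t. exp (\<mu> * t) * U t) \<longlongrightarrow> d) at_top" for U
    using filterlim_compose[OF that filterlim_uminus_at_top_at_bot] by simp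
  have "exp (- \<mu> * (- T)) * U1 (- (- T)) = exp (- \<mu> * (- T)) * U2 (- (- T)) \<and>
     - exp (- \<mu> * (- T)) * (\<mu> * U1 (- (- T)) + P1 (- (- T))) = - exp (- \<mu> * (- T)) * (\<mu> * U2 (- (- T)) + P2 (- (- T)))"
    by (rule singular_unique[where h = "\<lambda>x. k * spow q' x" and T = "- T" and d = d
        and ?w1.0 = "\<lambda>s. exp (- \<mu> * s) * U1 (- s)" and ?p1.0 = "\<lambda>s. - exp (- \<mu> * s) * (\<mu> * U1 (- s) + P1 (- s))"
        and ?w2.0 = "\<lambda>s. exp (- \<mu> * s) * U2 (- s)" and ?p2.0 = "\<lambda>s. - exp (- \<mu> * s) * (\<mu> * U2 (- s) + P2 (- s))",
        OF mu outer.rho_pos spow_local_lipschitz[OF outer.q]])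
       (rule outer_time_reversal[OF 1] outer_time_reversal[OF 2] lim[OF l(1)] lim[OF l(2)] TJ order.refl | assumption)+
  then have eq: "U1 T = U2 T \<and> P1 T = P2 T" by auto
  have "{t..T} \<subseteq> J" using J[OF t] by auto
  then show ?thesis using logsol_unique[OF 1 2, of t T T t] eq by (auto simp: T_def)
qed

subsection \<open>Back to radial solutions\<close>

lemma unlog_logU: "0 < r \<Longrightarrow> r powr (- \<kappa>) * logU u (ln r) = u r"
  by (simp add: logU_def powr_def exp_minus)

lemma unlog_at_0: "filterlim U Fl at_bot \<Longrightarrow> filterlim (\<lambda>r. unlog U r * r powr \<kappa>) Fl (at_right 0)"
proof -
  assume "filterlim U Fl at_bot"
  then have l: "filterlim (\<lambda>r. U (ln r)) Fl (at_right 0)" by (rule filterlim_compose[OF _ ln_at_0])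
  have "\<forall>\<^sub>F r in at_right (0::real). U (ln r) = unlog U r * r powr \<kappa>"
    unfolding eventually_at_filter by (rule always_eventually) (auto simp: unlog_def powr_minus)
  from filterlim_cong[OF refl refl this, THEN iffD1, OF l] show ?thesis .
qed

lemma unlog_at_top:
  assumes "((\<lambda>t. exp (\<mu> * t) * U t) \<longlongrightarrow> L) at_top"
  shows "((\<lambda>r. unlog U r * r powr (real n - 2 - \<kappa>)) \<longlongrightarrow> L) at_top"
proof -
  have "((\<lambda>r. exp (\<mu> * ln r) * U (ln r)) \<longlongrightarrow> L) at_top" by (rule filterlim_compose[OF assms ln_at_top])
  moreover have "\<forall>\<^sub>F r in at_top. exp (\<mu> * ln r) * U (ln r) = unlog U r * r powr (real n - 2 - \<kappa>)"
    using eventually_gt_at_top[of 0]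
  proof eventually_elim
    case (elim r)
    have "real n - 2 - \<kappa> = \<kappa> + \<mu>" using dim by simp
    then show ?case using elim by (simp add: unlog_def powr_def exp_add[symmetric] algebra_simps)
  qed
  ultimately show ?thesis by (rule Lim_transform_eventually)
qed

lemma v_sol_unlog:
  assumes L: "logsol UNIV U P" and l: "((\<lambda>t. exp (\<mu> * t) * U t) \<longlongrightarrow> l) at_top" and r: "0 < r"
  shows "v_sol n \<eta> f l r = unlog U r"
  unfolding v_sol_def kappa[symmetric]
proof (rule the_equality)
  show "\<exists>a v. 0 \<le> a \<and> a < r \<and> is_solution n \<eta> f {a<..} v \<and>
      ((\<lambda>s. v s * s powr (real n - 2 - \<kappa>)) \<longlongrightarrow> l) at_top \<and> unlog U r = v r"
    using is_solution_unlog[OF L] unlog_at_top[OF l] r by blast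
next
  fix z assume "\<exists>a v. 0 \<le> a \<and> a < r \<and> is_solution n \<eta> f {a<..} v \<and>
      ((\<lambda>s. v s * s powr (real n - 2 - \<kappa>)) \<longlongrightarrow> l) at_top \<and> z = v r"
  then obtain e v where v: "e < r" "is_solution n \<eta> f {e<..} v"
      "((\<lambda>s. v s * s powr (real n - 2 - \<kappa>)) \<longlongrightarrow> l) at_top" "z = v r" by blast
  have "((\<lambda>t. v (exp t) * exp t powr (real n - 2 - \<kappa>)) \<longlongrightarrow> l) at_top"
    by (rule filterlim_compose[OF v(3) exp_at_top])
  moreover have "v (exp t) * exp t powr (real n - 2 - \<kappa>) = exp (\<mu> * t) * logU v t" for t
  proof -
    have "real n - 2 - \<kappa> = \<mu> + \<kappa>" using dim by simp
    then show ?thesis by (simp add: logU_def exp_powr exp_add distrib_right)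
  qed
  ultimately have lv: "((\<lambda>t. exp (\<mu> * t) * logU v t) \<longlongrightarrow> l) at_top" by simp
  have "logU v (ln r) = U (ln r)"
  proof (rule fast_decay_unique[OF is_solution_logsol[OF v(2)] logsol_subset[OF L subset_UNIV] _ lv l])
    show "ln r \<in> {t. exp t \<in> {e<..}}" using r v by simp
    show "s \<in> {t. exp t \<in> {e<..}}" if "t \<in> {t. exp t \<in> {e<..}}" "t \<le> s" for s t
      using that by (auto intro: less_le_trans)
  qed simp
  then show "z = unlog U r" using unlog_logU[OF r, of v] v(4) by (simp add: unlog_def)
qed

lemma u_sol_unlog:
  assumes L: "logsol UNIV U P" and l: "(U \<longlongrightarrow> d) at_bot" and r: "0 < r"
  shows "u_sol n \<eta> f d r = unlog U r"
  unfolding u_sol_def kappa[symmetric]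
proof (rule the_equality)
  have "is_solution n \<eta> f {0<..<r + 1} (unlog U)" by (rule is_solution_subset[OF is_solution_unlog[OF L]]) auto
  then show "\<exists>R u. 0 < r \<and> r < R \<and> is_solution n \<eta> f {0<..<R} u \<and>
      ((\<lambda>s. u s * s powr \<kappa>) \<longlongrightarrow> d) (at_right 0) \<and> unlog U r = u r"
    using unlog_at_0[OF l] r by (intro exI[of _ "r + 1"] exI[of _ "unlog U"]) auto
next
  fix z assume "\<exists>R u. 0 < r \<and> r < R \<and> is_solution n \<eta> f {0<..<R} u \<and>
      ((\<lambda>s. u s * s powr \<kappa>) \<longlongrightarrow> d) (at_right 0) \<and> z = u r"
  then obtain e u where u: "r < e" "is_solution n \<eta> f {0<..<e} u"
      "((\<lambda>s. u s * s powr \<kappa>) \<longlongrightarrow> d) (at_right 0)" "z = u r" by blast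
  have "filterlim exp (at_right (0::real)) at_bot"
    using exp_at_bot by (simp add: filterlim_at)
  then have "((\<lambda>t. u (exp t) * exp t powr \<kappa>) \<longlongrightarrow> d) at_bot"
    by (rule filterlim_compose[OF u(3)])
  moreover have "u (exp t) * exp t powr \<kappa> = logU u t" for t
    by (simp add: logU_def exp_powr)
  ultimately have lu: "(logU u \<longlongrightarrow> d) at_bot" by simp
  have "logU u (ln r) = U (ln r)"
  proof (rule regular_unique[OF is_solution_logsol[OF u(2)] logsol_subset[OF L subset_UNIV] _ lu l])
    show "ln r \<in> {t. exp t \<in> {0<..<e}}" using r u by simp
    show "s \<in> {t. exp t \<in> {0<..<e}}" if "t \<in> {t. exp t \<in> {0<..<e}}" "s \<le> t" for s t
      using that by (auto intro: le_less_trans)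
  qed simp
  then show "z = unlog U r" using unlog_logU[OF r, of u] u(4) by (simp add: unlog_def)
qed

lemma nondegenerate_zeros_unlog:
  assumes L: "logsol UNIV U P" and z: "finite {t. U t = 0}" "card {t. U t = 0} = m"
    and nz: "\<And>t. U t = 0 \<Longrightarrow> P t \<noteq> 0"
  shows "nondegenerate_zeros m (unlog U)"
proof -
  have "{r. 0 < r \<and> unlog U r = 0} = exp ` {t. U t = 0}"
  proof (intro set_eqI iffI)
    fix r assume "r \<in> {r. 0 < r \<and> unlog U r = 0}"
    then have "r = exp (ln r)" "U (ln r) = 0" by (auto simp: unlog_def)
    then show "r \<in> exp ` {t. U t = 0}" by blast
  qed (auto simp: unlog_def)
  moreover have "deriv (unlog U) r \<noteq> 0" if "0 < r" "unlog U r = 0" for r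
  proof -
    have "U (ln r) = 0" using that by (simp add: unlog_def)
    then show ?thesis using DERIV_imp_deriv[OF unlog_deriv[OF L that(1)]] nz[of "ln r"] that by simp
  qed
  moreover have "card (exp ` {t. U t = 0}) = card {t. U t = 0}" by (rule card_image) (simp add: inj_on_def)
  ultimately show ?thesis using z by (simp add: nondegenerate_zeros_def)
qed

lemma fd_solution_unlog:
  assumes S: "is_solution n \<eta> f {0<..} u" and u: "\<And>r. 0 < r \<Longrightarrow> unlog U r = u r"
    and l: "((\<lambda>t. exp (\<mu> * t) * U t) \<longlongrightarrow> l) at_top"
  shows "fd_solution n \<eta> f u"
proof -
  have "\<forall>\<^sub>F r in at_top. unlog U r * r powr (real n - 2 - \<kappa>) = u r * r powr (real n - 2 - \<kappa>)"
    using eventually_gt_at_top[of 0] by eventually_elim (simp add: u)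
  with unlog_at_top[OF l] have "((\<lambda>r. u r * r powr (real n - 2 - \<kappa>)) \<longlongrightarrow> l) at_top"
    by (rule Lim_transform_eventually)
  then show ?thesis unfolding fd_solution_def kappa[symmetric] using S order.refl by blast
qed

lemma at_0_cong:
  assumes u: "\<And>r. 0 < r \<Longrightarrow> unlog U r = u r" and l: "filterlim U Fl at_bot"
  shows "filterlim (\<lambda>r. u r * r powr \<kappa>) Fl (at_right 0)"
proof -
  have "\<forall>\<^sub>F r in at_right 0. unlog U r * r powr \<kappa> = u r * r powr \<kappa>"
    unfolding eventually_at_filter by (rule always_eventually) (auto simp: u)
  from filterlim_cong[OF refl refl this, THEN iffD1, OF unlog_at_0[OF l]] show ?thesis .
qed

lemma R_fd_unlog:
  assumes L: "logsol UNIV U P" and u: "\<And>r. 0 < r \<Longrightarrow> unlog U r = u r"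
    and l: "((\<lambda>t. exp (\<mu> * t) * U t) \<longlongrightarrow> l) at_top" and d: "(U \<longlongrightarrow> d) at_bot"
    and z: "finite {t. U t = 0}" "card {t. U t = 0} = m" "\<And>t. U t = 0 \<Longrightarrow> P t \<noteq> 0"
  shows "R_fd n \<eta> f m u"
proof -
  have S: "is_solution n \<eta> f {0<..} u" by (rule is_solution_cong[OF is_solution_unlog[OF L] u])
  moreover have "is_solution n \<eta> f {0<..<1} u" by (rule is_solution_subset[OF S]) auto
  moreover have "((\<lambda>r. u r * r powr \<kappa>) \<longlongrightarrow> d) (at_right 0)" by (rule at_0_cong[of U u, OF u d])
  ultimately have "R_solution n \<eta> f u"
    unfolding R_solution_def kappa[symmetric] using zero_less_one by blast
  then show ?thesis unfolding R_fd_def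
    by (intro conjI S fd_solution_unlog[OF S u l] nondegenerate_zeros_cong[OF nondegenerate_zeros_unlog[OF L z] u])
qed

lemma S_fd_unlog:
  assumes L: "logsol UNIV U P" and u: "\<And>r. 0 < r \<Longrightarrow> unlog U r = u r"
    and l: "((\<lambda>t. exp (\<mu> * t) * U t) \<longlongrightarrow> l) at_top" and d: "filterlim U at_top at_bot \<or> filterlim U at_bot at_bot"
    and z: "finite {t. U t = 0}" "card {t. U t = 0} = m" "\<And>t. U t = 0 \<Longrightarrow> P t \<noteq> 0"
  shows "S_fd n \<eta> f m u"
proof -
  have S: "is_solution n \<eta> f {0<..} u" by (rule is_solution_cong[OF is_solution_unlog[OF L] u])
  moreover have "is_solution n \<eta> f {0<..<1} u" by (rule is_solution_subset[OF S]) auto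
  moreover have "filterlim (\<lambda>r. u r * r powr \<kappa>) at_top (at_right 0) \<or> filterlim (\<lambda>r. u r * r powr \<kappa>) at_bot (at_right 0)"
    using d at_0_cong[of U u _, OF u] by blast
  ultimately have "S_solution n \<eta> f u"
    unfolding S_solution_def kappa[symmetric] using zero_less_one by blast
  then show ?thesis unfolding S_fd_def
    by (intro conjI S fd_solution_unlog[OF S u l] nondegenerate_zeros_cong[OF nondegenerate_zeros_unlog[OF L z] u])
qed

subsection \<open>The fast decaying solutions for all radii\<close>

text \<open>The fast decaying solution with coefficient \<open>e\<^bsup>\<gamma>'\<sigma>\<^esup>\<close>, continued inwards by a trajectory \<open>x\<close>, and its
  derivative.\<close>

definition gU :: "real \<Rightarrow> (real \<Rightarrow> real) \<Rightarrow> real \<Rightarrow> real" where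
  "gU \<sigma> x t = (if t \<le> 0 then exp (- \<gamma> * t) * x (- t) else exp (- \<mu> * t) * (exp (\<gamma>' * \<sigma>) * outer.W (\<sigma> - t)))"

definition gP :: "real \<Rightarrow> (real \<Rightarrow> real) \<Rightarrow> (real \<Rightarrow> real) \<Rightarrow> real \<Rightarrow> real" where
  "gP \<sigma> x y t = (if t \<le> 0 then exp (- \<gamma> * t) * (- \<gamma> * x (- t) - y (- t))
     else exp (- \<mu> * t) * (exp (\<gamma>' * \<sigma>) * (- \<mu> * outer.W (\<sigma> - t) - outer.P (\<sigma> - t))))"

lemma outer_solution:
  assumes D: "\<sigma> - t \<in> outer.D"
  shows "((\<lambda>t. exp (- \<mu> * t) * (exp (\<gamma>' * \<sigma>) * outer.W (\<sigma> - t))) has_real_derivative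
      exp (- \<mu> * t) * (exp (\<gamma>' * \<sigma>) * (- \<mu> * outer.W (\<sigma> - t) - outer.P (\<sigma> - t)))) (at t)" (is ?A)
    and "0 < t \<Longrightarrow> ((\<lambda>t. exp (- \<mu> * t) * (exp (\<gamma>' * \<sigma>) * (- \<mu> * outer.W (\<sigma> - t) - outer.P (\<sigma> - t)))) has_real_derivative
      - \<mu> * (exp (- \<mu> * t) * (exp (\<gamma>' * \<sigma>) * (- \<mu> * outer.W (\<sigma> - t) - outer.P (\<sigma> - t)))) -
      R t (exp (- \<mu> * t) * (exp (\<gamma>' * \<sigma>) * outer.W (\<sigma> - t)))) (at t)" (is "_ \<Longrightarrow> ?B")
    and "isCont (\<lambda>t. exp (- \<mu> * t) * (exp (\<gamma>' * \<sigma>) * (- \<mu> * outer.W (\<sigma> - t) - outer.P (\<sigma> - t)))) t" (is ?C)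
proof -
  define E where "E = exp (\<gamma>' * \<sigma>)"
  have e: "((\<lambda>t. exp (- \<mu> * t)) has_real_derivative - \<mu> * exp (- \<mu> * t)) (at t)" by (rule exp_scale_deriv)
  have m: "((\<lambda>t. \<sigma> - t) has_real_derivative -1) (at t)" by (auto intro!: derivative_eq_intros)
  note W = DERIV_chain2[OF outer.W_deriv[OF D] m] and P = DERIV_chain2[OF outer.P_deriv[OF D] m]
  show ?A
    by (rule DERIV_cong[OF DERIV_mult[OF e DERIV_cmult[OF W]]]) (simp add: algebra_simps)
  note PP = DERIV_mult[OF e DERIV_cmult[OF DERIV_diff[OF DERIV_cmult[OF W, of "- \<mu>"] P]], of E]
  show ?C using DERIV_isCont[OF PP] by (simp only: E_def)
  assume t: "0 < t"
  define w where "w = outer.W (\<sigma> - t)"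
  have eq: "exp (- \<mu> * t) * (E * w) = exp (\<gamma>' * \<sigma> - \<mu> * t) * w" by (simp add: E_def exp_diff exp_minus field_simps)
  have "spow q' (exp (- \<mu> * t) * (E * w)) = exp ((q' - 1) * (\<gamma>' * \<sigma> - \<mu> * t)) * spow q' w"
    unfolding eq using spow_scale[of "exp (\<gamma>' * \<sigma> - \<mu> * t)" q' w] by (simp add: powr_def)
  moreover have "exp ((q' - 2) * (\<mu> - \<gamma>') * t) * exp ((q' - 1) * (\<gamma>' * \<sigma> - \<mu> * t))
     = exp (- \<mu> * t) * (E * exp (outer.\<rho> * (\<sigma> - t)))"
    by (simp add: E_def exp_add[symmetric] outer.\<rho>_def algebra_simps)
  ultimately have "R t (exp (- \<mu> * t) * (E * w)) = - (exp (- \<mu> * t) * (E * exp (outer.\<rho> * (\<sigma> - t))) * (k * spow q' w))"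
    using t by (simp add: R_def)
  then show ?B unfolding E_def[symmetric] w_def[symmetric]
    by (intro DERIV_cong[OF PP]) (simp add: w_def[symmetric] algebra_simps)
qed

lemma glued_solution:
  assumes D: "\<sigma> \<in> outer.D" and T: "traj x y" and i: "x 0 = data_x \<sigma>" "y 0 = data_y \<sigma>"
  shows "logsol UNIV (gU \<sigma> x) (gP \<sigma> x y)"
  unfolding logsol_def
proof (intro ballI conjI impI)
  let ?U1 = "\<lambda>t. exp (- \<gamma> * t) * x (- t)" and ?P1 = "\<lambda>t. exp (- \<gamma> * t) * (- \<gamma> * x (- t) - y (- t))"
  let ?U2 = "\<lambda>t. exp (- \<mu> * t) * (exp (\<gamma>' * \<sigma>) * outer.W (\<sigma> - t))"
    and ?P2 = "\<lambda>t. exp (- \<mu> * t) * (exp (\<gamma>' * \<sigma>) * (- \<mu> * outer.W (\<sigma> - t) - outer.P (\<sigma> - t)))"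
  note 1 = w_of_traj_deriv[OF T]
  have D2: "\<sigma> - t \<in> outer.D" if "0 \<le> t" for t by (rule outer.D_down[OF D]) (use that in simp)
  note 2 = outer_solution[OF D2]
  have m: "?U1 0 = ?U2 0" "?P1 0 = ?P2 0" using i by (auto simp: data_x_def data_y_def algebra_simps)
  fix t
  show U: "(gU \<sigma> x has_real_derivative gP \<sigma> x y t) (at t)"
  proof (cases t "0 :: real" rule: linorder_cases)
    case less
    then have "(?U1 has_real_derivative gP \<sigma> x y t) (at t)" using 1(1)[of t] by (simp add: gP_def)
    then show ?thesis
      by (rule has_field_derivative_transform_within_open[of _ _ _ "{..<0}"]) (use less in \<open>auto simp: gU_def\<close>)
  next
    case equal
    have d1: "(?U1 has_real_derivative ?P1 0) (at 0)" by (rule 1(1)) simp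
    have d2: "(?U2 has_real_derivative ?P1 0) (at 0)" unfolding m(2) by (rule 2(1)) simp
    have "((\<lambda>t. if t \<le> 0 then ?U1 t else ?U2 t) has_real_derivative ?P1 0) (at 0)"
      by (rule DERIV_glue[OF has_field_derivative_at_within[OF d1] has_field_derivative_at_within[OF d2] m(1)])
    then show ?thesis unfolding equal gU_def[abs_def] gP_def by simp
  next
    case greater
    then have "(?U2 has_real_derivative gP \<sigma> x y t) (at t)" using 2(1)[of t] by (simp add: gP_def)
    then show ?thesis
      by (rule has_field_derivative_transform_within_open[of _ _ _ "{0<..}"]) (use greater in \<open>auto simp: gU_def\<close>)
  qed
  have P: "(gP \<sigma> x y has_real_derivative - \<mu> * gP \<sigma> x y t - R t (gU \<sigma> x t)) (at t)" if "t \<noteq> 0" for t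
  proof (cases "t < 0")
    case True
    then have "(?P1 has_real_derivative - \<mu> * gP \<sigma> x y t - R t (gU \<sigma> x t)) (at t)"
      using 1(2)[of t] by (simp add: gP_def gU_def R_def)
    then show ?thesis
      by (rule has_field_derivative_transform_within_open[of _ _ _ "{..<0}"]) (use True in \<open>auto simp: gP_def\<close>)
  next
    case False
    then have t: "0 < t" using that by simp
    then have "(?P2 has_real_derivative - \<mu> * gP \<sigma> x y t - R t (gU \<sigma> x t)) (at t)"
      using 2(2)[of t] by (simp add: gP_def gU_def)
    then show ?thesis
      by (rule has_field_derivative_transform_within_open[of _ _ _ "{0<..}"]) (use t in \<open>auto simp: gP_def\<close>)
  qed
  show "t \<noteq> 0 \<Longrightarrow> (gP \<sigma> x y has_real_derivative - \<mu> * gP \<sigma> x y t - R t (gU \<sigma> x t)) (at t)" by (rule P)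
  show "isCont (gP \<sigma> x y) t"
  proof (cases "t = 0")
    case True
    have c1: "isCont ?P1 0" by (rule DERIV_isCont[OF 1(2)]) simp
    have c2: "isCont ?P2 0" by (rule 2(3)) simp
    have "isCont (\<lambda>t. if t \<le> 0 then ?P1 t else ?P2 t) 0" by (rule isCont_glue[OF c1 c2 m(2)])
    then show ?thesis unfolding True gP_def[abs_def] .
  qed (rule DERIV_isCont[OF P])
qed

lemma glued_fast_decay: "((\<lambda>t. exp (\<mu> * t) * gU \<sigma> x t) \<longlongrightarrow> exp (\<gamma>' * \<sigma>)) at_top"
proof -
  have "((\<lambda>t. exp (\<gamma>' * \<sigma>) * outer.W (\<sigma> - t)) \<longlongrightarrow> exp (\<gamma>' * \<sigma>) * 1) at_top"
    by (intro tendsto_intros filterlim_compose[OF outer.W_lim filterlim_diff_at_bot])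
  moreover have "\<forall>\<^sub>F t in at_top. exp (\<gamma>' * \<sigma>) * outer.W (\<sigma> - t) = exp (\<mu> * t) * gU \<sigma> x t"
    using eventually_gt_at_top[of 0] by eventually_elim (simp add: gU_def exp_minus)
  ultimately show ?thesis by (simp add: Lim_transform_eventually)
qed

definition start :: "real \<Rightarrow> (real \<Rightarrow> real) \<times> (real \<Rightarrow> real)" where
  "start \<sigma> = (SOME z. traj (fst z) (snd z) \<and> fst z 0 = data_x \<sigma> \<and> snd z 0 = data_y \<sigma>)"
definition sx :: "real \<Rightarrow> real \<Rightarrow> real" where "sx \<sigma> = fst (start \<sigma>)"
definition sy :: "real \<Rightarrow> real \<Rightarrow> real" where "sy \<sigma> = snd (start \<sigma>)"

lemma traj_s: "traj (sx \<sigma>) (sy \<sigma>)" and sx_0: "sx \<sigma> 0 = data_x \<sigma>" and sy_0: "sy \<sigma> 0 = data_y \<sigma>"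
proof -
  obtain x y where "traj x y \<and> x 0 = data_x \<sigma> \<and> y 0 = data_y \<sigma>" using traj_exists by blast
  then have "\<exists>z. traj (fst z) (snd z) \<and> fst z 0 = data_x \<sigma> \<and> snd z 0 = data_y \<sigma>" by (intro exI[of _ "(x, y)"]) simp
  then have "traj (sx \<sigma>) (sy \<sigma>) \<and> sx \<sigma> 0 = data_x \<sigma> \<and> sy \<sigma> 0 = data_y \<sigma>"
    unfolding sx_def sy_def start_def by (rule someI_ex)
  then show "traj (sx \<sigma>) (sy \<sigma>)" "sx \<sigma> 0 = data_x \<sigma>" "sy \<sigma> 0 = data_y \<sigma>" by auto
qed

definition U :: "real \<Rightarrow> real \<Rightarrow> real" where "U \<sigma> = gU \<sigma> (sx \<sigma>)"
definition dU :: "real \<Rightarrow> real \<Rightarrow> real" where "dU \<sigma> = gP \<sigma> (sx \<sigma>) (sy \<sigma>)"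

lemma logsol_U: "\<sigma> \<in> outer.D \<Longrightarrow> logsol UNIV (U \<sigma>) (dU \<sigma>)"
  unfolding U_def dU_def by (rule glued_solution[OF _ traj_s sx_0 sy_0])

lemma U_fast_decay: "((\<lambda>t. exp (\<mu> * t) * U \<sigma> t) \<longlongrightarrow> exp (\<gamma>' * \<sigma>)) at_top"
  unfolding U_def by (rule glued_fast_decay)

lemma U_zero_iff:
  assumes D: "\<sigma> \<in> outer.D"
  shows "U \<sigma> t = 0 \<longleftrightarrow> - t \<in> zeros (sx \<sigma>)"
proof (cases "t \<le> 0")
  case True
  then show ?thesis using data_x_pos[OF D] sx_0[of \<sigma>] by (cases "t = 0") (auto simp: U_def gU_def zeros_def)
next
  case False
  then have "1 < outer.W (\<sigma> - t)" by (intro outer.W_gt_1 outer.D_down[OF D]) simp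
  then show ?thesis using False by (auto simp: U_def gU_def zeros_def)
qed

lemma U_zeros:
  assumes D: "\<sigma> \<in> outer.D"
  shows "{t. U \<sigma> t = 0} = uminus ` zeros (sx \<sigma>)"
proof (intro set_eqI iffI)
  fix t assume "t \<in> {t. U \<sigma> t = 0}"
  then show "t \<in> uminus ` zeros (sx \<sigma>)" by (intro image_eqI[of _ _ "- t"]) (auto simp: U_zero_iff[OF D])
qed (auto simp: U_zero_iff[OF D])

lemma U_zeros_card:
  assumes D: "\<sigma> \<in> outer.D" and z: "finite (zeros (sx \<sigma>)) \<and> card (zeros (sx \<sigma>)) = m"
  shows "finite {t. U \<sigma> t = 0}" "card {t. U \<sigma> t = 0} = m"
  unfolding U_zeros[OF D] using z by (auto simp: card_image)

lemma U_nondegenerate: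
  assumes D: "\<sigma> \<in> outer.D" and z: "U \<sigma> t = 0"
  shows "dU \<sigma> t \<noteq> 0"
proof -
  have t: "t < 0" "sx \<sigma> (- t) = 0" using z by (auto simp: U_zero_iff[OF D] zeros_def)
  have "sy \<sigma> (- t) \<noteq> 0" using traj_zero[OF traj_s t(2), of 0] t data_x_pos[OF D] sx_0[of \<sigma>] by auto
  then show ?thesis using t by (simp add: dU_def gP_def)
qed

text \<open>A regular limit at the origin forces the trajectory to be an arc of the spiral, so its starting point,
  which moves outwards, lies on an outgoing branch.\<close>

lemma U_regular_only_at_crossings:
  assumes D: "\<sigma> \<in> outer.D" and l: "(U \<sigma> \<longlongrightarrow> d) at_bot"
  shows "\<exists>j. \<sigma> = cross j"
proof -
  have "\<forall>\<^sub>F t in at_bot. U \<sigma> t = exp (- \<gamma> * t) * sx \<sigma> (- t)"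
    using eventually_le_at_bot[of 0] by eventually_elim (simp add: U_def gU_def)
  with l have "((\<lambda>t. exp (- \<gamma> * t) * sx \<sigma> (- t)) \<longlongrightarrow> d) at_bot" by (rule Lim_transform_eventually)
  then obtain e c where e: "\<bar>e\<bar> = 1" and s: "\<And>s. 0 \<le> s \<Longrightarrow> sx \<sigma> s = e * X (c - s) \<and> sy \<sigma> s = - e * Y (c - s)"
    using regular_orbit[OF traj_s, of \<sigma> d 0] data_x_pos[OF D] sx_0[of \<sigma>] by auto
  have x: "data_x \<sigma> = e * X c" and y: "data_y \<sigma> = - e * Y c" using s[of 0] sx_0 sy_0 by auto
  have e': "e = 1 \<or> e = -1" using e by linarith
  have "0 < data_x \<sigma> * data_y \<sigma>" using data_x_pos[OF D] data_y_pos[OF D] by simp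
  then have "X c * Y c < 0" unfolding x y using e' by auto
  then obtain j where j: "\<tau> j < c" "c < \<zeta> j" using arc_cover by blast
  have "0 < sg j * X c" using j by (intro X_arc) auto
  then have "e = sg j" using data_x_pos[OF D] e' sg_cases[of j] unfolding x by auto
  then have "\<sigma> = cross j" using x y by (intro on_branch_unique[OF D j]) auto
  then show ?thesis by blast
qed

text \<open>After its last zero the trajectory has one sign, and \<open>finite_or_infinite_limit\<close> applies to it or to its mirror image.\<close>

lemma U_limit_dichotomy:
  assumes D: "\<sigma> \<in> outer.D" and z: "finite (zeros (sx \<sigma>))"
  shows "(\<exists>d. (U \<sigma> \<longlongrightarrow> d) at_bot) \<or> filterlim (U \<sigma>) at_top at_bot \<or> filterlim (U \<sigma>) at_bot at_bot"
proof -
  have ev: "\<forall>\<^sub>F t in at_bot. exp (- \<gamma> * t) * sx \<sigma> (- t) = U \<sigma> t"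
    using eventually_le_at_bot[of 0] by eventually_elim (simp add: U_def gU_def)
  obtain s0 where s0: "0 < s0" "\<And>s. s0 \<le> s \<Longrightarrow> sx \<sigma> s \<noteq> 0"
  proof -
    have "bdd_above (zeros (sx \<sigma>))" using z by (rule bdd_above_finite)
    then obtain C where C: "\<And>s. s \<in> zeros (sx \<sigma>) \<Longrightarrow> s \<le> C" by (auto simp: bdd_above_def)
    have "sx \<sigma> s \<noteq> 0" if "max 1 (C + 1) \<le> s" for s using C[of s] that by (auto simp: zeros_def)
    then show ?thesis by (intro that[of "max 1 (C + 1)"]) auto
  qed
  have c: "continuous_on {s0..s} (sx \<sigma>)" for s using s0 by (intro traj_cont(1)[OF traj_s]) auto
  show ?thesis
  proof (cases "0 < sx \<sigma> s0")
    case True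
    have "0 < sx \<sigma> s" if "s0 \<le> s" for s
      using IVT2'[of "sx \<sigma>" s 0 s0] True that c s0(2) by force
    from finite_or_infinite_limit[OF traj_s this] show ?thesis
      using filterlim_cong[OF refl refl ev] by blast
  next
    case False
    then have neg: "sx \<sigma> s0 < 0" using s0(2)[of s0] by simp
    have "0 < - sx \<sigma> s" if "s0 \<le> s" for s
      using IVT'[of "sx \<sigma>" s0 0 s] neg that c s0(2) by force
    from finite_or_infinite_limit[OF traj_minus[OF traj_s] this]
    have "(\<exists>d. ((\<lambda>t. - (exp (- \<gamma> * t) * sx \<sigma> (- t))) \<longlongrightarrow> d) at_bot) \<or>
        filterlim (\<lambda>t. - (exp (- \<gamma> * t) * sx \<sigma> (- t))) at_top at_bot" by simp
    then have "(\<exists>d. ((\<lambda>t. exp (- \<gamma> * t) * sx \<sigma> (- t)) \<longlongrightarrow> d) at_bot) \<or>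
        filterlim (\<lambda>t. exp (- \<gamma> * t) * sx \<sigma> (- t)) at_bot at_bot"
      unfolding filterlim_uminus_at_bot using tendsto_minus_cancel_left by (metis minus_minus)
    then show ?thesis
      using filterlim_cong[OF refl refl ev] by blast
  qed
qed

lemma v_sol_U: "\<sigma> \<in> outer.D \<Longrightarrow> 0 < r \<Longrightarrow> v_sol n \<eta> f (exp (\<gamma>' * \<sigma>)) r = unlog (U \<sigma>) r"
  by (rule v_sol_unlog[OF logsol_U U_fast_decay])

lemma S_fd_between:
  assumes D: "\<sigma> \<in> outer.D" and nc: "\<And>j. \<sigma> \<noteq> cross j" and z: "finite (zeros (sx \<sigma>)) \<and> card (zeros (sx \<sigma>)) = m"
  shows "S_fd n \<eta> f m (v_sol n \<eta> f (exp (\<gamma>' * \<sigma>)))"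
proof (rule S_fd_unlog[OF logsol_U[OF D] v_sol_U[OF D, symmetric] U_fast_decay _ U_zeros_card[OF D z] U_nondegenerate[OF D]])
  show "filterlim (U \<sigma>) at_top at_bot \<or> filterlim (U \<sigma>) at_bot at_bot"
    using U_limit_dichotomy[OF D] z U_regular_only_at_crossings[OF D] nc by blast
qed

lemma U_at_crossing: "(U (cross j) \<longlongrightarrow> sg j * exp (\<gamma> * cross_time j)) at_bot"
  and zeros_at_crossing: "finite (zeros (sx (cross j))) \<and> card (zeros (sx (cross j))) = j"
proof -
  have s: "sx (cross j) s = Rx j (cross_time j) s" if "0 \<le> s" for s
  proof -
    have "sx (cross j) (0 + s) = Rx j (cross_time j) (0 + s) \<and> sy (cross j) (0 + s) = Ry j (cross_time j) (0 + s)"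
      by (rule traj_unique[OF traj_s traj_R]) (use that in \<open>auto simp: sx_0 sy_0 Rx_def Ry_def cross_time_X cross_time_Y\<close>)
    then show ?thesis by simp
  qed
  have "zeros (sx (cross j)) = zeros (Rx j (cross_time j))" using s by (auto simp: zeros_def)
  then show "finite (zeros (sx (cross j))) \<and> card (zeros (sx (cross j))) = j" using zeros_on_branch[OF cross_time_in] by simp
  have "((\<lambda>t. sg j * exp (\<gamma> * cross_time j) * w0 (cross_time j + t)) \<longlongrightarrow> sg j * exp (\<gamma> * cross_time j) * 1) at_bot"
    by (intro tendsto_intros filterlim_compose[OF w0_lim filterlim_add_at_bot])
  moreover have "\<forall>\<^sub>F t in at_bot. sg j * exp (\<gamma> * cross_time j) * w0 (cross_time j + t) = U (cross j) t"
    using eventually_le_at_bot[of 0]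
  proof eventually_elim
    case (elim t)
    have "exp (- \<gamma> * t) * exp (\<gamma> * (cross_time j + t)) = exp (\<gamma> * cross_time j)" by (simp add: exp_add[symmetric] algebra_simps)
    then show ?case using elim by (simp add: U_def gU_def s Rx_def X_def)
  qed
  ultimately show "(U (cross j) \<longlongrightarrow> sg j * exp (\<gamma> * cross_time j)) at_bot" by (simp add: Lim_transform_eventually)
qed

lemma R_fd_at_crossing: "R_fd n \<eta> f j (v_sol n \<eta> f (exp (\<gamma>' * cross j)))"
  by (rule R_fd_unlog[OF logsol_U[OF cross_D] v_sol_U[OF cross_D, symmetric] U_fast_decay U_at_crossing
        U_zeros_card[OF cross_D zeros_at_crossing] U_nondegenerate[OF cross_D]])

text \<open>The regular solution with positive coefficient is the one at the crossing, up to the sign with which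
  the spiral was reflected.\<close>

lemma R_fd_regular: "R_fd n \<eta> f j (u_sol n \<eta> f (exp (\<gamma> * cross_time j)))"
proof -
  have sgz: "sg j \<noteq> 0" using sg_cases[of j] by auto
  have L: "logsol UNIV (\<lambda>t. sg j * U (cross j) t) (\<lambda>t. sg j * dU (cross j) t)"
    by (rule logsol_sign[OF logsol_U[OF cross_D] sg_abs])
  have d: "((\<lambda>t. sg j * U (cross j) t) \<longlongrightarrow> exp (\<gamma> * cross_time j)) at_bot"
    using tendsto_mult_left[OF U_at_crossing[of j], of "sg j"] by (simp add: mult.assoc[symmetric])
  have l: "((\<lambda>t. exp (\<mu> * t) * (sg j * U (cross j) t)) \<longlongrightarrow> sg j * exp (\<gamma>' * cross j)) at_top"
    using tendsto_mult_left[OF U_fast_decay[of "cross j"], of "sg j"] by (simp add: mult.left_commute)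
  show ?thesis
    by (rule R_fd_unlog[OF L u_sol_unlog[OF L d, symmetric] l d])
      (use U_zeros_card[OF cross_D zeros_at_crossing] U_nondegenerate[OF cross_D] in \<open>auto simp: sgz\<close>)
qed

lemma before_cross_D: "\<sigma> < cross j \<Longrightarrow> \<sigma> \<in> outer.D"
  using outer.D_down[OF cross_D[of j]] by simp

lemma count_below_first: "\<sigma> < cross 0 \<Longrightarrow> zeros (sx \<sigma>) = {}"
proof -
  assume "\<sigma> < cross 0"
  have D: "\<sigma> \<in> outer.D" by (rule before_cross_D) fact
  have "finite (zeros (sx \<sigma>)) \<and> card (zeros (sx \<sigma>)) = 0"
    by (rule zeros_between_branches[OF traj_s])
      (use data_x_pos[OF D] data_y_pos[OF D] before_cross[OF \<open>\<sigma> < cross 0\<close>] in \<open>simp_all add: sx_0 sy_0\<close>)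
  then show "zeros (sx \<sigma>) = {}" using card_0_eq by blast
qed

lemma count_between:
  assumes "cross (k' - 1) < \<sigma>" "\<sigma> < cross k'"
  shows "finite (zeros (sx \<sigma>)) \<and> card (zeros (sx \<sigma>)) = k'"
proof -
  have D: "\<sigma> \<in> outer.D" by (rule before_cross_D[OF assms(2)])
  show ?thesis
    by (rule zeros_between_branches[OF traj_s])
      (use data_x_pos[OF D] data_y_pos[OF D] before_cross[OF assms(2)] after_cross[OF D assms(1)] in \<open>simp_all add: sx_0 sy_0\<close>)
qed

lemma not_cross_between: "cross j < \<sigma> \<Longrightarrow> \<sigma> < cross (Suc j) \<Longrightarrow> \<sigma> \<noteq> cross i"
  using strict_mono_less[OF cross_strict_mono, of j i] strict_mono_less[OF cross_strict_mono, of i "Suc j"] by auto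

lemma not_cross_below: "\<sigma> < cross 0 \<Longrightarrow> \<sigma> \<noteq> cross i"
  using strict_mono_less[OF cross_strict_mono, of i 0] by auto

text \<open>\<open>L\<^sub>k\<close> and \<open>D\<^sub>k\<close> are read off from the crossings; monotone convergence uses that the curve ends at a finite parameter.\<close>

theorem fast_decay_structure:
  "(\<exists>(L :: nat \<Rightarrow> real) (L_inf :: real).
      strict_mono L \<and> (\<forall>k. 0 < L k) \<and> L \<longlonglongrightarrow> L_inf \<and>
      (\<forall>k. R_fd n \<eta> f k (v_sol n \<eta> f (L k))) \<and>
      (\<forall>l. 0 < l \<and> l < L 0 \<longrightarrow>
         S_fd n \<eta> f 0 (v_sol n \<eta> f l) \<and> (\<forall>r>0. v_sol n \<eta> f l r > 0)) \<and>
      (\<forall>k\<ge>1. \<forall>l. L (k - 1) < l \<and> l < L k \<longrightarrow> S_fd n \<eta> f k (v_sol n \<eta> f l))) \<and>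
   (\<exists>D :: nat \<Rightarrow> real. strict_mono D \<and> filterlim D at_top sequentially \<and>
      (\<forall>k. R_fd n \<eta> f k (u_sol n \<eta> f (D k))))"
proof
  define L where "L j = exp (\<gamma>' * cross j)" for j
  have g': "0 < \<gamma>'" by (rule outer.gam)
  have L: "strict_mono L"
    using strict_monoD[OF cross_strict_mono] g' by (auto intro!: strict_monoI simp: L_def)
  obtain C where C: "\<And>t. t \<in> outer.D \<Longrightarrow> t \<le> C" using outer.D_bounded by blast
  have "L j \<le> exp (\<gamma>' * C)" for j using C[OF cross_D[of j]] g' by (simp add: L_def)
  then obtain Li where Li: "L \<longlonglongrightarrow> Li"
    using incseq_convergent[of L "exp (\<gamma>' * C)"] strict_mono_mono[OF L] by blast
  have lev: "\<exists>\<sigma>. l = exp (\<gamma>' * \<sigma>)" if "0 < l" for l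
    using that g' by (intro exI[of _ "ln l / \<gamma>'"]) simp
  have first: "S_fd n \<eta> f 0 (v_sol n \<eta> f l) \<and> (\<forall>r>0. v_sol n \<eta> f l r > 0)" if l: "0 < l" "l < L 0" for l
  proof -
    obtain \<sigma> where \<sigma>: "l = exp (\<gamma>' * \<sigma>)" using lev l by blast
    then have lt: "\<sigma> < cross 0" using l g' by (simp add: L_def)
    have D: "\<sigma> \<in> outer.D" by (rule before_cross_D[OF lt])
    note z = count_below_first[OF lt]
    have S: "S_fd n \<eta> f 0 (v_sol n \<eta> f l)"
      unfolding \<sigma> by (rule S_fd_between[OF D not_cross_below[OF lt]]) (simp add: z)
    have nz: "U \<sigma> t \<noteq> 0" for t using U_zeros[OF D] z by auto
    have Uc: "continuous_on S (U \<sigma>)" for S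
      using logsol_U[OF D] unfolding logsol_def by (auto intro!: continuous_at_imp_continuous_on dest: DERIV_isCont)
    have U0: "0 < U \<sigma> t" if "0 \<le> t" for t
    proof (cases "t = 0")
      case True then show ?thesis using data_x_pos[OF D] by (simp add: U_def gU_def sx_0)
    next
      case False
      have "1 < outer.W (\<sigma> - t)" by (intro outer.W_gt_1 outer.D_down[OF D]) (use that in simp)
      then show ?thesis using that False by (simp add: U_def gU_def)
    qed
    have "0 < U \<sigma> t" for t
    proof (cases "0 \<le> t")
      case False
      then show ?thesis using IVT'[of "U \<sigma>" t 0 0] U0[of 0] nz Uc by force
    qed (rule U0)
    then have "\<forall>r>0. v_sol n \<eta> f l r > 0" unfolding \<sigma> by (simp add: v_sol_U[OF D] unlog_def)
    with S show ?thesis by blast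
  qed
  have btw: "S_fd n \<eta> f m (v_sol n \<eta> f l)" if m: "1 \<le> m" and l: "L (m - 1) < l" "l < L m" for m l
  proof -
    obtain \<sigma> where \<sigma>: "l = exp (\<gamma>' * \<sigma>)" using lev[of l] l(1) less_trans[of 0 "L (m - 1)" l] by (auto simp: L_def)
    then have lt: "cross (m - 1) < \<sigma>" "\<sigma> < cross m" using l g' by (auto simp: L_def)
    have D: "\<sigma> \<in> outer.D" by (rule before_cross_D[OF lt(2)])
    show ?thesis unfolding \<sigma>
      by (rule S_fd_between[OF D not_cross_between[of "m - 1"] count_between[OF lt]]) (use lt m in auto)
  qed
  show "\<exists>(L :: nat \<Rightarrow> real) (L_inf :: real).
      strict_mono L \<and> (\<forall>k. 0 < L k) \<and> L \<longlonglongrightarrow> L_inf \<and>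
      (\<forall>k. R_fd n \<eta> f k (v_sol n \<eta> f (L k))) \<and>
      (\<forall>l. 0 < l \<and> l < L 0 \<longrightarrow>
         S_fd n \<eta> f 0 (v_sol n \<eta> f l) \<and> (\<forall>r>0. v_sol n \<eta> f l r > 0)) \<and>
      (\<forall>k\<ge>1. \<forall>l. L (k - 1) < l \<and> l < L k \<longrightarrow> S_fd n \<eta> f k (v_sol n \<eta> f l))"
    by (intro exI[of _ L] exI[of _ Li] conjI L Li allI impI)
      (use first btw R_fd_at_crossing in \<open>auto simp: L_def\<close>)
next
  define E where "E j = exp (\<gamma> * cross_time j)" for j
  have E: "strict_mono E" using strict_monoD[OF cross_time_strict_mono] gam_pos by (auto intro!: strict_monoI simp: E_def)
  have "filterlim cross_time at_top sequentially"
    unfolding filterlim_at_top eventually_sequentially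
  proof
    fix Z
    obtain j where "Z < cross_time j" using cross_time_unbounded by blast
    then have "Z \<le> cross_time i" if "j \<le> i" for i using strict_mono_mono[OF cross_time_strict_mono] that by (meson less_imp_le monoD order_trans)
    then show "\<exists>j. \<forall>i\<ge>j. Z \<le> cross_time i" by blast
  qed
  then have "filterlim E at_top sequentially" unfolding E_def[abs_def]
    by (intro filterlim_compose[OF exp_at_top] filterlim_tendsto_pos_mult_at_top[OF tendsto_const gam_pos])
  then show "\<exists>D :: nat \<Rightarrow> real. strict_mono D \<and> filterlim D at_top sequentially \<and>
      (\<forall>k. R_fd n \<eta> f k (u_sol n \<eta> f (D k)))"
    using E R_fd_regular unfolding E_def[abs_def] by blast
qed

end

theorem theorem3p4:
  fixes n :: nat and \<eta> q1 q2 \<delta>1 \<delta>2 l1 l2 K1 K2 :: real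
    and f :: "real \<Rightarrow> real \<Rightarrow> real"
  assumes "n \<ge> 3" and "\<eta> < (real n - 2)\<^sup>2 / 4"
    and "q1 > 2" and "q2 > 2" and "\<delta>1 > -2" and "\<delta>2 > -2"
    and "l1 = 2 * ((q1 + \<delta>1) / (2 + \<delta>1))" and "l2 = 2 * ((q2 + \<delta>2) / (2 + \<delta>2))"
    and "\<And>u r. f u r = (if r \<le> 1 then K1 * r powr \<delta>1 * u * \<bar>u\<bar> powr (q1 - 2)
                                  else K2 * r powr \<delta>2 * u * \<bar>u\<bar> powr (q2 - 2))"
    and "K2 < 0" and "0 < K1"
    and "2 < l1" and "l1 < upper_two_star n" and "l2 > lower_two_star n \<eta>"
    and "l2 \<ge> l1" and "l1 \<ge> lower_two_star n \<eta>"
  shows "(\<exists>(L :: nat \<Rightarrow> real) (L_inf :: real).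
            strict_mono L \<and> (\<forall>k. 0 < L k) \<and> L \<longlonglongrightarrow> L_inf \<and>
            (\<forall>k. R_fd n \<eta> f k (v_sol n \<eta> f (L k))) \<and>
            (\<forall>l. 0 < l \<and> l < L 0 \<longrightarrow>
               S_fd n \<eta> f 0 (v_sol n \<eta> f l) \<and> (\<forall>r>0. v_sol n \<eta> f l r > 0)) \<and>
            (\<forall>k\<ge>1. \<forall>l. L (k - 1) < l \<and> l < L k \<longrightarrow> S_fd n \<eta> f k (v_sol n \<eta> f l))) \<and>
         (\<exists>D :: nat \<Rightarrow> real. strict_mono D \<and> filterlim D at_top sequentially \<and>
            (\<forall>k. R_fd n \<eta> f k (u_sol n \<eta> f (D k))))"
proof -
  define c where "c = real n - 2"
  define \<mu> where "\<mu> = sqrt (c\<^sup>2 - 4 * \<eta>)"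
  define \<kappa> where "\<kappa> = kappa n \<eta>"
  \<comment> \<open>The exponent of the homogeneous singular solution \<open>r\<^bsup>-\<alpha>\<^sub>i\<^esup>\<close>; it determines \<open>l\<^sub>i = 2 + 2/\<alpha>\<^sub>i\<close>, so that the conditions on \<open>l\<^sub>i\<close> become linear.\<close>
  define \<alpha>1 where "\<alpha>1 = (2 + \<delta>1) / (q1 - 2)"
  define \<alpha>2 where "\<alpha>2 = (2 + \<delta>2) / (q2 - 2)"
  have c: "1 \<le> c" using assms(1) by (simp add: c_def)
  have pos: "0 < c\<^sup>2 - 4 * \<eta>" using assms(2) by (simp add: c_def)
  have \<mu>: "0 < \<mu>" using pos by (simp add: \<mu>_def)
  have \<mu>2: "\<mu>\<^sup>2 = c\<^sup>2 - 4 * \<eta>" using pos by (simp add: \<mu>_def)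
  have \<kappa>: "\<kappa> = (c - \<mu>) / 2" by (simp add: \<kappa>_def kappa_def \<mu>_def c_def)
  have \<alpha>pos: "0 < \<alpha>1" "0 < \<alpha>2" using assms(3-6) by (auto simp: \<alpha>1_def \<alpha>2_def)
  have l1: "l1 = 2 + 2 / \<alpha>1" and l2: "l2 = 2 + 2 / \<alpha>2"
    using assms(3-8) by (auto simp: \<alpha>1_def \<alpha>2_def field_simps)
  have up: "upper_two_star n = 2 + 2 / (c / 2)"
    using c by (simp add: upper_two_star_def c_def field_simps)
  have lo: "lower_two_star n \<eta> = 2 + 2 / ((c + \<mu>) / 2)"
  proof -
    have "real n = c + 2" by (simp add: c_def)
    then show ?thesis unfolding lower_two_star_def \<mu>_def[unfolded c_def, symmetric]
      using c \<mu> by (simp add: field_simps)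
  qed
  have inv: "2 + 2 / x < 2 + 2 / y \<longleftrightarrow> y < x" "2 + 2 / x \<le> 2 + 2 / y \<longleftrightarrow> y \<le> x" if "0 < x" "0 < y" for x y :: real
    using that by (auto simp: field_simps)
  have half: "0 < c / 2" "0 < (c + \<mu>) / 2" using c \<mu> by auto
  note ineqs = assms(13-16)[unfolded l1 l2 up lo]
  have a1: "c / 2 < \<alpha>1" "\<alpha>1 \<le> (c + \<mu>) / 2" and a2: "\<alpha>2 < (c + \<mu>) / 2" "\<alpha>2 \<le> \<alpha>1"
    using ineqs(1)[unfolded inv(1)[OF \<alpha>pos(1) half(1)]] ineqs(2)[unfolded inv(1)[OF half(2) \<alpha>pos(2)]]
      ineqs(3)[unfolded inv(2)[OF \<alpha>pos]] ineqs(4)[unfolded inv(2)[OF half(2) \<alpha>pos(1)]] by auto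
  interpret radial \<mu> "\<alpha>1 - \<kappa>" K1 q1 "\<kappa> + \<mu> - \<alpha>2" "- K2" q2 n \<eta> \<kappa> \<delta>1 \<delta>2 f
  proof
    show "\<eta> = \<kappa> * (\<kappa> + \<mu>)"
    proof -
      have "\<kappa> * (\<kappa> + \<mu>) = (c\<^sup>2 - \<mu>\<^sup>2) / 4" unfolding \<kappa> by (simp add: field_simps power2_eq_square)
      then show ?thesis using \<mu>2 by simp
    qed
    show "2 + \<delta>1 = (q1 - 2) * (\<kappa> + (\<alpha>1 - \<kappa>))" "2 + \<delta>2 = (q2 - 2) * (\<kappa> + \<mu> - (\<kappa> + \<mu> - \<alpha>2))"
      using assms(3,4) by (auto simp: \<alpha>1_def \<alpha>2_def)
    have "c = 2 * \<kappa> + \<mu>" unfolding \<kappa> by (simp add: field_simps)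
    then show "real n - 2 = 2 * \<kappa> + \<mu>" by (simp add: c_def)
    show "\<kappa> = kappa n \<eta>" by (rule \<kappa>_def)
    show "f u r = (if r \<le> 1 then K1 * r powr \<delta>1 * u * \<bar>u\<bar> powr (q1 - 2)
        else - (- K2) * r powr \<delta>2 * u * \<bar>u\<bar> powr (q2 - 2))" for u r using assms(9) by simp
  qed (use assms(3,4,10,11) \<mu> a1 a2 in \<open>auto simp: \<kappa> field_simps\<close>)
  show ?thesis by (rule fast_decay_structure)
qed

end
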